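(* Let $x_0\in\Omega$ and let $\rho>0$ be such that $D^2(x_0,\rho)\subset\Omega$. If $0<r_0\le r_1\le\rho$, then $$\frac{\zeta_\star(D^2(x_0,r_1))}{r_1}\ge\frac{\zeta_\star(D^2(x_0,r_0))}{r_0}.$$ For every $x_0\in\Omega$ the quantity $\frac{\zeta_\star(D^2(x_0,r))}{r}$ has a limit when $r\to0$, and we have the estimate $$\lim_{r\to0}\frac{\zeta_\star(D^2(x_0,r))}{r}\le\frac{\zeta_\star(D^2(x_0,\rho))}{\rho}\le\frac{M_0}{{\rm dist}(x_0,\partial\Omega)}.$$ The measure $\zeta_\star$ is hence absolutely continuous with respect to the $\mathcal H^1$-measure on $\mathfrak S_\star$.
   Context: $\Omega\subset\mathbb R^2$ is a smooth bounded domain. $V:\mathbb R^k\to\mathbb R$ ($k\ge1$) is smooth with $\inf V=0$ and satisfies: (1) the zero set $\Sigma=\{V=0\}$ is finite with at least two elements; (2) $\nabla^2V(\sigma)$ is positive definite at each $\sigma\in\Sigma$; (3) there are $\alpha_\infty,R_\infty>0$ with $y\cdot\nabla V(y)\ge\alpha_\infty|y|^2$ if $|y|>R_\infty$, and $V(y)\to+\infty$ as $|y|\to+\infty$. Set $e_\varepsilon(u)=\varepsilon\frac{|\nabla u|^2}{2}+\frac1\varepsilon V(u)$ and $E_\varepsilon(u)=\int_\Omega e_\varepsilon(u)dx$. $D^2(x,r)$ is the open disk of center $x$ and radius $r$. Let $M_0>0$, $\varepsilon_n\in(0,1]$, $\varepsilon_n\to0$, and let $u_{\varepsilon_n}\in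 H^1(\Omega,\mathbb R^k)$ be solutions of $-\Delta u_{\varepsilon_n}=-\varepsilon_n^{-2}\nabla_uV(u_{\varepsilon_n})$ in $\Omega$ with $E_{\varepsilon_n}(u_{\varepsilon_n})\le M_0$. Passing to a subsequence, $e_{\varepsilon_n}(u_{\varepsilon_n})dx\rightharpoonup\nu_\star$ and $\frac{V(u_{\varepsilon_n})}{\varepsilon_n}dx\rightharpoonup\zeta_\star$ weakly as measures on $\Omega$. Let $\eta_1>0$ be a constant depending only on $V$ with the clearing-out property (such a constant exists): for every sequence $\tilde\varepsilon_n\in(0,1]$ with $\tilde\varepsilon_n\to0$, all solutions $v_n\in H^1(\Omega,\mathbb R^k)$ of $-\Delta v_n=-\tilde\varepsilon_n^{-2}\nabla_uV(v_n)$ in $\Omega$ with $\sup_nE_{\tilde\varepsilon_n}(v_n)<+\infty$, and every measure $\nu$ on $\Omega$ such that $e_{\tilde\varepsilon_n}(v_n)dx\rightharpoonup\nu$ weakly as measures on $\Omega$, if $D^2(x_0,r)\subset\Omega$ and $\nu(\overline{D^2(x_0,r)})<\eta_1r$, then $\nu(\overline{D^2(x_0,r/2)})=0$. The concentration set is $\mathfrak S_\star=\{x\in\Omega:\liminf_{r\to0}\nu_\star(\overline{D^2(x,r)})/r\ge\eta_1\}$; it is closed in $\Omega$, $1$-rectifiable and of finite $\mathcal H^1$ measure. (Closed disks are understood intersected with $\Omega$.) *)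

theory Defs
  imports "HOL-Analysis.Analysis"
begin

primrec C_on :: "nat \<Rightarrow> 'a set \<Rightarrow> ('a::euclidean_space \<Rightarrow> 'b::real_normed_vector) \<Rightarrow> bool" where
  "C_on 0 S f = continuous_on S f"
| "C_on (Suc m) S f =
     (\<exists>f'. (\<forall>x\<in>S. (f has_derivative f' x) (at x)) \<and> (\<forall>b\<in>Basis. C_on m S (\<lambda>x. f' x b)))"

text \<open>The derivatives above are two-sided, so this is only meant for open \<open>S\<close>.\<close>

definition smooth_on :: "'a set \<Rightarrow> ('a::euclidean_space \<Rightarrow> 'b::real_normed_vector) \<Rightarrow> bool" where
  "smooth_on S f \<longleftrightarrow> (\<forall>m. C_on m S f)"

definition partial :: "'n \<Rightarrow> (real^'n \<Rightarrow> 'b::real_normed_vector) \<Rightarrow> real^'n \<Rightarrow> 'b" where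
  "partial i f x = frechet_derivative f (at x) (axis i 1)"

definition grad :: "(real^'n \<Rightarrow> real) \<Rightarrow> real^'n \<Rightarrow> real^'n" where
  "grad f x = (\<chi> i. partial i f x)"

definition hessian :: "(real^'n \<Rightarrow> real) \<Rightarrow> real^'n \<Rightarrow> real^'n^'n" where
  "hessian f x = jacobian (grad f) (at x)"

text \<open>Near every boundary point the domain is the strict sublevel set at \<open>0\<close> of a smooth function
  with non-vanishing gradient (a local defining function).\<close>

definition smooth_bounded_domain :: "(real^2) set \<Rightarrow> bool" where
  "smooth_bounded_domain \<Omega> \<longleftrightarrow>
     open \<Omega> \<and> connected \<Omega> \<and> \<Omega> \<noteq> {} \<and> bounded \<Omega> \<and>
     (\<forall>p\<in>frontier \<Omega>. \<exists>U \<psi>. open U \<and> p \<in> U \<and> smooth_on U \<psi> \<and>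
        (\<forall>x\<in>U. grad \<psi> x \<noteq> 0) \<and> \<Omega> \<inter> U = {x\<in>U. \<psi> x < 0})"

definition admissible_potential :: "(real^'k \<Rightarrow> real) \<Rightarrow> bool" where
  "admissible_potential V \<longleftrightarrow>
     smooth_on UNIV V \<and>
     bdd_below (range V) \<and> (INF y. V y) = 0 \<and>
     finite {y. V y = 0} \<and> 2 \<le> card {y. V y = 0} \<and>
     (\<forall>\<sigma>. V \<sigma> = 0 \<longrightarrow> (\<forall>h. h \<noteq> 0 \<longrightarrow> 0 < h \<bullet> (hessian V \<sigma> *v h))) \<and>
     (\<exists>\<alpha> R. 0 < \<alpha> \<and> 0 < R \<and> (\<forall>y. R < norm y \<longrightarrow> \<alpha> * (norm y)\<^sup>2 \<le> y \<bullet> grad V y)) \<and>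
     filterlim V at_top at_infinity"

definition test_function :: "(real^2) set \<Rightarrow> (real^2 \<Rightarrow> real) \<Rightarrow> bool" where
  "test_function \<Omega> \<phi> \<longleftrightarrow>
     smooth_on UNIV \<phi> \<and> compact (closure {x. \<phi> x \<noteq> 0}) \<and> closure {x. \<phi> x \<noteq> 0} \<subseteq> \<Omega>"

definition locally_integrable_on ::
    "('a::euclidean_space \<Rightarrow> 'b::euclidean_space) \<Rightarrow> 'a set \<Rightarrow> bool" where
  "locally_integrable_on f \<Omega> \<longleftrightarrow> (\<forall>K. compact K \<and> K \<subseteq> \<Omega> \<longrightarrow> f absolutely_integrable_on K)"

definition square_integrable_on ::
    "('a::euclidean_space \<Rightarrow> 'b::euclidean_space) \<Rightarrow> 'a set \<Rightarrow> bool" where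
  "square_integrable_on f \<Omega> \<longleftrightarrow>
     f \<in> borel_measurable (lebesgue_on \<Omega>) \<and> integrable (lebesgue_on \<Omega>) (\<lambda>x. (norm (f x))\<^sup>2)"

text \<open>Matrix convention: \<open>G x $ j $ i\<close> is the weak derivative of the component \<open>u\<^sub>j\<close> in direction \<open>i\<close>.
  The norm on \<open>real^2^'k\<close> is the Frobenius norm.\<close>

definition is_weak_gradient ::
    "(real^2) set \<Rightarrow> (real^2 \<Rightarrow> real^'k) \<Rightarrow> (real^2 \<Rightarrow> real^2^'k) \<Rightarrow> bool" where
  "is_weak_gradient \<Omega> u G \<longleftrightarrow>
     locally_integrable_on u \<Omega> \<and> locally_integrable_on G \<Omega> \<and>
     (\<forall>\<phi> i j. test_function \<Omega> \<phi> \<longrightarrow>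
        (\<integral>x. u x $ j * partial i \<phi> x \<partial>lebesgue_on \<Omega>) = - (\<integral>x. G x $ j $ i * \<phi> x \<partial>lebesgue_on \<Omega>))"

text \<open>A representative of the weak gradient; it is unique up to a null set.\<close>

definition weak_gradient :: "(real^2) set \<Rightarrow> (real^2 \<Rightarrow> real^'k) \<Rightarrow> real^2 \<Rightarrow> real^2^'k" where
  "weak_gradient \<Omega> u = (SOME G. is_weak_gradient \<Omega> u G)"

definition sobolev_H1 :: "(real^2) set \<Rightarrow> (real^2 \<Rightarrow> real^'k) \<Rightarrow> bool" where
  "sobolev_H1 \<Omega> u \<longleftrightarrow>
     square_integrable_on u \<Omega> \<and> (\<exists>G. is_weak_gradient \<Omega> u G \<and> square_integrable_on G \<Omega>)"

definition energy_density ::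
    "(real^'k \<Rightarrow> real) \<Rightarrow> (real^2) set \<Rightarrow> real \<Rightarrow> (real^2 \<Rightarrow> real^'k) \<Rightarrow> real^2 \<Rightarrow> real" where
  "energy_density V \<Omega> \<epsilon> u x = \<epsilon> * (norm (weak_gradient \<Omega> u x))\<^sup>2 / 2 + V (u x) / \<epsilon>"

definition energy ::
    "(real^'k \<Rightarrow> real) \<Rightarrow> (real^2) set \<Rightarrow> real \<Rightarrow> (real^2 \<Rightarrow> real^'k) \<Rightarrow> ennreal" where
  "energy V \<Omega> \<epsilon> u = (\<integral>\<^sup>+x. ennreal (energy_density V \<Omega> \<epsilon> u x) \<partial>lebesgue_on \<Omega>)"

text \<open>\<open>H\<^sup>1\<close> functions solving \<open>-\<Delta>u = -\<epsilon>\<^sup>-\<^sup>2 \<nabla>V(u)\<close> in the sense of distributions. The local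
  integrability of \<open>\<nabla>V(u)\<close> is what makes its right-hand side a distribution; no growth
  condition from above is imposed on \<open>V\<close>.\<close>

definition AC_solution ::
    "(real^'k \<Rightarrow> real) \<Rightarrow> (real^2) set \<Rightarrow> real \<Rightarrow> (real^2 \<Rightarrow> real^'k) \<Rightarrow> bool" where
  "AC_solution V \<Omega> \<epsilon> u \<longleftrightarrow>
     sobolev_H1 \<Omega> u \<and> locally_integrable_on (\<lambda>x. grad V (u x)) \<Omega> \<and>
     (\<forall>\<phi> j. test_function \<Omega> \<phi> \<longrightarrow>
        (\<integral>x. weak_gradient \<Omega> u x $ j \<bullet> grad \<phi> x \<partial>lebesgue_on \<Omega>)
        = - (1 / \<epsilon>\<^sup>2) * (\<integral>x. grad V (u x) $ j * \<phi> x \<partial>lebesgue_on \<Omega>))"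

definition radon_measure_on :: "'a::euclidean_space set \<Rightarrow> 'a measure \<Rightarrow> bool" where
  "radon_measure_on \<Omega> \<mu> \<longleftrightarrow>
     sets \<mu> = sets (restrict_space borel \<Omega>) \<and> (\<forall>K. compact K \<and> K \<subseteq> \<Omega> \<longrightarrow> emeasure \<mu> K < \<infinity>)"

text \<open>Weak convergence of the measures \<open>f\<^sub>n dx\<close> to \<open>\<mu>\<close> as (Radon) measures on the open set \<open>\<Omega>\<close>, that is,
  tested against continuous functions with compact support in \<open>\<Omega>\<close>; mass may escape to the
  boundary.\<close>

definition densities_converge_weakly ::
    "'a::euclidean_space set \<Rightarrow> (nat \<Rightarrow> 'a \<Rightarrow> real) \<Rightarrow> 'a measure \<Rightarrow> bool" where
  "densities_converge_weakly \<Omega> f \<mu> \<longleftrightarrow>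
     radon_measure_on \<Omega> \<mu> \<and>
     (\<forall>\<phi>::'a \<Rightarrow> real. continuous_on UNIV \<phi> \<and> compact (closure {x. \<phi> x \<noteq> 0}) \<and>
          closure {x. \<phi> x \<noteq> 0} \<subseteq> \<Omega> \<longrightarrow>
        (\<lambda>n. \<integral>x. \<phi> x \<partial>density (lebesgue_on \<Omega>) (\<lambda>x. ennreal (f n x))) \<longlonglongrightarrow> (\<integral>x. \<phi> x \<partial>\<mu>))"

text \<open>The Hausdorff measure is defined on all subsets, as an outer measure.\<close>

definition hausdorff1_delta :: "real \<Rightarrow> 'a::metric_space set \<Rightarrow> ennreal" where
  "hausdorff1_delta \<delta> A =
     (INF C\<in>{C :: nat \<Rightarrow> 'a set. A \<subseteq> (\<Union>i. C i) \<and> (\<forall>i. bounded (C i) \<and> diameter (C i) \<le> \<delta>)}.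
        \<Sum>i. ennreal (diameter (C i)))"

definition hausdorff1 :: "'a::metric_space set \<Rightarrow> ennreal" where
  "hausdorff1 A = (SUP \<delta>\<in>{0<..}. hausdorff1_delta \<delta> A)"

definition rectifiable1 :: "'a::euclidean_space set \<Rightarrow> bool" where
  "rectifiable1 A \<longleftrightarrow>
     (\<exists>\<gamma> :: nat \<Rightarrow> real \<Rightarrow> 'a. (\<forall>i. \<exists>L. L-lipschitz_on UNIV (\<gamma> i)) \<and>
        hausdorff1 (A - (\<Union>i. range (\<gamma> i))) = 0)"

definition clearing_out :: "(real^'k \<Rightarrow> real) \<Rightarrow> (real^2) set \<Rightarrow> real \<Rightarrow> bool" where
  "clearing_out V \<Omega> \<eta> \<longleftrightarrow>
     (\<forall>\<epsilon> v \<nu>.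
        (\<forall>n. 0 < \<epsilon> n \<and> \<epsilon> n \<le> 1) \<longrightarrow> \<epsilon> \<longlonglongrightarrow> 0 \<longrightarrow>
        (\<forall>n. AC_solution V \<Omega> (\<epsilon> n) (v n)) \<longrightarrow>
        (SUP n. energy V \<Omega> (\<epsilon> n) (v n)) < \<infinity> \<longrightarrow>
        densities_converge_weakly \<Omega> (\<lambda>n. energy_density V \<Omega> (\<epsilon> n) (v n)) \<nu> \<longrightarrow>
        (\<forall>x r. 0 < r \<longrightarrow> ball x r \<subseteq> \<Omega> \<longrightarrow>
           emeasure \<nu> (cball x r \<inter> \<Omega>) < ennreal (\<eta> * r) \<longrightarrow>
           emeasure \<nu> (cball x (r / 2) \<inter> \<Omega>) = 0))"

definition concentration_set :: "(real^2) set \<Rightarrow> (real^2) measure \<Rightarrow> real \<Rightarrow> (real^2) set" where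
  "concentration_set \<Omega> \<nu> \<eta> =
     {x\<in>\<Omega>. ennreal \<eta> \<le> Liminf (at_right 0) (\<lambda>r. emeasure \<nu> (cball x r \<inter> \<Omega>) / ennreal r)}"

end

theory Submission
 imports Defs "HOL-Complex_Analysis.Complex_Analysis"
begin

text \<open>The stress tensor of a solution is divergence free, so on a disk it is the rotated Hessian of an Airy function
\<open>w\<close> with \<open>\<Delta>w = 2 V(u)/\<epsilon> \<ge> 0\<close>. Clearing out makes the energy vanish in the limit away from \<open>S\<close>, and \<open>S\<close> meets almost
every line of a given direction in finitely many points. Hence the limit Airy function is piecewise affine and subharmonic, and a concave
kink on a non-null set would contradict the mean value inequality at a density point. It is therefore convex along almost every ray, its
radial means are convex in the radius, and their derivative is the mass of \<open>\<zeta>\<close> divided by the radius.\<close>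

text \<open>Only \<open>w\<close> passes to the limit, never the maps \<open>u\<close>. This is
  possible because the energy bounds the stress tensor in L^1, and in two variables an L^1 bound of
  the Hessian controls a function uniformly up to an affine part. Concave kinks are excluded by
  comparing two orders of magnitude: at a density point the excess of the limit over one affine
  branch is divided by 4 whenever the radius is halved, whereas the dip behind the kink is linear in
  the radius. A different obstacle precedes the limit. Nothing bounds the growth of \<open>V\<close>
  from above, so \<open>\<nabla>V(u)\<close> is only locally integrable and its product with
  \<open>\<nabla>u\<close> need not be. Kato's inequality for \<open>sqrt (1 + |u|^2)\<close>, fed
  by the lower bound of \<open>y \<bullet> \<nabla>V(y)\<close>, first yields local boundedness of
  \<open>u\<close>; only then can the divergence of the tensor be computed. Absolute continuity is a
  covering argument: monotonicity gives \<open>\<zeta>(ball x r) \<le> C r\<close> for centres in a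
  compact set and small \<open>r\<close>, and off \<open>S\<close> clearing out makes
  \<open>\<zeta>\<close> vanish.\<close>

type_synonym plane = "real \<times> real"

abbreviation lebesgue_nn_integral :: "('a::euclidean_space \<Rightarrow> ennreal) \<Rightarrow> ennreal" (binder "NNI " 10)
 where "lebesgue_nn_integral f \<equiv> integral\<^sup>N lborel f"

abbreviation lebesgue_integral :: "('a::euclidean_space \<Rightarrow> 'b::{banach, second_countable_topology}) \<Rightarrow> 'b" (binder "LI " 10)
 where "lebesgue_integral f \<equiv> integral\<^sup>L lborel f"

abbreviation integ :: "('a::euclidean_space \<Rightarrow> 'b::{banach, second_countable_topology}) \<Rightarrow> bool"
 where "integ \<equiv> integrable lborel"

abbreviation borel_fun :: "('a::topological_space \<Rightarrow> 'b::topological_space) set"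
 where "borel_fun \<equiv> borel_measurable borel"

abbreviation contU :: "('a::topological_space \<Rightarrow> 'b::topological_space) \<Rightarrow> bool"
 where "contU \<equiv> continuous_on UNIV"

abbreviation seq_limit :: "(nat \<Rightarrow> 'a::topological_space) \<Rightarrow> 'a \<Rightarrow> bool" (infixr "~~>" 60)
 where "X ~~> L \<equiv> X \<longlonglongrightarrow> L"

notation inner (infix ".*" 70) and scaleR (infixr "*." 75)

lemmas B_integrable_add = Bochner_Integration.integrable_add and B_integrable_bound = Bochner_Integration.integrable_bound and B_integrable_diff = Bochner_Integration.integrable_diff and B_integral_add = Bochner_Integration.integral_add and B_integral_cong = Bochner_Integration.integral_cong and B_integral_diff = Bochner_Integration.integral_diff



section \<open>Explicit gradients, integration by parts and convolution in the plane\<close>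

text \<open>The partial derivatives are arguments and not derived quantities, so that a function,
  its gradient and its Hessian can be named and handed on as a chain of functions.\<close>

definition has_grad :: "(plane => 'b::real_normed_vector) => 'b => 'b => plane => bool" where
 "has_grad F a b x \<longleftrightarrow> (F has_derivative (%v. fst v *. a + snd v *. b)) (at x)"

lemma has_grad_unique:
 assumes "has_grad F a b x" "has_grad F a' b' x"
 shows "a = a'" "b = b'"
proof -
 have "(%v. fst v *. a + snd v *. b) = (%v::plane. fst v *. a' + snd v *. b')"
  using assms unfolding has_grad_def by (rule has_derivative_unique)
 from fun_cong[OF this, of "(1,0)"] fun_cong[OF this, of "(0,1)"]
 show "a = a'" "b = b'" by auto
qed

lemma has_grad_isCont: "has_grad F a b x ==> isCont F x"
 unfolding has_grad_def by (rule has_derivative_continuous)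

lemma abs_fst_snd_le_norm:
 fixes w :: "plane"
 shows "\<bar>fst w\<bar> <= norm w" "\<bar>snd w\<bar> <= norm w"
 using norm_fst_le[of "fst w" "snd w"] norm_snd_le[of "snd w" "fst w"] by auto

lemma has_grad_line:
 assumes "has_grad F a b (x + t *. e)"
 shows "((%t. F (x + t *. e)) has_vector_derivative (fst e *. a + snd e *. b)) (at t within T)"
proof -
 have "((%t. x + t *. e) has_derivative (%h. h *. e)) (at t within T)"
  by (auto intro!: derivative_eq_intros)
 from has_derivative_compose[OF this assms[unfolded has_grad_def]]
 show ?thesis
  by (simp add: has_vector_derivative_def scaleR_add_right mult.commute)
qed

text \<open>By translation invariance every difference quotient in direction \<open>e\<close>
  integrates to 0. The mean value theorem bounds all of them by one multiple of an indicator, so the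
  integral of their limit is 0 as well.\<close>

lemma integral_directional_derivative_eq_0:
 fixes F F' :: "'a::euclidean_space => real"
 assumes D: "!!x t. ((%t. F (x + t *. e)) has_vector_derivative F' (x + t *. e)) (at t)"
  and cF: "contU F" and cF': "contU F'"
  and Z: "!!x. R < norm x ==> F x = 0" "!!x. R < norm x ==> F' x = 0"
 shows "integral\<^sup>L lborel F' = 0"
proof -
 have "bounded (F' ` cball 0 R)"
  by (intro compact_imp_bounded compact_continuous_image continuous_on_subset[OF cF']) auto
 then obtain B where "0 < B" and BB: "\<forall>y\<in>F' ` cball 0 R. norm y <= B"
  unfolding bounded_pos by blast
 then have B: "!!x. x : cball 0 R ==> \<bar>F' x\<bar> <= B" and B0: "B >= 0"
  by auto
 have B': "\<bar>F' x\<bar> <= B" for x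
  using B[of x] Z(2)[of x] B0 by (cases "norm x <= R") auto
 have lip: "\<bar>F (x + h *. e) - F x\<bar> <= B * h" if h: "h > 0" for x h
 proof -
  have "norm (F (x + h *. e) - F (x + 0 *. e)) <= B * norm (h - 0)"
   by (rule field_differentiable_bound[where S=UNIV and f'="%t. F' (x + t *. e)" and f="%t. F (x + t *. e)"])
    (use D B' in \<open>auto simp: has_real_derivative_iff_has_vector_derivative\<close>)
  with h show ?thesis by simp
 qed
 let ?h = "%n::nat. inverse (real (Suc n))"
 let ?D = "%n x. (F (x + ?h n *. e) - F x) / ?h n"
 have mF[measurable]: "F : borel_fun" "F' : borel_fun"
  using cF cF' by (auto intro: borel_measurable_continuous_onI)
 \<comment> \<open>The steps \<open>?h n\<close> are at most 1, so a shift moves points by at most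
   \<open>norm e\<close>; hence the enlarged radius.\<close>
 have bd: "\<bar>?D n x\<bar> <= B * indicator (cball 0 (R + norm e)) x" for n x
 proof (cases "norm x <= R + norm e")
  case True
  have "\<bar>?D n x\<bar> <= B * ?h n / ?h n" 
   unfolding abs_divide by (rule frac_le) (use lip[of "?h n" x] in auto)
  then show ?thesis using True by simp
 next
  case False
  have 1: "?h n * norm e <= norm e" by (intro mult_left_le_one_le) (auto simp: inverse_le_1_iff)
  have "norm x <= norm (x + ?h n *. e) + norm (?h n *. e)"
   by (metis add_diff_cancel norm_triangle_ineq4)
  then have "norm x <= norm (x + ?h n *. e) + norm e"
   using 1 by auto
  then have "R < norm (x + ?h n *. e)" "R < norm x" using False norm_ge_zero[of e] by linarith+
  then show ?thesis using False B0 Z(1) by (simp add: mult_nonneg_nonneg)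
 qed
 have ind: "integ (%x::'a. B * indicator (cball 0 (R + norm e)) x)"
  by (intro integrable_mult_right integrable_real_indicator emeasure_lborel_cball_finite) auto
 have "(%n. ?D n x) ~~> F' x" for x
 proof -
  have "((%t. F (x + t *. e)) has_field_derivative F' x) (at 0)"
   using D[of x 0] by (simp add: has_real_derivative_iff_has_vector_derivative)
  then have "((%h. (F (x + h *. e) - F x) / h) \<longlongrightarrow> F' x) (at 0)"
   by (simp add: DERIV_def)
  moreover have "filterlim ?h (at 0) sequentially"
   using LIMSEQ_inverse_real_of_nat by (auto simp: filterlim_at)
  ultimately show ?thesis by (rule filterlim_compose)
 qed
 then have "(%n. integral\<^sup>L lborel (?D n)) ~~> integral\<^sup>L lborel F'"
  by (intro integral_dominated_convergence[OF _ _ ind]) (use bd in \<open>auto simp del: of_nat_Suc\<close>)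
 moreover have "integral\<^sup>L lborel (?D n) = 0" for n
 proof -
  have bF: "bounded (F ` cball 0 R)"
   by (intro compact_imp_bounded compact_continuous_image continuous_on_subset[OF cF]) auto
  obtain C where "\<forall>y\<in>F ` cball 0 R. norm y <= C"
   using bF unfolding bounded_iff by blast
  then have C: "!!x. x : cball 0 R ==> \<bar>F x\<bar> <= C" by auto
  have int: "integ F"
  proof (rule B_integrable_bound)
   show "integ (%x::'a. C * indicator (cball 0 R) x)"
    by (intro integrable_mult_right integrable_real_indicator emeasure_lborel_cball_finite) auto
   show "AE x in lborel. norm (F x) <= norm (C * indicator (cball 0 R) x)"
   proof (rule AE_I2)
    fix x show "norm (F x) <= norm (C * indicator (cball 0 R) x)"
     using C[of x] Z(1)[of x] by (cases "norm x <= R") auto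
   qed
  qed auto
  have eq: "integral\<^sup>L lborel (%x. F (x + ?h n *. e)) = integral\<^sup>L lborel F"
   by (subst (2) lborel_distr_plus[of "?h n *. e", symmetric], subst integral_distr) (auto simp: add.commute)
  have "integrable (distr lborel borel ((+) (?h n *. e))) F"
   using int by (simp add: lborel_distr_plus)
  then have "integ (%x. F (x + ?h n *. e))"
   by (subst (asm) integrable_distr_eq) (auto simp: add.commute)
  with int eq show ?thesis by simp
 qed
 ultimately have "(%n::nat. 0) ~~> integral\<^sup>L lborel F'"
  by (simp only:)
 then show ?thesis by (simp add: LIMSEQ_const_iff)
qed

lemma integral_has_grad_eq_0:
 fixes F :: "plane => real"
 assumes "!!x. has_grad F (F1 x) (F2 x) x"
  and "contU F1" "contU F2"
  and Z: "!!x. R < norm x ==> F x = 0"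
 shows "integral\<^sup>L lborel F1 = 0" "integral\<^sup>L lborel F2 = 0"
proof -
 have c: "contU F"
  using assms(1) has_grad_isCont by (blast intro: continuous_at_imp_continuous_on)
 \<comment> \<open>\<open>F\<close> vanishes on an open set there, so its gradient vanishes with
   it.\<close>
 have 0: "F1 x = 0 & F2 x = 0" if "R < norm x" for x
 proof -
  have "((%_. 0) has_derivative (%v. fst v *. F1 x + snd v *. F2 x)) (at x)"
  proof (rule has_derivative_transform_within_open[of F _ x UNIV "- cball 0 R"])
   show "(F has_derivative (%v. fst v *. F1 x + snd v *. F2 x)) (at x)"
    using assms(1) by (simp add: has_grad_def)
  qed (use that Z in auto)
  then have "has_grad (%_. 0::real) (F1 x) (F2 x) x" by (simp add: has_grad_def)
  moreover have "has_grad (%_. 0::real) 0 0 x" by (simp add: has_grad_def)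
  ultimately show ?thesis using has_grad_unique by metis
 qed
 show "integral\<^sup>L lborel F1 = 0"
  by (rule integral_directional_derivative_eq_0[where F=F and e="(1,0)" and R=R])
   (use c assms 0 has_grad_line[OF assms(1), where e="(1,0)"] in auto)
 show "integral\<^sup>L lborel F2 = 0"
  by (rule integral_directional_derivative_eq_0[where F=F and e="(0,1)" and R=R])
   (use c assms 0 has_grad_line[OF assms(1), where e="(0,1)"] in auto)
qed

definition zero_outside :: "real => ('a::real_normed_vector => 'b::zero) => bool" where
 "zero_outside R K \<longleftrightarrow> (\<forall>x. R < norm x --> K x = 0)"

lemma zero_outsideD: "zero_outside R K ==> R < norm x ==> K x = 0"
 by (simp add: zero_outside_def)

lemma uniformly_continuous_compact_support:
 fixes K :: "'a::euclidean_space => real"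
 assumes c: "contU K" and Z: "zero_outside R K" and e: "0 < e"
 shows "\<exists>d>0. \<forall>x y. dist x y < d --> \<bar>K x - K y\<bar> < e"
proof -
 have "uniformly_continuous_on (cball 0 (R+1)) K"
  by (intro compact_uniformly_continuous continuous_on_subset[OF c]) auto
 then obtain d where d: "d > 0" "!!x y. x : cball 0 (R+1) ==> y : cball 0 (R+1) ==> dist x y < d ==> dist (K x) (K y) < e"
  using e unfolding uniformly_continuous_on_def by metis
 show ?thesis
 proof (intro exI[of _ "min d 1"] conjI allI impI)
  fix x y :: 'a assume xy: "dist x y < min d 1"
  have "norm x <= norm y + dist x y" "norm y <= norm x + dist x y"
   by (metis norm_triangle_sub add.commute dist_norm norm_minus_commute)+
  then show "\<bar>K x - K y\<bar> < e"
   using d(2)[of x y] zero_outsideD[OF Z, of x] zero_outsideD[OF Z, of y] e xy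
   by (cases "norm x <= R+1 & norm y <= R+1") (auto simp: dist_real_def)
 qed (use d in auto)
qed

lemma bounded_compact_support:
 fixes K :: "'a::euclidean_space => real"
 assumes c: "contU K" and Z: "zero_outside R K"
 shows "\<exists>B\<ge>0. \<forall>x. \<bar>K x\<bar> <= B"
proof -
 have "bounded (K ` cball 0 R)"
  by (intro compact_imp_bounded compact_continuous_image continuous_on_subset[OF c]) auto
 then obtain B where "\<forall>y\<in>K ` cball 0 R. norm y <= B"
  unfolding bounded_iff by blast
 then have B: "!!x. x : cball 0 R ==> \<bar>K x\<bar> <= B" by auto
 show ?thesis
 proof (intro exI[of _ "max B 0"] conjI allI)
  fix x show "\<bar>K x\<bar> <= max B 0"
   using B[of x] zero_outsideD[OF Z, of x] by (cases "norm x <= R") auto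
 qed auto
qed

text \<open>All regularity comes from the scalar kernel \<open>K\<close>; \<open>h\<close> may be
  vector valued and merely integrable.\<close>

definition conv :: "('a::euclidean_space => real) => ('a => 'b::euclidean_space) => 'a => 'b" where
 "conv K h x = (LI z. K (x - z) *. h z)"

lemma conv_integrable:
 fixes h :: "'a::euclidean_space => 'b::euclidean_space"
 assumes c: "contU K" and Z: "zero_outside R K" and h: "integ h"
 shows "integ (%z. K (x - z) *. h z)"
proof -
 obtain B where B: "B >= 0" "!!x. \<bar>K x\<bar> <= B" using bounded_compact_support[OF c Z] by blast
 have [measurable]: "K : borel_fun" using c by (rule borel_measurable_continuous_onI)
 have [measurable]: "h : borel_fun" using h by auto
 show ?thesis
  by (rule B_integrable_bound[of _ "%z. B *. h z"])
   (use h B in \<open>auto intro!: AE_I2 mult_right_mono\<close>)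
qed

lemma conv_continuous:
 fixes h :: "'a::euclidean_space => 'b::euclidean_space"
 assumes c: "contU K" and Z: "zero_outside R K" and h: "integ h"
 shows "contU (conv K h)"
 unfolding continuous_on_iff
proof (intro ballI allI impI)
 fix x :: 'a and e :: real assume e: "0 < e"
 define H where "H = (LI z. norm (h z))"
 have H0: "H >= 0" unfolding H_def by simp
 have "0 < e / (H + 1)" using e H0 by simp
 from uniformly_continuous_compact_support[OF c Z this]
 obtain d where d: "d > 0" "!!x y. dist x y < d ==> \<bar>K x - K y\<bar> < e / (H + 1)"
  by blast
 show "\<exists>d>0. \<forall>x'\<in>UNIV. dist x' x < d --> dist (conv K h x') (conv K h x) < e"
 proof (intro exI[of _ d] conjI ballI impI)
  fix y assume y: "dist y x < d"
  note I = conv_integrable[OF c Z h]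
  have "conv K h y - conv K h x = (LI z. (K (y - z) - K (x - z)) *. h z)"
   unfolding conv_def scaleR_diff_left by (rule B_integral_diff[symmetric]) (use I in auto)
  also have "norm ... <= (LI z. norm ((K (y - z) - K (x - z)) *. h z))"
   by (rule integral_norm_bound)
  also have "... <= (LI z. e / (H+1) * norm (h z))"
  proof (rule integral_mono)
   show "integ (%z. norm ((K (y - z) - K (x - z)) *. h z))"
    using I[of y] I[of x] by (auto simp: scaleR_diff_left intro!: integrable_norm B_integrable_diff)
   fix z show "norm ((K (y - z) - K (x - z)) *. h z) <= e / (H + 1) * norm (h z)"
    using d(2)[where x="y - z" and y="x - z"] y
    unfolding norm_scaleR real_norm_def by (intro mult_right_mono) (auto simp: dist_norm less_imp_le)
  qed (use h in auto)
  also have "... = e / (H+1) * H" by (simp add: H_def)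
  also have "... < e" using e H0 by (simp add: field_simps)
  finally show "dist (conv K h y) (conv K h x) < e" by (simp add: dist_norm)
 qed (use d in auto)
qed

text \<open>The derivative falls on the kernel. Uniform continuity of \<open>K1\<close> and
  \<open>K2\<close> makes the linearisation error of \<open>K\<close> at most
  \<open>2 * e' * norm v\<close> at all points simultaneously, and such a bound survives integration
  against an integrable \<open>h\<close>.\<close>

lemma conv_has_grad:
 fixes h :: "plane => 'b::euclidean_space"
 assumes K: "!!x. has_grad K (K1 x) (K2 x) x"
  and c: "contU K1" "contU K2"
  and Z: "zero_outside R K" "zero_outside R K1" "zero_outside R K2"
  and h: "integ h"
 shows "has_grad (conv K h) (conv K1 h x) (conv K2 h x) x"
 unfolding has_grad_def has_derivative_at_alt
proof (intro conjI allI impI)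
 show "bounded_linear (%v. fst v *. conv K1 h x + snd v *. conv K2 h x)"
  by (intro bounded_linear_add bounded_linear_compose[OF bounded_linear_scaleR_left] bounded_linear_fst bounded_linear_snd)
 fix e :: real assume e: "0 < e"
 define H where "H = (LI z. norm (h z))"
 have H0: "H >= 0" unfolding H_def by simp
 \<comment> \<open>The factor 2 pays for the two partial derivatives, \<open>H + 1\<close> for the
   L^1 norm \<open>H\<close> of \<open>h\<close>, which may be 0.\<close>
 define e' where "e' = e / (2 * (H + 1))"
 have e': "e' > 0" using e H0 by (simp add: e'_def)
 obtain d1 where d1: "d1 > 0" "!!x y. dist x y < d1 ==> \<bar>K1 x - K1 y\<bar> < e'"
  using uniformly_continuous_compact_support[OF c(1) Z(2) e'] by blast
 obtain d2 where d2: "d2 > 0" "!!x y. dist x y < d2 ==> \<bar>K2 x - K2 y\<bar> < e'"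
  using uniformly_continuous_compact_support[OF c(2) Z(3) e'] by blast
 define d where "d = min d1 d2"
 have cK: "contU K"
  using K has_grad_isCont by (blast intro: continuous_at_imp_continuous_on)
 have key: "\<bar>K (y + v) - K y - (fst v * K1 y + snd v * K2 y)\<bar> <= 2 * e' * norm v" if v: "norm v < d" for y v
 proof -
  have "norm (K (y + v) - K y - (fst (y + v - y) *. K1 y + snd (y + v - y) *. K2 y)) <= norm (y + v - y) * (2 * e')"
  proof (rule differentiable_bound_linearization[where S = "ball y d" and f' = "%x v. fst v *. K1 x + snd v *. K2 x" and ?x0.0 = y])
   show "y + t *. (y + v - y) : ball y d" if "t : {0..1}" for t
   proof -
    have "\<bar>t\<bar> * norm v <= norm v" using that by (intro mult_left_le_one_le) auto
    then show ?thesis using v by (simp add: dist_norm)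
   qed
   show "(K has_derivative (%v. fst v *. K1 x + snd v *. K2 x)) (at x within ball y d)" for x
    using K[of x] unfolding has_grad_def by (rule has_derivative_at_withinI)
   show "onorm ((%v. fst v *. K1 x + snd v *. K2 x) - (%v. fst v *. K1 y + snd v *. K2 y)) <= 2 * e'"
    if "x : ball y d" for x
   proof (rule onorm_le)
    fix w :: "plane"
    have "\<bar>K1 x - K1 y\<bar> <= e'" "\<bar>K2 x - K2 y\<bar> <= e'"
     using d1(2)[of x y] d2(2)[of x y] that by (auto simp: d_def dist_commute)
    then have "\<bar>fst w\<bar> * \<bar>K1 x - K1 y\<bar> <= norm w * e'" "\<bar>snd w\<bar> * \<bar>K2 x - K2 y\<bar> <= norm w * e'"
     by (auto intro!: mult_mono simp: abs_fst_snd_le_norm)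
    then have "\<bar>fst w * (K1 x - K1 y)\<bar> + \<bar>snd w * (K2 x - K2 y)\<bar> <= 2 * e' * norm w"
     unfolding abs_mult by (simp add: mult.commute[of "norm w"])
    then show "norm (((%v. fst v *. K1 x + snd v *. K2 x) - (%v. fst v *. K1 y + snd v *. K2 y)) w) <= 2 * e' * norm w"
     by (simp add: fun_diff_def algebra_simps)
   qed
   show "y : ball y d" using d1 d2 by (simp add: d_def)
  qed
  then show ?thesis by (simp add: mult.commute)
 qed
 show "\<exists>d>0. \<forall>y. norm (y - x) < d -->
   norm (conv K h y - conv K h x - (fst (y - x) *. conv K1 h x + snd (y - x) *. conv K2 h x)) <= e * norm (y - x)"
 proof (intro exI[of _ d] conjI allI impI)
  fix y assume y: "norm (y - x) < d"
  define v where "v = y - x"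
  note I = conv_integrable[OF cK Z(1) h] conv_integrable[OF c(1) Z(2) h] conv_integrable[OF c(2) Z(3) h]
  let ?G = "%z. (K (y - z) - K (x - z) - (fst v * K1 (x - z) + snd v * K2 (x - z))) *. h z"
  have "(%z. (K (y - z) *. h z - K (x - z) *. h z) - (fst v *. (K1 (x - z) *. h z) + snd v *. (K2 (x - z) *. h z))) = ?G"
   by (auto simp: algebra_simps)
  moreover have "has_bochner_integral lborel (%z. (K (y - z) *. h z - K (x - z) *. h z) - (fst v *. (K1 (x - z) *. h z) + snd v *. (K2 (x - z) *. h z)))
    (conv K h y - conv K h x - (fst v *. conv K1 h x + snd v *. conv K2 h x))"
   unfolding conv_def
   by (intro has_bochner_integral_diff has_bochner_integral_add has_bochner_integral_scaleR_right
     has_bochner_integral_integrable I)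
  ultimately have IG: "has_bochner_integral lborel ?G (conv K h y - conv K h x - (fst v *. conv K1 h x + snd v *. conv K2 h x))"
   by (simp only:)
  then have eq: "conv K h y - conv K h x - (fst v *. conv K1 h x + snd v *. conv K2 h x) = (LI z. ?G z)"
   and IG': "integ ?G"
   by (auto simp only: has_bochner_integral_integral_eq[OF IG] has_bochner_integral_iff)
  have "norm (LI z. ?G z) <= (LI z. norm (?G z))"
   by (rule integral_norm_bound)
  also have "... <= (LI z. 2 * e' * norm v * norm (h z))"
  proof (rule integral_mono)
   show "integ (%z. norm (?G z))" using IG' by (rule integrable_norm)
   fix z
   have yz: "y - z = (x - z) + v" by (simp add: v_def)
   show "norm (?G z) <= 2 * e' * norm v * norm (h z)"
    using key[of v "x - z"] y[folded v_def] unfolding norm_scaleR real_norm_def yz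
    by (intro mult_right_mono) auto
  qed (use h in auto)
  also have "... = 2 * e' * H * norm v" by (simp add: H_def)
  also have "... <= e * norm v"
   using e H0 by (intro mult_right_mono) (auto simp: e'_def field_simps)
  finally show "norm (conv K h y - conv K h x - (fst (y - x) *. conv K1 h x + snd (y - x) *. conv K2 h x)) <= e * norm (y - x)"
   using eq by (simp add: v_def)
 qed (use d1 d2 in \<open>auto simp: d_def\<close>)
qed


section \<open>Smooth bump kernels\<close>

text \<open>The derivatives of \<open>exp (-1/t)\<close> are combinations of
  \<open>exp (-1/t) / t^k\<close>. Numbering these functions by \<open>k\<close> gives a family that
  is closed under differentiation, see \<open>ek_deriv\<close>.\<close>

definition ek :: "nat => real => real" where
 "ek k t = (if t > 0 then exp (- inverse t) * inverse t ^ k else 0)"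

lemma ek_nonneg: "0 <= ek k t" and ek_pos: "0 < t ==> 0 < ek k t" and ek_zero: "t <= 0 ==> ek k t = 0"
 by (auto simp: ek_def)

text \<open>The only delicate point is 0: the left difference quotient vanishes, and the right one
  becomes \<open>x ^ (k+1) / exp x\<close> for \<open>x = 1/t\<close>, which tends to 0 at
  infinity.\<close>

lemma ek_deriv: "(ek k has_real_derivative (ek (k+2) t - k * ek (k+1) t)) (at t)"
proof -
 consider "t > 0" | "t < 0" | "t = 0" by linarith
 then show ?thesis
 proof cases
  case 1
  have p: "real k * inverse t ^ (k - 1) * inverse t ^ 2 = k * inverse t ^ (k+1)"
   by (cases k) (auto simp: power2_eq_square)
  have "((%t. exp (- inverse t) * inverse t ^ k) has_real_derivative
    (exp (- inverse t) * inverse t ^ 2) * inverse t ^ k + exp (- inverse t) * - (real k * inverse t ^ (k - 1) * inverse t ^ 2)) (at t)"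
   using 1 by (auto intro!: derivative_eq_intros simp: power2_eq_square algebra_simps)
  also have "(exp (- inverse t) * inverse t ^ 2) * inverse t ^ k + exp (- inverse t) * - (real k * inverse t ^ (k - 1) * inverse t ^ 2)
    = ek (k+2) t - k * ek (k+1) t"
   unfolding p using 1 by (simp add: ek_def power_add power2_eq_square)
  finally show ?thesis
   by (rule has_field_derivative_transform_within_open[where S="{0<..}"]) (use 1 in \<open>auto simp: ek_def\<close>)
 next
  case 2
  have "((%t. 0) has_real_derivative (ek (k+2) t - k * ek (k+1) t)) (at t)"
   using 2 by (auto simp: ek_def)
  then show ?thesis
   by (rule has_field_derivative_transform_within_open[where S="{..<0}"]) (use 2 in \<open>auto simp: ek_def\<close>)
 next
  case 3
  have "((%h. ek k h / h) \<longlongrightarrow> 0) (at 0)"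
   unfolding filterlim_split_at_real
  proof (rule filterlim_split_at_real)
   show "((%h. ek k h / h) \<longlongrightarrow> 0) (at_left 0)"
    by (rule Lim_transform_eventually[where f="%_. 0"]) (auto simp: ek_def eventually_at_left_field intro!: exI[of _ "-1"])
   have "((%x. x ^ (k+1) / exp x) \<longlongrightarrow> (0::real)) at_top" by (rule tendsto_power_div_exp_0)
   moreover have "\<forall>\<^sub>F x in at_top. x ^ (k+1) / exp x = ek k (inverse x) / inverse x"
    using eventually_gt_at_top[of "0::real"] by eventually_elim (auto simp: ek_def exp_minus field_simps)
   ultimately show "((%h. ek k h / h) \<longlongrightarrow> 0) (at_right 0)"
    unfolding filterlim_at_right_to_top by (rule Lim_transform_eventually)
  qed
  then show ?thesis using 3 by (simp add: DERIV_def ek_def)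
 qed
qed

lemma ek_continuous: "contU (ek k)"
 using ek_deriv by (metis DERIV_isCont continuous_at_imp_continuous_on)

text \<open>For \<open>k = 0\<close> this is the standard bump
  \<open>exp (-1 / (d^2 - |x|^2))\<close>; larger \<open>k\<close> occur in its derivatives.\<close>

definition kq :: "nat => real => 'a::real_inner => real" where
 "kq k d x = ek k (d\<^sup>2 - x .* x)"

lemma kq_derivative:
 "((%x. kq k d (x - c)) has_derivative (%v. (kq (k+2) d (x - c) - k * kq (k+1) d (x - c)) * (-2 * ((x - c) .* v)))) (at x)"
proof -
 have "((%x. d\<^sup>2 - (x - c) .* (x - c)) has_derivative (%v. -2 * ((x - c) .* v))) (at x)"
  by (auto intro!: derivative_eq_intros simp: inner_commute)
 from has_derivative_compose[OF this ek_deriv[unfolded has_field_derivative_def]]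
 show ?thesis by (simp add: kq_def)
qed

lemma kq_continuous: "contU (kq k d)"
 unfolding kq_def by (intro continuous_on_compose2[OF ek_continuous] continuous_intros) auto

lemma kq_zero_outside: "0 < d ==> d <= norm x ==> kq k d x = 0"
 unfolding kq_def by (intro ek_zero) (auto simp: dot_square_norm)

lemma kq_pos: "norm x < d ==> 0 < kq k d x"
 unfolding kq_def by (intro ek_pos) (auto simp: dot_square_norm power_strict_mono)

lemma kq_nonneg: "0 <= kq k d x"
 unfolding kq_def by (rule ek_nonneg)

definition mollifier :: "real => ('a::euclidean_space => real) => bool" where
 "mollifier d K \<longleftrightarrow> contU K & (\<forall>x. 0 <= K x) & zero_outside d K & integral\<^sup>L lborel K = 1"

lemma continuous_zero_outside_integrable:
 fixes K :: "'a::euclidean_space => real"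
 assumes c: "contU K" and Z: "zero_outside R K"
 shows "integ K"
proof -
 obtain B where B: "!!x. \<bar>K x\<bar> <= B" using bounded_compact_support[OF c Z] by blast
 have [measurable]: "K : borel_fun" using c by (rule borel_measurable_continuous_onI)
 show ?thesis
 proof (rule B_integrable_bound)
  show "integ (%x::'a. B * indicator (cball 0 R) x)"
   by (intro integrable_mult_right integrable_real_indicator emeasure_lborel_cball_finite) auto
  show "AE x in lborel. norm (K x) <= norm (B * indicator (cball 0 R) x)"
  proof (rule AE_I2)
   fix x show "norm (K x) <= norm (B * indicator (cball 0 R) x)"
    using B[of x] zero_outsideD[OF Z, of x] by (cases "norm x <= R") auto
  qed
 qed auto
qed

text \<open>\<open>bmp\<close> is the bump of integral 1, and \<open>bmp1\<close> to
  \<open>bmp22\<close> are its first and second partial derivatives in closed form, which shows at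
  once that they are continuous with support in the same disk.\<close>

definition bmpZ :: "real => real" where "bmpZ d = (\<integral>x. kq 0 d x \<partial>(lborel :: (plane) measure))"
definition bmp :: "real => plane => real" where "bmp d x = kq 0 d x / bmpZ d"
definition bmp1 :: "real => plane => real" where "bmp1 d x = -2 * fst x * kq 2 d x / bmpZ d"
definition bmp2 :: "real => plane => real" where "bmp2 d x = -2 * snd x * kq 2 d x / bmpZ d"
definition bmp11 :: "real => plane => real" where
 "bmp11 d x = (4 * (fst x)\<^sup>2 * (kq 4 d x - 2 * kq 3 d x) - 2 * kq 2 d x) / bmpZ d"
definition bmp12 :: "real => plane => real" where
 "bmp12 d x = (4 * fst x * snd x * (kq 4 d x - 2 * kq 3 d x)) / bmpZ d"
definition bmp22 :: "real => plane => real" where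
 "bmp22 d x = (4 * (snd x)\<^sup>2 * (kq 4 d x - 2 * kq 3 d x) - 2 * kq 2 d x) / bmpZ d"

lemma kq_zero_outside': "0 < d ==> zero_outside d (kq k d)"
 unfolding zero_outside_def by (auto intro: kq_zero_outside)

lemma bmpZ_pos: assumes "0 < d" shows "0 < bmpZ d"
proof -
 have i: "integ (kq 0 d :: plane => real)"
  by (rule continuous_zero_outside_integrable[OF kq_continuous kq_zero_outside'[OF assms]])
 have "bmpZ d ~= 0"
 proof
  assume "bmpZ d = 0"
  then have "AE x in (lborel :: (plane) measure). kq 0 d x = 0"
   using integral_nonneg_eq_0_iff_AE[OF i] kq_nonneg by (auto simp: bmpZ_def)
  then have "AE x in (lborel :: (plane) measure). x ~: ball 0 d"
   by eventually_elim (auto dest!: kq_pos[where k=0])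
  then have "emeasure lborel (ball (0 :: plane) d) = 0"
   by (subst (asm) AE_iff_measurable[of "ball 0 d"]) auto
  moreover have "emeasure lborel (ball (0 :: plane) d) ~= 0"
   using assms open_not_negligible[of "ball (0 :: plane) d"]
   by (auto simp: negligible_iff_null_sets null_sets_def)
  ultimately show False by simp
 qed
 moreover have "0 <= bmpZ d" unfolding bmpZ_def by (rule integral_nonneg_AE) (auto simp: kq_nonneg)
 ultimately show ?thesis by simp
qed

lemma bmp_mollifier: assumes "0 < d" shows "mollifier d (bmp d)"
 unfolding mollifier_def
proof (intro conjI allI)
 show "contU (bmp d)"
  unfolding bmp_def using bmpZ_pos[OF assms] by (intro continuous_intros kq_continuous) auto
 show "0 <= bmp d x" for x using bmpZ_pos[OF assms] by (auto simp: bmp_def kq_nonneg)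
 show "zero_outside d (bmp d)" by (auto simp: kq_zero_outside[OF assms] zero_outside_def bmp_def)
 show "integral\<^sup>L lborel (bmp d) = 1"
  unfolding bmp_def using bmpZ_pos[OF assms] by (simp add: bmpZ_def)
qed

lemma bmp_zero_outside:
 assumes "0 < d"
 shows "zero_outside d (bmp d)" "zero_outside d (bmp1 d)" "zero_outside d (bmp2 d)"
  "zero_outside d (bmp11 d)" "zero_outside d (bmp12 d)" "zero_outside d (bmp22 d)"
 by (auto simp: kq_zero_outside[OF assms] zero_outside_def bmp_def bmp1_def bmp2_def bmp11_def bmp12_def bmp22_def)

lemma bmp_continuous:
 assumes "0 < d"
 shows "contU (bmp d)" "contU (bmp1 d)" "contU (bmp2 d)"
  "contU (bmp11 d)" "contU (bmp12 d)" "contU (bmp22 d)"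
 unfolding bmp_def bmp1_def bmp2_def bmp11_def bmp12_def bmp22_def
 using bmpZ_pos[OF assms] by (auto intro!: continuous_intros kq_continuous)

lemma kq_derivative0:
 "(kq k d has_derivative (%v. (kq (k+2) d x - k * kq (k+1) d x) * (-2 * (x .* v)))) (at x)"
 using kq_derivative[of k d 0 x] by simp

lemma bmp_has_grad:
 assumes "0 < d"
 shows "has_grad (bmp d) (bmp1 d x) (bmp2 d x) x"
  "has_grad (bmp1 d) (bmp11 d x) (bmp12 d x) x"
  "has_grad (bmp2 d) (bmp12 d x) (bmp22 d x) x"
 unfolding has_grad_def bmp_def bmp1_def bmp2_def bmp11_def bmp12_def bmp22_def
 using bmpZ_pos[OF assms]
 by (auto intro!: derivative_eq_intros kq_derivative0 ext simp: inner_prod_def field_simps power2_eq_square numeral_eq_Suc)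

lemma C_on_cong_has: "C_on (Suc m) S f \<longleftrightarrow>
   (\<exists>f'. (\<forall>x\<in>S. (f has_derivative f' x) (at x)) & (\<forall>b\<in>Basis. C_on m S (%x. f' x b)))"
 by simp

lemma C_on_SucD: "C_on (Suc m) S f ==> C_on m S f"
proof (induction m arbitrary: f)
 case 0
 then obtain f' where "\<forall>x\<in>S. (f has_derivative f' x) (at x)" by auto
 then show ?case by (auto intro!: continuous_at_imp_continuous_on has_derivative_continuous)
next
 case (Suc m)
 from Suc.prems obtain f' where f': "\<forall>x\<in>S. (f has_derivative f' x) (at x)"
  "\<forall>b\<in>Basis. C_on (Suc m) S (%x. f' x b)" by (subst (asm) C_on_cong_has) blast
 then have "\<forall>b\<in>Basis. C_on m S (%x. f' x b)" using Suc.IH by blast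
 with f' show ?case by auto
qed

lemma C_on_const: "C_on m S (%_. c)"
proof (induction m arbitrary: c)
 case (Suc m)
 show ?case using Suc by (auto intro!: exI[of _ "%_ _. 0"])
qed auto

lemma C_on_inner: "C_on m S (%x. x .* b)"
proof (cases m)
 case (Suc n)
 show ?thesis unfolding Suc
  by (auto intro!: exI[of _ "%_ v. v .* b"] derivative_eq_intros C_on_const)
qed (auto intro!: continuous_intros)

lemma C_on_add: "C_on m S f ==> C_on m S g ==> C_on m S (%x. f x + g x)"
proof (induction m arbitrary: f g)
 case (Suc m)
 from Suc.prems obtain f' g' where "\<forall>x\<in>S. (f has_derivative f' x) (at x)" "\<forall>b\<in>Basis. C_on m S (%x. f' x b)"
  "\<forall>x\<in>S. (g has_derivative g' x) (at x)" "\<forall>b\<in>Basis. C_on m S (%x. g' x b)" by auto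
 then show ?case using Suc.IH by (auto intro!: exI[of _ "%x v. f' x v + g' x v"] derivative_intros)
qed (auto intro!: continuous_intros)

lemma C_on_mult:
 fixes f g :: "'a::euclidean_space => real"
 shows "C_on m S f ==> C_on m S g ==> C_on m S (%x. f x * g x)"
proof (induction m arbitrary: f g)
 case (Suc m)
 from Suc.prems obtain f' g' where *: "\<forall>x\<in>S. (f has_derivative f' x) (at x)" "\<forall>b\<in>Basis. C_on m S (%x. f' x b)"
  "\<forall>x\<in>S. (g has_derivative g' x) (at x)" "\<forall>b\<in>Basis. C_on m S (%x. g' x b)" by auto
 have "C_on m S f" "C_on m S g" using Suc.prems C_on_SucD by blast+
 then have "\<forall>b\<in>Basis. C_on m S (%x. f x * g' x b + f' x b * g x)"
  using * Suc.IH by (auto intro!: C_on_add)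
 with * show ?case by (auto intro!: exI[of _ "%x v. f x * g' x v + f' x v * g x"] derivative_intros)
qed (auto intro!: continuous_intros)

text \<open>A derivative of a member is an affine function times members of the same family, so the
  induction on the order has to treat all \<open>k\<close> at once.\<close>

lemma C_on_kq:
 fixes c :: "'a::euclidean_space"
 shows "C_on m S (%x. kq k d (x - c))"
proof (induction m arbitrary: k)
 case 0
 show ?case unfolding C_on.simps
  by (rule continuous_on_compose2[OF kq_continuous]) (auto intro!: continuous_intros)
next
 case (Suc m)
 have "C_on m S (%x. (kq (k+2) d (x - c) + (- real k) * kq (k+1) d (x - c)) * ((-2) * (x .* b + - (c .* b))))" for b
  by (intro C_on_mult C_on_add Suc.IH C_on_const C_on_inner)
 then have "C_on m S (%x. (kq (k+2) d (x - c) - k * kq (k+1) d (x - c)) * (-2 * ((x - c) .* b)))" for b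
  by (simp add: inner_diff_left)
 then show ?case unfolding C_on.simps
  by (intro exI[of _ "%x v. (kq (k+2) d (x - c) - k * kq (k+1) d (x - c)) * (-2 * ((x - c) .* v))"] conjI ballI kq_derivative)
qed

text \<open>The weak formulations will be tested with these bumps only, which turns them into
  identities between convolutions.\<close>

lemma test_function_kq:
 fixes c :: "real^2"
 assumes "0 < d" "cball c d <= \<Omega>"
 shows "test_function \<Omega> (%x. kq 0 d (x - c))"
proof -
 have "{x. kq 0 d (x - c) ~= 0} <= cball c d"
  using kq_zero_outside[OF assms(1)] by (force simp: dist_norm norm_minus_commute)
 then have s: "closure {x. kq 0 d (x - c) ~= 0} <= cball c d"
  by (intro closure_minimal) auto
 then have "compact (closure {x. kq 0 d (x - c) ~= 0})"
  by (metis bounded_cball bounded_subset closed_closure compact_eq_bounded_closed)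
 with s assms show ?thesis unfolding test_function_def smooth_on_def using C_on_kq by blast
qed

lemma partial_kq:
 fixes c :: "real^2"
 shows "partial i (%x. kq 0 d (x - c)) x = -2 * (x - c) $ i * kq 2 d (x - c)"
 unfolding partial_def frechet_derivative_at[OF kq_derivative, symmetric]
 by (simp add: inner_axis flip: numeral_2_eq_2)


section \<open>Continuity of translations and convergence of mollifications\<close>

lemma lborel_distr_reflect: "distr lborel borel (%z. x - z) = (lborel :: 'a::euclidean_space measure)"
 using lborel_affine[of "-1" x] by (simp add: density_1)

lemma lborel_distr_shift: "distr lborel borel (%x. x - z) = (lborel :: 'a::euclidean_space measure)"
proof -
 have "(%x. x - z) = (+) (- z)" by auto
 then show ?thesis by (simp only: lborel_distr_plus)
qed

lemma integral_reflect:
 fixes g :: "'a::euclidean_space => 'b::euclidean_space"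
 assumes [measurable]: "g : borel_fun"
 shows "(LI z. g (x - z)) = integral\<^sup>L lborel g"
 by (subst (2) lborel_distr_reflect[of x, symmetric], subst integral_distr) auto

lemma nn_integral_shift:
 fixes g :: "'a::euclidean_space => ennreal"
 assumes [measurable]: "g : borel_fun"
 shows "(NNI x. g (x - z)) = integral\<^sup>N lborel g"
 by (subst (2) lborel_distr_shift[of z, symmetric], subst nn_integral_distr) auto

definition L1shift :: "('a::euclidean_space => 'b::euclidean_space) => 'a => ennreal" where
 "L1shift h z = (NNI x. norm (h (x - z) - h x))"

text \<open>Regularity of Lebesgue measure with a compact inner set: two thirds of \<open>e\<close>
  pay for the outer open and the inner closed set, the last third for the truncation to a large
  ball.\<close>

lemma finite_measure_inner_outer:
 fixes A :: "'a::euclidean_space set"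
 assumes A: "A : sets borel" "emeasure lborel A < \<infinity>" and e: "0 < e"
 obtains K U where "compact K" "open U" "K <= A" "A <= U" "emeasure lborel (U - K) < ennreal e"
proof -
 have AL: "A : sets lebesgue" using A by auto
 have e3: "0 < e/3" using e by simp
 obtain U where U: "open U" "A <= U" "emeasure lebesgue (U - A) < ennreal (e/3)"
  using sets_lebesgue_outer_open[OF AL e3] by metis
 obtain C where C: "closed C" "C <= A" "emeasure lebesgue (A - C) < ennreal (e/3)"
  using sets_lebesgue_inner_closed[OF AL e3] by metis
 have "(%n. emeasure lborel (A - cball 0 (real n))) ~~> emeasure lborel (\<Inter>n. A - cball 0 (real n))"
 proof (rule Lim_emeasure_decseq)
  show "range (%n. A - cball 0 (real n)) <= sets lborel" using A by auto
  show "decseq (%n. A - cball 0 (real n))" by (auto simp: decseq_def)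
  fix n have "emeasure lborel (A - cball 0 (real n)) <= emeasure lborel A"
   by (rule emeasure_mono) (use A in auto)
  then show "emeasure lborel (A - cball 0 (real n)) ~= \<infinity>"
   using A(2) by (metis infinity_ennreal_def leD top.not_eq_extremum)
 qed
 moreover have "(\<Inter>n. A - cball 0 (real n)) = {}"
  using real_arch_simple by (auto simp: ) 
 ultimately have "(%n. emeasure lborel (A - cball 0 (real n))) ~~> 0" by (simp only: emeasure_empty)
 from order_tendstoD(2)[OF this, of "ennreal (e/3)"] e
 obtain n where n: "emeasure lborel (A - cball 0 (real n)) < ennreal (e/3)"
  by (auto simp: eventually_sequentially)
 let ?K = "C \<inter> cball 0 (real n)"
 have Cm: "C : sets borel" "U : sets borel" using C U by auto
 have "U - ?K <= (U - A) \<union> (A - C) \<union> (A - cball 0 (real n))" by auto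
 then have "emeasure lborel (U - ?K) <= emeasure lborel ((U - A) \<union> (A - C) \<union> (A - cball 0 (real n)))"
  by (rule emeasure_mono) (use A Cm in auto)
 also have "... <= emeasure lborel (U - A) + emeasure lborel (A - C) + emeasure lborel (A - cball 0 (real n))"
  using A Cm by (intro order_trans[OF emeasure_subadditive] add_mono emeasure_subadditive) auto
 also have "... < ennreal (e/3) + ennreal (e/3) + ennreal (e/3)"
  using U(3) C(3) n A Cm by (intro add_strict_mono) auto
 also have "... = ennreal e" using e by (simp flip: ennreal_plus)
 finally show thesis using C U by (intro that[of ?K U]) (auto intro: compact_Int_closed)
qed

text \<open>Approximation by indicators of sets of finite measure, sums and dominated limits. For an
  indicator with \<open>K <= A <= U\<close>, a translation too short to lead from \<open>K\<close>
  out of \<open>U\<close> can change membership in \<open>A\<close> only if \<open>x\<close> or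
  \<open>x - z\<close> lies in \<open>U - K\<close>.\<close>

lemma L1shift_tendsto:
 fixes h :: "'a::euclidean_space => 'b::euclidean_space"
 assumes "integ h"
 shows "\<forall>e>0. \<exists>d>0. \<forall>z. norm z < d --> L1shift h z <= ennreal e"
 using assms
proof (induction rule: integrable_induct)
 case (base A c)
 show ?case
 proof (intro allI impI)
  fix e :: real assume e: "0 < e"
  define e' where "e' = e / (2 * (norm c + 1))"
  have nc: "norm c + 1 > 0" using norm_ge_zero[of c] by linarith
  have e': "e' > 0" using e nc by (simp add: e'_def)
  have A: "A : sets borel" "emeasure lborel A < \<infinity>" using base by auto
  obtain K U where KU: "compact K" "open U" "K <= A" "A <= U" "emeasure lborel (U - K) < ennreal e'"
   by (rule finite_measure_inner_outer[OF A e'])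
  have "K <= U" using KU by auto
  obtain d where d: "d > 0" "!!x. x : K ==> ball x d <= U"
   using compact_subset_open_imp_ball_epsilon_subset[OF KU(1,2) \<open>K <= U\<close>] by (metis UN_subset_iff)
  have Km[measurable]: "K : sets borel" "U : sets borel" "A : sets borel" using KU A by (auto simp: compact_imp_closed)
  show "\<exists>d>0. \<forall>z. norm z < d --> L1shift (%x. indicator A x *. c) z <= ennreal e"
  proof (intro exI[of _ d] conjI allI impI)
   fix z :: 'a assume z: "norm z < d"
   have pt: "ennreal (norm (indicator A (x - z) *. c - indicator A x *. c)) \<le>
    ennreal (norm c) * (indicator (U - K) (x - z) + indicator (U - K) x)" for x
   proof -
    have 1: "x - z : K ==> x : U" "x : K ==> x - z : U"
     using d(2)[of "x - z"] d(2)[of x] z by (auto simp: dist_norm subset_eq)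
    have le: "norm (indicator A (x - z) *. c - indicator A x *. c) <= norm c"
     by (auto simp: indicator_def)
    consider "x : U - K" | "x - z : U - K" | "x : A \<longleftrightarrow> x - z : A" using 1 KU(3,4) by blast
    then show ?thesis
    proof cases
     case 1
     have "ennreal (norm c) * 1 <= ennreal (norm c) * (indicator (U - K) (x - z) + indicator (U - K) x)"
      using 1 by (intro mult_left_mono) (auto simp: add_increasing)
     with le show ?thesis by (metis ennreal_leI mult.right_neutral order_trans)
    next
     case 2
     have "ennreal (norm c) * 1 <= ennreal (norm c) * (indicator (U - K) (x - z) + indicator (U - K) x)"
      using 2 by (intro mult_left_mono) (auto simp: add_increasing2)
     with le show ?thesis by (metis ennreal_leI mult.right_neutral order_trans)
    next
     case 3
     then have "(indicator A (x - z) :: real) = indicator A x" by (auto simp: indicator_def)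
     then show ?thesis by simp
    qed
   qed
   have "L1shift (%x. indicator A x *. c) z <= (NNI x. ennreal (norm c) * (indicator (U - K) (x - z) + indicator (U - K) x))"
    unfolding L1shift_def by (intro nn_integral_mono pt)
   also have "... = ennreal (norm c) * ((NNI x. indicator (U - K) (x - z)) + (NNI x. indicator (U - K) x))"
    by (subst nn_integral_cmult, measurable, subst nn_integral_add) auto
   also have "... = ennreal (norm c) * (emeasure lborel (U - K) + emeasure lborel (U - K))"
    by (subst nn_integral_shift) auto
   also have "... <= ennreal (norm c) * (ennreal e' + ennreal e')"
    using KU(5) by (intro mult_left_mono add_mono) auto
   also have "... = ennreal (norm c * (2 * e'))" using e' by (simp add: ennreal_mult' flip: ennreal_plus)
   also have "... <= ennreal e"
    using e nc by (intro ennreal_leI) (auto simp: e'_def field_simps)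
   finally show "L1shift (%x. indicator A x *. c) z <= ennreal e" .
  qed (use d in auto)
 qed
next
 case (add f g)
 have [measurable]: "f : borel_fun" "g : borel_fun" using add by auto
 show ?case
 proof (intro allI impI)
  fix e :: real assume e: "0 < e"
  obtain d1 where d1: "d1 > 0" "!!z. norm z < d1 ==> L1shift f z <= ennreal (e/2)" using add(3) e by (meson half_gt_zero)
  obtain d2 where d2: "d2 > 0" "!!z. norm z < d2 ==> L1shift g z <= ennreal (e/2)" using add(4) e by (meson half_gt_zero)
  show "\<exists>d>0. \<forall>z. norm z < d --> L1shift (%x. f x + g x) z <= ennreal e"
  proof (intro exI[of _ "min d1 d2"] conjI allI impI)
   fix z :: 'a assume z: "norm z < min d1 d2"
   have "L1shift (%x. f x + g x) z <= (NNI x. ennreal (norm (f (x - z) - f x)) + ennreal (norm (g (x - z) - g x)))"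
    unfolding L1shift_def
   proof (intro nn_integral_mono)
    fix x
    have "norm (f (x - z) + g (x - z) - (f x + g x)) <= norm (f (x - z) - f x) + norm (g (x - z) - g x)"
     by (metis add_diff_add norm_triangle_ineq)
    then show "ennreal (norm (f (x - z) + g (x - z) - (f x + g x))) <= ennreal (norm (f (x - z) - f x)) + ennreal (norm (g (x - z) - g x))"
     by (simp flip: ennreal_plus)
   qed
   also have "... = L1shift f z + L1shift g z"
    unfolding L1shift_def by (subst nn_integral_add) auto
   also have "... <= ennreal (e/2) + ennreal (e/2)" using d1 d2 z by (intro add_mono) auto
   also have "... = ennreal e" using e by (simp flip: ennreal_plus)
   finally show "L1shift (%x. f x + g x) z <= ennreal e" .
  qed (use d1 d2 in auto)
 qed
next
 case (lim f s)
 have [measurable]: "f : borel_fun" "!!i. s i : borel_fun" using lim by auto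
 show ?case
 proof (intro allI impI)
  fix e :: real assume e: "0 < e"
  have "(%i. NNI x. norm (s i x - f x)) ~~> (\<integral>\<^sup>+x. 0 \<partial>(lborel::'a measure))"
  proof (rule nn_integral_dominated_convergence[where w="%x. ennreal (3 * norm (f x))"])
   show "AE x in lborel. ennreal (norm (s i x - f x)) <= ennreal (3 * norm (f x))" for i
   proof (intro AE_I2 ennreal_leI)
    fix x
    have "norm (s i x) <= 2 * norm (f x)" using lim.hyps(3)[of x i] by simp
    with norm_triangle_ineq4[of "s i x" "f x"] show "norm (s i x - f x) <= 3 * norm (f x)" by linarith
   qed
   show "(NNI x. ennreal (3 * norm (f x))) < \<infinity>"
    using lim.hyps(4) by (auto simp: integrable_iff_bounded ennreal_mult nn_integral_cmult ennreal_mult_less_top)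
   show "AE x in lborel. (%i. ennreal (norm (s i x - f x))) ~~> 0"
   proof (rule AE_I2)
    fix x
    have "(%i. norm (s i x - f x)) ~~> 0" using lim.hyps(2)[of x] by (simp add: LIM_zero_iff tendsto_norm_zero_iff)
    then show "(%i. ennreal (norm (s i x - f x))) ~~> 0" by (metis ennreal_0 tendsto_ennrealI)
   qed
  qed auto
  then have "(%i. NNI x. norm (s i x - f x)) ~~> 0" by simp
  then have "eventually (%i. (NNI x. norm (s i x - f x)) < ennreal (e/3)) sequentially"
   by (rule order_tendstoD(2)) (use e in simp)
  then obtain i where i: "(NNI x. norm (s i x - f x)) < ennreal (e/3)"
   unfolding eventually_sequentially by blast
  have e3: "0 < e/3" using e by simp
  obtain d where d: "d > 0" "!!z. norm z < d ==> L1shift (s i) z <= ennreal (e/3)"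
   using lim.IH[of i] e3 by blast
  show "\<exists>d>0. \<forall>z. norm z < d --> L1shift f z <= ennreal e"
  proof (intro exI[of _ d] conjI allI impI)
   fix z :: 'a assume z: "norm z < d"
   let ?g = "%x. ennreal (norm (s i x - f x))"
   have "L1shift f z <= (NNI x. (?g (x - z) + ?g x) + ennreal (norm (s i (x - z) - s i x)))"
    unfolding L1shift_def
   proof (intro nn_integral_mono)
    fix x
    have eq: "f (x - z) - f x = (s i x - f x) - (s i (x - z) - f (x - z)) + (s i (x - z) - s i x)" by simp
    have "norm (f (x - z) - f x) <= norm (s i (x - z) - f (x - z)) + norm (s i x - f x) + norm (s i (x - z) - s i x)"
     unfolding eq using norm_triangle_ineq[of "(s i x - f x) - (s i (x - z) - f (x - z))" "s i (x - z) - s i x"]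
      norm_triangle_ineq4[of "s i x - f x" "s i (x - z) - f (x - z)"] by linarith
    then show "ennreal (norm (f (x - z) - f x)) <= (?g (x - z) + ?g x) + ennreal (norm (s i (x - z) - s i x))"
     by (simp flip: ennreal_plus)
   qed
   also have "... = (NNI x. ?g (x - z)) + (NNI x. ?g x) + L1shift (s i) z"
    unfolding L1shift_def by (subst nn_integral_add, measurable, subst nn_integral_add) auto
   also have "... = (NNI x. ?g x) + (NNI x. ?g x) + L1shift (s i) z"
    by (subst nn_integral_shift[where g="?g"]) auto
   also have "... <= ennreal (e/3) + ennreal (e/3) + ennreal (e/3)"
    using i d z by (intro add_mono) auto
   also have "... = ennreal e" using e by (simp flip: ennreal_plus)
   finally show "L1shift f z <= ennreal e" .
  qed (use d in auto)
 qed
qed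


lemma conv_alt:
 fixes h :: "'a::euclidean_space => 'b::euclidean_space"
 assumes [measurable]: "K : borel_fun" "h : borel_fun"
 shows "conv K h x = (LI z. K z *. h (x - z))"
 using integral_reflect[of "%z. K z *. h (x - z)" x] by (simp add: conv_def)

lemma mollifierD:
 assumes "mollifier d K"
 shows "contU K" "!!x. 0 <= K x" "zero_outside d K" "integral\<^sup>L lborel K = 1"
  "K : borel_fun" "integ K" "(NNI x. ennreal (K x)) = 1"
proof -
 show *: "contU K" "!!x. 0 <= K x" "zero_outside d K" "integral\<^sup>L lborel K = 1"
  using assms by (auto simp: mollifier_def)
 then show "K : borel_fun" by (intro borel_measurable_continuous_onI)
 show "integ K" using * by (intro continuous_zero_outside_integrable)
 then show "(NNI x. ennreal (K x)) = 1"
  using * by (subst nn_integral_eq_integral) auto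
qed

lemma conv_minus_le:
 fixes h :: "'a::euclidean_space => 'b::euclidean_space"
 assumes K: "mollifier d K" and h: "integ h"
 shows "ennreal (norm (conv K h x - h x)) <= (NNI z. ennreal (K z) * ennreal (norm (h (x - z) - h x)))"
proof -
 note KD = mollifierD[OF K]
 have [measurable]: "K : borel_fun" "h : borel_fun" using KD h by auto
 have i1: "integ (%z. K (x - z) *. h z)"
  by (rule conv_integrable[OF KD(1,3) h])
 then have "integrable (distr lborel borel (%z. x - z)) (%z. K (x - z) *. h z)"
  by (simp only: lborel_distr_reflect)
 then have i1: "integ (%z. K z *. h (x - z))"
  by (subst (asm) integrable_distr_eq) auto
 have i2: "integ (%z. K z *. h x)" using KD by auto
 have "conv K h x - h x = (LI z. K z *. h (x - z)) - (LI z. K z *. h x)"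
  using KD by (simp add: conv_alt)
 also have "... = (LI z. K z *. h (x - z) - K z *. h x)"
  using i1 i2 by simp
 finally have eq: "conv K h x - h x = (LI z. K z *. h (x - z) - K z *. h x)" .
 have "ennreal (norm (conv K h x - h x)) <= (NNI z. ennreal (norm (K z *. h (x - z) - K z *. h x)))"
  unfolding eq by (rule integral_norm_bound_ennreal) (use i1 i2 in auto)
 also have "... = (NNI z. ennreal (K z) * ennreal (norm (h (x - z) - h x)))"
  using KD(2) by (intro nn_integral_cong) (simp add: ennreal_mult' flip: scaleR_diff_right)
 finally show ?thesis .
qed

lemma mollifier_average_le:
 assumes K: "mollifier d K" and F: "!!z. norm z <= d ==> F z <= ennreal e"
 shows "(NNI z. ennreal (K z) * F z) <= ennreal e"
proof -
 note KD = mollifierD[OF K]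
 have [measurable]: "K : borel_fun" using KD by auto
 have "(NNI z. ennreal (K z) * F z) <= (NNI z. ennreal (K z) * ennreal e)"
 proof (intro nn_integral_mono)
  fix z show "ennreal (K z) * F z <= ennreal (K z) * ennreal e"
   using F[of z] zero_outsideD[OF KD(3), of z] by (cases "norm z <= d") (auto intro!: mult_left_mono)
 qed
 also have "... = ennreal e" using KD(7) by (simp add: nn_integral_multc)
 finally show ?thesis .
qed

definition L2shift :: "('a::euclidean_space => 'b::euclidean_space) => 'a => ennreal" where
 "L2shift h z = (NNI x. ennreal ((norm (h (x - z) - h x))\<^sup>2))"

text \<open>By Fubini the error is at most the \<open>K\<close>-average of the translation errors,
  and \<open>K\<close> sees only translations of length at most \<open>d\<close>.\<close>

lemma mollify_L1_le:
 fixes h :: "'a::euclidean_space => 'b::euclidean_space"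
 assumes K: "mollifier d K" and h: "integ h" and e: "!!z. norm z <= d ==> L1shift h z <= ennreal e"
 shows "(NNI x. ennreal (norm (conv K h x - h x))) <= ennreal e"
proof -
 have [measurable]: "K : borel_fun" "h : borel_fun" using mollifierD[OF K] h by auto
 have "(NNI x. ennreal (norm (conv K h x - h x)))
   <= (NNI x. (NNI z. ennreal (K z) * ennreal (norm (h (x - z) - h x))))"
  by (intro nn_integral_mono conv_minus_le[OF K h])
 also have "... = (NNI z. (NNI x. ennreal (K z) * ennreal (norm (h (x - z) - h x))))"
  by (rule lborel_pair.Fubini') measurable
 also have "... = (NNI z. ennreal (K z) * L1shift h z)"
  unfolding L1shift_def by (subst nn_integral_cmult) auto
 also have "... <= ennreal e" by (rule mollifier_average_le[OF K e])
 finally show ?thesis .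
qed

text \<open>Jensen's inequality for the probability density \<open>K\<close>, obtained from
  Cauchy-Schwarz by splitting \<open>K\<close> into two factors \<open>sqrt K\<close>; afterwards
  Fubini as in the L^1 case.\<close>

lemma mollify_L2_le:
 fixes h :: "'a::euclidean_space => 'b::euclidean_space"
 assumes K: "mollifier d K" and h: "integ h" and e: "!!z. norm z <= d ==> L2shift h z <= ennreal e"
 shows "(NNI x. ennreal ((norm (conv K h x - h x))\<^sup>2)) <= ennreal e"
proof -
 note KD = mollifierD[OF K]
 have [measurable]: "K : borel_fun" "h : borel_fun" using KD h by auto
 have pt: "ennreal ((norm (conv K h x - h x))\<^sup>2) <= (NNI z. ennreal (K z) * ennreal ((norm (h (x - z) - h x))\<^sup>2))" for x
 proof -
  have "ennreal ((norm (conv K h x - h x))\<^sup>2) = (ennreal (norm (conv K h x - h x)))\<^sup>2"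
   by (simp add: ennreal_power)
  also have "... <= (NNI z. ennreal (K z) * ennreal (norm (h (x - z) - h x)))\<^sup>2"
   by (intro power_mono conv_minus_le[OF K h]) auto
  also have "... = (NNI z. ennreal (sqrt (K z)) * (ennreal (sqrt (K z)) * ennreal (norm (h (x - z) - h x))))\<^sup>2"
   using KD(2) by (simp flip: ennreal_mult' mult.assoc add: real_sqrt_mult_self)
  also have "... <= (NNI z. (ennreal (sqrt (K z)))\<^sup>2) * (NNI z. (ennreal (sqrt (K z)) * ennreal (norm (h (x - z) - h x)))\<^sup>2)"
   by (rule Cauchy_Schwarz_nn_integral) auto
  also have "... = (NNI z. ennreal (K z) * ennreal ((norm (h (x - z) - h x))\<^sup>2))"
   using KD(2,7) by (simp add: ennreal_power power_mult_distrib)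
  finally show ?thesis .
 qed
 have "(NNI x. ennreal ((norm (conv K h x - h x))\<^sup>2))
   <= (NNI x. (NNI z. ennreal (K z) * ennreal ((norm (h (x - z) - h x))\<^sup>2)))"
  by (intro nn_integral_mono pt)
 also have "... = (NNI z. (NNI x. ennreal (K z) * ennreal ((norm (h (x - z) - h x))\<^sup>2)))"
  by (rule lborel_pair.Fubini') measurable
 also have "... = (NNI z. ennreal (K z) * L2shift h z)"
  unfolding L2shift_def by (subst nn_integral_cmult) auto
 also have "... <= ennreal e" by (rule mollifier_average_le[OF K e])
 finally show ?thesis .
qed

text \<open>This reduces the continuity of translations in \<open>L\<^sup>2\<close> to the one in \<open>L\<^sup>1\<close>.\<close>

lemma norm_diff_sq_le_signed_square:
 fixes a b :: "'a::real_inner"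
 shows "(norm (a - b))\<^sup>2 <= 2 * norm (norm a *. a - norm b *. b)"
proof (cases "a = b")
 case False
 define p q where "p = norm a" and "q = norm b"
 have aa: "a .* a = p\<^sup>2" "b .* b = q\<^sup>2" by (auto simp: p_def q_def dot_square_norm)
 have pq: "0 <= p" "0 <= q" by (auto simp: p_def q_def)
 have n: "(norm (a - b))\<^sup>2 = p\<^sup>2 + q\<^sup>2 - 2 * (a .* b)"
  by (simp add: power2_norm_eq_inner inner_diff_left inner_diff_right aa inner_commute)
 have "(p *. a - q *. b) .* (a - b) = (p + q) / 2 * (norm (a - b))\<^sup>2 + (p + q) / 2 * (p - q)\<^sup>2"
  unfolding n by (simp add: inner_diff_left inner_diff_right aa inner_commute field_simps power2_eq_square)
 then have "(p + q) / 2 * (norm (a - b))\<^sup>2 <= (p *. a - q *. b) .* (a - b)" using pq by simp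
 also have "... <= norm (p *. a - q *. b) * norm (a - b)" by (rule norm_cauchy_schwarz)
 finally have "(p + q) / 2 * norm (a - b) <= norm (p *. a - q *. b)"
  using False by (simp add: power2_eq_square mult.assoc[symmetric])
 moreover have "norm (a - b) <= p + q" unfolding p_def q_def by (rule norm_triangle_ineq4)
 then have "norm (a - b) * norm (a - b) <= (p + q) * norm (a - b)" by (rule mult_right_mono) auto
 ultimately show ?thesis by (simp add: power2_eq_square p_def q_def)
qed auto

lemma L2shift_le: 
 fixes h :: "'a::euclidean_space => 'b::euclidean_space"
 assumes [measurable]: "h : borel_fun"
 shows "L2shift h z <= 2 * L1shift (%x. norm (h x) *. h x) z"
proof -
 have "L2shift h z <= (NNI x. 2 * ennreal (norm (norm (h (x - z)) *. h (x - z) - norm (h x) *. h x)))"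
  unfolding L2shift_def
 proof (intro nn_integral_mono)
  fix x
  have "ennreal ((norm (h (x - z) - h x))\<^sup>2) <= ennreal (2 * norm (norm (h (x - z)) *. h (x - z) - norm (h x) *. h x))"
   by (intro ennreal_leI norm_diff_sq_le_signed_square)
  then show "ennreal ((norm (h (x - z) - h x))\<^sup>2) <= 2 * ennreal (norm (norm (h (x - z)) *. h (x - z) - norm (h x) *. h x))"
   by (simp add: ennreal_mult')
 qed
 also have "... = 2 * L1shift (%x. norm (h x) *. h x) z"
  unfolding L1shift_def by (subst nn_integral_cmult) auto
 finally show ?thesis .
qed

lemma mollify_L1:
 fixes h :: "'a::euclidean_space => 'b::euclidean_space"
 assumes h: "integ h" and e: "0 < e"
 shows "\<exists>d>0. \<forall>r K. r < d --> mollifier r K --> (NNI x. ennreal (norm (conv K h x - h x))) <= ennreal e"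
proof -
 obtain d where d: "d > 0" "!!z. norm z < d ==> L1shift h z <= ennreal e"
  using L1shift_tendsto[OF h] e by blast
 show ?thesis
 proof (intro exI[of _ d] conjI allI impI)
  fix r :: real and K :: "'a => real" assume "r < d" "mollifier r K"
  then show "(NNI x. ennreal (norm (conv K h x - h x))) <= ennreal e"
   using d by (intro mollify_L1_le[OF _ h]) auto
 qed (use d in auto)
qed

lemma mollify_L2:
 fixes h :: "'a::euclidean_space => 'b::euclidean_space"
 assumes h: "integ h" and h2: "integ (%x. (norm (h x))\<^sup>2)" and e: "0 < e"
 shows "\<exists>d>0. \<forall>r K. r < d --> mollifier r K --> (NNI x. ennreal ((norm (conv K h x - h x))\<^sup>2)) <= ennreal e"
proof -
 have [measurable]: "h : borel_fun" using h by auto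
 have "integ (%x. norm (h x) *. h x)"
  by (rule B_integrable_bound[OF h2]) (auto simp: power2_eq_square)
 then obtain d where d: "d > 0" "!!z. norm z < d ==> L1shift (%x. norm (h x) *. h x) z <= ennreal (e/2)"
  using L1shift_tendsto e by (metis half_gt_zero)
 have L2: "L2shift h z <= ennreal e" if "norm z < d" for z
 proof -
  have "L2shift h z <= 2 * ennreal (e/2)"
   by (intro order_trans[OF L2shift_le] mult_left_mono d(2) that) auto
  also have "... = ennreal e" using e by (simp add: ennreal_mult'[symmetric] flip: ennreal_numeral)
  finally show ?thesis .
 qed
 show ?thesis
 proof (intro exI[of _ d] conjI allI impI)
  fix r :: real and K :: "'a => real" assume "r < d" "mollifier r K"
  then show "(NNI x. ennreal ((norm (conv K h x - h x))\<^sup>2)) <= ennreal e"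
   using L2 by (intro mollify_L2_le[OF _ h]) auto
 qed (use d in auto)
qed


section \<open>Radial weights and the mean value inequality\<close>

text \<open>A C^1 cut-off of the unit disk: squaring removes the corner at the boundary circle. As
  \<open>j\<close> tends to infinity it approaches the indicator of the open disk, see
  \<open>rcut_limit\<close>.\<close>

definition rcut :: "nat => plane => real" where
 "rcut j z = (max 0 (1 - (z .* z) ^ j))\<^sup>2"

text \<open>Chosen so that the gradient of \<open>rcut j\<close> at \<open>z\<close> is
  \<open>- rwt j z\<close> times \<open>z\<close>. Means with weight \<open>rwt j\<close> therefore
  have radial derivatives with weight \<open>rcut j\<close>.\<close>

definition rwt :: "nat => plane => real" where
 "rwt j z = 4 * real j * (z .* z) ^ (j - 1) * max 0 (1 - (z .* z) ^ j)"

lemma rcut_nonneg: "0 <= rcut j z" and rwt_nonneg: "0 <= rwt j z"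
 by (auto simp: rcut_def rwt_def)

lemma one_le_inner_self_power: "1 <= norm z ==> 1 <= (z .* z) ^ j"
 by (simp add: dot_square_norm one_le_power)

lemma rcut_outside: "1 <= norm z ==> rcut j z = 0" and rwt_outside: "1 <= norm z ==> rwt j z = 0"
 using one_le_inner_self_power[of z j] by (auto simp: rcut_def rwt_def max_def)

lemma rcut_zero_outside: "zero_outside 1 (rcut j)" and rwt_zero_outside: "zero_outside 1 (rwt j)"
 by (auto simp: zero_outside_def rcut_outside rwt_outside)

lemma rcut_continuous: "continuous_on A (rcut j)" and rwt_continuous: "continuous_on A (rwt j)"
 unfolding rcut_def rwt_def by (intro continuous_intros)+

lemma pos_part_sq_deriv: "((%s::real. (max 0 s)\<^sup>2) has_real_derivative 2 * max 0 s) (at s)"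
proof -
 consider "s > 0" | "s < 0" | "s = 0" by linarith
 then show ?thesis
 proof cases
  case 1
  have "((%s::real. s\<^sup>2) has_real_derivative 2 * max 0 s) (at s)"
   using 1 by (auto intro!: derivative_eq_intros)
  then show ?thesis
   by (rule has_field_derivative_transform_within_open[where S="{0<..}"]) (use 1 in auto)
 next
  case 2
  have "((%s::real. 0) has_real_derivative 2 * max 0 s) (at s)"
   using 2 by (auto intro!: derivative_eq_intros)
  then show ?thesis
   by (rule has_field_derivative_transform_within_open[where S="{..<0}"]) (use 2 in auto)
 next
  case 3
  have "((%h::real. (max 0 h)\<^sup>2 / h) \<longlongrightarrow> 0) (at 0)"
  proof (rule Lim_null_comparison)
   show "\<forall>\<^sub>F h in at 0. norm ((max 0 h)\<^sup>2 / h) <= \<bar>h :: real\<bar>"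
    by (rule always_eventually) (auto simp: max_def power2_eq_square)
   show "((%h::real. \<bar>h\<bar>) \<longlongrightarrow> 0) (at 0)" by (auto intro!: tendsto_eq_intros)
  qed
  then show ?thesis using 3 by (simp add: DERIV_def)
 qed
qed

lemma rcut_has_grad:
 assumes "0 < j"
 shows "has_grad (rcut j) (- rwt j z * fst z) (- rwt j z * snd z) z"
proof -
 have "((%z::plane. 1 - (z .* z) ^ j) has_derivative (%v. - (real j * (z .* z) ^ (j - 1) * (2 * (z .* v))))) (at z)"
  by (auto intro!: derivative_eq_intros simp: inner_commute algebra_simps)
 from has_derivative_compose[OF this pos_part_sq_deriv[unfolded has_field_derivative_def]]
 show ?thesis unfolding has_grad_def rcut_def rwt_def
  by (rule has_derivative_eq_rhs) (auto simp: inner_prod_def algebra_simps)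
qed

lemma has_real_derivative_integral:
 fixes f f' :: "real => 'a => real"
 assumes r: "0 < r"
  and int: "!!t. \<bar>t - s\<bar> < r ==> integrable M (f t)"
  and D: "!!t z. \<bar>t - s\<bar> < r ==> ((%t. f t z) has_real_derivative f' t z) (at t)"
  and bd: "!!t z. \<bar>t - s\<bar> < r ==> \<bar>f' t z\<bar> <= g z"
  and g: "integrable M g" and m: "f' s : borel_measurable M"
 shows "((%t. \<integral>z. f t z \<partial>M) has_real_derivative (\<integral>z. f' s z \<partial>M)) (at s)"
 unfolding DERIV_def tendsto_at_iff_sequentially comp_def
proof (intro allI impI)
 fix X :: "nat => real" assume X: "\<forall>i. X i : UNIV - {0}" "X ~~> 0"
 then obtain N where N: "!!n. n >= N ==> \<bar>X n\<bar> < r"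
  using LIMSEQ_D[OF X(2) r] by auto
 have lip: "\<bar>(f (s + h) z - f s z) / h\<bar> <= g z" if h: "\<bar>h\<bar> < r" "h ~= 0" for h z
 proof -
  have "norm (f (s + h) z - f s z) <= g z * norm ((s + h) - s)"
   by (rule field_differentiable_bound[where S="ball s r" and f'="%t. f' t z"])
    (use D bd h r in \<open>auto simp: dist_real_def abs_minus_commute intro: has_field_derivative_at_within\<close>)
  with h show ?thesis by (simp add: abs_divide divide_le_eq)
 qed
 have "(%n. \<integral>z. (f (s + X (n + N)) z - f s z) / X (n + N) \<partial>M) ~~> (\<integral>z. f' s z \<partial>M)"
 proof (rule integral_dominated_convergence[OF m _ g])
  show "(%z. (f (s + X (n + N)) z - f s z) / X (n + N)) : borel_measurable M" for n
   using int[of s] int[of "s + X (n+N)"] N[of "n+N"] r by auto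
  show "AE z in M. (%n. (f (s + X (n + N)) z - f s z) / X (n + N)) ~~> f' s z"
  proof (rule AE_I2)
   fix z
   have "((%h. (f (s + h) z - f s z) / h) \<longlongrightarrow> f' s z) (at 0)"
    using D[of s z] r by (simp add: DERIV_def)
   then have "(%n. (f (s + X n) z - f s z) / X n) ~~> f' s z"
    unfolding tendsto_at_iff_sequentially comp_def using X by auto
   then show "(%n. (f (s + X (n + N)) z - f s z) / X (n + N)) ~~> f' s z"
    by (rule LIMSEQ_ignore_initial_segment)
  qed
  show "AE z in M. norm ((f (s + X (n + N)) z - f s z) / X (n + N)) <= g z" for n
   using lip[of "X (n+N)"] N[of "n+N"] X(1) by auto
 qed
 moreover have "(\<integral>z. (f (s + X (n + N)) z - f s z) / X (n + N) \<partial>M)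
   = ((\<integral>z. f (s + X (n + N)) z \<partial>M) - (\<integral>z. f s z \<partial>M)) / X (n + N)" for n
  using int[of s] int[of "s + X (n+N)"] N[of "n+N"] r by auto
 ultimately have "(%n. ((\<integral>z. f (s + X (n + N)) z \<partial>M) - (\<integral>z. f s z \<partial>M)) / X (n + N)) ~~> (\<integral>z. f' s z \<partial>M)"
  by (simp only:)
 then show "(%n. ((\<integral>z. f (s + X n) z \<partial>M) - (\<integral>z. f s z \<partial>M)) / X n) ~~> (\<integral>z. f' s z \<partial>M)"
  by (intro LIMSEQ_offset[where k=N and f="%n. ((\<integral>z. f (s + X n) z \<partial>M) - (\<integral>z. f s z \<partial>M)) / X n"])
qed

text \<open>\<open>f\<close> is controlled on a disk only, but the product is continuous everywhere:
  the cut-off vanishes before \<open>x0 + s *. z\<close> can leave that disk.\<close>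

lemma continuous_cutoff_mult:
 fixes K :: "'a::euclidean_space => real" and f :: "'a => real"
 assumes K: "contU K" "zero_outside 1 K" and f: "continuous_on (ball x0 R) f" and s: "\<bar>s\<bar> < R"
 shows "contU (%z. K z * f (x0 + s *. z))"
proof (rule continuous_at_imp_continuous_on, rule ballI)
 fix z :: 'a
 show "isCont (%z. K z * f (x0 + s *. z)) z"
 proof (cases "norm z <= 1")
  case True
  have "\<bar>s\<bar> * norm z <= \<bar>s\<bar>" using True by (intro mult_left_le) auto
  then have "x0 + s *. z : ball x0 R" using s by (simp add: dist_norm)
  then have c: "isCont f (x0 + s *. z)" using f by (simp add: continuous_on_eq_continuous_at)
  have "isCont (%z. x0 + s *. z) z" by (intro continuous_intros)
  from isCont_o2[OF this c] have "isCont (%z. f (x0 + s *. z)) z" .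
  moreover have "isCont K z" using K(1) by (simp add: continuous_on_eq_continuous_at)
  ultimately show ?thesis by (intro continuous_intros)
 next
  case False
  have "\<forall>\<^sub>F y in nhds z. y : - cball 0 1"
   using False by (intro eventually_nhds_in_open) auto
  then have "\<forall>\<^sub>F y in nhds z. K y * f (x0 + s *. y) = 0"
   by eventually_elim (use zero_outsideD[OF K(2)] in auto)
  then show ?thesis by (subst isCont_cong[where g="%_. 0"]) auto
 qed
qed

lemma cutoff_mult_integrable:
 fixes K :: "'a::euclidean_space => real" and f :: "'a => real"
 assumes K: "contU K" "zero_outside 1 K" and f: "continuous_on (ball x0 R) f" and s: "\<bar>s\<bar> < R"
 shows "integ (%z. K z * f (x0 + s *. z))"
 by (rule continuous_zero_outside_integrable[OF continuous_cutoff_mult[OF assms], where R=1])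
  (use K(2) in \<open>auto simp: zero_outside_def\<close>)

lemma has_grad_scaled:
 assumes "has_grad f a b (x0 + s *. z)"
 shows "has_grad (%z. f (x0 + s *. z)) (s *. a) (s *. b) z"
proof -
 have "((%z. x0 + s *. z) has_derivative (%v. s *. v)) (at z)"
  by (auto intro!: derivative_eq_intros)
 from has_derivative_compose[OF this assms[unfolded has_grad_def]]
 show ?thesis unfolding has_grad_def
  by (rule has_derivative_eq_rhs) (auto simp: algebra_simps)
qed

lemma has_grad_mult:
 fixes f g :: "plane => real"
 assumes "has_grad f a b z" "has_grad g a' b' z"
 shows "has_grad (%z. f z * g z) (f z * a' + a * g z) (f z * b' + b * g z) z"
 unfolding has_grad_def
 by (rule has_derivative_eq_rhs[OF has_derivative_mult[OF assms[unfolded has_grad_def]]])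
  (auto simp: algebra_simps)

lemma integration_by_parts_rcut:
 fixes p :: "plane => real"
 assumes p: "!!x. x : ball x0 R ==> has_grad p (a x) (b x) x"
  and c: "continuous_on (ball x0 R) a" "continuous_on (ball x0 R) b" and j: "0 < j" and s: "\<bar>s\<bar> < R"
 shows "(LI z. rwt j z * (fst z * p (x0 + s *. z))) = s * (LI z. rcut j z * a (x0 + s *. z))"
  "(LI z. rwt j z * (snd z * p (x0 + s *. z))) = s * (LI z. rcut j z * b (x0 + s *. z))"
proof -
 have cp: "continuous_on (ball x0 R) p"
  using p by (auto intro!: continuous_at_imp_continuous_on has_grad_isCont)
 let ?F = "%z. rcut j z * p (x0 + s *. z)"
 let ?F1 = "%z. s * (rcut j z * a (x0 + s *. z)) - (rwt j z * fst z) * p (x0 + s *. z)"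
 let ?F2 = "%z. s * (rcut j z * b (x0 + s *. z)) - (rwt j z * snd z) * p (x0 + s *. z)"
 have z1: "zero_outside 1 (%z. rwt j z * fst z)" "zero_outside 1 (%z. rwt j z * snd z)"
  using rwt_zero_outside by (auto simp: zero_outside_def)
 have cc: "contU (%z. rwt j z * fst z)" "contU (%z. rwt j z * snd z)"
  by (intro continuous_intros rwt_continuous)+
 have g: "has_grad ?F (?F1 z) (?F2 z) z" for z
 proof (cases "norm z <= 1")
  case True
  have "\<bar>s\<bar> * norm z <= \<bar>s\<bar>" using True by (intro mult_left_le) auto
  then have "x0 + s *. z : ball x0 R" using s by (simp add: dist_norm)
  from has_grad_mult[OF rcut_has_grad[OF j] has_grad_scaled[OF p[OF this]]]
  show ?thesis by (simp add: algebra_simps)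
 next
  case False
  have "has_grad (%_. 0) 0 (0::real) z" by (simp add: has_grad_def)
  then have "has_grad ?F 0 0 z"
   unfolding has_grad_def
   by (rule has_derivative_transform_within_open[where s="- cball 0 1"]) (use False in \<open>auto simp: rcut_outside\<close>)
  then show ?thesis using False by (simp add: rcut_outside rwt_outside)
 qed
 have cF: "contU ?F1" "contU ?F2"
  by (intro continuous_intros continuous_cutoff_mult[OF rcut_continuous rcut_zero_outside _ s]
   continuous_cutoff_mult[OF cc(1) z1(1) _ s] continuous_cutoff_mult[OF cc(2) z1(2) _ s] c cp)+
 have 0: "integral\<^sup>L lborel ?F1 = 0" "integral\<^sup>L lborel ?F2 = 0"
  by (rule integral_has_grad_eq_0[OF g cF, where R=1], simp add: rcut_outside)+
 note I = cutoff_mult_integrable[OF rcut_continuous rcut_zero_outside c(1) s, of j]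
   cutoff_mult_integrable[OF rcut_continuous rcut_zero_outside c(2) s, of j]
   cutoff_mult_integrable[OF cc(1) z1(1) cp s] cutoff_mult_integrable[OF cc(2) z1(2) cp s]
 show "(LI z. rwt j z * (fst z * p (x0 + s *. z))) = s * (LI z. rcut j z * a (x0 + s *. z))"
  using 0(1) I by (simp add: mult.assoc)
 show "(LI z. rwt j z * (snd z * p (x0 + s *. z))) = s * (LI z. rcut j z * b (x0 + s *. z))"
  using 0(2) I by (simp add: mult.assoc)
qed

text \<open>Differentiation under the integral leaves \<open>rwt j z\<close> times
  \<open>z \<bullet> \<nabla>w\<close>, and \<open>rwt j z\<close> times \<open>z\<close> is minus
  the gradient of \<open>rcut j\<close>. Integration by parts produces the Laplacian and, from the
  scaling of the argument, the factor \<open>s\<close>.\<close>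

lemma radial_mean_deriv:
 fixes w p q a b b' c :: "plane => real"
 assumes w: "!!x. x : ball x0 R ==> has_grad w (p x) (q x) x"
  and p: "!!x. x : ball x0 R ==> has_grad p (a x) (b x) x"
  and q: "!!x. x : ball x0 R ==> has_grad q (b' x) (c x) x"
  and cont: "continuous_on (ball x0 R) a" "continuous_on (ball x0 R) b" "continuous_on (ball x0 R) b'" "continuous_on (ball x0 R) c"
  and j: "0 < j" and s: "\<bar>s\<bar> < R"
 shows "((%s. LI z. rwt j z * w (x0 + s *. z)) has_real_derivative
      s * (LI z. rcut j z * (a (x0 + s *. z) + c (x0 + s *. z)))) (at s)"
proof -
 have cw: "continuous_on (ball x0 R) w" and cp: "continuous_on (ball x0 R) p" and cq: "continuous_on (ball x0 R) q"
  using w p q by (auto intro!: continuous_at_imp_continuous_on has_grad_isCont)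
 define S where "S = (\<bar>s\<bar> + R) / 2"
 have S: "\<bar>s\<bar> < S" "S < R" using s by (auto simp: S_def)
 define r where "r = S - \<bar>s\<bar>"
 have r: "0 < r" using S by (simp add: r_def)
 have sub: "cball x0 S <= ball x0 R" using S by (auto simp: cball_subset_ball_iff)
 have "bounded (p ` cball x0 S)" "bounded (q ` cball x0 S)" "bounded (rwt j ` cball 0 1)"
  by (intro compact_imp_bounded compact_continuous_image continuous_on_subset[OF cp sub] continuous_on_subset[OF cq sub] rwt_continuous compact_cball)+
 then obtain Bp Bq Bw where B: "\<forall>y\<in>p ` cball x0 S. norm y <= Bp" "\<forall>y\<in>q ` cball x0 S. norm y <= Bq" "\<forall>y\<in>rwt j ` cball 0 1. norm y <= Bw"
  unfolding bounded_iff by metis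
 have Bp: "\<bar>p x\<bar> <= Bp" and Bq: "\<bar>q x\<bar> <= Bq" if "x : cball x0 S" for x using B that by auto
 have "rwt j z <= Bw" if "norm z <= 1" for z using B(3) that by (auto simp: rwt_nonneg)
 have inS: "x0 + t *. z : cball x0 S" if "\<bar>t - s\<bar> < r" "norm z <= 1" for t and z :: "plane"
 proof -
  have "\<bar>t\<bar> * norm z <= \<bar>t\<bar>" using that by (intro mult_left_le) auto
  then show ?thesis using that(1) unfolding r_def by (simp add: dist_norm)
 qed
 have tR: "\<bar>t\<bar> < R" if "\<bar>t - s\<bar> < r" for t using that S unfolding r_def by linarith
 have "((%t. LI z. rwt j z * w (x0 + t *. z)) has_real_derivative
   (LI z. rwt j z * (fst z * p (x0 + s *. z) + snd z * q (x0 + s *. z)))) (at s)"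
 proof (rule has_real_derivative_integral[OF r, where g="%z. (Bw * (Bp + Bq)) * indicator (cball 0 1) z"])
  show "integ (%z. rwt j z * w (x0 + t *. z))" if "\<bar>t - s\<bar> < r" for t
   by (rule cutoff_mult_integrable[OF rwt_continuous rwt_zero_outside cw tR[OF that]])
  show "((%t. rwt j z * w (x0 + t *. z)) has_real_derivative
    rwt j z * (fst z * p (x0 + t *. z) + snd z * q (x0 + t *. z))) (at t)" if "\<bar>t - s\<bar> < r" for t z
  proof (cases "norm z <= 1")
   case True
   have "x0 + t *. z : ball x0 R" using inS[OF that True] sub by blast
   from has_grad_line[OF w[OF this], where T=UNIV]
   show ?thesis
    by (intro DERIV_cmult) (auto simp: has_real_derivative_iff_has_vector_derivative)
  qed (simp add: rwt_outside)
  show "\<bar>rwt j z * (fst z * p (x0 + t *. z) + snd z * q (x0 + t *. z))\<bar> <= (Bw * (Bp + Bq)) * indicator (cball 0 1) z"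
   if t: "\<bar>t - s\<bar> < r" for t z
  proof (cases "norm z <= 1")
   case True
   have fs: "\<bar>fst z\<bar> <= 1" "\<bar>snd z\<bar> <= 1" using abs_fst_snd_le_norm[of z] True by auto
   have "\<bar>fst z * p (x0 + t *. z)\<bar> <= 1 * Bp" "\<bar>snd z * q (x0 + t *. z)\<bar> <= 1 * Bq"
    unfolding abs_mult using fs Bp[OF inS[OF t True]] Bq[OF inS[OF t True]] by (intro mult_mono; simp)+
   then have 1: "\<bar>fst z * p (x0 + t *. z) + snd z * q (x0 + t *. z)\<bar> <= Bp + Bq" by linarith
   have 2: "\<bar>rwt j z\<bar> <= Bw" using B(3) True by auto
   have "0 <= Bw" using 2 by linarith
   then have "\<bar>rwt j z\<bar> * \<bar>fst z * p (x0 + t *. z) + snd z * q (x0 + t *. z)\<bar> <= Bw * (Bp + Bq)"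
    by (intro mult_mono 1 2) auto
   then show ?thesis using True by (simp add: abs_mult)
  qed (simp add: rwt_outside)
  show "integ (%z::plane. (Bw * (Bp + Bq)) * indicator (cball 0 1) z)"
   by (intro integrable_mult_right integrable_real_indicator emeasure_lborel_cball_finite) auto
  have "contU (%z. (rwt j z * fst z) * p (x0 + s *. z) + (rwt j z * snd z) * q (x0 + s *. z))"
   by (intro continuous_on_add continuous_cutoff_mult[OF _ _ cp s] continuous_cutoff_mult[OF _ _ cq s] continuous_on_mult rwt_continuous continuous_on_fst continuous_on_snd continuous_on_id)
    (auto simp: zero_outside_def rwt_outside)
  then show "(%z. rwt j z * (fst z * p (x0 + s *. z) + snd z * q (x0 + s *. z))) : borel_measurable lborel"
   by (auto intro!: borel_measurable_continuous_onI simp: algebra_simps)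
 qed
 moreover have "(LI z. rwt j z * (fst z * p (x0 + s *. z) + snd z * q (x0 + s *. z)))
   = s * (LI z. rcut j z * (a (x0 + s *. z) + c (x0 + s *. z)))"
 proof -
  have "contU (%z. rwt j z * fst z)" "contU (%z. rwt j z * snd z)"
   by (intro continuous_intros rwt_continuous)+
  moreover have "zero_outside 1 (%z. rwt j z * fst z)" "zero_outside 1 (%z. rwt j z * snd z)"
   by (auto simp: zero_outside_def rwt_outside)
  ultimately have i: "integ (%z. rwt j z * (fst z * p (x0 + s *. z)))" "integ (%z. rwt j z * (snd z * q (x0 + s *. z)))"
   using cutoff_mult_integrable[OF _ _ cp s, of "%z. rwt j z * fst z"] cutoff_mult_integrable[OF _ _ cq s, of "%z. rwt j z * snd z"]
   by (simp_all add: mult.assoc)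
  have i': "integ (%z. rcut j z * a (x0 + s *. z))" "integ (%z. rcut j z * c (x0 + s *. z))"
   by (intro cutoff_mult_integrable[OF rcut_continuous rcut_zero_outside _ s] cont)+
  show ?thesis
   using i i' integration_by_parts_rcut(1)[OF p cont(1,2) j s] integration_by_parts_rcut(2)[OF q cont(3,4) j s]
   by (simp add: distrib_left)
 qed
 ultimately show ?thesis by simp
qed

definition rwt_mass :: "nat => real" where "rwt_mass j = (LI z. rwt j z)"
definition rcut_mass :: "nat => real" where "rcut_mass j = (LI z. rcut j z)"

lemma rwt_integrable: "integ (rwt j)" and rcut_integrable: "integ (rcut j)"
 by (rule continuous_zero_outside_integrable[OF rwt_continuous rwt_zero_outside]
   continuous_zero_outside_integrable[OF rcut_continuous rcut_zero_outside])+

text \<open>As a function of \<open>s\<close> the right-hand side has derivative \<open>s\<close>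
  times the integral of \<open>rcut j\<close> against \<open>\<Delta>w + C\<close>, which is
  nonnegative; at \<open>s = 0\<close> it equals the left-hand side.\<close>

lemma weighted_mean_value_inequality:
 fixes w p q a b b' c :: "plane => real"
 assumes w: "!!x. x : ball x0 R ==> has_grad w (p x) (q x) x"
  and p: "!!x. x : ball x0 R ==> has_grad p (a x) (b x) x"
  and q: "!!x. x : ball x0 R ==> has_grad q (b' x) (c x) x"
  and cont: "continuous_on (ball x0 R) a" "continuous_on (ball x0 R) b" "continuous_on (ball x0 R) b'" "continuous_on (ball x0 R) c"
  and j: "0 < j" and s: "0 <= s" "s < R"
  and lap: "!!x. x : ball x0 R ==> - C <= a x + c x"
 shows "w x0 * rwt_mass j <= (LI z. rwt j z * w (x0 + s *. z)) + C * s\<^sup>2 / 2 * rcut_mass j"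
proof -
 define A where "A = (%s. (LI z. rwt j z * w (x0 + s *. z)) + C * s\<^sup>2 / 2 * rcut_mass j)"
 have "A 0 <= A s"
 proof (rule DERIV_nonneg_imp_nondecreasing[OF s(1)])
  fix t assume t: "0 <= t" "t <= s"
  have tR: "\<bar>t\<bar> < R" using t s by simp
  let ?I = "(LI z. rcut j z * (a (x0 + t *. z) + c (x0 + t *. z)))"
  have "(A has_real_derivative t * ?I + C * t * rcut_mass j) (at t)"
   unfolding A_def
  proof (rule DERIV_add[OF radial_mean_deriv[OF w p q cont j tR]])
   show "((%s. C * s\<^sup>2 / 2 * rcut_mass j) has_real_derivative C * t * rcut_mass j) (at t)"
    by (rule derivative_eq_intros refl | simp)+
  qed
  moreover have "- C * rcut_mass j <= ?I"
  proof -
   have "- C * rcut_mass j = (LI z. - C * rcut j z)" by (simp add: rcut_mass_def)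
   also have "... <= ?I"
   proof (rule integral_mono)
    show "integ (%z. - C * rcut j z)" using rcut_integrable by (intro integrable_mult_right)
    show "integ (%z. rcut j z * (a (x0 + t *. z) + c (x0 + t *. z)))"
     by (rule cutoff_mult_integrable[OF rcut_continuous rcut_zero_outside _ tR, where f="%x. a x + c x"])
      (intro continuous_intros cont)
    fix z
    show "- C * rcut j z <= rcut j z * (a (x0 + t *. z) + c (x0 + t *. z))"
    proof (cases "norm z <= 1")
     case True
     have "\<bar>t\<bar> * norm z <= \<bar>t\<bar>" using True by (intro mult_left_le) auto
     then have "x0 + t *. z : ball x0 R" using tR by (simp add: dist_norm)
     from mult_left_mono[OF lap[OF this] rcut_nonneg[of j z]] show ?thesis by (simp add: mult.commute)
    qed (simp add: rcut_outside)
   qed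
   finally show ?thesis .
  qed
  then have "0 <= t * (?I + C * rcut_mass j)" using t by (intro mult_nonneg_nonneg) auto
  then have "0 <= t * ?I + C * t * rcut_mass j" by (simp add: algebra_simps)
  ultimately show "\<exists>y. (A has_real_derivative y) (at t) & 0 <= y" by blast
 qed
 then show ?thesis by (simp add: A_def rwt_mass_def mult.commute)
qed

lemma rwt_mass_pos: "0 < j ==> 0 < rwt_mass j"
proof -
 assume j: "0 < j"
 have "rwt_mass j ~= 0"
 proof
  assume "rwt_mass j = 0"
  then have "AE x in lborel. rwt j x = 0"
   using integral_nonneg_eq_0_iff_AE[OF rwt_integrable] rwt_nonneg by (auto simp: rwt_mass_def)
  then have "AE x in lborel. x ~: (ball 0 1 - {0} :: plane set)"
  proof eventually_elim
   fix x :: "plane" assume x: "rwt j x = 0"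
   show "x ~: ball 0 1 - {0}"
   proof
    assume "x : ball 0 1 - {0}"
    then have "0 < x .* x" "x .* x < 1" by (auto simp: dot_square_norm power_less_one_iff abs_square_less_1)
    then have "0 < rwt j x" using j by (auto simp: rwt_def power_Suc_less_one power_less_one_iff intro!: mult_pos_pos)
    with x show False by simp
   qed
  qed
  then have "emeasure lborel (ball 0 1 - {0} :: plane set) = 0"
   by (subst (asm) AE_iff_measurable[of "ball 0 1 - {0}"]) auto
  moreover have "emeasure lborel (ball 0 1 - {0} :: plane set) ~= 0"
  proof -
   have "norm ((1/2, 0) :: plane) = 1/2" "((1/2, 0) :: plane) ~= 0"
    by (auto simp: norm_Pair zero_prod_def)
   then have "((1/2, 0) :: plane) : ball 0 1 - {0}" by (simp add: mem_ball_0)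
   then have "ball 0 1 - {0} ~= ({} :: plane set)" by blast
   then have "\<not> negligible (ball 0 1 - {0} :: plane set)"
    by (intro open_not_negligible open_delete) auto
   then show ?thesis by (auto simp: negligible_iff_null_sets null_sets_def)
  qed
  ultimately show False by simp
 qed
 moreover have "0 <= rwt_mass j" unfolding rwt_mass_def by (rule integral_nonneg_AE) (auto simp: rwt_nonneg)
 ultimately show ?thesis by simp
qed


section \<open>Airy functions with Hessians bounded in L^1\<close>

text \<open>\<open>(p, q)\<close> is the gradient, and \<open>a\<close>, \<open>b\<close>,
  \<open>c\<close> are the entries 11, 12, 22 of the Hessian. Continuity of the entries on the whole
  plane makes them measurable without reference to \<open>D\<close>.\<close>

definition airy :: "plane set => (plane => real) => (plane => real) => (plane => real) \<Rightarrow>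
  (plane => real) => (plane => real) => (plane => real) => bool" where
 "airy D w p q a b c \<longleftrightarrow>
  (\<forall>x\<in>D. has_grad w (p x) (q x) x & has_grad p (a x) (b x) x & has_grad q (b x) (c x) x) &
  contU a & contU b & contU c"

definition hmass :: "plane set => (plane => real) => (plane => real) => (plane => real) => ennreal" where
 "hmass D a b c = (NNI x. ennreal (\<bar>a x\<bar> + \<bar>b x\<bar> + \<bar>c x\<bar>) * indicator D x)"

lemma airyD:
 assumes "airy D w p q a b c"
 shows "!!x. x : D ==> has_grad w (p x) (q x) x" "!!x. x : D ==> has_grad p (a x) (b x) x"
  "!!x. x : D ==> has_grad q (b x) (c x) x"
  "contU a" "contU b" "contU c"
  "a : borel_fun" "b : borel_fun" "c : borel_fun"
 using assms by (auto simp: airy_def intro: borel_measurable_continuous_onI)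

lemma airy_subset: "airy D w p q a b c ==> D' <= D ==> airy D' w p q a b c"
 by (auto simp: airy_def)

lemma hmass_mono: "D' <= D ==> hmass D' a b c <= hmass D a b c"
 unfolding hmass_def by (intro nn_integral_mono mult_left_mono) (auto simp: indicator_def)

lemma has_grad_fst:
 assumes "has_grad F a b (s, t)"
 shows "((%s. F (s, t)) has_real_derivative a) (at s)"
 using has_grad_line[of F a b "(0, t)" s "(1, 0)" UNIV] assms
 by (simp add: has_real_derivative_iff_has_vector_derivative)

lemma has_grad_snd:
 assumes "has_grad F a b (s, t)"
 shows "((%t. F (s, t)) has_real_derivative b) (at t)"
 using has_grad_line[of F a b "(s, 0)" t "(0, 1)" UNIV] assms
 by (simp add: has_real_derivative_iff_has_vector_derivative)

text \<open>Chebyshev's inequality: values of at least \<open>M / d\<close> on an interval of length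
  \<open>2 * d\<close> would already give the integral \<open>2 * M\<close>.\<close>

lemma exists_small_slice:
 fixes F :: "real => ennreal"
 assumes [measurable]: "F : borel_fun" and M: "(NNI t. F t) < ennreal M" and d: "0 < d" and "0 < M"
 shows "\<exists>t. \<bar>t - z\<bar> <= d & F t <= ennreal (M / d)"
proof (rule ccontr)
 assume "\<not> ?thesis"
 then have *: "ennreal (M / d) <= F t" if "\<bar>t - z\<bar> <= d" for t using that by (meson linorder_not_le less_imp_le)
 have "ennreal M <= ennreal (M / d) * ennreal (2 * d)"
  using d \<open>0 < M\<close> by (simp flip: ennreal_mult' add: ennreal_leI)
 also have "... = (NNI t. ennreal (M / d) * indicator {z - d..z + d} t)"
  using d by (subst nn_integral_cmult_indicator) auto
 also have "... <= (NNI t. F t)"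
  by (intro nn_integral_mono) (auto simp: indicator_def abs_le_iff intro!: *)
 finally show False using M by simp
qed

text \<open>The segment makes the order of the end points irrelevant; in the application one of them
  is the centre of a cross that may lie on either side.\<close>

lemma abs_diff_le_nn_integral_deriv:
 fixes f f' :: "real => real"
 assumes D: "!!t. t : closed_segment x y ==> (f has_real_derivative f' t) (at t)"
  and c: "continuous_on (closed_segment x y) f'"
 shows "ennreal \<bar>f y - f x\<bar> <= (NNI t. ennreal \<bar>f' t\<bar> * indicator (closed_segment x y) t)"
proof -
 have *: "ennreal \<bar>f y - f x\<bar> <= (NNI t. ennreal \<bar>f' t\<bar> * indicator {x..y} t)"
  if xy: "x <= y" and D: "!!t. t : {x..y} ==> (f has_real_derivative f' t) (at t)"
  and c: "continuous_on {x..y} f'" for x y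
 proof -
  have h: "has_bochner_integral lborel (%t. indicator {x..y} t *. f' t) (f y - f x)"
   by (rule has_bochner_integral_FTC_Icc[OF xy _ c])
    (use D in \<open>auto simp: has_real_derivative_iff_has_vector_derivative intro: has_vector_derivative_at_within\<close>)
  then have "ennreal (norm (f y - f x)) <= (NNI t. ennreal (norm (indicator {x..y} t *. f' t)))"
   using integral_norm_bound_ennreal[of lborel "%t. indicator {x..y} t *. f' t"]
   by (auto simp: has_bochner_integral_iff)
  also have "... = (NNI t. ennreal \<bar>f' t\<bar> * indicator {x..y} t)"
   by (intro nn_integral_cong) (auto simp: indicator_def)
  finally show ?thesis by simp
 qed
 show ?thesis
 proof (cases "x <= y")
  case True
  then show ?thesis using *[OF True] D c by (simp add: closed_segment_eq_real_ivl)
 next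
  case False
  then have "y <= x" by simp
  then show ?thesis using *[OF \<open>y <= x\<close>] D c False by (simp add: closed_segment_eq_real_ivl abs_minus_commute)
 qed
qed

lemma nn_integral_pair:
 fixes F :: "plane => ennreal"
 assumes [measurable]: "F : borel_fun"
 shows "(NNI x. F x) = (NNI s. (NNI t. F (s, t)))"
  and "(NNI x. F x) = (NNI t. (NNI s. F (s, t)))"
proof -
 have m: "F : borel_measurable (lborel \<Otimes>\<^sub>M lborel)" by (simp add: lborel_prod)
 show "(NNI x. F x) = (NNI s. (NNI t. F (s, t)))"
  using lborel.nn_integral_fst[OF m] by (simp add: lborel_prod)
 show "(NNI x. F x) = (NNI t. (NNI s. F (s, t)))"
  using lborel_pair.nn_integral_snd[OF m] by (simp add: lborel_prod)
qed

lemma slice_integral_measurable: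
 fixes F :: "plane => ennreal"
 assumes [measurable]: "F : borel_fun"
 shows "(%s. NNI t. F (s, t)) : borel_fun"
  and "(%t. NNI s. F (s, t)) : borel_fun"
proof -
 have m: "F : borel_measurable (lborel \<Otimes>\<^sub>M lborel)" by (simp add: lborel_prod)
 show "(%s. NNI t. F (s, t)) : borel_fun"
  using lborel.borel_measurable_nn_integral_fst[OF m] by simp
 have "(%x. F (snd x, fst x)) : borel_measurable (lborel \<Otimes>\<^sub>M lborel)"
  by (rule measurable_compose[OF _ m]) measurable
 from lborel.borel_measurable_nn_integral_fst[OF this]
 show "(%t. NNI s. F (s, t)) : borel_fun" by simp
qed

lemma closed_segment_abs_le:
 fixes s x y z :: real
 assumes "s : closed_segment x y"
 shows "\<bar>s - z\<bar> <= max \<bar>x - z\<bar> \<bar>y - z\<bar>"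
 using assms by (auto simp: closed_segment_eq_real_ivl split: if_splits)

lemma abs_add3_le: "\<bar>x\<bar> <= a ==> \<bar>y\<bar> <= b ==> \<bar>z\<bar> <= c ==> \<bar>x + y + z\<bar> <= a + b + c" for a b c x y z :: real
 by linarith

text \<open>The embedding of W^{2,1} into the continuous functions of two variables, modulo affine
  ones. A cross with centre \<open>m = (c1, c2)\<close> is chosen on whose two lines the Hessian has
  mass at most \<open>M / d\<close>. Along each line \<open>w\<close> stays within
  \<open>r * (M / d)\<close> of its tangent at \<open>m\<close>, and the mixed second difference
  between \<open>x\<close> and \<open>m\<close> is an integral of \<open>b\<close> over a rectangle,
  hence at most \<open>M\<close>.\<close>

lemma airy_affine_approx:
 assumes A: "airy (ball z r) w p q a b c" and r: "0 < r'" "r' < r"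
  and M: "hmass (ball z r) a b c < ennreal M" "0 < M"
 shows "\<exists>\<alpha> \<beta> \<gamma>. \<forall>x\<in>ball z r'. \<bar>w x - (\<alpha> + \<beta> * fst x + \<gamma> * snd x)\<bar> <= (1 + 4 * r / (r - r')) * M"
proof -
 note D = airyD[OF A]
 have [measurable]: "a : borel_fun" "b : borel_fun" "c : borel_fun" using D by auto
 \<comment> \<open>Tolerance for the two coordinates of the cross. It is small enough that the
   rectangle between its centre and any point of the smaller disk stays inside the larger disk, see
   \<open>inb\<close>.\<close>
 define d where "d = (r - r') / 2"
 have d: "0 < d" using r by (simp add: d_def)
 define g where "g x = ennreal (\<bar>a x\<bar> + \<bar>b x\<bar> + \<bar>c x\<bar>) * indicator (ball z r) x" for x
 have [measurable]: "ball z r : sets borel" by auto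
 have gm[measurable]: "g : borel_fun" unfolding g_def by measurable
 have hg: "hmass (ball z r) a b c = (NNI x. g x)" by (simp add: hmass_def g_def)
 have ga: "ennreal \<bar>a x\<bar> <= g x" "ennreal \<bar>b x\<bar> <= g x" "ennreal \<bar>c x\<bar> <= g x" if "x : ball z r" for x
  using that by (auto simp: g_def intro!: ennreal_leI)
 from exists_small_slice[OF slice_integral_measurable(2)[OF gm] _ d M(2), of "snd z"] M(1)[unfolded hg]
 obtain c2 where c2: "\<bar>c2 - snd z\<bar> <= d" "(NNI s. g (s, c2)) <= ennreal (M / d)"
  by (auto simp flip: nn_integral_pair(2)[OF gm])
 from exists_small_slice[OF slice_integral_measurable(1)[OF gm] _ d M(2), of "fst z"] M(1)[unfolded hg]
 obtain c1 where c1: "\<bar>c1 - fst z\<bar> <= d" "(NNI t. g (c1, t)) <= ennreal (M / d)"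
  by (auto simp flip: nn_integral_pair(1)[OF gm])
 have inb: "(s, t) : ball z r" if x: "x : ball z r'" and s: "s : closed_segment c1 (fst x)" and t: "t : closed_segment c2 (snd x)" for x s t
 proof -
  have nx: "(fst x - fst z)\<^sup>2 + (snd x - snd z)\<^sup>2 < r'\<^sup>2"
  proof -
   have "norm (x - z) < r'" using x by (simp add: dist_norm norm_minus_commute)
   then have "(norm (x - z))\<^sup>2 < r'\<^sup>2" by (intro power_strict_mono) auto
   then show ?thesis by (simp add: norm_prod_def)
  qed
  have "\<bar>s - fst z\<bar> <= max d \<bar>fst x - fst z\<bar>" using closed_segment_abs_le[OF s, of "fst z"] c1 by auto
  then have "\<bar>s - fst z\<bar>\<^sup>2 <= (max d \<bar>fst x - fst z\<bar>)\<^sup>2" by (intro power_mono) auto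
  then have s2: "(s - fst z)\<^sup>2 <= d\<^sup>2 \<or> (s - fst z)\<^sup>2 <= (fst x - fst z)\<^sup>2" by (auto simp: max_def split: if_splits)
  have "\<bar>t - snd z\<bar> <= max d \<bar>snd x - snd z\<bar>" using closed_segment_abs_le[OF t, of "snd z"] c2 by auto
  then have "\<bar>t - snd z\<bar>\<^sup>2 <= (max d \<bar>snd x - snd z\<bar>)\<^sup>2" by (intro power_mono) auto
  then have t2: "(t - snd z)\<^sup>2 <= d\<^sup>2 \<or> (t - snd z)\<^sup>2 <= (snd x - snd z)\<^sup>2" by (auto simp: max_def split: if_splits)
  have n0: "0 <= (fst x - fst z)\<^sup>2" "0 <= (snd x - snd z)\<^sup>2" by auto
  have dd: "d\<^sup>2 + r'\<^sup>2 < r\<^sup>2"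
  proof -
   have "r\<^sup>2 - r'\<^sup>2 - d\<^sup>2 = (r - r') * (3 * r + 5 * r') / 4" by (simp add: d_def field_simps power2_eq_square)
   also have "... > 0" using r by simp
   finally show ?thesis by simp
  qed
  have dd2: "d\<^sup>2 + d\<^sup>2 < r\<^sup>2"
  proof -
   have "(r - r') * (r - r') < r * r" "0 < r * r"
    using r mult_strict_mono[of "r - r'" r "r - r'" r] by auto
   moreover have "d * d = (r - r') * (r - r') / 4" by (simp add: d_def)
   ultimately have "d * d < r * r / 2" by linarith
   then show ?thesis by (simp add: power2_eq_square)
  qed
  have rr: "r'\<^sup>2 < r\<^sup>2" using r by (intro power_strict_mono) auto
  have "(s - fst z)\<^sup>2 + (t - snd z)\<^sup>2 < r\<^sup>2"
   using s2 t2 n0 nx dd dd2 rr by linarith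
  then have "sqrt ((s - fst z)\<^sup>2 + (t - snd z)\<^sup>2) < r" using r by (intro real_less_lsqrt) auto
  then show ?thesis by (simp add: dist_norm norm_prod_def power2_commute)
 qed
 have le1: "(NNI s. ennreal \<bar>h (s,t)\<bar> * indicator (closed_segment u v) s) <= (NNI s. g (s, t))"
  if "!!s. s : closed_segment u v ==> (s,t) : ball z r" "!!x. x : ball z r ==> ennreal \<bar>h x\<bar> <= g x" for h t u v
  using that by (intro nn_integral_mono) (auto simp: indicator_def)
 have le2: "(NNI t. ennreal \<bar>h (s,t)\<bar> * indicator (closed_segment u v) t) <= (NNI t. g (s, t))"
  if "!!t. t : closed_segment u v ==> (s,t) : ball z r" "!!x. x : ball z r ==> ennreal \<bar>h x\<bar> <= g x" for h s u v
  using that by (intro nn_integral_mono) (auto simp: indicator_def)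
 define m where "m = (c1, c2)"
 have "\<bar>w x - ((w m - p m * c1 - q m * c2) + p m * fst x + q m * snd x)\<bar> <= (1 + 4 * r / (r - r')) * M"
  if x: "x : ball z r'" for x
 proof -
  obtain x1 x2 where xx: "x = (x1, x2)" by (cases x)
  note B = inb[OF x, unfolded xx fst_conv snd_conv]
  have Md: "0 <= M / d" using M d by simp
  have dz: "\<bar>x1 - fst z\<bar> < r'" "\<bar>x2 - snd z\<bar> < r'"
   using x abs_fst_snd_le_norm[of "x - z"] by (auto simp: xx dist_norm norm_minus_commute)
  have len: "\<bar>x1 - c1\<bar> <= r" "\<bar>x2 - c2\<bar> <= r" 
  proof -
   have "\<bar>x1 - c1\<bar> <= \<bar>x1 - fst z\<bar> + \<bar>c1 - fst z\<bar>" "\<bar>x2 - c2\<bar> <= \<bar>x2 - snd z\<bar> + \<bar>c2 - snd z\<bar>" by linarith+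
   moreover have "r' + d <= r" using r by (simp add: d_def field_simps)
   ultimately show "\<bar>x1 - c1\<bar> <= r" "\<bar>x2 - c2\<bar> <= r" using dz c1(1) c2(1) by linarith+
  qed
  have pb: "\<bar>p (s, c2) - p m\<bar> <= M / d" if s: "s : closed_segment c1 x1" for s
  proof -
   have sub: "closed_segment c1 s <= closed_segment c1 x1" using s by (simp add: subset_closed_segment)
   have "ennreal \<bar>p (s, c2) - p (c1, c2)\<bar> <= (NNI t. ennreal \<bar>a (t, c2)\<bar> * indicator (closed_segment c1 s) t)"
   proof (rule abs_diff_le_nn_integral_deriv)
    show "((%s. p (s, c2)) has_real_derivative a (t, c2)) (at t)" if "t : closed_segment c1 s" for t
     by (rule has_grad_fst[OF D(2)]) (use B[of t c2] that sub in auto)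
    show "continuous_on (closed_segment c1 s) (%t. a (t, c2))"
     by (intro continuous_on_compose2[OF D(4)] continuous_intros) auto
   qed
   also have "... <= (NNI t. g (t, c2))"
    by (rule le1) (use B[of _ c2] sub ga in auto)
   also have "... <= ennreal (M / d)" by (rule c2(2))
   finally show ?thesis using Md by (simp add: m_def)
  qed
  have qb: "\<bar>q (c1, t) - q m\<bar> <= M / d" if t: "t : closed_segment c2 x2" for t
  proof -
   have sub: "closed_segment c2 t <= closed_segment c2 x2" using t by (simp add: subset_closed_segment)
   have "ennreal \<bar>q (c1, t) - q (c1, c2)\<bar> <= (NNI s. ennreal \<bar>c (c1, s)\<bar> * indicator (closed_segment c2 t) s)"
   proof (rule abs_diff_le_nn_integral_deriv)
    show "((%s. q (c1, s)) has_real_derivative c (c1, s)) (at s)" if "s : closed_segment c2 t" for s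
     by (rule has_grad_snd[OF D(3)]) (use B[of c1 s] that sub in auto)
    show "continuous_on (closed_segment c2 t) (%s. c (c1, s))"
     by (intro continuous_on_compose2[OF D(6)] continuous_intros) auto
   qed
   also have "... <= (NNI s. g (c1, s))"
    by (rule le2) (use B[of c1] sub ga in auto)
   also have "... <= ennreal (M / d)" by (rule c1(2))
   finally show ?thesis using Md by (simp add: m_def)
  qed
  have T1: "\<bar>w (x1, c2) - w m - p m * (x1 - c1)\<bar> <= r * (M / d)"
  proof -
   have "norm ((w (x1, c2) - p m * x1) - (w (c1, c2) - p m * c1)) <= M / d * norm (x1 - c1)"
   proof (rule field_differentiable_bound[where S="closed_segment c1 x1" and f="%s. w (s, c2) - p m * s" and f'="%s. p (s, c2) - p m"])
    show "((%s. w (s, c2) - p m * s) has_field_derivative p (s, c2) - p m) (at s within closed_segment c1 x1)"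
     if s: "s : closed_segment c1 x1" for s
    proof -
     have "((%s. w (s, c2)) has_field_derivative p (s, c2)) (at s)"
      by (rule has_grad_fst[OF D(1)]) (use B[of s c2] s in auto)
     then show ?thesis by (auto intro!: derivative_eq_intros intro: has_field_derivative_at_within)
    qed
   qed (use pb in auto)
   also have "... <= M / d * r" using len Md by (intro mult_left_mono) auto
   finally show ?thesis by (simp add: m_def algebra_simps)
  qed
  have T2: "\<bar>w (c1, x2) - w m - q m * (x2 - c2)\<bar> <= r * (M / d)"
  proof -
   have "norm ((w (c1, x2) - q m * x2) - (w (c1, c2) - q m * c2)) <= M / d * norm (x2 - c2)"
   proof (rule field_differentiable_bound[where S="closed_segment c2 x2" and f="%s. w (c1, s) - q m * s" and f'="%s. q (c1, s) - q m"])
    show "((%s. w (c1, s) - q m * s) has_field_derivative q (c1, s) - q m) (at s within closed_segment c2 x2)"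
     if s: "s : closed_segment c2 x2" for s
    proof -
     have "((%s. w (c1, s)) has_field_derivative q (c1, s)) (at s)"
      by (rule has_grad_snd[OF D(1)]) (use B[of c1 s] s in auto)
     then show ?thesis by (auto intro!: derivative_eq_intros intro: has_field_derivative_at_within)
    qed
   qed (use qb in auto)
   also have "... <= M / d * r" using len Md by (intro mult_left_mono) auto
   finally show ?thesis by (simp add: m_def algebra_simps)
  qed
  have T3: "\<bar>(w (x1, x2) - w (c1, x2)) - (w (x1, c2) - w (c1, c2))\<bar> <= M"
  proof -
   have "ennreal \<bar>(w (x1, x2) - w (c1, x2)) - (w (x1, c2) - w (c1, c2))\<bar>
    <= (NNI t. ennreal \<bar>q (x1, t) - q (c1, t)\<bar> * indicator (closed_segment c2 x2) t)"
   proof (rule abs_diff_le_nn_integral_deriv[where f="%t. w (x1, t) - w (c1, t)" and f'="%t. q (x1, t) - q (c1, t)"])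
    fix t assume t: "t : closed_segment c2 x2"
    show "((%t. w (x1, t) - w (c1, t)) has_real_derivative q (x1, t) - q (c1, t)) (at t)"
     by (intro DERIV_diff has_grad_snd[OF D(1)]) (use B t in auto)
   next
    have "isCont (%t. q (x1, t) - q (c1, t)) t" if t: "t : closed_segment c2 x2" for t
     by (intro isCont_diff DERIV_isCont[OF has_grad_snd[OF D(3)]]) (use B t in auto)
    then show "continuous_on (closed_segment c2 x2) (%t. q (x1, t) - q (c1, t))"
     by (blast intro: continuous_at_imp_continuous_on)
   qed
   also have "... <= (NNI t. (NNI s. g (s, t)))"
   proof (intro nn_integral_mono)
    fix t
    show "ennreal \<bar>q (x1, t) - q (c1, t)\<bar> * indicator (closed_segment c2 x2) t <= (NNI s. g (s, t))"
    proof (cases "t : closed_segment c2 x2")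
     case True
     have "ennreal \<bar>q (x1, t) - q (c1, t)\<bar> <= (NNI s. ennreal \<bar>b (s, t)\<bar> * indicator (closed_segment c1 x1) s)"
     proof (rule abs_diff_le_nn_integral_deriv)
      show "((%s. q (s, t)) has_real_derivative b (s, t)) (at s)" if "s : closed_segment c1 x1" for s
       by (rule has_grad_fst[OF D(3)]) (use B that True in auto)
      show "continuous_on (closed_segment c1 x1) (%s. b (s, t))"
       by (intro continuous_on_compose2[OF D(5)] continuous_intros) auto
     qed
     also have "... <= (NNI s. g (s, t))"
      by (rule le1) (use B True ga in auto)
     finally show ?thesis using True by simp
    qed simp
   qed
   also have "... = hmass (ball z r) a b c" unfolding hg nn_integral_pair(2)[OF gm] ..
   also have "... <= ennreal M" using M by simp
   finally show ?thesis using M by simp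
  qed
  have "w x - ((w m - p m * c1 - q m * c2) + p m * fst x + q m * snd x) =
    ((w (x1, x2) - w (c1, x2)) - (w (x1, c2) - w (c1, c2))) + (w (x1, c2) - w m - p m * (x1 - c1)) + (w (c1, x2) - w m - q m * (x2 - c2))"
   by (simp add: xx m_def algebra_simps)
  then have "\<bar>w x - ((w m - p m * c1 - q m * c2) + p m * fst x + q m * snd x)\<bar> <= M + r * (M / d) + r * (M / d)"
   by (simp only: abs_add3_le[OF T3 T1 T2])
  also have "... = (1 + 4 * r / (r - r')) * M"
  proof -
   have e1: "r * (M / d) = 2 * (r / (r - r')) * M" by (simp add: d_def)
   show ?thesis unfolding e1 by (simp add: algebra_simps)
  qed
  finally show ?thesis .
 qed
 then show ?thesis by blast
qed

lemma airy_minus_affine: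
 assumes "airy D w p q a b c"
 shows "airy D (%x. w x - (\<alpha> + \<beta> * fst x + \<gamma> * snd x)) (%x. p x - \<beta>) (%x. q x - \<gamma>) a b c"
 using assms unfolding airy_def has_grad_def
 by (auto intro!: derivative_eq_intros simp: algebra_simps)

text \<open>A subsequence that converges at the rational points is fixed once and for all. Near a
  point off \<open>S\<close> the functions are asymptotically affine, and an affine function is
  determined by its values at three rational points; so convergence at these forces convergence on a
  whole disk, with an affine limit.\<close>

lemma affine_locally_constant_limit:
 fixes w p q a b c :: "nat => plane => real"
 assumes A: "!!n. airy (ball c0 R) (w n) (p n) (q n) (a n) (b n) (c n)"
  and bd: "!!n x. x : ball c0 R ==> \<bar>w n x\<bar> <= B"
  and op: "open (ball c0 R - S)"
  and small: "!!K. compact K ==> K <= ball c0 R - S ==> (%n. hmass K (a n) (b n) (c n)) ~~> 0"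
 obtains k W where "strict_mono (k :: nat => nat)" 
  "!!x. x : ball c0 R - S ==> (%n. w (k n) x) ~~> W x"
  "!!x. x : ball c0 R - S ==> \<exists>r>0. \<exists>\<alpha> \<beta> \<gamma>. ball x r <= ball c0 R - S & (\<forall>y\<in>ball x r. W y = \<alpha> + \<beta> * fst y + \<gamma> * snd y)"
proof -
 define Q where "Q = (\<rat> \<times> \<rat> :: plane set) \<inter> ball c0 R"
 have "countable Q" unfolding Q_def by (intro countable_Int1 countable_SIGMA countable_rat)
 then obtain k where k: "strict_mono (k :: nat => nat)" "!!x. x : Q ==> \<exists>l. (%n. w (k n) x) ~~> l"
  using function_convergent_subsequence[of Q w B] bd by (auto simp: Q_def)
 have local: "\<exists>r>0. \<exists>\<alpha> \<beta> \<gamma>. ball x r <= ball c0 R - S & (\<forall>y\<in>ball x r. (%n. w (k n) y) ~~> \<alpha> + \<beta> * fst y + \<gamma> * snd y)"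
  if x: "x : ball c0 R - S" for x
 proof -
  obtain e where e: "e > 0" "cball x e <= ball c0 R - S" using op x open_contains_cball by metis
  define r where "r = e / 2"
  have r: "0 < r" "r < e" using e by (auto simp: r_def)
  obtain s s' where s: "s : \<rat>" "s' : \<rat>" "fst x < s" "s < s'" "s' < fst x + r / 2"
   using Rats_dense_in_real[of "fst x" "fst x + r/2"] Rats_dense_in_real r by (metis add_less_cancel_left less_add_same_cancel1 half_gt_zero)
  obtain t t' where t: "t : \<rat>" "t' : \<rat>" "snd x < t" "t < t'" "t' < snd x + r / 2"
   using Rats_dense_in_real[of "snd x" "snd x + r/2"] Rats_dense_in_real r by (metis add_less_cancel_left less_add_same_cancel1 half_gt_zero)
  have near: "(u, v) : ball x r" if "fst x < u" "u < fst x + r/2" "snd x < v" "v < snd x + r/2" for u v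
  proof -
   have "norm ((u, v) - x) <= norm (u - fst x) + norm (v - snd x)"
    using norm_Pair_le[of "u - fst x" "v - snd x"] by (cases x) auto
   also have "... < r" using that by auto
   finally show ?thesis by (simp add: dist_norm norm_minus_commute)
  qed
  have inr: "(s, t) : ball x r" "(s', t) : ball x r" "(s, t') : ball x r" using near s t by auto
  have sub: "ball x r <= ball c0 R - S" "ball x e <= ball c0 R" using e r by (auto simp: subset_eq)
  have "(s, t) : Q" "(s', t) : Q" "(s, t') : Q" using inr sub s t by (auto simp: Q_def)
  then obtain l1 l2 l3 where l: "(%n. w (k n) (s, t)) ~~> l1" "(%n. w (k n) (s', t)) ~~> l2" "(%n. w (k n) (s, t')) ~~> l3"
   using k(2) by meson
  define lam mu where "lam y = (fst y - s) / (s' - s)" and "mu y = (snd y - t) / (t' - t)" for y :: "plane"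
  \<comment> \<open>Affine interpolation of \<open>w n\<close> at the three rational points;
    \<open>lam\<close> and \<open>mu\<close> are the two coordinates relative to them.\<close>
  define I where "I n y = w n (s, t) + (w n (s', t) - w n (s, t)) * lam y + (w n (s, t') - w n (s, t)) * mu y" for n y
  define L where "L y = l1 + (l2 - l1) * lam y + (l3 - l1) * mu y" for y
  have "(%n. I (k n) y) ~~> L y" for y
   unfolding I_def L_def by (intro tendsto_intros l)
  moreover have "(%n. w (k n) y - I (k n) y) ~~> 0" if y: "y : ball x r" for y
  proof (rule LIMSEQ_subseq_LIMSEQ[OF _ k(1), unfolded comp_def])
   define Cc where "Cc = 1 + 4 * e / (e - r)"
   define E where "E = 2 + 2 * \<bar>lam y\<bar> + 2 * \<bar>mu y\<bar>"
   have E: "E > 0" "Cc > 0" using r by (auto simp: E_def Cc_def intro!: add_pos_nonneg divide_nonneg_pos)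
   show "(%n. w n y - I n y) ~~> 0"
   proof (rule LIMSEQ_I)
    fix \<eta> :: real assume \<eta>: "0 < \<eta>"
    define M where "M = \<eta> / (2 * E * Cc)"
    have M: "0 < M" using \<eta> E by (simp add: M_def)
    have "(%n. hmass (cball x e) (a n) (b n) (c n)) ~~> 0" by (rule small) (use e in auto)
    then have "\<forall>\<^sub>F n in sequentially. hmass (cball x e) (a n) (b n) (c n) < ennreal M"
     by (rule order_tendstoD(2)) (use M in simp)
    then obtain N where N: "!!n. n >= N ==> hmass (cball x e) (a n) (b n) (c n) < ennreal M"
     unfolding eventually_sequentially by blast
    show "\<exists>N. \<forall>n\<ge>N. norm (w n y - I n y - 0) < \<eta>"
    proof (intro exI[of _ N] allI impI)
     fix n assume n: "n >= N"
     have "hmass (ball x e) (a n) (b n) (c n) < ennreal M"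
      by (rule le_less_trans[OF hmass_mono N[OF n]]) auto
     from airy_affine_approx[OF airy_subset[OF A sub(2)] r this M]
     obtain \<alpha> \<beta> \<gamma> where ap: "!!x'. x' : ball x r ==> \<bar>w n x' - (\<alpha> + \<beta> * fst x' + \<gamma> * snd x')\<bar> <= Cc * M"
      unfolding Cc_def by blast
     \<comment> \<open>Interpolation reproduces affine functions, so \<open>w n\<close> may be
       replaced by its deviation \<open>f\<close> from the approximating affine function, which is
       at most \<open>Cc * M\<close> at all four points involved. Collecting terms gives the factor
       \<open>E\<close>.\<close>
     define f where "f x' = w n x' - (\<alpha> + \<beta> * fst x' + \<gamma> * snd x')" for x'
     have ap: "\<bar>f x'\<bar> <= Cc * M" if "x' : ball x r" for x' using ap[OF that] by (simp add: f_def)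
     have "(s' - s) * lam y = fst y - s" "(t' - t) * mu y = snd y - t" using s t by (auto simp: lam_def mu_def)
     then have sl: "s' * lam y = fst y - s + s * lam y" "t' * mu y = snd y - t + t * mu y" by (auto simp: algebra_simps)
     have "w n y - I n y = f y - (f (s, t) + (f (s', t) - f (s, t)) * lam y + (f (s, t') - f (s, t)) * mu y)
       + (\<beta> * (fst y - s + s * lam y - s' * lam y) + \<gamma> * (snd y - t + t * mu y - t' * mu y))"
      unfolding I_def f_def by (simp add: algebra_simps)
     then have eq: "w n y - I n y = f y - (f (s, t) + (f (s', t) - f (s, t)) * lam y + (f (s, t') - f (s, t)) * mu y)"
      using sl by simp
     have "\<bar>(f (s', t) - f (s, t)) * lam y\<bar> <= (2 * (Cc * M)) * \<bar>lam y\<bar>" "\<bar>(f (s, t') - f (s, t)) * mu y\<bar> <= (2 * (Cc * M)) * \<bar>mu y\<bar>"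
      unfolding abs_mult using ap[OF inr(1)] ap[OF inr(2)] ap[OF inr(3)] by (intro mult_right_mono; linarith)+
     then have "\<bar>w n y - I n y\<bar> <= Cc * M + (Cc * M + (2 * (Cc * M)) * \<bar>lam y\<bar> + (2 * (Cc * M)) * \<bar>mu y\<bar>)"
      unfolding eq using ap[OF y] ap[OF inr(1)] by linarith
     also have "... = (Cc * M) * E" by (simp add: E_def algebra_simps)
     also have "... = \<eta> / 2" using E by (simp add: M_def)
     also have "... < \<eta>" using \<eta> by simp
     finally show "norm (w n y - I n y - 0) < \<eta>" by simp
    qed
   qed
  qed
  ultimately have conv: "(%n. w (k n) y) ~~> L y" if "y : ball x r" for y
   using tendsto_add[of "%n. w (k n) y - I (k n) y" 0 sequentially "%n. I (k n) y" "L y"] that by auto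
  have "L y = (l1 - (l2 - l1) * s / (s' - s) - (l3 - l1) * t / (t' - t)) + ((l2 - l1) / (s' - s)) * fst y + ((l3 - l1) / (t' - t)) * snd y" for y
   unfolding L_def lam_def mu_def by (simp add: diff_divide_distrib right_diff_distrib left_diff_distrib)
  then show ?thesis using conv sub r by metis
 qed
 define W where "W x = lim (%n. w (k n) x)" for x
 have cW: "(%n. w (k n) x) ~~> W x" if x: "x : ball c0 R - S" for x
 proof -
  obtain r \<alpha> \<beta> \<gamma> where "r > 0" "\<forall>y\<in>ball x r. (%n. w (k n) y) ~~> \<alpha> + \<beta> * fst y + \<gamma> * snd y"
   using local[OF x] by blast
  then have "(%n. w (k n) x) ~~> \<alpha> + \<beta> * fst x + \<gamma> * snd x" by simp
  then show ?thesis unfolding W_def by (simp add: limI)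
 qed
 show thesis
 proof (rule that[OF k(1) cW])
  fix x assume x: "x : ball c0 R - S"
  obtain r \<alpha> \<beta> \<gamma> where r: "r > 0" "ball x r <= ball c0 R - S" "!!y. y : ball x r ==> (%n. w (k n) y) ~~> \<alpha> + \<beta> * fst y + \<gamma> * snd y"
   using local[OF x] by blast
  have "W y = \<alpha> + \<beta> * fst y + \<gamma> * snd y" if "y : ball x r" for y
   using r(3)[OF that] by (simp add: W_def limI)
  then show "\<exists>r>0. \<exists>\<alpha> \<beta> \<gamma>. ball x r <= ball c0 R - S & (\<forall>y\<in>ball x r. W y = \<alpha> + \<beta> * fst y + \<gamma> * snd y)"
   using r by blast
 qed
qed


section \<open>Fibres of sets of finite length, and density points on the line\<close>

lemma hausdorff1_finite_cover:
 fixes S :: "'a::metric_space set"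
 assumes "hausdorff1 S < \<infinity>"
 obtains H :: real where "0 <= H"
  "!!\<delta>. 0 < \<delta> ==> \<exists>C::nat => 'a set. S <= (\<Union>i. C i) & (\<forall>i. bounded (C i) & diameter (C i) <= \<delta>) &
    (\<Sum>i. ennreal (diameter (C i))) <= ennreal H"
proof -
 obtain h where h: "hausdorff1 S = ennreal h" "0 <= h"
  using assms by (cases "hausdorff1 S") auto
 show thesis
 proof (rule that[of "h + 1"])
  fix \<delta> :: real assume \<delta>: "0 < \<delta>"
  have "hausdorff1_delta \<delta> S <= hausdorff1 S"
   unfolding hausdorff1_def using \<delta> by (intro SUP_upper) auto
  also have "... < ennreal (h + 1)" using h by (simp add: ennreal_less_iff)
  finally show "\<exists>C::nat => 'a set. S <= (\<Union>i. C i) & (\<forall>i. bounded (C i) & diameter (C i) <= \<delta>) &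
    (\<Sum>i. ennreal (diameter (C i))) <= ennreal (h + 1)"
   unfolding hausdorff1_delta_def INF_less_iff by (auto intro: less_imp_le)
 qed (use h in auto)
qed

lemma finite_separation:
 fixes T :: "'a::metric_space set"
 assumes "finite T"
 shows "\<exists>d>0. \<forall>x\<in>T. \<forall>y\<in>T. x ~= y --> d <= dist x y"
proof -
 let ?D = "insert 1 ((%(x, y). dist x y) ` {(x, y) : T \<times> T. x ~= y})"
 have f: "finite ?D" using assms by (auto intro: finite_subset[of _ "T \<times> T"])
 show ?thesis
 proof (intro exI[of _ "Min ?D"] conjI ballI impI)
  show "0 < Min ?D" using f by (subst Min_gr_iff) auto
  fix x y assume "x : T" "y : T" "x ~= y"
  then show "Min ?D <= dist x y" using f by (intro Min_le) (auto intro!: image_eqI[of _ _ "(x, y)"])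
 qed
qed

text \<open>Eilenberg's inequality in its simplest form: the multiplicity of the fibres is bounded from above by
  counting the covering sets whose image contains the point, and Fatou's lemma passes to the limit.\<close>

lemma finite_fibres_of_lipschitz:
 fixes S :: "'a::metric_space set" and f :: "'a => real"
 assumes S: "hausdorff1 S < \<infinity>" and L: "0 <= L" "!!x y. \<bar>f x - f y\<bar> <= L * dist x y"
 shows "AE y in lborel. finite (S \<inter> f -` {y})"
proof -
 obtain H where H: "0 <= H" and cov: "!!\<delta>. 0 < \<delta> ==> \<exists>C::nat => 'a set. S <= (\<Union>i. C i) & (\<forall>i. bounded (C i) & diameter (C i) <= \<delta>) &
    (\<Sum>i. ennreal (diameter (C i))) <= ennreal H"
  by (rule hausdorff1_finite_cover[OF S]) blast
 have "\<forall>m::nat. \<exists>C::nat => 'a set. S <= (\<Union>i. C i) & (\<forall>i. bounded (C i) & diameter (C i) <= inverse (real (Suc m))) &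
    (\<Sum>i. ennreal (diameter (C i))) <= ennreal H"
  by (intro allI cov) simp
 from choice[OF this] obtain C :: "nat => nat => 'a set" where
  CC: "\<forall>m. S <= (\<Union>i. C m i) & (\<forall>i. bounded (C m i) & diameter (C m i) <= inverse (real (Suc m))) &
    (\<Sum>i. ennreal (diameter (C m i))) <= ennreal H" by blast
 then have C: "!!m. S <= (\<Union>i. C m i)" "!!m i. bounded (C m i)" "!!m i. diameter (C m i) <= inverse (real (Suc m))"
   "!!m. (\<Sum>i. ennreal (diameter (C m i))) <= ennreal H"
  by blast+
 \<comment> \<open>This interval contains the image of \<open>C m i\<close>. For an empty set the
   centre is arbitrary, but then the diameter, and with it the length, is 0.\<close>
 define I where "I m i = cball (f (SOME x. x : C m i)) (L * diameter (C m i))" for m i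
 have dn: "0 <= diameter (C m i)" for m i using C(2) diameter_ge_0 by blast
 have fI: "f x : I m i" if "x : C m i" for x m i
 proof -
  have "(SOME x. x : C m i) : C m i" using that by (rule someI)
  then have "dist (SOME x. x : C m i) x <= diameter (C m i)"
   using diameter_bounded_bound[OF C(2)] that by blast
  then have "L * dist (SOME x. x : C m i) x <= L * diameter (C m i)" using L by (intro mult_left_mono)
  then show ?thesis using L(2)[of "SOME x. x : C m i" x] unfolding I_def by (simp add: dist_real_def)
 qed
 define g where "g m y = (\<Sum>i. indicator (I m i) y :: ennreal)" for m y
 have [measurable]: "I m i : sets borel" for m i unfolding I_def by auto
 have gm[measurable]: "g m : borel_measurable lborel" for m unfolding g_def by measurable
 have "(NNI y. g m y) <= ennreal (2 * L * H)" for m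
 proof -
  have "(NNI y. g m y) = (\<Sum>i. emeasure lborel (I m i))"
   unfolding g_def by (subst nn_integral_suminf) auto
  also have "... = (\<Sum>i. ennreal (2 * L) * ennreal (diameter (C m i)))"
   using L dn by (intro suminf_cong) (simp add: I_def cball_eq_atLeastAtMost ennreal_mult'[symmetric] mult.assoc)
  also have "... = ennreal (2 * L) * (\<Sum>i. ennreal (diameter (C m i)))" by simp
  also have "... <= ennreal (2 * L) * ennreal H" using C(4) by (intro mult_left_mono) auto
  also have "... = ennreal (2 * L * H)" using L H by (simp add: ennreal_mult)
  finally show ?thesis .
 qed
 then have "liminf (%m. NNI y. g m y) <= ennreal (2 * L * H)"
  by (intro Liminf_le) (auto intro: always_eventually)
 moreover have "(NNI y. liminf (%m. g m y)) <= liminf (%m. NNI y. g m y)"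
  by (rule nn_integral_liminf) measurable
 ultimately have fin: "(NNI y. liminf (%m. g m y)) <= ennreal (2 * L * H)" by (rule order_trans[rotated])
 have "AE y in lborel. liminf (%m. g m y) ~= \<infinity>"
 proof (rule nn_integral_PInf_AE)
  show "(%y. liminf (%m. g m y)) : borel_measurable lborel" by measurable
  show "(NNI y. liminf (%m. g m y)) ~= \<infinity>" using fin by (auto simp: top_unique)
 qed
 then show ?thesis
 proof eventually_elim
  fix y assume y: "liminf (%m. g m y) ~= \<infinity>"
  show "finite (S \<inter> f -` {y})"
  proof (rule ccontr)
   assume inf: "infinite (S \<inter> f -` {y})"
   have "of_nat N <= liminf (%m. g m y)" for N :: nat
   proof -
    obtain T where T: "T <= S \<inter> f -` {y}" "finite T" "card T = N"
     using infinite_arbitrarily_large[OF inf] by blast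
    obtain d where d: "0 < d" "!!u v. u : T ==> v : T ==> u ~= v ==> d <= dist u v"
     using finite_separation[OF T(2)] by blast
    \<comment> \<open>Once the covering sets are smaller than the separation of the \<open>N\<close>
      points, these lie in \<open>N\<close> different sets, and \<open>N\<close> intervals contain
      \<open>y\<close>.\<close>
    obtain M where M: "inverse (real (Suc M)) < d" using reals_Archimedean[OF d(1)] by blast
    have "of_nat N <= g m y" if m: "m >= M" for m
    proof -
     have "\<forall>x\<in>T. \<exists>i. x : C m i" using C(1)[of m] T(1) by blast
     then obtain i where i: "!!x. x : T ==> x : C m (i x)" by metis
     have inj: "inj_on i T"
     proof (rule inj_onI, rule ccontr)
      fix u v assume uv: "u : T" "v : T" "i u = i v" "u ~= v"
      have "dist u v <= diameter (C m (i u))"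
       using diameter_bounded_bound[OF C(2)] i[OF uv(1)] i[OF uv(2)] uv(3) by metis
      also have "... <= inverse (real (Suc m))" by (rule C(3))
      also have "... <= inverse (real (Suc M))" using m by (intro le_imp_inverse_le) auto
      finally show False using M d(2)[OF uv(1,2,4)] by linarith
     qed
     have "of_nat N = (\<Sum>k\<in>i ` T. indicator (I m k) y :: ennreal)"
     proof -
      have "indicator (I m k) y = (1 :: ennreal)" if "k : i ` T" for k
       using that fI i T(1) by (auto simp: indicator_def)
      then have "(\<Sum>k\<in>i ` T. indicator (I m k) y :: ennreal) = of_nat (card (i ` T))" by simp
      then show ?thesis using card_image[OF inj] T(3) by simp
     qed
     also have "... <= g m y" unfolding g_def by (rule sum_le_suminf) (use T(2) in auto)
     finally show ?thesis .
    qed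
    then show ?thesis by (intro Liminf_bounded) (auto simp: eventually_sequentially)
   qed
   moreover obtain N :: nat where "liminf (%m. g m y) < of_nat N"
    using y ennreal_Ex_less_of_nat[of "liminf (%m. g m y)"] by (auto simp: top.not_eq_extremum)
   ultimately show False by (meson leD)
  qed
 qed
qed

text \<open>Lebesgue's density theorem in the form needed later. By Vitali the exceptional points
  are covered, up to a null set, by disjoint intervals inside an open set \<open>G'\<close> that
  exceeds \<open>P\<close> by less than \<open>\<kappa> * e / 2\<close>. Each interval is at most
  \<open>2 / \<kappa>\<close> times as long as its part off \<open>P\<close>, so the total length is
  at most \<open>e\<close>.\<close>

lemma small_balls_density_points:
 fixes P :: "real set"
 assumes P: "P : sets borel" and k: "0 < \<kappa>"
 shows "negligible {y : P. \<forall>r0>0. \<exists>r. 0 < r & r <= r0 & measure lborel (cball y r - P) > \<kappa> * r}" (is "negligible ?B")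
proof -
 have "negligible (?B \<inter> ball 0 (real n))" for n
  unfolding negligible_outer_le
 proof (intro allI impI)
  fix e :: real assume e: "0 < e"
  define P' where "P' = P \<inter> ball 0 (real n)"
  have "P' : sets lebesgue" using P by (auto simp: P'_def)
  moreover have ke: "0 < \<kappa> * e / 2" using k e by simp
  ultimately obtain G where G: "open G" "P' <= G" "emeasure lebesgue (G - P') < ennreal (\<kappa> * e / 2)"
   using sets_lebesgue_outer_open by metis
  define G' where "G' = G \<inter> ball 0 (real n)"
  have G': "open G'" "G' - P <= G - P'" using G by (auto simp: G'_def P'_def)
  have mG': "G' - P : sets borel" using G' P by auto
  have "emeasure lborel (G' - P) = emeasure lebesgue (G' - P)" using mG' by simp
  also have "... <= emeasure lebesgue (G - P')"
   by (rule emeasure_mono[OF G'(2)]) (use G(1) \<open>P' : sets lebesgue\<close> in auto)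
  finally have GP: "emeasure lborel (G' - P) < ennreal (\<kappa> * e / 2)" using G(3) by (rule le_less_trans)
  let ?K = "{(y, r). y : ?B \<inter> ball 0 (real n) & 0 < r & cball y r <= G' & measure lborel (cball y r - P) > \<kappa> * r}"
  have V: "\<exists>i. i : ?K & x : cball (fst i) (snd i) & snd i < d" if x: "x : ?B \<inter> ball 0 (real n)" and d: "0 < d" for x d
  proof -
   have "x : G'" using x G(2) by (auto simp: G'_def P'_def)
   then obtain e1 where e1: "0 < e1" "cball x e1 <= G'" using G'(1) open_contains_cball by metis
   have "0 < min (d/2) e1" using d e1 by simp
   then obtain r where r: "0 < r" "r <= min (d/2) e1" "measure lborel (cball x r - P) > \<kappa> * r" using x by blast
   have "cball x r <= G'" using e1 r by (auto simp: subset_eq)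
   then show ?thesis using r x d by (intro exI[of _ "(x, r)"]) auto
  qed
  have K0: "0 < snd i" if "i : ?K" for i using that by auto
  obtain Cc where Cc: "countable Cc" "Cc <= ?K"
   "pairwise (%i j. disjnt (cball (fst i) (snd i)) (cball (fst j) (snd j))) Cc"
   "negligible (?B \<inter> ball 0 (real n) - (\<Union>i\<in>Cc. cball (fst i) (snd i)))"
   by (rule Vitali_covering_theorem_cballs[OF K0 V]) (assumption | rule that)+
  let ?U = "\<Union>i\<in>Cc. cball (fst i) (snd i)"
  have dis: "disjoint_family_on (%i. cball (fst i) (snd i)) Cc"
   using Cc(3) by (auto simp: disjoint_family_on_def pairwise_def disjnt_def)
  have dis2: "disjoint_family_on (%i. cball (fst i) (snd i) - P) Cc"
   using dis unfolding disjoint_family_on_def by blast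
  have "emeasure lborel ?U = (\<integral>\<^sup>+i. emeasure lborel (cball (fst i) (snd i)) \<partial>count_space Cc)"
   using Cc(1) dis by (intro emeasure_UN_countable) auto
  also have "... <= (\<integral>\<^sup>+i. ennreal (2 / \<kappa>) * emeasure lborel (cball (fst i) (snd i) - P) \<partial>count_space Cc)"
  proof (intro nn_integral_mono)
   fix i assume "i : space (count_space Cc)"
   then have i: "i : ?K" using Cc(2) by auto
   have fin: "emeasure lborel (cball (fst i) (snd i) - P) ~= \<infinity>"
    using emeasure_mono[of "cball (fst i) (snd i) - P" "cball (fst i) (snd i)" lborel] emeasure_lborel_cball_finite[of "fst i" "snd i"]
    by (auto simp: top_unique)
   have "emeasure lborel (cball (fst i) (snd i)) = ennreal (2 * snd i)"
    using i by (simp add: cball_eq_atLeastAtMost case_prod_unfold)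
   also have "... <= ennreal (2 / \<kappa> * measure lborel (cball (fst i) (snd i) - P))"
    using i k by (intro ennreal_leI) (auto simp: case_prod_unfold field_simps)
   also have "... = ennreal (2 / \<kappa>) * emeasure lborel (cball (fst i) (snd i) - P)"
    unfolding emeasure_eq_ennreal_measure[OF fin[unfolded infinity_ennreal_def]] by (rule ennreal_mult) (use k in auto)
   finally show "emeasure lborel (cball (fst i) (snd i)) <= ennreal (2 / \<kappa>) * emeasure lborel (cball (fst i) (snd i) - P)" .
  qed
  also have "... = ennreal (2 / \<kappa>) * (\<integral>\<^sup>+i. emeasure lborel (cball (fst i) (snd i) - P) \<partial>count_space Cc)"
   by (rule nn_integral_cmult) auto
  also have "(\<integral>\<^sup>+i. emeasure lborel (cball (fst i) (snd i) - P) \<partial>count_space Cc) = emeasure lborel (\<Union>i\<in>Cc. cball (fst i) (snd i) - P)"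
   using Cc(1) P by (intro emeasure_UN_countable[symmetric] dis2) auto
  also have "ennreal (2 / \<kappa>) * ... <= ennreal (2 / \<kappa>) * emeasure lborel (G' - P)"
  proof (intro mult_left_mono emeasure_mono)
   have "cball (fst i) (snd i) <= G'" if "i : Cc" for i
    using subsetD[OF Cc(2) that] by (simp add: case_prod_unfold)
   then show "(\<Union>i\<in>Cc. cball (fst i) (snd i) - P) <= G' - P" by blast
  qed (use mG' in auto)
  also have "... <= ennreal (2 / \<kappa>) * ennreal (\<kappa> * e / 2)" using GP by (intro mult_left_mono) auto
  also have "... = ennreal e" using k e by (simp flip: ennreal_mult')
  finally have U: "emeasure lborel ?U <= ennreal e" .
  have Um: "?U : sets borel" using Cc(1) by (intro sets.countable_UN'') auto
  let ?N = "?B \<inter> ball 0 (real n) - ?U"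
  have N0: "?N : null_sets lebesgue" using Cc(4) by (simp add: negligible_iff_null_sets)
  have em: "emeasure lebesgue (?U \<union> ?N) <= ennreal e"
   using U Um N0 by (subst emeasure_Un_null_set) auto
  show "\<exists>T. ?B \<inter> ball 0 (real n) <= T & T : lmeasurable & measure lebesgue T <= e"
  proof (intro exI[of _ "?U \<union> ?N"] conjI)
   have "?U : sets lebesgue" using Um by simp
   moreover have "?N : sets lebesgue" using N0 by (rule null_setsD2)
   ultimately have "?U \<union> ?N : sets lebesgue" by (rule sets.Un)
   then show "?U \<union> ?N : lmeasurable" using em by (intro fmeasurableI) (auto simp: le_less_trans)
   show "measure lebesgue (?U \<union> ?N) <= e" using em e by (simp add: measure_def enn2real_leI)
  qed auto
 qed
 then have "negligible (\<Union>n. ?B \<inter> ball 0 (real n))" by (intro negligible_countable_Union) auto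
 moreover have "?B <= (\<Union>n. ?B \<inter> ball 0 (real n))"
  using reals_Archimedean2 by (auto simp: )
 ultimately show ?thesis using negligible_subset by blast
qed


section \<open>Piecewise affine functions with a sub-mean value property\<close>

text \<open>Subtract the chord and suppose that the difference \<open>h\<close> is positive at
  \<open>t2\<close>. At the leftmost point \<open>z\<close> of its maximum \<open>h\<close> is
  strictly smaller to the left, so \<open>s1\<close> exceeds the slope \<open>m\<close> of the
  chord, and not larger to the right, so \<open>s2 <= m\<close>. This contradicts
  \<open>s1 <= s2\<close>.\<close>

lemma chord_inequality_from_local:
 fixes g :: "real => real"
 assumes c: "continuous_on {t1..t3} g" and t: "t1 < t2" "t2 < t3"
  and loc: "!!p. t1 < p ==> p < t3 ==> \<exists>d>0. \<exists>s1 s2. s1 <= s2 & (\<forall>t. p - d < t & t < p --> g t = g p + s1 * (t - p)) &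
    (\<forall>t. p < t & t < p + d --> g t = g p + s2 * (t - p))"
 shows "g t2 <= ((t3 - t2) * g t1 + (t2 - t1) * g t3) / (t3 - t1)"
proof (rule ccontr)
 assume neg: "\<not> ?thesis"
 define m where "m = (g t3 - g t1) / (t3 - t1)"
 define h where "h t = g t - (g t1 + m * (t - t1))" for t
 have m: "m * (t3 - t1) = g t3 - g t1" using t by (simp add: m_def)
 have h13: "h t1 = 0" "h t3 = 0" using m by (auto simp: h_def)
 have "((t3 - t2) * g t1 + (t2 - t1) * g t3) / (t3 - t1) = g t1 + m * (t2 - t1)"
 proof -
  have "(t3 - t2) * g t1 + (t2 - t1) * g t3 = (t3 - t1) * g t1 + (t2 - t1) * (m * (t3 - t1))"
   unfolding m by (simp add: algebra_simps)
  also have "... = (t3 - t1) * (g t1 + m * (t2 - t1))" by (simp add: algebra_simps)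
  finally show ?thesis using t by simp
 qed
 then have h2: "h t2 > 0" using neg by (simp add: h_def)
 have ch: "continuous_on {t1..t3} h" unfolding h_def by (intro continuous_intros c)
 have "\<exists>x\<in>{t1..t3}. \<forall>y\<in>{t1..t3}. h y <= h x"
  by (rule continuous_attains_sup) (use ch t in auto)
 then obtain x where x: "x : {t1..t3}" "!!y. y : {t1..t3} ==> h y <= h x" by blast
 define Z where "Z = {t : {t1..t3}. h t = h x}"
 have "closed Z" unfolding Z_def by (rule continuous_closed_preimage_constant[OF ch]) auto
 moreover have Zx: "x : Z" "bdd_below Z" using x by (auto simp: Z_def intro: bdd_belowI[of _ t1])
 ultimately have z: "Inf Z : Z" by (intro closed_contains_Inf) auto
 define z where "z = Inf Z"
 have hz: "h z = h x" "z : {t1..t3}" using z by (auto simp: Z_def z_def)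
 have "h x > 0" using x(2)[of t2] h2 t by auto
 then have zin: "t1 < z" "z < t3" using hz h13 by (auto simp: less_le)
 obtain d s1 s2 where d: "d > 0" "s1 <= s2" "!!t. z - d < t ==> t < z ==> g t = g z + s1 * (t - z)"
   "!!t. z < t ==> t < z + d ==> g t = g z + s2 * (t - z)"
  using loc[OF zin] by blast
 define e where "e = min (d/2) (min ((z - t1)/2) ((t3 - z)/2))"
 have e: "0 < e" "e < d" "t1 < z - e" "z + e < t3" using d zin by (auto simp: e_def min_def field_simps)
 have "h (z - e) < h x"
 proof -
  have "h (z - e) <= h x" using x(2) e zin by auto
  moreover have "h (z - e) ~= h x"
  proof
   assume "h (z - e) = h x"
   then have "z - e : Z" using e zin by (auto simp: Z_def)
   then have "z <= z - e" unfolding z_def using Zx(2) by (intro cInf_lower)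
   then show False using e by simp
  qed
  ultimately show ?thesis by simp
 qed
 moreover have "h (z - e) = h z - (s1 - m) * e"
  using d(3)[of "z - e"] e by (simp add: h_def algebra_simps)
 ultimately have s1: "s1 > m" using e hz by (simp add: zero_less_mult_iff)
 have "h (z + e) <= h x" using x(2) e zin by auto
 moreover have "h (z + e) = h z + (s2 - m) * e"
  using d(4)[of "z + e"] e by (simp add: h_def algebra_simps)
 ultimately have "s2 <= m" using e hz by (simp add: mult_le_0_iff)
 with s1 d(2) show False by simp
qed

definition lin :: "real \<times> real \<times> real => plane => real" where
 "lin L x = fst L + fst (snd L) * fst x + snd (snd L) * snd x"

lemma lin_continuous: "continuous_on A (lin L)"
 unfolding lin_def[abs_def] by (intro continuous_intros)

text \<open>Lines of slope \<open>m\<close> are indexed by their intercept \<open>y\<close> and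
  parametrised by the abscissa \<open>t\<close>, so that Lebesgue measure on the reals speaks about
  almost every parallel. Vertical lines are missing, but the directions \<open>z\<close> with
  \<open>fst z = 0\<close> form a null set.\<close>

definition pt :: "real => real => real => plane" where
 "pt m y t = (t, y + m * t)"

lemma pt_simps[simp]: "fst (pt m y t) = t" "snd (pt m y t) = y + m * t"
 by (auto simp: pt_def)

lemma emeasure_affine_vimage:
 fixes A :: "plane set"
 assumes A: "A : sets borel" and s: "0 < s"
 shows "emeasure lborel A = ennreal (s\<^sup>2) * emeasure lborel ((%z. x + s *. z) -` A)"
proof -
 have "emeasure lborel A = emeasure (density (distr lborel borel (%z. x + s *. z)) (%_. ennreal (\<bar>s\<bar> ^ DIM(plane)))) A"
  using lborel_affine[of s x] s by simp
 also have "... = ennreal (\<bar>s\<bar> ^ DIM(plane)) * emeasure (distr lborel borel (%z. x + s *. z)) A"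
  using A by (subst emeasure_density_const) auto
 also have "... = ennreal (s\<^sup>2) * emeasure lborel ((%z. x + s *. z) -` A)"
  using A by (subst emeasure_distr) (auto simp: power2_eq_square)
 finally show ?thesis .
qed

text \<open>\<open>submean\<close> is what the mean value inequality of the Airy functions becomes
  in the limit. The integrable majorant \<open>h\<close> avoids any mention of \<open>W\<close>
  outside \<open>U\<close>, where it is uncontrolled, and affine functions may be subtracted because
  they are harmonic.\<close>

locale pw_affine =
 fixes c0 :: "plane" and R B :: real and U :: "plane set" and W :: "plane => real"
 assumes U_open: "open U" and U_sub: "U <= ball c0 R"
  and loc_aff: "!!x. x : U ==> \<exists>r>0. \<exists>L. ball x r <= U & (\<forall>y\<in>ball x r. W y = lin L y)"
  and bd: "!!x. x : U ==> \<bar>W x\<bar> <= B"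
  and submean: "!!x s L h. x : U ==> 0 < s ==> cball x s <= ball c0 R ==> integ h ==>
    (!!z. norm z < 1 ==> x + s *. z : U ==> rwt 1 z * (W (x + s *. z) - lin L (x + s *. z)) <= h z) ==>
    (!!z. 1 <= norm z ==> 0 <= h z) ==>
    (W x - lin L x) * rwt_mass 1 <= integral\<^sup>L lborel h"
begin

text \<open>The piece on which one affine formula is valid locally. The pieces are open and pairwise
  disjoint, hence at most countably many are nonempty; exceptional null sets for pairs of formulas
  can therefore be united.\<close>

definition Ul :: "real \<times> real \<times> real => plane set" where
 "Ul L = {x. \<exists>r>0. ball x r <= U & (\<forall>y\<in>ball x r. W y = lin L y)}"

lemma Ul_open: "open (Ul L)"
 unfolding open_contains_ball
proof
 fix x assume "x : Ul L"
 then obtain r where r: "r > 0" "ball x r <= U" "\<forall>y\<in>ball x r. W y = lin L y" by (auto simp: Ul_def)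
 have "y : Ul L" if "y : ball x r" for y
 proof -
  from openE[OF open_ball that] obtain e where "e > 0" "ball y e <= ball x r" .
  then show ?thesis using r unfolding Ul_def by blast
 qed
 then show "\<exists>e>0. ball x e <= Ul L" using r by blast
qed

lemma Ul_subset: "Ul L <= U"
 unfolding Ul_def using centre_in_ball by blast

lemma Ul_eq: "x : Ul L ==> W x = lin L x"
 unfolding Ul_def using centre_in_ball by blast

lemma Ul_cover: "x : U ==> \<exists>L. x : Ul L"
 unfolding Ul_def using loc_aff by blast

lemma Ul_unique: assumes "x : Ul L" "x : Ul L'" shows "L = L'"
proof -
 obtain e where e: "e > 0" "ball x e <= Ul L \<inter> Ul L'"
  using open_Int[OF Ul_open Ul_open, of L L'] assms open_contains_ball by (metis IntI)
 have eq: "lin L y = lin L' y" if "y : ball x e" for y using e(2) that Ul_eq by (metis Int_iff subsetD)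
 obtain x1 x2 where x: "x = (x1, x2)" by (cases x)
 have 1: "lin L (x1, x2) = lin L' (x1, x2)" using eq[of x] e by (simp add: x)
 have 2: "lin L (x1 + e/2, x2) = lin L' (x1 + e/2, x2)" using eq[of "(x1 + e/2, x2)"] e by (simp add: x dist_norm norm_Pair)
 have 3: "lin L (x1, x2 + e/2) = lin L' (x1, x2 + e/2)" using eq[of "(x1, x2 + e/2)"] e by (simp add: x dist_norm norm_Pair)
 obtain a b c a' b' c' where L: "L = (a, b, c)" "L' = (a', b', c')" by (cases L, cases L') auto
 have "b * (e/2) = b' * (e/2)" "c * (e/2) = c' * (e/2)"
  using 1 2 3 unfolding lin_def L fst_conv snd_conv distrib_left by linarith+
 then have "b = b'" "c = c'" using e by auto
 then show ?thesis using 1 by (simp add: lin_def L)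
qed

text \<open>\<open>Ul L\<close> and the union of the other pieces are open, disjoint, and cover
  \<open>U\<close>.\<close>

lemma Ul_connected:
 assumes "connected A" "A <= U" "x : A" "x : Ul L"
 shows "A <= Ul L"
proof (rule ccontr)
 assume n: "\<not> A <= Ul L"
 let ?O = "\<Union>L'\<in>{L'. L' ~= L}. Ul L'"
 have "open ?O" using Ul_open by blast
 moreover have sub: "A <= Ul L \<union> ?O"
 proof
  fix y assume "y : A"
  then obtain L' where "y : Ul L'" using assms(2) Ul_cover by (meson subsetD)
  then show "y : Ul L \<union> ?O" by blast
 qed
 moreover have "Ul L \<inter> ?O \<inter> A = {}"
 proof -
  have "False" if "y : Ul L" "y : Ul L'" "L' ~= L" for y L' using Ul_unique[OF that(1,2)] that(3) by simp
  then show ?thesis by blast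
 qed
 ultimately have "Ul L \<inter> A = {} \<or> ?O \<inter> A = {}" by (intro connectedD[OF assms(1) Ul_open])
 then show False using assms(3,4) n sub by blast
qed

lemma Ul_countable: "countable {L. Ul L ~= {}}"
proof -
 have "countable (Ul ` {L. Ul L ~= {}})"
 proof (rule countable_disjoint_open_subsets)
  have "disjnt (Ul L) (Ul L')" if "Ul L ~= Ul L'" for L L'
   using Ul_unique that unfolding disjnt_def by blast
  then show "pairwise disjnt (Ul ` {L. Ul L ~= {}})" unfolding pairwise_def by blast
 qed (use Ul_open in blast)
 moreover have "inj_on Ul {L. Ul L ~= {}}" by (rule inj_onI) (use Ul_unique in blast)
 ultimately show ?thesis by (rule countable_image_inj_on)
qed

text \<open>A transition from \<open>L1\<close> to \<open>L2\<close> along a line, recorded by the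
  intercept of the line. The uniform one-sided length \<open>\<delta>\<close> allows all these lines
  to be compared on one disk; arbitrary transitions are exhausted by
  \<open>\<delta> = 1 / (n + 1)\<close>.\<close>

definition kinks :: "real => real \<times> real \<times> real => real \<times> real \<times> real => real => real set" where
 "kinks m L1 L2 \<delta> = {y. \<exists>t. pt m y t : ball c0 R & lin L1 (pt m y t) = lin L2 (pt m y t) &
   (\<forall>s. 0 < s & s < \<delta> --> pt m y (t - s) : Ul L1 & pt m y (t + s) : Ul L2)}"

text \<open>The change of the derivative in direction \<open>(1, m)\<close>; negative values belong
  to concave transitions.\<close>

definition slope_jump :: "real => real \<times> real \<times> real => real \<times> real \<times> real => real" where
 "slope_jump m L1 L2 = (fst (snd L2) + m * snd (snd L2)) - (fst (snd L1) + m * snd (snd L1))"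

lemma lin_diff_pt: "lin L2 (pt m y t) - lin L1 (pt m y t) = (fst L2 - fst L1) + (snd (snd L2) - snd (snd L1)) * y + slope_jump m L1 L2 * t"
 by (simp add: lin_def slope_jump_def algebra_simps)

text \<open>The tube lemma: projection along a compact factor is a closed map.\<close>

lemma open_forall_compact:
 fixes f :: "plane => plane"
 assumes "compact K" "open G" "contU f"
 shows "open {y. \<forall>s\<in>K. f (s, y) : G}"
proof -
 have "closed (f -` (- G))" using assms by (intro closed_vimage) auto
 from closed_compact_projection[OF assms(1) this]
 have "open (- {y. \<exists>s. s : K & (s, y) : f -` (- G)})" by auto
 moreover have "- {y. \<exists>s. s : K & (s, y) : f -` (- G)} = {y. \<forall>s\<in>K. f (s, y) : G}" by auto
 ultimately show ?thesis by simp
qed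

text \<open>A nonzero jump determines the abscissa of the transition as an affine function
  \<open>\<tau>\<close> of the intercept. After inserting it, the condition for all
  \<open>0 < s < \<delta>\<close> is a countable intersection over compact ranges of
  \<open>s\<close>, and each of these conditions is open in \<open>y\<close>.\<close>

lemma kinks_borel:
 assumes th: "slope_jump m L1 L2 ~= 0" and d: "0 < \<delta>"
 shows "kinks m L1 L2 \<delta> : sets borel"
proof -
 define \<tau> where "\<tau> y = - ((fst L2 - fst L1) + (snd (snd L2) - snd (snd L1)) * y) / slope_jump m L1 L2" for y
 have tau: "lin L1 (pt m y t) = lin L2 (pt m y t) \<longleftrightarrow> t = \<tau> y" for y t
 proof -
  have "lin L1 (pt m y t) = lin L2 (pt m y t) \<longleftrightarrow> lin L2 (pt m y t) - lin L1 (pt m y t) = 0" by auto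
  also have "... \<longleftrightarrow> t = \<tau> y" unfolding lin_diff_pt \<tau>_def using th by (auto simp: field_simps)
  finally show ?thesis .
 qed
 have ct: "contU \<tau>" unfolding \<tau>_def using th by (intro continuous_intros) auto
 let ?K = "%j::nat. {\<delta> / (real j + 2) .. \<delta> - \<delta> / (real j + 2)}"
 have "kinks m L1 L2 \<delta> = {y. pt m y (\<tau> y) : ball c0 R} \<inter>
   (\<Inter>j. {y. \<forall>s\<in>?K j. pt m y (\<tau> y - s) : Ul L1} \<inter> {y. \<forall>s\<in>?K j. pt m y (\<tau> y + s) : Ul L2})" (is "_ = ?X")
 proof -
  have "(\<forall>s. 0 < s & s < \<delta> --> Q s) \<longleftrightarrow> (\<forall>j. \<forall>s\<in>?K j. Q s)" for Q
  proof safe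
   fix j s assume "\<forall>s. 0 < s & s < \<delta> --> Q s" "s : ?K j"
   moreover have "0 < \<delta> / (real j + 2)" using d by simp
   ultimately show "Q s" by auto
  next
   fix s assume a: "\<forall>j. \<forall>s\<in>?K j. Q s" "0 < s" "s < \<delta>"
   define e where "e = min s (\<delta> - s) / \<delta>"
   have e: "0 < e" using a d by (auto simp: e_def)
   obtain j :: nat where "1 / e < real j" using reals_Archimedean2 by blast
   then have "1 / e < real j + 2" by simp
   then have "1 / (real j + 2) < e" using e by (simp add: field_simps)
   then have "\<delta> * (1 / (real j + 2)) < \<delta> * e" using d by (intro mult_strict_left_mono)
   then have "\<delta> / (real j + 2) < \<delta> * e" by simp
   also have "\<delta> * e = min s (\<delta> - s)" using d by (simp add: e_def)
   finally have "s : ?K j" by auto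
   then show "Q s" using a by blast
  qed
  then show ?thesis unfolding kinks_def tau by auto
 qed
 moreover have "?X : sets borel"
 proof (intro sets.Int sets.countable_INT'')
  have "open ((%y. pt m y (\<tau> y)) -` ball c0 R)"
   unfolding pt_def by (intro continuous_open_vimage continuous_intros ct) auto
  then show "{y. pt m y (\<tau> y) : ball c0 R} : sets borel" by (simp add: vimage_def)
  have cc: "contU (%x. \<tau> (snd x))" by (intro continuous_on_compose2[OF ct] continuous_intros) auto
  have c1: "contU (%x. (\<tau> (snd x) - fst x, snd x + m * (\<tau> (snd x) - fst x)))"
   and c2: "contU (%x. (\<tau> (snd x) + fst x, snd x + m * (\<tau> (snd x) + fst x)))"
   by (intro continuous_on_Pair continuous_on_add continuous_on_diff continuous_on_mult cc continuous_on_const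
     continuous_on_fst continuous_on_snd continuous_on_id)+
  show "{y. \<forall>s\<in>?K j. pt m y (\<tau> y - s) : Ul L1} : sets borel" for j
   using open_forall_compact[OF compact_Icc Ul_open c1] unfolding pt_def by (intro borel_open) simp
  show "{y. \<forall>s\<in>?K j. pt m y (\<tau> y + s) : Ul L2} : sets borel" for j
   using open_forall_compact[OF compact_Icc Ul_open c2] unfolding pt_def by (intro borel_open) simp
 qed auto
 ultimately show ?thesis by simp
qed

text \<open>On such a line \<open>W\<close> is the minimum of the two formulas near a concave
  transition. The distance to the transition is measured by \<open>lin L2 - lin L1\<close>, which
  vanishes there and has slope \<open>slope_jump m L1 L2\<close> along the line.\<close>

lemma near_kink:
 assumes th: "slope_jump m L1 L2 < 0" and y: "snd x - m * fst x : kinks m L1 L2 \<delta>" and xU: "x : U"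
  and d: "\<bar>lin L2 x - lin L1 x\<bar> < \<delta> * \<bar>slope_jump m L1 L2\<bar>"
 shows "W x <= lin L1 x" "lin L2 x < lin L1 x ==> W x = lin L2 x"
proof -
 define y where "y = snd x - m * fst x"
 define t where "t = fst x"
 have x: "x = pt m y t" by (simp add: pt_def y_def t_def)
 obtain t' where t': "lin L1 (pt m y t') = lin L2 (pt m y t')"
   "!!s. 0 < s ==> s < \<delta> ==> pt m y (t' - s) : Ul L1 & pt m y (t' + s) : Ul L2"
  using assms(2) unfolding kinks_def y_def by blast
 have dx: "lin L2 x - lin L1 x = slope_jump m L1 L2 * (t - t')"
  using lin_diff_pt[of L2 m y t L1] lin_diff_pt[of L2 m y t' L1] t'(1) unfolding x by (simp add: algebra_simps)
 then have "\<bar>t - t'\<bar> < \<delta>" using d th by (simp add: abs_mult mult.commute)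
 then have "W x <= lin L1 x & (lin L2 x < lin L1 x --> W x = lin L2 x)"
 proof (cases t t' rule: linorder_cases)
  case less
  then have "x : Ul L1" using t'(2)[of "t' - t"] \<open>\<bar>t - t'\<bar> < \<delta>\<close> by (simp add: x)
  moreover have "0 < slope_jump m L1 L2 * (t - t')" using th less by (simp add: mult_neg_neg)
  ultimately show ?thesis using Ul_eq dx by auto
 next
  case greater
  then have "x : Ul L2" using t'(2)[of "t - t'"] \<open>\<bar>t - t'\<bar> < \<delta>\<close> by (simp add: x)
  moreover have "slope_jump m L1 L2 * (t - t') < 0" using th greater by (simp add: mult_neg_pos)
  ultimately show ?thesis using Ul_eq[of x L2] dx by auto
 next
  \<comment> \<open>At the transition itself only the hypothesis \<open>x : U\<close> speaks about
    \<open>W\<close>: it is affine near \<open>x\<close> and agrees with \<open>L1\<close> at two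
    points of the line to the left, hence at \<open>x\<close>.\<close>
  case equal
  obtain L where L: "x : Ul L" using Ul_cover[OF xU] by blast
  then obtain r where r: "0 < r" "ball x r <= Ul L" using Ul_open open_contains_ball by metis
  define s where "s = min (\<delta> / 2) (r / (2 * (1 + \<bar>m\<bar>)))"
  have dpos: "0 < \<delta>" using \<open>\<bar>t - t'\<bar> < \<delta>\<close> by linarith
  have "0 < r / (2 * (1 + \<bar>m\<bar>))" using r by (intro divide_pos_pos) auto
  moreover have "s <= \<delta> / 2" unfolding s_def by (rule min.cobounded1)
  ultimately have s: "0 < s" "s < \<delta>" using dpos by (auto simp: s_def)
  have sr: "s * (1 + \<bar>m\<bar>) < r"
  proof -
   have "s * (1 + \<bar>m\<bar>) <= r / (2 * (1 + \<bar>m\<bar>)) * (1 + \<bar>m\<bar>)" by (intro mult_right_mono) (auto simp: s_def)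
   also have "... = r / 2"
    unfolding times_divide_eq_left by (rule mult_divide_mult_cancel_right) auto
   finally show ?thesis using r by simp
  qed
  have inb: "pt m y (t - s') : ball x r" if "0 < s'" "s' <= s" for s'
  proof -
   have "norm (x - pt m y (t - s')) <= \<bar>s'\<bar> + \<bar>m * s'\<bar>"
    using norm_Pair_le[of s' "m * s'"] by (simp add: x pt_def algebra_simps)
   also have "... = s' * (1 + \<bar>m\<bar>)" using that by (simp add: abs_mult algebra_simps)
   also have "... <= s * (1 + \<bar>m\<bar>)" using that by (intro mult_right_mono) auto
   finally show ?thesis using sr by (simp add: dist_norm)
  qed
  have "lin L (pt m y (t - s')) = lin L1 (pt m y (t - s'))" if "0 < s'" "s' <= s" for s'
  proof -
   have "pt m y (t - s') : Ul L" using inb that r by blast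
   moreover have "pt m y (t - s') : Ul L1" using t'(2)[of s'] that s equal by auto
   ultimately show ?thesis using Ul_eq by metis
  qed
  from this[of s] this[of "s/2"] have "lin L x = lin L1 x"
   using s by (simp add: x lin_def algebra_simps)
  moreover have "lin L2 x = lin L1 x" using dx equal by simp
  ultimately show ?thesis using Ul_eq[OF L] by simp
 qed
 then show "W x <= lin L1 x" "lin L2 x < lin L1 x ==> W x = lin L2 x" by auto
qed


lemma lin_diff_le:
 "\<bar>(lin L2 x - lin L1 x) - (lin L2 x' - lin L1 x')\<bar>
  <= (\<bar>fst (snd L2) - fst (snd L1)\<bar> + \<bar>snd (snd L2) - snd (snd L1)\<bar>) * norm (x - x')"
proof -
 have "(lin L2 x - lin L1 x) - (lin L2 x' - lin L1 x') =
   (fst (snd L2) - fst (snd L1)) * fst (x - x') + (snd (snd L2) - snd (snd L1)) * snd (x - x')"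
  by (simp add: lin_def algebra_simps)
 also have "\<bar>...\<bar> <= \<bar>fst (snd L2) - fst (snd L1)\<bar> * norm (x - x') + \<bar>snd (snd L2) - snd (snd L1)\<bar> * norm (x - x')"
  by (rule order_trans[OF abs_triangle_ineq]) (auto simp only: abs_mult intro!: add_mono mult_left_mono abs_fst_snd_le_norm abs_ge_zero)
 finally show ?thesis by (simp add: distrib_right)
qed

text \<open>Fubini: lines of slope \<open>m\<close> through the disk have intercepts within
  \<open>(1 + \<bar>m\<bar>) * r\<close> of \<open>y0\<close>, so each vertical slice of the bad set
  lies in a translate of the set of bad intercepts, and the slices range over an interval of length
  \<open>2 * r\<close>.\<close>

lemma bad_strip_emeasure:
 assumes P: "P : sets borel" and r: "0 < r" and k: "0 <= \<kappa>"
  and y0: "y0 = snd p0 - m * fst p0"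
  and dens: "measure lborel (cball y0 ((1 + \<bar>m\<bar>) * r) - P) <= \<kappa> * ((1 + \<bar>m\<bar>) * r)"
 shows "emeasure lborel {x : ball p0 r. snd x - m * fst x ~: P} <= ennreal (2 * \<kappa> * (1 + \<bar>m\<bar>) * r\<^sup>2)"
proof -
 let ?bad = "{x : ball p0 r. snd x - m * fst x ~: P}"
 let ?Q = "cball y0 ((1 + \<bar>m\<bar>) * r) - P"
 have [measurable]: "P : sets borel" "ball p0 r : sets borel" using P by auto
 have Qm[measurable]: "?Q : sets borel" using P by auto
 have "?bad = ball p0 r \<inter> ((%x. snd x - m * fst x) -` (- P))" by auto
 moreover have "(%x::plane. snd x - m * fst x) -` (- P) : sets borel"
 proof -
  have "(%x::plane. snd x - m * fst x) : borel_fun"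
   by (intro borel_measurable_continuous_onI continuous_intros)
  from measurable_sets[OF this, of "- P"] show ?thesis using P by simp
 qed
 ultimately have bm[measurable]: "?bad : sets borel" by auto
 have "emeasure lborel ?Q ~= \<infinity>"
  using emeasure_mono[of ?Q "cball y0 ((1 + \<bar>m\<bar>) * r)" lborel] emeasure_lborel_cball_finite[of y0 "(1 + \<bar>m\<bar>) * r"]
  by (auto simp: top_unique)
 then have Q: "emeasure lborel ?Q <= ennreal (\<kappa> * ((1 + \<bar>m\<bar>) * r))"
  using dens by (simp add: emeasure_eq_ennreal_measure ennreal_leI)
 have "emeasure lborel ?bad = (NNI x. indicator ?bad x)"
  by (rule nn_integral_indicator[symmetric]) (use bm in simp)
 also have "... = (NNI s. (NNI v. indicator ?bad (s, v)))"
  by (rule nn_integral_pair) measurable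
 also have "... <= (NNI s. ennreal (\<kappa> * ((1 + \<bar>m\<bar>) * r)) * indicator (cball (fst p0) r) s)"
 proof (intro nn_integral_mono)
  fix s :: real
  show "(NNI v. indicator ?bad (s, v)) <= ennreal (\<kappa> * ((1 + \<bar>m\<bar>) * r)) * indicator (cball (fst p0) r) s"
  proof (cases "\<bar>s - fst p0\<bar> <= r")
   case True
   have "(NNI v. indicator ?bad (s, v)) <= (NNI v. indicator ?Q (v - m * s))"
   proof (intro nn_integral_mono)
    fix v
    have "v - m * s : ?Q" if "(s, v) : ?bad"
    proof -
     have "norm ((s, v) - p0) < r" using that by (simp add: dist_norm norm_minus_commute)
     then have *: "\<bar>s - fst p0\<bar> <= r" "\<bar>v - snd p0\<bar> <= r" using abs_fst_snd_le_norm[of "(s, v) - p0"] by auto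
     have "v - m * s - y0 = (v - snd p0) - m * (s - fst p0)" by (simp add: y0 algebra_simps)
     also have "\<bar>...\<bar> <= \<bar>v - snd p0\<bar> + \<bar>m\<bar> * \<bar>s - fst p0\<bar>" by (metis abs_mult abs_triangle_ineq4)
     also have "... <= r + \<bar>m\<bar> * r" using * by (intro add_mono mult_left_mono) auto
     finally show ?thesis using that by (auto simp: dist_real_def algebra_simps)
    qed
    then show "indicator ?bad (s, v) <= (indicator ?Q (v - m * s) :: ennreal)" by (auto simp: indicator_def)
   qed
   also have "... = emeasure lborel ?Q"
    by (subst nn_integral_shift) (auto intro!: borel_measurable_indicator Qm)
   finally show ?thesis using Q True by (simp add: dist_real_def abs_minus_commute)
  next
   case False
   have "(s, v) ~: ?bad" for v
   proof
    assume "(s, v) : ?bad"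
    then have "norm ((s, v) - p0) < r" by (simp add: dist_norm norm_minus_commute)
    then show False using abs_fst_snd_le_norm[of "(s, v) - p0"] False by auto
   qed
   then have "indicator ?bad (s, v) = (0::ennreal)" for v by (rule indicator_simps(2))
   then show ?thesis by simp
  qed
 qed
 also have "... = ennreal (\<kappa> * ((1 + \<bar>m\<bar>) * r)) * ennreal (2 * r)"
  using r by (subst nn_integral_cmult_indicator) (auto simp: cball_eq_atLeastAtMost)
 also have "... = ennreal (2 * \<kappa> * (1 + \<bar>m\<bar>) * r\<^sup>2)"
  using k r by (simp flip: ennreal_mult add: power2_eq_square algebra_simps)
 finally show ?thesis .
qed

text \<open>The weight is \<open>4 * (1 - |z|^2)\<close> on the unit disk, which at
  \<open>norm z = 5/8\<close> still equals \<open>39/16\<close>. The upper bound serves for crude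
  estimates, the lower one for the gain behind a kink.\<close>

lemma rwt1_bounds: "rwt 1 z <= 4" "norm z <= 5/8 ==> 2 <= rwt 1 z"
proof -
 show "rwt 1 z <= 4" by (simp add: rwt_def)
 assume "norm z <= 5/8"
 then have "(norm z)\<^sup>2 <= (5/8)\<^sup>2" by (intro power_mono) auto
 then have "z .* z <= 25/64" by (simp add: dot_square_norm power2_eq_square)
 then show "2 <= rwt 1 z" by (simp add: rwt_def max_def)
qed


text \<open>Suppose \<open>y0\<close> is a density point of the concave transitions and
  \<open>p0\<close> the transition point on its line. On good lines the excess
  \<open>W - lin L1\<close> is at most 0, so only the few bad lines count in the mean value
  inequality, and halving the radius divides the bound of the excess by 4 (\<open>iter\<close>). At
  a point shortly before \<open>p0\<close> the excess is 0, whereas behind \<open>p0\<close> it is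
  negative of the order of the radius; the mean value inequality bounds this linear dip by the
  quadratic excess (\<open>main\<close>), which is impossible at small scales.\<close>

lemma kink_null:
 assumes th: "slope_jump m L1 L2 < 0" and d: "0 < \<delta>"
 shows "AE y in lborel. y ~: kinks m L1 L2 \<delta>"
proof -
 define P where "P = kinks m L1 L2 \<delta>"
 have Pb: "P : sets borel" unfolding P_def using th d by (intro kinks_borel) auto
 define \<theta> where "\<theta> = - slope_jump m L1 L2"
 have \<theta>: "0 < \<theta>" using th by (simp add: \<theta>_def)
 define c where "c = 1 + \<bar>m\<bar>"
 have c: "1 <= c" by (simp add: c_def)
 define e :: "plane" where "e = (1, m)"
 have e1: "1 <= norm e" using norm_fst_le[of "1::real" m] by (simp add: e_def)
 define u where "u x = lin L2 x - lin L1 x" for x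
 define Ld where "Ld = \<bar>fst (snd L2) - fst (snd L1)\<bar> + \<bar>snd (snd L2) - snd (snd L1)\<bar>"
 have Ld0: "0 <= Ld" by (simp add: Ld_def)
 have uL: "\<bar>u x - u x'\<bar> <= Ld * norm (x - x')" for x x'
  unfolding u_def Ld_def by (rule lin_diff_le)
 have ue: "u (x + t *. e) = u x - \<theta> * t" for x t
  by (simp add: u_def lin_def e_def \<theta>_def slope_jump_def algebra_simps)
 \<comment> \<open>The bound \<open>1/8\<close> keeps \<open>G\<close> within radius
   \<open>5/8\<close>, where the weight is at least 2. The other bound keeps the variation of
   \<open>u\<close> over the rescaled \<open>G\<close> below two thirds of its size at the
   centre.\<close>
 define \<sigma> where "\<sigma> = min (1/8) (\<theta> / (4 * norm e * (Ld + 1)))"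
 have \<sigma>: "0 < \<sigma>" "\<sigma> <= 1/8"
 proof -
  show "\<sigma> <= 1/8" unfolding \<sigma>_def by (rule min.cobounded1)
  have "0 < norm e" using e1 by linarith
  then have "0 < \<theta> / (4 * norm e * (Ld + 1))" using \<theta> Ld0 by simp
  then show "0 < \<sigma>" by (simp add: \<sigma>_def)
 qed
 have L\<sigma>: "Ld * \<sigma> <= \<theta> / (4 * norm e)"
 proof -
  have "Ld * \<sigma> <= (Ld + 1) * (\<theta> / (4 * norm e * (Ld + 1)))"
   using \<sigma> Ld0 by (intro mult_mono) (auto simp: \<sigma>_def)
  also have "... = \<theta> / (4 * norm e)" using Ld0 by simp
  finally show ?thesis .
 qed
 \<comment> \<open>Centre of the region of gain: seen from the point \<open>x\<close> of the last
   step, \<open>G\<close> lies on the \<open>L2\<close> side of the kink.\<close>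
 define ce where "ce = (1 / (2 * norm e)) *. e"
 have nce: "norm ce = 1/2" using e1 by (auto simp: ce_def)
 define G where "G = ball ce \<sigma>"
 have G58: "norm z <= 5/8" if "z : G" for z
 proof -
  have "norm z <= norm ce + norm (z - ce)" by (metis add.commute diff_add_cancel norm_triangle_ineq)
  then show ?thesis using that \<sigma> nce by (auto simp: G_def dist_norm norm_minus_commute)
 qed
 define g where "g = measure lborel G"
 have Gfin: "emeasure lborel G ~= \<infinity>" "emeasure lborel (ball 0 1 :: plane set) ~= \<infinity>"
  unfolding G_def using emeasure_lborel_ball_finite[of ce \<sigma>] emeasure_lborel_ball_finite[of "0 :: plane" 1] by auto
 have g: "0 < g"
 proof -
  have "G ~= {}" using \<sigma> unfolding G_def by auto
  then have "\<not> negligible G" by (intro open_not_negligible) (auto simp: G_def)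
  then have "emeasure lborel G ~= 0" by (auto simp: negligible_iff_null_sets null_sets_def G_def)
  then show ?thesis using Gfin unfolding g_def by (simp add: measure_def enn2real_positive_iff top.not_eq_extremum zero_less_iff_neq_zero)
 qed
 define \<omega> where "\<omega> = measure lborel (ball 0 1 :: plane set)"
 have \<omega>: "0 <= \<omega>" by (simp add: \<omega>_def)
 define ma where "ma = rwt_mass 1"
 have ma: "0 < ma" unfolding ma_def by (rule rwt_mass_pos) simp
 \<comment> \<open>The bad part of a rescaled unit disk has measure at most
   \<open>8 * c * \<kappa>\<close>. The first bound makes its contribution, with weight at most 4,
   no more than a quarter of the mass \<open>ma\<close>; the second leaves at least half of
   \<open>G\<close> good.\<close>
 define \<kappa> where "\<kappa> = min (ma / (128 * c)) (g / (16 * c))"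
 have \<kappa>: "0 < \<kappa>" "32 * c * \<kappa> <= ma / 4" "8 * c * \<kappa> <= g / 2"
 proof -
  show "0 < \<kappa>" using ma g c by (simp add: \<kappa>_def)
  have "\<kappa> <= ma / (128 * c)" "\<kappa> <= g / (16 * c)" unfolding \<kappa>_def by auto
  then show "32 * c * \<kappa> <= ma / 4" "8 * c * \<kappa> <= g / 2" using c by (auto simp: field_simps)
 qed
 have False if y0: "y0 : P" and r0: "0 < r0" "!!r. 0 < r ==> r <= r0 ==> measure lborel (cball y0 r - P) <= \<kappa> * r" for y0 r0
 proof -
  obtain t0 where t0: "pt m y0 t0 : ball c0 R" "lin L1 (pt m y0 t0) = lin L2 (pt m y0 t0)"
    "!!s. 0 < s ==> s < \<delta> ==> pt m y0 (t0 - s) : Ul L1"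
   using y0 unfolding P_def kinks_def by blast
  define p0 where "p0 = pt m y0 t0"
  have y0p: "y0 = snd p0 - m * fst p0" by (simp add: p0_def)
  have u0: "u p0 = 0" using t0(2) by (simp add: u_def p0_def)
  obtain \<rho> where \<rho>: "0 < \<rho>" "cball p0 \<rho> <= ball c0 R"
   using t0(1) open_contains_cball[of "ball c0 R"] unfolding p0_def by blast
  \<comment> \<open>Four demands: the disks stay in the domain, \<open>u\<close> stays in the range
    of \<open>near_kink\<close>, the density bound is available up to radius \<open>c * r1\<close>,
    and the \<open>L1\<close> segment of length \<open>\<delta>\<close> is long enough.\<close>
  define r1 where "r1 = min (min (\<rho> / 2) (\<delta> * \<theta> / (Ld + 1))) (min (r0 / c) \<delta>)"
  have r1: "0 < r1" using \<rho> d \<theta> Ld0 r0 c by (auto simp: r1_def intro!: divide_pos_pos)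
  have r1le: "r1 <= \<rho> / 2" "r1 <= \<delta> * \<theta> / (Ld + 1)" "r1 <= r0 / c" "r1 <= \<delta>"
   unfolding r1_def by (meson min.cobounded1 min.cobounded2 order_trans)+
  have ud: "\<bar>u x\<bar> < \<delta> * \<theta>" if "x : ball p0 r1" for x
  proof -
   have nx: "norm (x - p0) < r1" using that by (simp add: dist_norm norm_minus_commute)
   have "\<bar>u x\<bar> <= Ld * norm (x - p0)" using uL[of x p0] u0 by simp
   also have "... <= Ld * r1" using nx Ld0 by (intro mult_left_mono) auto
   also have "... < (Ld + 1) * r1" using r1 by simp
   also have "... <= \<delta> * \<theta>" using r1le(2) Ld0 by (simp add: pos_le_divide_eq mult.commute)
   finally show ?thesis .
  qed
  have good: "W x - lin L1 x <= 0" "u x < 0 ==> W x - lin L1 x = u x" if "x : U" "x : ball p0 r1" "snd x - m * fst x : P" for x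
   using near_kink[OF th that(3)[unfolded P_def] that(1)] ud[OF that(2)] \<theta> unfolding \<theta>_def u_def by auto
  define B' where "B' = B + (\<bar>fst L1\<bar> + (\<bar>fst (snd L1)\<bar> + \<bar>snd (snd L1)\<bar>) * (norm c0 + R)) + 1"
  have B': "W x - lin L1 x <= B'" if "x : U" for x
  proof -
   have "x : ball c0 R" using that U_sub by blast
   then have nx: "norm x <= norm c0 + R" using norm_triangle_ineq2[of x c0] by (simp add: dist_norm norm_minus_commute)
   then have "\<bar>fst x\<bar> <= norm c0 + R" "\<bar>snd x\<bar> <= norm c0 + R" using abs_fst_snd_le_norm[of x] by auto
   then have "\<bar>fst (snd L1) * fst x\<bar> <= \<bar>fst (snd L1)\<bar> * (norm c0 + R)" "\<bar>snd (snd L1) * snd x\<bar> <= \<bar>snd (snd L1)\<bar> * (norm c0 + R)"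
    by (auto simp only: abs_mult intro!: mult_left_mono)
   then show ?thesis using bd[OF that] unfolding B'_def lin_def by (simp add: distrib_right)
  qed
  have B'0: "0 <= B'"
  proof -
   have "pt m y0 (t0 - \<delta>/2) : U" using t0(3)[of "\<delta>/2"] d by (intro subsetD[OF Ul_subset]) auto
   then have "\<bar>W (pt m y0 (t0 - \<delta>/2))\<bar> <= B" "pt m y0 (t0 - \<delta>/2) : ball c0 R"
    using bd U_sub by blast+
   then have "0 <= B" "0 <= R"
    using zero_le_dist[of c0 "pt m y0 (t0 - \<delta>/2)"] unfolding mem_ball by linarith+
   then have "0 <= B" "0 <= norm c0 + R" by auto
   moreover from this have "0 <= (\<bar>fst (snd L1)\<bar> + \<bar>snd (snd L1)\<bar>) * (norm c0 + R)"
    by (intro mult_nonneg_nonneg) auto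
   ultimately show ?thesis unfolding B'_def by linarith
  qed
  have bad: "emeasure lborel {x : ball p0 r. snd x - m * fst x ~: P} <= ennreal (2 * \<kappa> * c * r\<^sup>2)" if "0 < r" "r <= r1" for r
   unfolding c_def
  proof (rule bad_strip_emeasure[OF Pb that(1) _ y0p])
   show "0 <= \<kappa>" using \<kappa> by simp
   have "r <= r0 / c" using that r1le(3) by linarith
   then have "c * r <= r0" using c by (simp add: pos_le_divide_eq mult.commute)
   then show "measure lborel (cball y0 ((1 + \<bar>m\<bar>) * r) - P) <= \<kappa> * ((1 + \<bar>m\<bar>) * r)"
    using r0(2)[of "c * r"] that c by (simp add: c_def)
  qed
  define Zb where "Zb x s = {z : ball 0 1. snd (x + s *. z) - m * fst (x + s *. z) ~: P}" for x :: "plane" and s :: real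
  have Zbm: "Zb x s : sets borel" for x s
  proof -
   have "(%z. snd (x + s *. z) - m * fst (x + s *. z)) : borel_fun"
    by (intro borel_measurable_continuous_onI continuous_intros)
   from measurable_sets[OF this, of "- P"] Pb have "(%z. snd (x + s *. z) - m * fst (x + s *. z)) -` (- P) : sets borel" by simp
   moreover have "Zb x s = ball 0 1 \<inter> (%z. snd (x + s *. z) - m * fst (x + s *. z)) -` (- P)" by (auto simp: Zb_def)
   ultimately show ?thesis by auto
  qed
  have Zb_le: "measure lborel (Zb x s) <= 8 * c * \<kappa>" "emeasure lborel (Zb x s) ~= \<infinity>"
   if s: "0 < s" "2 * s <= r1" and x: "ball x s <= ball p0 (2 * s)" for x s
  proof -
   let ?A = "{x : ball p0 (2 * s). snd x - m * fst x ~: P}"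
   have Am: "?A : sets borel"
   proof -
    have "(%x::plane. snd x - m * fst x) : borel_fun"
     by (intro borel_measurable_continuous_onI continuous_intros)
    from measurable_sets[OF this, of "- P"] Pb have "(%x::plane. snd x - m * fst x) -` (- P) : sets borel" by simp
    moreover have "?A = ball p0 (2 * s) \<inter> (%x. snd x - m * fst x) -` (- P)" by auto
    ultimately show ?thesis by auto
   qed
   have sub: "Zb x s <= (%z. x + s *. z) -` ?A"
   proof
    fix z assume z: "z : Zb x s"
    then have "x + s *. z : ball x s" using s by (simp add: Zb_def dist_norm mult_less_cancel_left1)
    then show "z : (%z. x + s *. z) -` ?A" using z x by (auto simp: Zb_def)
   qed
   have vm: "(%z. x + s *. z) -` ?A : sets borel"
    using measurable_sets[of "%z. x + s *. z" borel borel ?A] Am by simp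
   have "ennreal (s\<^sup>2) * emeasure lborel (Zb x s) <= ennreal (s\<^sup>2) * emeasure lborel ((%z. x + s *. z) -` ?A)"
    using sub vm by (intro mult_left_mono emeasure_mono) auto
   also have "... = emeasure lborel ?A" using emeasure_affine_vimage[OF Am s(1)] by simp
   also have "... <= ennreal (2 * \<kappa> * c * (2 * s)\<^sup>2)" using s by (intro bad) auto
   also have "... = ennreal (s\<^sup>2) * ennreal (8 * c * \<kappa>)" using \<kappa> c by (simp flip: ennreal_mult add: power2_eq_square algebra_simps)
   finally have *: "emeasure lborel (Zb x s) <= ennreal (8 * c * \<kappa>)"
    using s by (simp add: ennreal_mult_le_mult_iff)
   then show "emeasure lborel (Zb x s) ~= \<infinity>" by (auto simp: top_unique)
   show "measure lborel (Zb x s) <= 8 * c * \<kappa>" using * \<kappa> c by (simp add: measure_def enn2real_leI)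
  qed
  \<comment> \<open>About a point of the disk of half the radius, the disk of radius
    \<open>s\<close> still lies in the previous one, where the old bound \<open>b\<close> holds; in
    the mean it is spent on bad points only.\<close>
  have iter: "\<forall>x\<in>ball p0 (r1 / 2 ^ k) \<inter> U. W x - lin L1 x <= B' / 4 ^ k" for k
  proof (induction k)
   case 0 then show ?case using B' by auto
  next
   case (Suc k)
   define s where "s = r1 / 2 ^ Suc k"
   have s: "0 < s" "2 * s = r1 / 2 ^ k" "2 * s <= r1" using r1 by (auto simp: s_def field_simps)
   define b where "b = B' / 4 ^ k"
   have b: "0 <= b" using B'0 by (simp add: b_def)
   show ?case
   proof
    fix x assume x: "x : ball p0 (r1 / 2 ^ Suc k) \<inter> U"
    then have xs: "dist p0 x < s" by (simp add: s_def)
    have sub: "ball x s <= ball p0 (2 * s)"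
    proof
     fix z assume "z : ball x s"
     then show "z : ball p0 (2 * s)" using xs dist_triangle[of p0 z x] by auto
    qed
    have csub: "cball x s <= ball c0 R"
    proof
     fix z assume "z : cball x s"
     then have "dist p0 z <= \<rho>" using xs s r1le(1) \<rho>(1) dist_triangle[of p0 z x] by auto
     then show "z : ball c0 R" using \<rho>(2) by auto
    qed
    have "(W x - lin L1 x) * rwt_mass 1 <= (LI z. (4 * b) * indicator (Zb x s) z)"
    proof (rule submean[OF _ s(1) csub])
     show "x : U" using x by simp
     show "integ (%z. (4 * b) * indicator (Zb x s) z)"
      using Zb_le(2)[OF s(1,3) sub] Zbm by (intro integrable_mult_right integrable_real_indicator) (auto simp: top.not_eq_extremum)
     show "0 <= (4 * b) * indicator (Zb x s) z" for z using b by simp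
     fix z :: "plane" assume z: "norm z < 1" "x + s *. z : U"
     have "x + s *. z : ball x s" using z s by (simp add: dist_norm mult_less_cancel_left1)
     then have zin: "x + s *. z : ball p0 (r1 / 2 ^ k)" using sub s(2) by auto
     then have zin1: "x + s *. z : ball p0 r1" using s by auto
     show "rwt 1 z * (W (x + s *. z) - lin L1 (x + s *. z)) <= (4 * b) * indicator (Zb x s) z"
     proof (cases "z : Zb x s")
      case True
      have "W (x + s *. z) - lin L1 (x + s *. z) <= b" using Suc.IH zin z unfolding b_def by blast
      then have "rwt 1 z * (W (x + s *. z) - lin L1 (x + s *. z)) <= rwt 1 z * b"
       by (rule mult_left_mono[OF _ rwt_nonneg])
      also have "... <= 4 * b" using b by (intro mult_right_mono rwt1_bounds)
      finally show ?thesis using True by simp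
     next
      case False
      then have "W (x + s *. z) - lin L1 (x + s *. z) <= 0" using z by (intro good zin1) (auto simp: Zb_def)
      then have "rwt 1 z * (W (x + s *. z) - lin L1 (x + s *. z)) <= 0" by (intro mult_nonneg_nonpos rwt_nonneg)
      then show ?thesis using False by simp
     qed
    qed
    also have "... = 4 * b * measure lborel (Zb x s)" using Zbm by simp
    also have "... <= 4 * b * (8 * c * \<kappa>)" using b Zb_le(1)[OF s(1,3) sub] by (intro mult_left_mono) auto
    also have "... = b * (32 * c * \<kappa>)" by simp
    also have "... <= b * (ma / 4)" using b \<kappa> by (intro mult_left_mono) auto
    finally have "(W x - lin L1 x) * ma <= (b / 4) * ma" by (simp add: ma_def)
    then have "W x - lin L1 x <= b / 4" using ma by simp
    then show "W x - lin L1 x <= B' / 4 ^ Suc k" by (simp add: b_def mult.commute)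
   qed
  qed
  define \<eta> where "\<eta> = \<theta> / (8 * norm e)"
  have \<eta>: "0 < \<eta>" using \<theta> e1 by (auto simp: \<eta>_def intro!: divide_pos_pos)
  have main: "r1 * \<eta> * g / 2 * 2 ^ k <= 4 * B' * \<omega>" for k
  proof -
   define s where "s = r1 / 2 ^ Suc k"
   have s: "0 < s" "2 * s = r1 / 2 ^ k" "2 * s <= r1" using r1 by (auto simp: s_def field_simps)
   define b where "b = B' / 4 ^ k"
   have b: "0 <= b" using B'0 by (simp add: b_def)
   \<comment> \<open>This puts \<open>x\<close> at distance \<open>s / 8\<close> from
     \<open>p0\<close> on the \<open>L1\<close> side and \<open>x + s *. ce\<close> at distance
     \<open>3 * s / 8\<close> on the \<open>L2\<close> side, where \<open>u\<close> equals
     \<open>- 3 * (s * \<eta>)\<close>.\<close>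
   define \<tau> where "\<tau> = s / (8 * norm e)"
   have \<tau>: "0 < \<tau>" "\<tau> * norm e = s / 8" using s e1 by (auto simp: \<tau>_def intro!: divide_pos_pos)
   have "\<tau> <= \<tau> * norm e" using \<tau> e1 by simp
   then have \<tau>\<delta>: "\<tau> < \<delta>" using \<tau> s r1le(4) r1 by linarith
   define x where "x = p0 - \<tau> *. e"
   have xpt: "x = pt m y0 (t0 - \<tau>)" by (simp add: x_def p0_def pt_def e_def algebra_simps)
   have xU: "x : Ul L1" using t0(3)[OF \<tau>(1) \<tau>\<delta>] by (simp add: xpt)
   have xs: "dist p0 x = s / 8" using \<tau> by (simp add: x_def dist_norm)
   have sub: "ball x s <= ball p0 (2 * s)"
   proof
    fix z assume "z : ball x s"
    then show "z : ball p0 (2 * s)" using xs s(1) dist_triangle[of p0 z x] by auto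
   qed
   have csub: "cball x s <= ball c0 R"
   proof
    fix z assume "z : cball x s"
    then have "dist p0 z <= \<rho>" using xs s r1le(1) \<rho>(1) dist_triangle[of p0 z x] by auto
    then show "z : ball c0 R" using \<rho>(2) by auto
   qed
   have uG: "u (x + s *. z) <= - (s * \<eta>)" if z: "z : G" for z
   proof -
    have "u (x + s *. ce) = u (p0 + (s / (2 * norm e) - \<tau>) *. e)" by (simp add: x_def ce_def algebra_simps)
    also have "... = - \<theta> * (s / (2 * norm e) - \<tau>)" using u0 by (simp add: ue)
    also have "... = - 3 * (s * \<eta>)" using e1 by (simp add: \<tau>_def \<eta>_def field_simps)
    finally have 1: "u (x + s *. ce) = - 3 * (s * \<eta>)" .
    have "\<bar>u (x + s *. z) - u (x + s *. ce)\<bar> <= Ld * norm (s *. (z - ce))"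
     using uL[of "x + s *. z" "x + s *. ce"] by (simp add: algebra_simps)
    also have "... <= Ld * (s * \<sigma>)" using z s Ld0 by (intro mult_left_mono) (auto simp: G_def dist_norm norm_minus_commute)
    also have "... <= s * (\<theta> / (4 * norm e))" using mult_left_mono[OF L\<sigma>, of s] s by (simp add: algebra_simps)
    also have "... = 2 * (s * \<eta>)" by (simp add: \<eta>_def)
    finally show ?thesis using 1 by linarith
   qed
   \<comment> \<open>The crude bound \<open>4 * b\<close> on the whole disk, minus a gain on the
     good part of \<open>G\<close>. On bad points off \<open>G\<close> the difference of indicators
     is -1, which only enlarges the majorant.\<close>
   let ?h = "%z. (4 * b) * indicator (ball 0 1) z - (2 * (s * \<eta>)) * (indicator G z - indicator (Zb x s) z)"
   have hi: "has_bochner_integral lborel ?h ((4 * b) * \<omega> - (2 * (s * \<eta>)) * (g - measure lborel (Zb x s)))"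
    unfolding \<omega>_def g_def
    using Zb_le(2)[OF s(1,3) sub] Zbm Gfin
    by (intro has_bochner_integral_diff has_bochner_integral_mult_right has_bochner_integral_real_indicator)
     (auto simp: top.not_eq_extremum G_def)
   have GB: "G <= ball 0 1" using G58 by force
   have ZB: "Zb x s <= ball 0 1" by (auto simp: Zb_def)
   have s\<eta>: "0 <= s * \<eta>" using s \<eta> by simp
   have "(W x - lin L1 x) * rwt_mass 1 <= integral\<^sup>L lborel ?h"
   proof (rule submean[OF _ s(1) csub])
    show "x : U" using xU Ul_subset by blast
    show "integ ?h" using hi by (simp add: has_bochner_integral_iff)
    show "0 <= ?h z" if "1 <= norm z" for z
    proof -
     have "z ~: ball 0 1" using that by simp
     then show ?thesis using GB ZB by (auto simp: indicator_def)
    qed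
    fix z :: "plane" assume z: "norm z < 1" "x + s *. z : U"
    have zb: "z : ball 0 1" using z by simp
    have "x + s *. z : ball x s" using z s by (simp add: dist_norm mult_less_cancel_left1)
    then have zin: "x + s *. z : ball p0 (r1 / 2 ^ k)" using sub s(2) by auto
    then have zin1: "x + s *. z : ball p0 r1" using s by auto
    let ?v = "W (x + s *. z) - lin L1 (x + s *. z)"
    have "?v <= b" using iter[of k] zin z unfolding b_def by blast
    then have "rwt 1 z * ?v <= rwt 1 z * b" by (rule mult_left_mono[OF _ rwt_nonneg])
    also have "... <= 4 * b" using b by (intro mult_right_mono rwt1_bounds)
    finally have le4: "rwt 1 z * ?v <= 4 * b" .
    show "rwt 1 z * ?v <= ?h z"
    proof (cases "z : G & z ~: Zb x s")
     case True
     have un: "u (x + s *. z) < 0" using uG[of z] True s \<eta> by (smt (verit) mult_pos_pos)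
     have "snd (x + s *. z) - m * fst (x + s *. z) : P" using True zb unfolding Zb_def by blast
     then have v: "?v = u (x + s *. z)" using good(2)[OF z(2) zin1 _ un] by simp
     have "rwt 1 z * ?v <= rwt 1 z * (- (s * \<eta>))" unfolding v using uG True by (intro mult_left_mono rwt_nonneg) auto
     also have "... <= 2 * (- (s * \<eta>))" using rwt1_bounds(2)[OF G58] True s\<eta> by (intro mult_right_mono_neg) auto
     also have "... <= ?h z" using True zb b by simp
     finally show ?thesis .
    next
     case False
     then have "indicator G z - indicator (Zb x s) z <= (0::real)" by (auto simp: indicator_def)
     then have "(2 * (s * \<eta>)) * (indicator G z - indicator (Zb x s) z) <= 0" using s\<eta> by (intro mult_nonneg_nonpos) auto
     moreover have "?h z = 4 * b - (2 * (s * \<eta>)) * (indicator G z - indicator (Zb x s) z)"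
      using zb by (simp only: indicator_simps mult_1_right)
     ultimately show ?thesis using le4 by linarith
    qed
   qed
   moreover have "W x - lin L1 x = 0" using Ul_eq[OF xU] by simp
   ultimately have "0 <= (4 * b) * \<omega> - (2 * (s * \<eta>)) * (g - measure lborel (Zb x s))"
    using hi by (simp add: has_bochner_integral_iff)
   moreover have "(2 * (s * \<eta>)) * (g / 2) <= (2 * (s * \<eta>)) * (g - measure lborel (Zb x s))"
    using Zb_le(1)[OF s(1,3) sub] \<kappa>(3) s\<eta> by (intro mult_left_mono) auto
   moreover have "(2 * (s * \<eta>)) * (g / 2) = s * \<eta> * g" by simp
   ultimately have "s * \<eta> * g <= 4 * b * \<omega>" by linarith
   then have "s * \<eta> * g * 4 ^ k <= 4 * b * \<omega> * 4 ^ k" by (intro mult_right_mono) auto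
   also have "4 * b * \<omega> * 4 ^ k = 4 * B' * \<omega>" by (simp add: b_def)
   also have "s * \<eta> * g * 4 ^ k = r1 * \<eta> * g / 2 * 2 ^ k"
   proof -
    have "(4::real) ^ k = 2 ^ k * 2 ^ k" by (simp flip: power_mult_distrib)
    then show ?thesis by (simp add: s_def)
   qed
   finally show ?thesis .
  qed
  \<comment> \<open>The gain is proportional to \<open>r1 / 2^(k+1)\<close> and the error to
    \<open>B' / 4^k\<close>, so \<open>main\<close> bounds a quantity that grows like
    \<open>2^k\<close>.\<close>
  define q where "q = r1 * \<eta> * g / 2"
  have q: "0 < q" using r1 \<eta> g by (simp add: q_def)
  obtain k where "4 * B' * \<omega> / q < 2 ^ k" using real_arch_pow[of 2 "4 * B' * \<omega> / q"] by auto
  then have "4 * B' * \<omega> < q * 2 ^ k" using q by (simp add: divide_less_eq mult.commute)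
  then show False using main[of k] by (simp add: q_def)
 qed
 then have "P <= {y : P. \<forall>r0>0. \<exists>r. 0 < r & r <= r0 & measure lborel (cball y r - P) > \<kappa> * r}"
  by (auto simp: not_le[symmetric])
 then have "negligible P" using small_balls_density_points[OF Pb \<kappa>(1)] negligible_subset by blast
 then have "P : null_sets lborel" using Pb by (simp add: negligible_iff_null_sets null_sets_def)
 then show ?thesis unfolding P_def by (rule AE_not_in)
qed

end


context pw_affine begin

text \<open>Off the countably many null sets of \<open>kink_null\<close> a line carries no concave
  transition. The Lipschitz bound extends \<open>W\<close> continuously over the finitely many
  points of the line that are missing from \<open>U\<close>, a single affine formula holds on either
  side of each point, and the local criterion for the chord inequality applies.\<close>

lemma line_convex:
 assumes fin: "AE y in lborel. finite {t. pt m y t : ball c0 R - U}"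
  and lip: "AE y in lborel. \<forall>\<alpha> \<beta>. (\<forall>t\<in>{\<alpha>..\<beta>}. pt m y t : ball c0 R) -->
    (\<exists>K. \<forall>t\<in>{\<alpha>..\<beta>}. \<forall>t'\<in>{\<alpha>..\<beta>}. pt m y t : U --> pt m y t' : U --> \<bar>W (pt m y t) - W (pt m y t')\<bar> <= K * \<bar>t - t'\<bar>)"
 shows "AE y in lborel. \<forall>t1 t2 t3. t1 < t2 --> t2 < t3 --> pt m y t1 : U --> pt m y t2 : U --> pt m y t3 : U -->
   W (pt m y t2) <= ((t3 - t2) * W (pt m y t1) + (t2 - t1) * W (pt m y t3)) / (t3 - t1)"
proof -
 define I where "I = {L. Ul L ~= {}} \<times> {L. Ul L ~= {}} \<times> (UNIV :: nat set)"
 have "countable I" unfolding I_def by (intro countable_SIGMA Ul_countable) auto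
 then have "AE y in lborel. \<forall>i\<in>I. slope_jump m (fst i) (fst (snd i)) < 0 --> y ~: kinks m (fst i) (fst (snd i)) (inverse (real (Suc (snd (snd i)))))"
  by (subst AE_ball_countable) (auto intro!: kink_null)
 with fin lip show ?thesis
 proof eventually_elim
  fix y
  assume fin: "finite {t. pt m y t : ball c0 R - U}"
   and lip: "\<forall>\<alpha> \<beta>. (\<forall>t\<in>{\<alpha>..\<beta>}. pt m y t : ball c0 R) -->
    (\<exists>K. \<forall>t\<in>{\<alpha>..\<beta>}. \<forall>t'\<in>{\<alpha>..\<beta>}. pt m y t : U --> pt m y t' : U --> \<bar>W (pt m y t) - W (pt m y t')\<bar> <= K * \<bar>t - t'\<bar>)"
   and nk: "\<forall>i\<in>I. slope_jump m (fst i) (fst (snd i)) < 0 --> y ~: kinks m (fst i) (fst (snd i)) (inverse (real (Suc (snd (snd i)))))"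
  show "\<forall>t1 t2 t3. t1 < t2 --> t2 < t3 --> pt m y t1 : U --> pt m y t2 : U --> pt m y t3 : U -->
   W (pt m y t2) <= ((t3 - t2) * W (pt m y t1) + (t2 - t1) * W (pt m y t3)) / (t3 - t1)"
  proof (intro allI impI)
   fix t1 t2 t3 assume t: "t1 < t2" "t2 < t3" and U1: "pt m y t1 : U" and U2: "pt m y t2 : U" and U3: "pt m y t3 : U"
   have seg: "pt m y t : ball c0 R" if t': "t : {t1..t3}" for t
   proof -
    define l where "l = (t - t1) / (t3 - t1)"
    have l: "0 <= l" "l <= 1" using t' t by (auto simp: l_def)
    have "l * (t3 - t1) = t - t1" using t by (simp add: l_def)
    then have lt: "t = (1 - l) * t1 + l * t3" by (simp add: algebra_simps)
    have "pt m y t = (1 - l) *. pt m y t1 + l *. pt m y t3"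
     unfolding lt pt_def by (simp add: algebra_simps)
    moreover have "pt m y t1 : ball c0 R" "pt m y t3 : ball c0 R" using U1 U3 U_sub by blast+
    ultimately show ?thesis using convexD_alt[OF convex_ball _ _ l, of "pt m y t1" c0 R "pt m y t3"] by simp
   qed
   define F where "F = {t : {t1..t3}. pt m y t ~: U}"
   have F: "finite F" by (rule finite_subset[OF _ fin]) (use seg in \<open>auto simp: F_def\<close>)
   obtain K where K: "!!t t'. t : {t1..t3} ==> t' : {t1..t3} ==> pt m y t : U ==> pt m y t' : U ==> \<bar>W (pt m y t) - W (pt m y t')\<bar> <= K * \<bar>t - t'\<bar>"
   proof -
    have "\<forall>t\<in>{t1..t3}. pt m y t : ball c0 R" using seg by blast
    with spec[OF spec[OF lip, of t1], of t3]
    have "\<exists>K. \<forall>t\<in>{t1..t3}. \<forall>t'\<in>{t1..t3}. pt m y t : U --> pt m y t' : U --> \<bar>W (pt m y t) - W (pt m y t')\<bar> <= K * \<bar>t - t'\<bar>"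
     by (rule mp)
    then obtain K0 where K0: "\<forall>t\<in>{t1..t3}. \<forall>t'\<in>{t1..t3}. pt m y t : U --> pt m y t' : U --> \<bar>W (pt m y t) - W (pt m y t')\<bar> <= K0 * \<bar>t - t'\<bar>" ..
    show thesis by (rule that[of K0]) (use K0 in simp)
   qed
   let ?X = "{t1..t3} - F"
   have XU: "pt m y t : U" if "t : ?X" for t using that by (auto simp: F_def)
   have "(max K 0)-lipschitz_on ?X (%t. W (pt m y t))"
   proof (rule lipschitz_onI)
    fix s t assume st: "s : ?X" "t : ?X"
    have "\<bar>W (pt m y s) - W (pt m y t)\<bar> <= K * \<bar>s - t\<bar>" using K[of s t] st XU by auto
    also have "... <= max K 0 * \<bar>s - t\<bar>" by (intro mult_right_mono) auto
    finally show "dist (W (pt m y s)) (W (pt m y t)) <= max K 0 * dist s t" by (simp add: dist_real_def)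
   qed auto
   \<comment> \<open>At the points of \<open>F\<close> the values of \<open>W\<close> carry no
     information; the extension \<open>g\<close> replaces them.\<close>
   from lipschitz_extend_closure[OF this]
   obtain g where g: "(max K 0)-lipschitz_on (closure ?X) g" "!!t. t : ?X ==> g t = W (pt m y t)" by blast
   have cl: "{t1..t3} <= closure ?X"
   proof
    fix p assume p: "p : {t1..t3}"
    show "p : closure ?X" unfolding closure_approachable
    proof (intro allI impI)
     fix e :: real assume e: "0 < e"
     have "\<exists>a b. a < b & {a<..<b} <= {t1..t3} \<inter> ball p e"
     proof (cases "p < t3")
      case True
      then show ?thesis using p e by (intro exI[of _ p] exI[of _ "min t3 (p + e)"]) (auto simp: dist_real_def)
     next
      case False
      then show ?thesis using p e t by (intro exI[of _ "max t1 (p - e)"] exI[of _ p]) (auto simp: dist_real_def)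
     qed
     then obtain a b where ab: "a < b" "{a<..<b} <= {t1..t3} \<inter> ball p e" by blast
     have "infinite ({a<..<b} - F)" using ab F by (intro Diff_infinite_finite) auto
     then obtain q where "q : {a<..<b} - F" by (metis equals0I infinite_imp_nonempty)
     then show "\<exists>q\<in>?X. dist q p < e" using ab by (intro bexI[of _ q]) (auto simp: dist_commute)
    qed
   qed
   have cg: "continuous_on {t1..t3} g"
    using lipschitz_on_continuous_on[OF g(1)] cl by (rule continuous_on_subset)
   have "g t2 <= ((t3 - t2) * g t1 + (t2 - t1) * g t3) / (t3 - t1)"
   proof (rule chord_inequality_from_local[OF cg t])
    fix p assume p: "t1 < p" "p < t3"
    have "finite (F - {p})" using F by simp
    then obtain d0 where d0: "0 < d0" "!!x. x : F - {p} ==> d0 <= dist p x"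
     using finite_set_avoid[of "F - {p}" p] by auto
    define d where "d = min d0 (min (p - t1) (t3 - p))"
    have d: "0 < d" "d <= d0" "d <= p - t1" "d <= t3 - p" using d0 p by (auto simp: d_def)
    have inX: "s : ?X" if "\<bar>s - p\<bar> < d" "s ~= p" for s
     using d0(2)[of s] that d by (auto simp: dist_real_def)
    \<comment> \<open>A half-neighbourhood of \<open>p\<close> without \<open>p\<close> is connected
      and avoids \<open>F\<close>, so it stays in one piece.\<close>
    have one_side: "\<exists>L. Ul L ~= {} & (\<forall>s\<in>A. pt m y s : Ul L)" if A: "connected A" "A ~= {}" "A <= {s. \<bar>s - p\<bar> < d & s ~= p}" for A
    proof -
     have "connected (pt m y ` A)" unfolding pt_def by (intro connected_continuous_image A continuous_intros)
     moreover have sub: "pt m y ` A <= U" using A(3) inX XU by blast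
     moreover obtain s where s: "s : A" using A(2) by blast
     moreover obtain L where L: "pt m y s : Ul L" using sub s Ul_cover by blast
     ultimately have "pt m y ` A <= Ul L" by (intro Ul_connected) auto
     then show ?thesis using L by blast
    qed 
    have "{p - d<..<p} ~= {}" "{p<..<p + d} ~= {}" using d by auto
    then have "\<exists>L. Ul L ~= {} & (\<forall>s\<in>{p - d<..<p}. pt m y s : Ul L)" "\<exists>L. Ul L ~= {} & (\<forall>s\<in>{p<..<p + d}. pt m y s : Ul L)"
     by (intro one_side; auto)+
    then obtain L1 L2 where L1: "Ul L1 ~= {}" "!!s. s : {p - d<..<p} ==> pt m y s : Ul L1"
     and L2: "Ul L2 ~= {}" "!!s. s : {p<..<p + d} ==> pt m y s : Ul L2"
     by blast
    have gL1: "g s = lin L1 (pt m y s)" if "s : {p - d<..<p}" for s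
     using g(2)[of s] inX[of s] that Ul_eq[OF L1(2)[OF that]] by (auto simp: abs_less_iff)
    have gL2: "g s = lin L2 (pt m y s)" if "s : {p<..<p + d}" for s
     using g(2)[of s] inX[of s] that Ul_eq[OF L2(2)[OF that]] by (auto simp: abs_less_iff)
    have icg: "isCont g p" using cg p by (intro continuous_on_interior[OF cg]) auto
    have cl: "isCont (%s. lin L (pt m y s)) p" for L unfolding lin_def pt_simps by (intro continuous_intros)
    have gp1: "g p = lin L1 (pt m y p)"
    proof (rule tendsto_unique[of "at_left p"])
     show "(g \<longlongrightarrow> g p) (at_left p)" using icg by (auto simp: isCont_def intro: tendsto_mono[OF at_le])
     have "((%s. lin L1 (pt m y s)) \<longlongrightarrow> lin L1 (pt m y p)) (at_left p)"
      using cl[of L1] by (auto simp: isCont_def intro: tendsto_mono[OF at_le])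
     moreover have "\<forall>\<^sub>F s in at_left p. lin L1 (pt m y s) = g s"
      using eventually_at_left_real[of "p - d" p] d by (auto elim!: eventually_mono simp: gL1)
     ultimately show "(g \<longlongrightarrow> lin L1 (pt m y p)) (at_left p)" by (rule Lim_transform_eventually)
    qed auto
    have gp2: "g p = lin L2 (pt m y p)"
    proof (rule tendsto_unique[of "at_right p"])
     show "(g \<longlongrightarrow> g p) (at_right p)" using icg by (auto simp: isCont_def intro: tendsto_mono[OF at_le])
     have "((%s. lin L2 (pt m y s)) \<longlongrightarrow> lin L2 (pt m y p)) (at_right p)"
      using cl[of L2] by (auto simp: isCont_def intro: tendsto_mono[OF at_le])
     moreover have "\<forall>\<^sub>F s in at_right p. lin L2 (pt m y s) = g s"
      using eventually_at_right_real[of p "p + d"] d by (auto elim!: eventually_mono simp: gL2)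
     ultimately show "(g \<longlongrightarrow> lin L2 (pt m y p)) (at_right p)" by (rule Lim_transform_eventually)
    qed auto
    define sl where "sl L = fst (snd L) + m * snd (snd L)" for L :: "real \<times> real \<times> real"
    have lins: "lin L (pt m y s) = lin L (pt m y p) + sl L * (s - p)" for L s
     by (simp add: lin_def sl_def algebra_simps)
    have "sl L1 <= sl L2"
    proof (rule ccontr)
     assume "\<not> sl L1 <= sl L2"
     then have neg: "slope_jump m L1 L2 < 0" by (simp add: slope_jump_def sl_def)
     obtain n where n: "inverse (real (Suc n)) < d" using reals_Archimedean[OF d(1)] by blast
     have "y : kinks m L1 L2 (inverse (real (Suc n)))"
      unfolding kinks_def
     proof (intro CollectI exI[of _ p] conjI allI impI)
      show "pt m y p : ball c0 R" using seg p by simp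
      show "lin L1 (pt m y p) = lin L2 (pt m y p)" using gp1 gp2 by simp
      fix s assume s: "0 < s & s < inverse (real (Suc n))"
      show "pt m y (p - s) : Ul L1" using s n by (intro L1(2)) auto
      show "pt m y (p + s) : Ul L2" using s n by (intro L2(2)) auto
     qed
     moreover have "(L1, L2, n) : I" using L1(1) L2(1) by (simp add: I_def)
     ultimately show False using bspec[OF nk, of "(L1, L2, n)"] neg by simp
    qed
    moreover have "\<forall>s. p - d < s & s < p --> g s = g p + sl L1 * (s - p)"
    proof (intro allI impI)
     fix s assume "p - d < s & s < p"
     then show "g s = g p + sl L1 * (s - p)" using gL1[of s] lins[of L1 s] gp1 by simp
    qed
    moreover have "\<forall>s. p < s & s < p + d --> g s = g p + sl L2 * (s - p)"
    proof (intro allI impI)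
     fix s assume "p < s & s < p + d"
     then show "g s = g p + sl L2 * (s - p)" using gL2[of s] lins[of L2 s] gp2 by simp
    qed
    ultimately have conj: "sl L1 <= sl L2 & (\<forall>t. p - d < t & t < p --> g t = g p + sl L1 * (t - p)) &
      (\<forall>t. p < t & t < p + d --> g t = g p + sl L2 * (t - p))" by (intro conjI)
    have ex: "\<exists>s1 s2. s1 <= s2 & (\<forall>t. p - d < t & t < p --> g t = g p + s1 * (t - p)) &
      (\<forall>t. p < t & t < p + d --> g t = g p + s2 * (t - p))"
     by (rule exI[of _ "sl L1"], rule exI[of _ "sl L2"], rule conj)
    show "\<exists>d>0. \<exists>s1 s2. s1 <= s2 & (\<forall>t. p - d < t & t < p --> g t = g p + s1 * (t - p)) &
      (\<forall>t. p < t & t < p + d --> g t = g p + s2 * (t - p))"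
     by (rule exI[of _ d], rule conjI, rule d(1), rule ex)
   qed
   moreover have "t1 : ?X" "t2 : ?X" "t3 : ?X" using t U1 U2 U3 by (auto simp: F_def)
   ultimately show "W (pt m y t2) <= ((t3 - t2) * W (pt m y t1) + (t2 - t1) * W (pt m y t3)) / (t3 - t1)"
    using g(2) by simp
  qed
 qed
qed

text \<open>The chord inequality holds on almost every, hence on a dense set of parallels, and
  \<open>W\<close> is continuous on \<open>U\<close>; so every line inherits it. Rays from a common
  centre require this, since each slope contributes a single line, which may be exceptional.\<close>

lemma radial_convex:
 assumes lc: "!!m. AE y in lborel. \<forall>t1 t2 t3. t1 < t2 --> t2 < t3 --> pt m y t1 : U --> pt m y t2 : U --> pt m y t3 : U -->
   W (pt m y t2) <= ((t3 - t2) * W (pt m y t1) + (t2 - t1) * W (pt m y t3)) / (t3 - t1)"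
  and s: "s1 < s2" "s2 < s3" and z: "fst z ~= 0"
  and U: "x + s1 *. z : U" "x + s2 *. z : U" "x + s3 *. z : U"
 shows "W (x + s2 *. z) <= ((s3 - s2) * W (x + s1 *. z) + (s2 - s1) * W (x + s3 *. z)) / (s3 - s1)"
proof -
 have contW: "isCont W v" if v: "v : U" for v
 proof -
  obtain r L where r: "r > 0" "\<forall>y\<in>ball v r. W y = lin L y" using loc_aff[OF v] by blast
  have "\<forall>\<^sub>F y in nhds v. W y = lin L y"
   using eventually_nhds_in_open[of "ball v r" v] r by (auto elim: eventually_mono)
  moreover have "isCont (lin L) v" using lin_continuous[of UNIV L] continuous_on_eq_continuous_at[OF open_UNIV] by blast
  ultimately show ?thesis using isCont_cong[of W "lin L" v] by blast
 qed
 define m where "m = snd z / fst z"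
 have mz: "snd z = m * fst z" using z by (simp add: m_def)
 define y0 where "y0 = snd x - m * fst x"
 have ptx: "x + s *. z = pt m y0 (fst x + s * fst z)" for s
  by (simp add: prod_eq_iff y0_def mz algebra_simps)
 let ?N = "{y. \<forall>t1 t2 t3. t1 < t2 --> t2 < t3 --> pt m y t1 : U --> pt m y t2 : U --> pt m y t3 : U -->
   W (pt m y t2) <= ((t3 - t2) * W (pt m y t1) + (t2 - t1) * W (pt m y t3)) / (t3 - t1)}"
 define v where "v s y = pt m y (fst x + s * fst z)" for s y
 have ineq: "W (v s2 y) <= ((s3 - s2) * W (v s1 y) + (s2 - s1) * W (v s3 y)) / (s3 - s1)"
  if y: "y : ?N" and Uy: "v s1 y : U" "v s2 y : U" "v s3 y : U" for y
 proof (cases "0 < fst z")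
  case True
  let ?t = "%s. fst x + s * fst z"
  have "?t s1 < ?t s2" "?t s2 < ?t s3" using s True by auto
  then have "W (v s2 y) <= ((?t s3 - ?t s2) * W (v s1 y) + (?t s2 - ?t s1) * W (v s3 y)) / (?t s3 - ?t s1)"
   using y Uy unfolding v_def by blast
  also have "(?t s3 - ?t s2) * W (v s1 y) + (?t s2 - ?t s1) * W (v s3 y) = fst z * ((s3 - s2) * W (v s1 y) + (s2 - s1) * W (v s3 y))"
   by (simp add: algebra_simps)
  also have "?t s3 - ?t s1 = fst z * (s3 - s1)" by (simp add: algebra_simps)
  finally show ?thesis using True by simp
 next
  \<comment> \<open>The abscissa now runs backwards along the ray, which exchanges the roles of
    \<open>s1\<close> and \<open>s3\<close>.\<close>
  case False
  then have neg: "fst z < 0" using z by simp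
  let ?t = "%s. fst x + s * fst z"
  have "?t s3 < ?t s2" "?t s2 < ?t s1" using s neg by (auto simp: mult_less_cancel_right)
  then have "W (v s2 y) <= ((?t s1 - ?t s2) * W (v s3 y) + (?t s2 - ?t s3) * W (v s1 y)) / (?t s1 - ?t s3)"
   using y Uy unfolding v_def by blast
  also have "(?t s1 - ?t s2) * W (v s3 y) + (?t s2 - ?t s3) * W (v s1 y) = (- fst z) * ((s3 - s2) * W (v s1 y) + (s2 - s1) * W (v s3 y))"
   by (simp add: algebra_simps)
  also have "?t s1 - ?t s3 = (- fst z) * (s3 - s1)" by (simp add: algebra_simps)
  finally show ?thesis using neg by simp
 qed
 have dense: "\<exists>y\<in>?N. \<bar>y - y0\<bar> < e" if e: "0 < e" for e
 proof (rule ccontr)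
  assume n: "\<not> ?thesis"
  have "AE y in lborel. y ~: ball y0 e"
   using lc[of m]
  proof eventually_elim
   case (elim y)
   then have "y : ?N" by blast
   then have "\<not> \<bar>y - y0\<bar> < e" using n by blast
   then show ?case by (simp add: dist_real_def abs_minus_commute)
  qed
  then have "emeasure lborel (ball y0 e) = 0" by (subst (asm) AE_iff_measurable[of "ball y0 e"]) auto
  then show False using e by (simp add: ball_eq_greaterThanLessThan)
 qed
 have "\<exists>y\<in>?N. \<bar>y - y0\<bar> < inverse (real (Suc n))" for n by (rule dense) simp
 then have "\<forall>n. \<exists>y. y : ?N & \<bar>y - y0\<bar> < inverse (real (Suc n))" by blast
 from choice[OF this] obtain Y where Y': "\<forall>n. Y n : ?N & \<bar>Y n - y0\<bar> < inverse (real (Suc n))" ..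
 then have Y: "!!n. Y n : ?N" "!!n. \<bar>Y n - y0\<bar> < inverse (real (Suc n))" by blast+
 have Ylim: "Y ~~> y0"
 proof (rule LIM_zero_cancel, rule Lim_null_comparison[OF _ LIMSEQ_inverse_real_of_nat])
  show "\<forall>\<^sub>F n in sequentially. norm (Y n - y0) <= inverse (real (Suc n))"
   using Y(2) by (intro always_eventually) (auto intro: less_imp_le)
 qed
 have vlim: "(%n. v s (Y n)) ~~> x + s *. z" for s
  unfolding ptx v_def pt_def by (intro tendsto_intros Ylim)
 have evU: "\<forall>\<^sub>F n in sequentially. v s (Y n) : U" if "x + s *. z : U" for s
  using topological_tendstoD[OF vlim U_open that] .
 have Wlim: "(%n. W (v s (Y n))) ~~> W (x + s *. z)" if "x + s *. z : U" for s
  using isCont_tendsto_compose[OF contW[OF that] vlim] .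
 show ?thesis
 proof (rule tendsto_le[OF _ _ Wlim[OF U(2)]])
  show "(%n. ((s3 - s2) * W (v s1 (Y n)) + (s2 - s1) * W (v s3 (Y n))) / (s3 - s1)) ~~>
    ((s3 - s2) * W (x + s1 *. z) + (s2 - s1) * W (x + s3 *. z)) / (s3 - s1)"
   using s by (intro tendsto_intros Wlim U) auto
  show "\<forall>\<^sub>F n in sequentially. W (v s2 (Y n)) <= ((s3 - s2) * W (v s1 (Y n)) + (s2 - s1) * W (v s3 (Y n))) / (s3 - s1)"
   using evU[OF U(1)] evU[OF U(2)] evU[OF U(3)] by eventually_elim (use Y(1) ineq in blast)
 qed simp
qed

end


section \<open>Monotonicity for limits of Airy functions\<close>

text \<open>The shear that maps \<open>(t, y)\<close> to \<open>(t, y + m * t)\<close> preserves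
  area.\<close>

lemma nn_integral_lines:
 fixes g :: "plane => ennreal"
 assumes g: "g : borel_fun"
 shows "(NNI x. g x) = (NNI y. (NNI t. g (pt m y t)))"
  and "(%y. NNI t. g (pt m y t)) : borel_fun"
proof -
 note [measurable] = g
 define G where "G x = g (fst x, snd x + m * fst x)" for x
 have Gm[measurable]: "G : borel_fun"
  unfolding G_def by (rule measurable_compose[OF _ g], rule borel_measurable_continuous_onI) (intro continuous_intros)
 have Gp: "G (t, y) = g (pt m y t)" for t y by (simp add: G_def pt_def)
 have "(NNI y. (NNI t. g (pt m y t))) = (NNI x. G x)"
  using nn_integral_pair(2)[OF Gm] by (simp add: Gp)
 also have "... = (NNI t. (NNI y. G (t, y)))" by (rule nn_integral_pair(1)[OF Gm])
 also have "... = (NNI t. (NNI v. g (t, v)))"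
 proof (rule nn_integral_cong)
  fix t :: real
  have "(%v. g (t, v)) : borel_fun" by measurable
  from nn_integral_shift[OF this, of "- (m * t)"]
  show "(NNI y. G (t, y)) = (NNI v. g (t, v))" by (simp add: G_def)
 qed
 also have "... = (NNI x. g x)" by (rule nn_integral_pair(1)[OF g, symmetric])
 finally show "(NNI x. g x) = (NNI y. (NNI t. g (pt m y t)))" by simp
 show "(%y. NNI t. g (pt m y t)) : borel_fun"
  using slice_integral_measurable(2)[OF Gm] by (simp add: Gp)
qed

lemma null_of_finite_lines:
 fixes N :: "plane set"
 assumes N: "N : sets borel" and fin: "AE y in lborel. finite {t. pt 0 y t : N}"
 shows "emeasure lborel N = 0"
proof -
 have "emeasure lborel N = (NNI x. indicator N x)" by (rule nn_integral_indicator[symmetric]) (use N in simp)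
 also have "... = (NNI y. (NNI t. indicator N (pt 0 y t)))"
  by (rule nn_integral_lines) (use N in simp)
 also have "... = (\<integral>\<^sup>+y. 0 \<partial>(lborel :: real measure))"
 proof (rule nn_integral_cong_AE, use fin in eventually_elim)
  fix y assume f: "finite {t. pt 0 y t : N}"
  have "(NNI t. indicator N (pt 0 y t)) = (NNI t. indicator {t. pt 0 y t : N} t)"
   by (intro nn_integral_cong) (auto simp: indicator_def)
  also have "... = emeasure lborel {t. pt 0 y t : N}"
   using borel_closed[OF finite_imp_closed[OF f]] by (intro nn_integral_indicator) simp
  also have "... = 0" using f by (intro emeasure_lborel_countable countable_finite)
  finally show "(NNI t. indicator N (pt 0 y t)) = 0" .
 qed
 finally show ?thesis by simp
qed

text \<open>Convergence is known on \<open>U\<close> only, but the rest of the disk is a null set,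
  so the limit integrand may be set to 0 there. The uniform bound provides the dominating function
  \<open>B * rwt j\<close>.\<close>

lemma radial_average_limit:
 fixes v :: "nat => plane => real" and V :: "plane => real" and j :: nat
 assumes cont: "!!n. continuous_on (ball c0 R) (v n)" and bd: "!!n. \<forall>x\<in>ball c0 R. \<bar>v n x\<bar> <= B"
  and U: "open U" "U <= ball c0 R" and N: "emeasure lborel (ball c0 R - U) = 0"
  and lim: "\<forall>x\<in>U. (%n. v n x) ~~> V x"
  and s: "0 < s" "cball x s <= ball c0 R"
 defines "f \<equiv> %z. if norm z < 1 & x + s *. z : U then rwt j z * V (x + s *. z) else 0"
 shows "integ f" "(%n. LI z. rwt j z * v n (x + s *. z)) ~~> integral\<^sup>L lborel f"
  "AE z in lborel. norm z < 1 --> x + s *. z : U"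
proof -
 have sR: "s < R - dist x c0" using s by (simp add: cball_subset_ball_iff)
 define R0 where "R0 = R - dist x c0"
 have R0: "\<bar>s\<bar> < R0" "ball x R0 <= ball c0 R" using sR s by (auto simp: R0_def ball_subset_ball_iff)
 have inb: "x + s *. z : ball c0 R" if "norm z < 1" for z
 proof -
  have "x + s *. z : cball x s" using that s by (simp add: dist_norm mult_le_cancel_left1)
  then show ?thesis using s by blast
 qed
 define E where "E = {z : ball 0 1. x + s *. z : U}"
 have "open ((%z. x + s *. z) -` U)" by (intro continuous_open_vimage continuous_intros U)
 then have "open (ball 0 1 \<inter> (%z. x + s *. z) -` U)" by (rule open_Int[OF open_ball])
 then have Em: "E : sets borel" unfolding E_def by (auto simp: vimage_def Int_def)
 have "emeasure lborel ((%z. x + s *. z) -` (ball c0 R - U)) = 0"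
  using emeasure_affine_vimage[of "ball c0 R - U" s x] U N s by (auto simp: ennreal_zero_less_mult_iff)
 moreover have "(%z. x + s *. z) -` (ball c0 R - U) : sets borel"
  using measurable_sets[of "%z. x + s *. z" borel borel "ball c0 R - U"] U by simp
 ultimately have "(%z. x + s *. z) -` (ball c0 R - U) : null_sets lborel" by auto
 from AE_not_in[OF this] show ae: "AE z in lborel. norm z < 1 --> x + s *. z : U"
  by eventually_elim (use inb in auto)
 define F where "F n z = indicator E z * (rwt j z * v n (x + s *. z))" for n z
 have cF: "contU (%z. rwt j z * v n (x + s *. z))" for n
  by (rule continuous_cutoff_mult[OF rwt_continuous rwt_zero_outside continuous_on_subset[OF cont R0(2)] R0(1)])
 have Fm: "F n : borel_fun" for n
  unfolding F_def using cF Em by (intro borel_measurable_times borel_measurable_indicator borel_measurable_continuous_onI) auto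
 have Flim: "(%n. F n z) ~~> f z" for z
 proof (cases "z : E")
  case True
  then have "(%n. F n z) = (%n. rwt j z * v n (x + s *. z))" "f z = rwt j z * V (x + s *. z)"
   by (auto simp: F_def f_def E_def)
  moreover have "(%n. rwt j z * v n (x + s *. z)) ~~> rwt j z * V (x + s *. z)"
   using True by (intro tendsto_mult tendsto_const bspec[OF lim]) (auto simp: E_def)
  ultimately show ?thesis by simp
 next
  case False
  then have "F n z = 0" "f z = 0" for n by (auto simp: F_def f_def E_def)
  then show ?thesis by simp
 qed
 have fm: "f : borel_fun"
  by (rule borel_measurable_LIMSEQ_metric[OF Fm Flim])
 have dom: "integ (%z. B * rwt j z)" using rwt_integrable by (intro integrable_mult_right)
 have Fb: "norm (F n z) <= B * rwt j z" for n z
 proof (cases "z : E")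
  case True
  then have "\<bar>v n (x + s *. z)\<bar> <= B" using inb by (intro bspec[OF bd]) (auto simp: E_def)
  then have "rwt j z * \<bar>v n (x + s *. z)\<bar> <= rwt j z * B" by (intro mult_left_mono rwt_nonneg)
  then show ?thesis using True rwt_nonneg[of j z] by (simp add: F_def abs_mult mult.commute)
 next
  case False
  have "x : ball c0 R" by (rule subsetD[OF s(2)]) (use s(1) in simp)
  then have "\<bar>v 0 x\<bar> <= B" using bd by blast
  then have "0 <= B" by linarith
  then show ?thesis using False rwt_nonneg[of j z] by (simp add: F_def)
 qed
 have "integ f"
  by (rule integrable_dominated_convergence[where s=F and w="%z. B * rwt j z"]) (use fm Fm Flim Fb dom in auto)
 then show "integ f" .
 have "(%n. integral\<^sup>L lborel (F n)) ~~> integral\<^sup>L lborel f"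
  by (rule integral_dominated_convergence[where w="%z. B * rwt j z"]) (use fm Fm Flim Fb dom in auto)
 moreover have "integral\<^sup>L lborel (F n) = (LI z. rwt j z * v n (x + s *. z))" for n
 proof (rule integral_cong_AE)
  show "AE z in lborel. F n z = rwt j z * v n (x + s *. z)"
   using ae
  proof eventually_elim
   fix z :: "plane" assume "norm z < 1 --> x + s *. z : U"
   then show "F n z = rwt j z * v n (x + s *. z)"
    by (cases "norm z < 1") (auto simp: F_def E_def rwt_outside indicator_def)
  qed
 qed (use Fm cF in \<open>auto intro: borel_measurable_continuous_onI\<close>)
 ultimately show "(%n. LI z. rwt j z * v n (x + s *. z)) ~~> integral\<^sup>L lborel f" by simp
qed

lemma integral_affine_substitution:
 fixes f :: "plane => real"
 assumes [measurable]: "f : borel_fun" and s: "0 < s"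
 shows "integral\<^sup>L lborel f = s\<^sup>2 * (LI z. f (x + s *. z))"
proof -
 have "integral\<^sup>L lborel f = integral\<^sup>L (density (distr lborel borel (%z. x + s *. z)) (%_. ennreal (s\<^sup>2))) f"
  using lborel_affine[of s x] s by (simp add: power2_eq_square)
 also have "... = (\<integral>z. s\<^sup>2 *. f z \<partial>distr lborel borel (%z. x + s *. z))"
  by (rule integral_density) auto
 also have "... = (LI z. s\<^sup>2 *. f (x + s *. z))"
  by (rule integral_distr) auto
 finally show ?thesis by simp
qed

lemma rcut_radial_mono:
 assumes "0 < s" "s <= t"
 shows "rcut j ((1 / s) *. y) <= rcut j ((1 / t) *. y)"
proof -
 have "1 / t <= 1 / s" using assms by (simp add: frac_le)
 then have "(1 / t) * (1 / t) <= (1 / s) * (1 / s)" using assms by (intro mult_mono) auto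
 then have "((1/t) *. y) .* ((1/t) *. y) <= ((1/s) *. y) .* ((1/s) *. y)"
  using mult_right_mono[of "(1 / t) * (1 / t)" "(1 / s) * (1 / s)" "y .* y"] by (simp add: algebra_simps)
 then have "(((1/t) *. y) .* ((1/t) *. y)) ^ j <= (((1/s) *. y) .* ((1/s) *. y)) ^ j"
  by (intro power_mono) auto
 then show ?thesis unfolding rcut_def by (intro power_mono max.mono) auto
qed

lemma one_le_norm_scaled: "0 < s ==> s <= norm w ==> 1 <= norm ((1 / s) *. w)"
 by (simp add: field_simps)

text \<open>The hypotheses on \<open>w\<close>, \<open>p\<close>, \<open>q\<close>, \<open>a\<close>, \<open>b\<close>, \<open>c\<close> say that \<open>w n\<close> is an Airy function of the \<open>n\<close>-th stress tensor. The
  means of its limit over scaled copies of a radial weight are convex in the scale, because the limit is convex.\<close>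

lemma airy_limit_monotone:
 fixes w p q a b c :: "nat => plane => real"
 assumes A: "!!n. airy (ball c0 R) (w n) (p n) (q n) (a n) (b n) (c n)"
  and pos: "!!n x. x : ball c0 R ==> 0 <= a n x + c n x"
  and M: "0 < M" "!!n. hmass (ball c0 R) (a n) (b n) (c n) < ennreal M"
  and op: "open (ball c0 R - S)"
  and small: "!!K. compact K ==> K <= ball c0 R - S ==> (%n. hmass K (a n) (b n) (c n)) ~~> 0"
  and fin: "!!m. AE y in lborel. finite {t. pt m y t : ball c0 R \<inter> S}"
  and R': "0 < R'" "R' < R" and j: "0 < j"
  and lim: "!!s. 0 < s ==> s < R' ==> (%n. LI y. rcut j ((1 / s) *. (y - c0)) * (a n y + c n y)) ~~> Z s"
  and s: "0 < s" "s <= t" "t < R'"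
 shows "Z s / s <= Z t / t"
proof -
 have bR: "ball c0 R' <= ball c0 R" using R' by auto
 \<comment> \<open>The constant of \<open>airy_affine_approx\<close>. The sequence \<open>w\<close>
   itself may be unbounded, but affine functions can be subtracted without changing the
   Hessian.\<close>
 define B where "B = (1 + 4 * R / (R - R')) * M"
 have "\<exists>L. \<forall>x\<in>ball c0 R'. \<bar>w n x - (fst L + fst (snd L) * fst x + snd (snd L) * snd x)\<bar> <= B" for n
  using airy_affine_approx[OF A[of n] R' M(2)[of n] M(1)] unfolding B_def by auto
 then obtain L0 where L0: "!!n x. x : ball c0 R' ==> \<bar>w n x - (fst (L0 n) + fst (snd (L0 n)) * fst x + snd (snd (L0 n)) * snd x)\<bar> <= B"
  by metis
 define v where "v n x = w n x - (fst (L0 n) + fst (snd (L0 n)) * fst x + snd (snd (L0 n)) * snd x)" for n x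
 define p' where "p' n x = p n x - fst (snd (L0 n))" for n x
 define q' where "q' n x = q n x - snd (snd (L0 n))" for n x
 have A': "airy (ball c0 R) (v n) (p' n) (q' n) (a n) (b n) (c n)" for n
  unfolding v_def p'_def q'_def by (rule airy_minus_affine[OF A])
 have vb: "\<bar>v n x\<bar> <= B" if "x : ball c0 R'" for n x using L0[OF that] by (simp add: v_def)
 define U where "U = ball c0 R' - S"
 have Uo: "open U"
 proof -
  have "U = ball c0 R' \<inter> (ball c0 R - S)" using bR by (auto simp: U_def)
  then show ?thesis using op by auto
 qed
 have Us: "U <= ball c0 R'" by (auto simp: U_def)
 obtain k W where k: "strict_mono (k :: nat => nat)" 
  and Wl: "!!x. x : U ==> (%n. v (k n) x) ~~> W x"
  and Wa: "!!x. x : U ==> \<exists>r>0. \<exists>\<alpha> \<beta> \<gamma>. ball x r <= U & (\<forall>y\<in>ball x r. W y = \<alpha> + \<beta> * fst y + \<gamma> * snd y)"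
 proof (rule affine_locally_constant_limit[of c0 R' v p' q' a b c B S])
  show "airy (ball c0 R') (v n) (p' n) (q' n) (a n) (b n) (c n)" for n
   by (rule airy_subset[OF A' bR])
  show "open (ball c0 R' - S)" using Uo by (simp add: U_def)
  show "(%n. hmass K (a n) (b n) (c n)) ~~> 0" if "compact K" "K <= ball c0 R' - S" for K
   using that bR by (intro small) auto
 qed (use vb that in \<open>auto simp: U_def\<close>)
 have vc: "continuous_on (ball c0 R') (v n)" for n
 proof (intro continuous_at_imp_continuous_on ballI)
  fix x assume "x : ball c0 R'"
  then have "x : ball c0 R" using bR by blast
  then show "isCont (v n) x" by (rule has_grad_isCont[OF airyD(1)[OF A']])
 qed
 have N0: "emeasure lborel (ball c0 R' - U) = 0"
 proof (rule null_of_finite_lines)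
  show "ball c0 R' - U : sets borel" using Uo by auto
  show "AE y in lborel. finite {t. pt 0 y t : ball c0 R' - U}"
   using fin[of 0] by eventually_elim (auto elim!: rev_finite_subset simp: U_def, use R' in linarith)
 qed
 interpret pw_affine c0 R' B U W
 proof
  show "open U" by (rule Uo)
  show "U <= ball c0 R'" by (rule Us)
  show "\<exists>r>0. \<exists>L. ball x r <= U & (\<forall>y\<in>ball x r. W y = lin L y)" if x: "x : U" for x
  proof -
   obtain r \<alpha> \<beta> \<gamma> where "r > 0" "ball x r <= U" "\<forall>y\<in>ball x r. W y = \<alpha> + \<beta> * fst y + \<gamma> * snd y" using Wa[OF x] by blast
   then show ?thesis by (intro exI[of _ r] conjI exI[of _ "(\<alpha>, \<beta>, \<gamma>)"]) (auto simp: lin_def)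
  qed
  show "\<bar>W x\<bar> <= B" if x: "x : U" for x
  proof (rule tendsto_le[OF _ tendsto_const tendsto_rabs[OF Wl[OF x]]])
   have "x : ball c0 R'" using x Us by blast
   then show "\<forall>\<^sub>F n in sequentially. \<bar>v (k n) x\<bar> <= B" using vb by (intro always_eventually allI)
  qed simp
  \<comment> \<open>Subtracting \<open>lin L\<close> keeps the Laplacian nonnegative, so the mean
    value inequality holds with \<open>C = 0\<close> for each \<open>n\<close> and passes to the
    limit by \<open>radial_average_limit\<close>.\<close>
  show "(W x - lin L x) * rwt_mass 1 <= integral\<^sup>L lborel h"
   if x: "x : U" and s: "0 < s" "cball x s <= ball c0 R'" and h: "integ h"
    "!!z. norm z < 1 ==> x + s *. z : U ==> rwt 1 z * (W (x + s *. z) - lin L (x + s *. z)) <= h z"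
    "!!z. 1 <= norm z ==> 0 <= h z" for x s L h
  proof -
   define u where "u n x = v (k n) x - lin L x" for n x
   have Au: "airy (ball c0 R) (u n) (%x. p' (k n) x - fst (snd L)) (%x. q' (k n) x - snd (snd L)) (a (k n)) (b (k n)) (c (k n))" for n
    unfolding u_def lin_def by (rule airy_minus_affine[OF A'])
   have lc: "continuous_on (cball c0 R') (lin L)" by (rule lin_continuous)
   then have "bounded (lin L ` cball c0 R')" by (intro compact_imp_bounded compact_continuous_image) auto
   then obtain Bl where Bl: "\<forall>y\<in>lin L ` cball c0 R'. norm y <= Bl" unfolding bounded_iff by blast
   have ub: "\<bar>u n y\<bar> <= B + Bl" if "y : ball c0 R'" for n y
   proof -
    have "\<bar>lin L y\<bar> <= Bl" using Bl that by auto
    then show ?thesis using vb[OF that, of "k n"] unfolding u_def by linarith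
   qed
   have uc: "continuous_on (ball c0 R') (u n)" for n
    unfolding u_def[abs_def] by (intro continuous_on_diff vc lin_continuous)
   have ul: "(%n. u n y) ~~> W y - lin L y" if "y : U" for y
    unfolding u_def by (intro tendsto_diff Wl that tendsto_const)
   have ub': "!!n. \<forall>y\<in>ball c0 R'. \<bar>u n y\<bar> <= B + Bl" and ul': "\<forall>y\<in>U. (%n. u n y) ~~> W y - lin L y"
    using ub ul by blast+
   note RA = radial_average_limit(1,2)[where j=1, OF uc ub' Uo Us N0 ul' s] radial_average_limit(3)[OF uc ub' Uo Us N0 ul' s]
   define R0 where "R0 = R' - dist x c0"
   have sR0: "s < R0" "ball x R0 <= ball c0 R" "s < R0" "ball x R0 <= ball c0 R'"
    using s R' by (auto simp: R0_def cball_subset_ball_iff ball_subset_ball_iff)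
   have "u n x * rwt_mass 1 <= (LI z. rwt 1 z * u n (x + s *. z))" for n
   proof -
    note D = airyD[OF airy_subset[OF Au[of n] sR0(2)]]
    have "u n x * rwt_mass 1 <= (LI z. rwt 1 z * u n (x + s *. z)) + 0 * s\<^sup>2 / 2 * rcut_mass 1"
    proof (rule weighted_mean_value_inequality[OF D(1) D(2) D(3)])
     show "continuous_on (ball x R0) (a (k n))" "continuous_on (ball x R0) (b (k n))" "continuous_on (ball x R0) (b (k n))" "continuous_on (ball x R0) (c (k n))"
      using D(4-6) by (auto intro: continuous_on_subset)
     show "- 0 <= a (k n) y + c (k n) y" if "y : ball x R0" for y
      using pos[of y "k n"] that sR0 by auto
    qed (use s sR0 in auto)
    then show ?thesis by simp
   qed
   then have "(W x - lin L x) * rwt_mass 1 <= (LI z. (if norm z < 1 & x + s *. z : U then rwt 1 z * (W (x + s *. z) - lin L (x + s *. z)) else 0))"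
    by (intro tendsto_le[OF _ RA(2) tendsto_mult[OF ul[OF x] tendsto_const]] always_eventually) auto
   also have "... <= integral\<^sup>L lborel h"
   proof (rule integral_mono_AE[OF RA(1) h(1)])
    show "AE z in lborel. (if norm z < 1 & x + s *. z : U then rwt 1 z * (W (x + s *. z) - lin L (x + s *. z)) else 0) <= h z"
     using RA(3)
    proof eventually_elim
     fix z assume zU: "norm z < 1 --> x + s *. z : U"
     show "(if norm z < 1 & x + s *. z : U then rwt 1 z * (W (x + s *. z) - lin L (x + s *. z)) else 0) <= h z"
     proof (cases "norm z < 1")
      case True then show ?thesis using h(2)[of z] zU by simp
     next
      case False then show ?thesis using h(3)[of z] by simp
     qed
    qed
   qed
   finally show ?thesis .
  qed
 qed
 \<comment> \<open>For almost every line Fatou bounds the Hessian mass on the line along infinitely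
   many \<open>n\<close>. For these the derivative along the line oscillates by at most
   \<open>c1 * K0\<close>, and somewhere it is at most \<open>2 * B / (\<beta> - \<alpha>)\<close>
   by the mean value theorem. The sum is a Lipschitz constant that the limit keeps.\<close>
 have lip: "AE y in lborel. \<forall>\<alpha> \<beta>. (\<forall>t\<in>{\<alpha>..\<beta>}. pt m y t : ball c0 R') -->
    (\<exists>K. \<forall>t\<in>{\<alpha>..\<beta>}. \<forall>t'\<in>{\<alpha>..\<beta>}. pt m y t : U --> pt m y t' : U --> \<bar>W (pt m y t) - W (pt m y t')\<bar> <= K * \<bar>t - t'\<bar>)" for m
 proof -
  define g where "g n x = ennreal (\<bar>a (k n) x\<bar> + \<bar>b (k n) x\<bar> + \<bar>c (k n) x\<bar>) * indicator (ball c0 R) x" for n x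
  have gm: "g n : borel_fun" for n
  proof -
   note airyD(7-9)[OF A[of "k n"], measurable]
   have [measurable]: "ball c0 R : sets borel" by auto
   show ?thesis unfolding g_def[abs_def] by measurable
  qed
  define F where "F n y = (NNI t. g n (pt m y t))" for n y
  have Fm: "F n : borel_measurable lborel" for n
   unfolding F_def[abs_def] using nn_integral_lines(2)[OF gm] by simp
  have "(NNI y. F n y) <= ennreal M" for n
   using nn_integral_lines(1)[OF gm[of n], of m] M(2)[of "k n"] by (simp add: F_def g_def hmass_def)
  then have "liminf (%n. NNI y. F n y) <= ennreal M" by (intro Liminf_le always_eventually) auto
  moreover have "(NNI y. liminf (%n. F n y)) <= liminf (%n. NNI y. F n y)"
   by (rule nn_integral_liminf[OF Fm])
  ultimately have finI: "(NNI y. liminf (%n. F n y)) <= ennreal M" by (rule order_trans[rotated])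
  have "AE y in lborel. liminf (%n. F n y) ~= \<infinity>"
  proof (rule nn_integral_PInf_AE)
   show "(%y. liminf (%n. F n y)) : borel_measurable lborel" using Fm by (rule borel_measurable_liminf)
   show "(NNI y. liminf (%n. F n y)) ~= \<infinity>" using finI by (auto simp: top_unique)
  qed
  then show ?thesis
  proof eventually_elim
   fix y assume y: "liminf (%n. F n y) ~= \<infinity>"
   obtain K0 where K0: "liminf (%n. F n y) < ennreal K0" "0 <= K0"
   proof -
    obtain l where "liminf (%n. F n y) = ennreal l" "0 <= l" using y by (cases "liminf (%n. F n y)") auto
    then show thesis by (intro that[of "l + 1"]) (auto simp: ennreal_less_iff)
   qed
   \<comment> \<open>The good indices depend on the line. Infinitely many suffice, because
     \<open>v (k n)\<close> converges on \<open>U\<close> along the full sequence.\<close>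
   have freq: "\<exists>n\<ge>N. F n y < ennreal K0" for N
   proof (rule ccontr)
    assume "\<not> ?thesis"
    then have "\<forall>\<^sub>F n in sequentially. ennreal K0 <= F n y" unfolding eventually_sequentially by (meson not_le)
    then have "ennreal K0 <= liminf (%n. F n y)" by (rule Liminf_bounded)
    then show False using K0(1) by simp
   qed
   show "\<forall>\<alpha> \<beta>. (\<forall>t\<in>{\<alpha>..\<beta>}. pt m y t : ball c0 R') -->
    (\<exists>K. \<forall>t\<in>{\<alpha>..\<beta>}. \<forall>t'\<in>{\<alpha>..\<beta>}. pt m y t : U --> pt m y t' : U --> \<bar>W (pt m y t) - W (pt m y t')\<bar> <= K * \<bar>t - t'\<bar>)"
   proof (intro allI impI)
    fix \<alpha> \<beta> assume seg: "\<forall>t\<in>{\<alpha>..\<beta>}. pt m y t : ball c0 R'"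
    show "\<exists>K. \<forall>t\<in>{\<alpha>..\<beta>}. \<forall>t'\<in>{\<alpha>..\<beta>}. pt m y t : U --> pt m y t' : U --> \<bar>W (pt m y t) - W (pt m y t')\<bar> <= K * \<bar>t - t'\<bar>"
    proof (cases "\<alpha> < \<beta>")
     case False
     then have "t = t'" if "t : {\<alpha>..\<beta>}" "t' : {\<alpha>..\<beta>}" for t t' using that by auto
     then show ?thesis by (intro exI[of _ 0] ballI impI) auto
    next
     case True
     \<comment> \<open>The second derivative in direction \<open>(1, m)\<close> is
       \<open>a + 2 * m * b + m^2 * c\<close>, and \<open>c1\<close> dominates its three
       coefficients.\<close>
     define c1 where "c1 = (1 + \<bar>m\<bar>)\<^sup>2"
     define \<Lambda> where "\<Lambda> = 2 * B / (\<beta> - \<alpha>) + c1 * K0"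
     have vL: "\<bar>v (k n) (pt m y t) - v (k n) (pt m y t')\<bar> <= \<Lambda> * \<bar>t - t'\<bar>"
      if n: "F n y < ennreal K0" and t: "t : {\<alpha>..\<beta>}" "t' : {\<alpha>..\<beta>}" for n t t'
     proof -
      note D = airyD[OF A'[of "k n"]]
      have inR: "pt m y r : ball c0 R" if "r : {\<alpha>..\<beta>}" for r using seg that bR by blast
      have pte: "pt m y r = (0, y) + r *. (1, m)" for r by (simp add: pt_def algebra_simps)
      define \<psi> where "\<psi> r = p' (k n) (pt m y r) + m * q' (k n) (pt m y r)" for r
      define \<psi>' where "\<psi>' r = a (k n) (pt m y r) + m * b (k n) (pt m y r) + m * (b (k n) (pt m y r) + m * c (k n) (pt m y r))" for r
      have d1: "((%r. v (k n) (pt m y r)) has_real_derivative \<psi> r) (at r)" if "r : {\<alpha>..\<beta>}" for r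
       using has_grad_line[OF D(1)[OF inR[OF that], unfolded pte], where T=UNIV] unfolding pte[symmetric]
       by (simp add: has_real_derivative_iff_has_vector_derivative \<psi>_def)
      have d2: "(\<psi> has_real_derivative \<psi>' r) (at r)" if "r : {\<alpha>..\<beta>}" for r
      proof -
       have "((%r. p' (k n) (pt m y r)) has_real_derivative (a (k n) (pt m y r) + m * b (k n) (pt m y r))) (at r)"
        using has_grad_line[OF D(2)[OF inR[OF that], unfolded pte], where T=UNIV] unfolding pte[symmetric]
        by (simp add: has_real_derivative_iff_has_vector_derivative)
       moreover have "((%r. q' (k n) (pt m y r)) has_real_derivative (b (k n) (pt m y r) + m * c (k n) (pt m y r))) (at r)"
        using has_grad_line[OF D(3)[OF inR[OF that], unfolded pte], where T=UNIV] unfolding pte[symmetric]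
        by (simp add: has_real_derivative_iff_has_vector_derivative)
       ultimately show ?thesis unfolding \<psi>_def[abs_def] \<psi>'_def by (intro DERIV_add DERIV_cmult)
      qed
      have c\<psi>: "continuous_on A \<psi>'" for A
       unfolding \<psi>'_def pt_def
       by (intro continuous_intros continuous_on_compose2[OF D(4)] continuous_on_compose2[OF D(5)] continuous_on_compose2[OF D(6)]) auto
      have \<psi>b: "\<bar>\<psi> r - \<psi> r'\<bar> <= c1 * K0" if r: "r : {\<alpha>..\<beta>}" "r' : {\<alpha>..\<beta>}" for r r'
      proof -
       have sub: "closed_segment r' r <= {\<alpha>..\<beta>}" using r by (auto simp: closed_segment_eq_real_ivl split: if_splits)
       have "ennreal \<bar>\<psi> r - \<psi> r'\<bar> <= (NNI t. ennreal \<bar>\<psi>' t\<bar> * indicator (closed_segment r' r) t)"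
        by (rule abs_diff_le_nn_integral_deriv) (use d2 sub c\<psi> in auto)
       also have "... <= (NNI t. ennreal c1 * g n (pt m y t))"
       proof (intro nn_integral_mono)
        fix t
        show "ennreal \<bar>\<psi>' t\<bar> * indicator (closed_segment r' r) t <= ennreal c1 * g n (pt m y t)"
        proof (cases "t : closed_segment r' r")
         case True
         let ?a = "a (k n) (pt m y t)" and ?b = "b (k n) (pt m y t)" and ?c = "c (k n) (pt m y t)"
         have "\<bar>\<psi>' t\<bar> <= c1 * (\<bar>?a\<bar> + \<bar>?b\<bar> + \<bar>?c\<bar>)"
         proof -
          have "\<psi>' t = ?a + (2 * m) * ?b + m\<^sup>2 * ?c" by (simp add: \<psi>'_def power2_eq_square algebra_simps)
          then have "\<bar>\<psi>' t\<bar> <= \<bar>?a\<bar> + (2 * \<bar>m\<bar>) * \<bar>?b\<bar> + m\<^sup>2 * \<bar>?c\<bar>"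
           using abs_triangle_ineq[of "?a + (2 * m) * ?b" "m\<^sup>2 * ?c"] abs_triangle_ineq[of ?a "(2 * m) * ?b"] by (simp add: abs_mult)
          also have "... <= c1 * \<bar>?a\<bar> + c1 * \<bar>?b\<bar> + c1 * \<bar>?c\<bar>"
           by (intro add_mono mult_right_mono order_trans[OF _ mult_right_mono[of 1 c1]]) (auto simp: c1_def power2_sum)
          finally show ?thesis by (simp add: algebra_simps)
         qed
         moreover have "pt m y t : ball c0 R" using True sub inR by blast
         moreover define C where "C = \<bar>?a\<bar> + \<bar>?b\<bar> + \<bar>?c\<bar>"
         moreover have "ennreal (c1 * C) = ennreal c1 * ennreal C" by (rule ennreal_mult) (auto simp: c1_def C_def)
         ultimately show ?thesis using True ennreal_leI[of "\<bar>\<psi>' t\<bar>" "c1 * C"] by (simp add: g_def)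
        qed simp
       qed
       also have "... = ennreal c1 * F n y"
        unfolding F_def by (rule nn_integral_cmult) (rule measurable_compose[OF _ gm], simp add: pt_def)
       also have "... <= ennreal c1 * ennreal K0" using n by (intro mult_left_mono) auto
       also have "... = ennreal (c1 * K0)" using K0 by (simp add: c1_def ennreal_mult)
       finally show ?thesis using K0 by (simp add: c1_def)
      qed
      have "\<exists>\<xi>. \<alpha> < \<xi> & \<xi> < \<beta> & v (k n) (pt m y \<beta>) - v (k n) (pt m y \<alpha>) = (\<beta> - \<alpha>) * \<psi> \<xi>"
       by (rule MVT2[OF True]) (use d1 in auto)
      then obtain \<xi> where \<xi>: "\<alpha> < \<xi>" "\<xi> < \<beta>" "v (k n) (pt m y \<beta>) - v (k n) (pt m y \<alpha>) = (\<beta> - \<alpha>) * \<psi> \<xi>" by blast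
      have "\<bar>(\<beta> - \<alpha>) * \<psi> \<xi>\<bar> <= 2 * B"
       using vb[of "pt m y \<beta>" "k n"] vb[of "pt m y \<alpha>" "k n"] seg True unfolding \<xi>(3)[symmetric] by auto
      then have "\<bar>\<psi> \<xi>\<bar> <= 2 * B / (\<beta> - \<alpha>)" using True by (simp add: abs_mult pos_le_divide_eq mult.commute)
      then have \<psi>L: "\<bar>\<psi> r\<bar> <= \<Lambda>" if "r : {\<alpha>..\<beta>}" for r
       using \<psi>b[OF that, of \<xi>] \<xi> unfolding \<Lambda>_def by auto
      have "norm (v (k n) (pt m y t) - v (k n) (pt m y t')) <= \<Lambda> * norm (t - t')"
       by (rule field_differentiable_bound[where S="{\<alpha>..\<beta>}" and f="%r. v (k n) (pt m y r)" and f'=\<psi>])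
        (use d1 \<psi>L t in \<open>auto intro: has_field_derivative_at_within\<close>)
      then show ?thesis by simp
     qed
     show ?thesis
     proof (intro exI[of _ \<Lambda>] ballI impI)
      fix t t' assume t: "t : {\<alpha>..\<beta>}" "t' : {\<alpha>..\<beta>}" and Ut: "pt m y t : U" "pt m y t' : U"
      have l: "(%n. \<bar>v (k n) (pt m y t) - v (k n) (pt m y t')\<bar>) ~~> \<bar>W (pt m y t) - W (pt m y t')\<bar>"
       by (intro tendsto_rabs tendsto_diff Wl Ut)
      show "\<bar>W (pt m y t) - W (pt m y t')\<bar> <= \<Lambda> * \<bar>t - t'\<bar>"
      proof (rule ccontr)
       assume "\<not> ?thesis"
       then have "\<forall>\<^sub>F n in sequentially. \<Lambda> * \<bar>t - t'\<bar> < \<bar>v (k n) (pt m y t) - v (k n) (pt m y t')\<bar>"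
        by (intro order_tendstoD(1)[OF l]) simp
       then obtain N where N: "!!n. n >= N ==> \<Lambda> * \<bar>t - t'\<bar> < \<bar>v (k n) (pt m y t) - v (k n) (pt m y t')\<bar>"
        unfolding eventually_sequentially by blast
       obtain n where "n >= N" "F n y < ennreal K0" using freq by blast
       then show False using N[of n] vL[of n t t'] t by simp
      qed
     qed
    qed
   qed
  qed
 qed
 have fin': "AE y in lborel. finite {t. pt m y t : ball c0 R' - U}" for m
  using fin[of m] by eventually_elim (auto elim!: rev_finite_subset simp: U_def, use R' in linarith)
 note rc = radial_convex[OF line_convex[OF fin' lip]]
 define Aj where "Aj n s = (LI z. rwt j z * v (k n) (c0 + s *. z))" for n s
 define f where "f s z = (if norm z < 1 & c0 + s *. z : U then rwt j z * W (c0 + s *. z) else 0)" for s z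
 define Al where "Al s = integral\<^sup>L lborel (f s)" for s
 have RA: "integ (f s)" "(%n. Aj n s) ~~> Al s" "AE z in lborel. norm z < 1 --> c0 + s *. z : U"
  if "0 < s" "s < R'" for s
 proof -
  have "cball c0 s <= ball c0 R'" using that by auto
  have vc': "!!n. continuous_on (ball c0 R') (v (k n))" by (rule vc)
  have vb': "!!n. \<forall>x\<in>ball c0 R'. \<bar>v (k n) x\<bar> <= B" and Wl': "\<forall>x\<in>U. (%n. v (k n) x) ~~> W x"
   using vb Wl by blast+
  note R = radial_average_limit(1,2)[where v="%n. v (k n)" and V=W and j=j, OF vc' vb' Uo Us N0 Wl' that(1) \<open>cball c0 s <= ball c0 R'\<close>]
   radial_average_limit(3)[where v="%n. v (k n)" and V=W, OF vc' vb' Uo Us N0 Wl' that(1) \<open>cball c0 s <= ball c0 R'\<close>]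
  show "integ (f s)" "(%n. Aj n s) ~~> Al s" "AE z in lborel. norm z < 1 --> c0 + s *. z : U"
   using R unfolding f_def[abs_def] Aj_def Al_def by auto
 qed
 \<comment> \<open>The inequality on rays is integrated over \<open>z\<close> with weight
   \<open>rwt j\<close>; the directions excluded by \<open>fst z = 0\<close> do not
   contribute.\<close>
 have Aconv: "(s3 - s1) * Al s2 <= (s3 - s2) * Al s1 + (s2 - s1) * Al s3" if s: "0 < s1" "s1 < s2" "s2 < s3" "s3 < R'" for s1 s2 s3
 proof -
  have nz: "AE z in (lborel :: (plane) measure). fst z ~= 0"
  proof -
   have "emeasure lborel ({z. fst z = 0} :: plane set) = 0"
   proof (rule null_of_finite_lines)
    have "closed {z :: plane. fst z = 0}" by (intro closed_Collect_eq continuous_intros)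
    then show "{z :: plane. fst z = 0} : sets borel" by auto
   qed (auto simp: pt_def)
   moreover have "closed {z :: plane. fst z = 0}" by (intro closed_Collect_eq continuous_intros)
   ultimately have "{z :: plane. fst z = 0} : null_sets lborel" by auto
   from AE_not_in[OF this] show ?thesis by simp
  qed
  have "(LI z. (s3 - s1) * f s2 z) <= (LI z. (s3 - s2) * f s1 z + (s2 - s1) * f s3 z)"
  proof (rule integral_mono_AE)
   show "integ (%z. (s3 - s1) * f s2 z)" "integ (%z. (s3 - s2) * f s1 z + (s2 - s1) * f s3 z)"
    using RA(1)[of s1] RA(1)[of s2] RA(1)[of s3] s by auto
   have "AE z in lborel. norm z < 1 --> c0 + s1 *. z : U" "AE z in lborel. norm z < 1 --> c0 + s2 *. z : U" "AE z in lborel. norm z < 1 --> c0 + s3 *. z : U"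
    using s by (auto intro!: RA(3))
   then show "AE z in lborel. (s3 - s1) * f s2 z <= (s3 - s2) * f s1 z + (s2 - s1) * f s3 z"
    using nz
   proof eventually_elim
    fix z :: "plane" assume zU: "norm z < 1 --> c0 + s1 *. z : U" "norm z < 1 --> c0 + s2 *. z : U" "norm z < 1 --> c0 + s3 *. z : U" and z0: "fst z ~= 0"
    show "(s3 - s1) * f s2 z <= (s3 - s2) * f s1 z + (s2 - s1) * f s3 z"
    proof (cases "norm z < 1")
     case True
     have "W (c0 + s2 *. z) <= ((s3 - s2) * W (c0 + s1 *. z) + (s2 - s1) * W (c0 + s3 *. z)) / (s3 - s1)"
      by (rule rc[OF s(2,3) z0]) (use zU True in auto)
     then have "(s3 - s1) * W (c0 + s2 *. z) <= (s3 - s2) * W (c0 + s1 *. z) + (s2 - s1) * W (c0 + s3 *. z)"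
      using s by (simp add: pos_le_divide_eq mult.commute)
     from mult_left_mono[OF this rwt_nonneg[of j z]] show ?thesis
      using True zU by (simp add: f_def algebra_simps)
    next
     case False then show ?thesis by (simp add: f_def)
    qed
   qed
  qed
  then show ?thesis using RA(1)[of s1] RA(1)[of s2] RA(1)[of s3] s unfolding Al_def by simp
 qed
 define Dj where "Dj n s = (LI y. rcut j ((1 / s) *. (y - c0)) * (a n y + c n y))" for n s
 have DjB: "Dj n s = s\<^sup>2 * (LI z. rcut j z * (a n (c0 + s *. z) + c n (c0 + s *. z)))" if s: "0 < s" for n s
 proof -
  have m: "(%y. rcut j ((1 / s) *. (y - c0)) * (a n y + c n y)) : borel_fun"
   by (intro borel_measurable_continuous_onI continuous_intros continuous_on_compose2[OF rcut_continuous]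
     airyD(4)[OF A] airyD(6)[OF A]) auto
  show ?thesis unfolding Dj_def using integral_affine_substitution[OF m s, of c0] s by simp
 qed
 have Djint: "integ (%y. rcut j ((1 / s) *. (y - c0)) * (a n y + c n y))" if s: "0 < s" for n s
 proof (rule continuous_zero_outside_integrable[where R="norm c0 + s"])
  show "contU (%y. rcut j ((1 / s) *. (y - c0)) * (a n y + c n y))"
   by (intro continuous_intros continuous_on_compose2[OF rcut_continuous]
     airyD(4)[OF A] airyD(6)[OF A]) auto
  show "zero_outside (norm c0 + s) (%y. rcut j ((1 / s) *. (y - c0)) * (a n y + c n y))"
   unfolding zero_outside_def
  proof (intro allI impI)
   fix y :: "plane" assume "norm c0 + s < norm y"
   then have "s <= norm (y - c0)" using norm_triangle_sub[of y c0] by simp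
   then have "1 <= norm ((1 / s) *. (y - c0))" using s by (intro one_le_norm_scaled)
   then show "rcut j ((1 / s) *. (y - c0)) * (a n y + c n y) = 0" by (simp add: rcut_outside)
  qed
 qed
 have Djmono: "Dj n s <= Dj n t" if st: "0 < s" "s <= t" "t < R'" for n s t
  unfolding Dj_def
 proof (rule integral_mono[OF Djint Djint])
  show "rcut j ((1 / s) *. (y - c0)) * (a n y + c n y) <= rcut j ((1 / t) *. (y - c0)) * (a n y + c n y)" for y :: "plane"
  proof (cases "y : ball c0 R")
   case True
   then show ?thesis using rcut_radial_mono[OF st(1,2), of j "y - c0"] pos by (intro mult_right_mono) auto
  next
   case False
   then have "R <= norm (y - c0)" by (simp add: dist_norm norm_minus_commute)
   then have "1 <= norm ((1 / s) *. (y - c0))" "1 <= norm ((1 / t) *. (y - c0))" using st R' by (auto intro!: one_le_norm_scaled)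
   then show ?thesis by (simp add: rcut_outside)
  qed
 qed (use st in auto)
 have Dj0: "0 <= Dj n s" if st: "0 < s" "s < R'" for n s
  unfolding Dj_def
 proof (rule integral_nonneg_AE, rule AE_I2)
  fix y :: "plane" show "0 <= rcut j ((1 / s) *. (y - c0)) * (a n y + c n y)"
  proof (cases "y : ball c0 R")
   case True then show ?thesis using pos rcut_nonneg by simp
  next
   case False
   then have "R <= norm (y - c0)" by (simp add: dist_norm norm_minus_commute)
   then have "1 <= norm ((1 / s) *. (y - c0))" using st R' by (auto intro!: one_le_norm_scaled)
   then show ?thesis by (simp add: rcut_outside)
  qed
 qed
 \<comment> \<open>The factor \<open>s\<close> of \<open>radial_mean_deriv\<close> becomes
   \<open>1 / s\<close>, since rescaling the disk of radius \<open>s\<close> to the unit disk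
   contributes \<open>1 / s^2\<close> (\<open>DjB\<close>).\<close>
 have Ader: "((%s. Aj n s) has_real_derivative Dj (k n) s / s) (at s)" if s: "0 < s" "s < R'" for n s
 proof -
  note D = airyD[OF A'[of "k n"]]
  have "\<bar>s\<bar> < R" using s R' by simp
  then have "((%s. Aj n s) has_real_derivative s * (LI z. rcut j z * (a (k n) (c0 + s *. z) + c (k n) (c0 + s *. z)))) (at s)"
   unfolding Aj_def
   by (intro radial_mean_deriv[OF D(1) D(2) D(3) _ _ _ _ j]) (use D(4-6) in \<open>auto intro: continuous_on_subset\<close>)
  then show ?thesis using DjB[OF s(1), of "k n"] s by (simp add: power2_eq_square)
 qed
 \<comment> \<open>Convergence of the means gives no convergence of derivatives. Monotonicity of
   \<open>Dj\<close> in the radius traps the difference quotients between quantities that do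
   converge.\<close>
 have DQ: "h * (Dj (k n) s / (s + h)) <= Aj n (s + h) - Aj n s" "Aj n (s + h) - Aj n s <= h * (Dj (k n) (s + h) / s)"
  if s: "0 < s" "0 < h" "s + h < R'" for n s h
 proof -
  have "\<exists>z. s < z & z < s + h & Aj n (s + h) - Aj n s = (s + h - s) * (Dj (k n) z / z)"
   by (rule MVT2) (use Ader s in auto)
  then obtain z where z: "s < z" "z < s + h" "Aj n (s + h) - Aj n s = h * (Dj (k n) z / z)" by auto
  have "Dj (k n) s / (s + h) <= Dj (k n) z / z"
   using Djmono[of s z "k n"] Dj0[of z "k n"] z s by (intro frac_le) auto
  then show "h * (Dj (k n) s / (s + h)) <= Aj n (s + h) - Aj n s" unfolding z(3) using s by (intro mult_left_mono) auto
  have "Dj (k n) z / z <= Dj (k n) (s + h) / s"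
   using Djmono[of z "s + h" "k n"] Dj0[of "s + h" "k n"] z s by (intro frac_le) auto
  then show "Aj n (s + h) - Aj n s <= h * (Dj (k n) (s + h) / s)" unfolding z(3) using s by (intro mult_left_mono) auto
 qed
 have Dl: "(%n. Dj (k n) s) ~~> Z s" if "0 < s" "s < R'" for s
  using LIMSEQ_subseq_LIMSEQ[OF lim[OF that] k(1)] unfolding Dj_def comp_def .
 have DQl: "Z s / (s + h) <= (Al (s + h) - Al s) / h" "(Al (s + h) - Al s) / h <= Z (s + h) / s"
  if s: "0 < s" "0 < h" "s + h < R'" for s h
 proof -
  have l: "(%n. (Aj n (s + h) - Aj n s) / h) ~~> (Al (s + h) - Al s) / h"
   using s by (intro tendsto_intros RA(2)) auto
  show "Z s / (s + h) <= (Al (s + h) - Al s) / h"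
  proof (rule tendsto_le[OF _ l])
   show "(%n. Dj (k n) s / (s + h)) ~~> Z s / (s + h)" using s by (intro tendsto_intros Dl) auto
   show "\<forall>\<^sub>F n in sequentially. Dj (k n) s / (s + h) <= (Aj n (s + h) - Aj n s) / h"
    using DQ(1)[OF s] s by (intro always_eventually allI) (simp add: pos_le_divide_eq mult.commute)
  qed simp
  show "(Al (s + h) - Al s) / h <= Z (s + h) / s"
  proof (rule tendsto_le[OF _ _ l])
   show "(%n. Dj (k n) (s + h) / s) ~~> Z (s + h) / s" using s by (intro tendsto_intros Dl) auto
   show "\<forall>\<^sub>F n in sequentially. (Aj n (s + h) - Aj n s) / h <= Dj (k n) (s + h) / s"
    using DQ(2)[OF s] s by (intro always_eventually allI) (simp add: pos_divide_le_eq mult.commute)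
  qed simp
 qed
 show ?thesis
 proof (cases "s = t")
  case False
  then have st: "s < t" using s by simp
  \<comment> \<open>Convexity compares the quotients on \<open>[s, s + h]\<close> and
    \<open>[t - h, t]\<close>; the bound on \<open>h\<close> keeps these intervals apart. Letting
    \<open>h\<close> tend to 0 gives the claim.\<close>
  have key: "Z s / (s + h) <= Z t / (t - h)" if h: "0 < h" "h < (t - s) / 2" for h
  proof -
   have h2: "s + h < t - h" using h by (simp add: field_simps)
   have 1: "Z s / (s + h) <= (Al (s + h) - Al s) / h" using h h2 s by (intro DQl) auto
   have 2: "(Al t - Al (t - h)) / h <= Z t / (t - h)" using DQl(2)[of "t - h" h] h h2 s by auto
   have c1: "(t - h - s) * Al (s + h) <= (t - h - (s + h)) * Al s + (s + h - s) * Al (t - h)"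
    by (rule Aconv) (use h h2 s in auto)
   have c2: "(t - (s + h)) * Al (t - h) <= (t - (t - h)) * Al (s + h) + (t - h - (s + h)) * Al t"
    by (rule Aconv) (use h h2 s in auto)
   define X Y where "X = Al (s + h) - Al s" and "Y = Al t - Al (t - h)"
   define d where "d = t - h - (s + h)"
   have d: "0 < d" using h2 by (simp add: d_def)
   define Q where "Q = Al (t - h) - Al (s + h)"
   have "d * X <= h * Q"
    using c1 unfolding X_def Q_def d_def by (simp add: algebra_simps)
   moreover have "h * Q <= d * Y"
    using c2 unfolding Y_def Q_def d_def by (simp add: algebra_simps)
   ultimately have "d * X <= d * Y" by simp
   then have "X <= Y" using d by simp
   then have "X / h <= Y / h" using h by (intro divide_right_mono) auto
   then show ?thesis using 1 2 unfolding X_def Y_def by linarith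
  qed
  show ?thesis
  proof (rule tendsto_le[of "at_right 0"])
   show "((%h. Z s / (s + h)) \<longlongrightarrow> Z s / s) (at_right 0)" "((%h. Z t / (t - h)) \<longlongrightarrow> Z t / t) (at_right 0)"
    using s st by (auto intro!: tendsto_eq_intros)
   show "\<forall>\<^sub>F h in at_right 0. Z s / (s + h) <= Z t / (t - h)"
    using eventually_at_right_real[of 0 "(t - s) / 2"] st by (auto elim!: eventually_mono intro: key)
  qed simp
 qed simp
qed


section \<open>Passage to the limit in mollified products\<close>

lemma L1shift_bound:
 fixes h :: "'a::euclidean_space => 'b::euclidean_space"
 assumes h: "integ h"
 shows "L1shift h z <= ennreal (2 * (LI x. norm (h x)))"
proof -
 have [measurable]: "h : borel_fun" using h by auto
 have "L1shift h z <= (NNI x. ennreal (norm (h (x - z))) + ennreal (norm (h x)))"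
  unfolding L1shift_def by (intro nn_integral_mono) (simp add: norm_triangle_ineq4 flip: ennreal_plus)
 also have "... = (NNI x. ennreal (norm (h (x - z)))) + (NNI x. ennreal (norm (h x)))"
  by (rule nn_integral_add) auto
 also have "... = (NNI x. ennreal (norm (h x))) + (NNI x. ennreal (norm (h x)))"
  using nn_integral_shift[of "%x. ennreal (norm (h x))" z] by simp
 also have "(NNI x. ennreal (norm (h x))) = ennreal (LI x. norm (h x))"
  using h by (intro nn_integral_eq_integral) auto
 finally show ?thesis by (simp flip: ennreal_plus)
qed

lemma conv_mollifier_measurable:
 fixes h :: "'a::euclidean_space => 'b::euclidean_space"
 assumes "mollifier d K" "integ h"
 shows "conv K h : borel_fun"
 using conv_continuous[OF mollifierD(1,3)[OF assms(1)] assms(2)] by (rule borel_measurable_continuous_onI)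

lemma mollify_L1_seq:
 fixes h :: "'a::euclidean_space => 'b::euclidean_space"
 assumes h: "integ h" and K: "!!n. mollifier (d n) (K n)" and d: "d ~~> 0"
 shows "integ (%x. conv (K n) h x - h x)"
  "(%n. LI x. norm (conv (K n) h x - h x)) ~~> 0"
proof -
 have [measurable]: "h : borel_fun" "!!n. conv (K n) h : borel_fun"
  using h conv_mollifier_measurable[OF K h] by auto
 show int: "integ (%x. conv (K n) h x - h x)" for n
 proof (rule integrableI_bounded)
  show "(NNI x. ennreal (norm (conv (K n) h x - h x))) < \<infinity>"
   using mollify_L1_le[OF K h L1shift_bound[OF h], of n] by (auto intro: le_less_trans)
 qed simp
 show "(%n. LI x. norm (conv (K n) h x - h x)) ~~> 0"
 proof (rule LIMSEQ_I)
  fix e :: real assume e: "0 < e"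
  obtain r where r: "r > 0" "!!t K. t < r ==> mollifier t K ==> (NNI x. ennreal (norm (conv K h x - h x))) <= ennreal (e/2)"
   using mollify_L1[OF h, of "e/2"] e by auto
  obtain N where N: "!!n. n >= N ==> \<bar>d n\<bar> < r" using LIMSEQ_D[OF d r(1)] by auto
  show "\<exists>N. \<forall>n\<ge>N. norm ((LI x. norm (conv (K n) h x - h x)) - 0) < e"
  proof (intro exI[of _ N] allI impI)
   fix n assume "n >= N"
   then have "(NNI x. ennreal (norm (conv (K n) h x - h x))) <= ennreal (e/2)" using N[of n] by (intro r(2)[OF _ K]) auto
   then have "ennreal (LI x. norm (conv (K n) h x - h x)) <= ennreal (e/2)"
    using int by (subst (asm) nn_integral_eq_integral) auto
   then have "(LI x. norm (conv (K n) h x - h x)) <= e/2" using e by simp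
   then show "norm ((LI x. norm (conv (K n) h x - h x)) - 0) < e" using e by simp
  qed
 qed
qed

lemma mollify_L2_seq:
 fixes h :: "'a::euclidean_space => 'b::euclidean_space"
 assumes h: "integ h" and h2: "integ (%x. (norm (h x))\<^sup>2)"
  and K: "!!n. mollifier (d n) (K n)" and d: "d ~~> 0"
 shows "integ (%x. (norm (conv (K n) h x - h x))\<^sup>2)"
  "(%n. LI x. (norm (conv (K n) h x - h x))\<^sup>2) ~~> 0"
proof -
 have [measurable]: "h : borel_fun" "!!n. conv (K n) h : borel_fun"
  using h conv_mollifier_measurable[OF K h] by auto
 have s: "integ (%x. norm (h x) *. h x)"
  by (rule B_integrable_bound[OF h2]) (auto simp: power2_eq_square)
 have "L2shift h z <= ennreal (2 * (2 * (LI x. norm (norm (h x) *. h x))))" for z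
 proof -
  have "L2shift h z <= 2 * ennreal (2 * (LI x. norm (norm (h x) *. h x)))"
   by (intro order_trans[OF L2shift_le] mult_left_mono L1shift_bound[OF s]) auto
  then show ?thesis by (simp add: ennreal_mult')
 qed
 note L2b = this
 show int: "integ (%x. (norm (conv (K n) h x - h x))\<^sup>2)" for n
 proof (rule integrableI_bounded)
  show "(NNI x. ennreal (norm ((norm (conv (K n) h x - h x))\<^sup>2))) < \<infinity>"
   using mollify_L2_le[OF K h L2b, of n] by (auto intro: le_less_trans)
 qed simp
 show "(%n. LI x. (norm (conv (K n) h x - h x))\<^sup>2) ~~> 0"
 proof (rule LIMSEQ_I)
  fix e :: real assume e: "0 < e"
  obtain r where r: "r > 0" "!!t K. t < r ==> mollifier t K ==> (NNI x. ennreal ((norm (conv K h x - h x))\<^sup>2)) <= ennreal (e/2)"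
   using mollify_L2[OF h h2, of "e/2"] e by auto
  obtain N where N: "!!n. n >= N ==> \<bar>d n\<bar> < r" using LIMSEQ_D[OF d r(1)] by auto
  show "\<exists>N. \<forall>n\<ge>N. norm ((LI x. (norm (conv (K n) h x - h x))\<^sup>2) - 0) < e"
  proof (intro exI[of _ N] allI impI)
   fix n assume "n >= N"
   then have "(NNI x. ennreal ((norm (conv (K n) h x - h x))\<^sup>2)) <= ennreal (e/2)" using N[of n] by (intro r(2)[OF _ K]) auto
   then have "ennreal (LI x. (norm (conv (K n) h x - h x))\<^sup>2) <= ennreal (e/2)"
    using int by (subst (asm) nn_integral_eq_integral) auto
   then have "(LI x. (norm (conv (K n) h x - h x))\<^sup>2) <= e/2" using e by simp
   then show "norm ((LI x. (norm (conv (K n) h x - h x))\<^sup>2) - 0) < e" using e by simp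
  qed
 qed
qed

text \<open>The two error terms are estimated by \<open>2xy \<le> x\<^sup>2/t + t y\<^sup>2\<close> with a small \<open>t\<close>.\<close>

lemma inner_L2_limit:
 fixes F G :: "nat => 'a::euclidean_space => 'b::euclidean_space"
 assumes [measurable]: "!!n. F n : borel_fun" "!!n. G n : borel_fun" "f : borel_fun" "g : borel_fun"
  and F: "!!n. integ (%x. (norm (F n x - f x))\<^sup>2)" "(%n. LI x. (norm (F n x - f x))\<^sup>2) ~~> 0"
  and G: "!!n. integ (%x. (norm (G n x - g x))\<^sup>2)" "(%n. LI x. (norm (G n x - g x))\<^sup>2) ~~> 0"
  and f: "integ (%x. (norm (f x))\<^sup>2)" and g: "integ (%x. (norm (g x))\<^sup>2)"
 shows "integ (%x. F n x .* G n x - f x .* g x)"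
  "(%n. LI x. \<bar>F n x .* G n x - f x .* g x\<bar>) ~~> 0"
proof -
 have pt: "\<bar>F n x .* G n x - f x .* g x\<bar> <= (1 + 1 / t) * (norm (F n x - f x))\<^sup>2 + (1 + 1 / t) * (norm (G n x - g x))\<^sup>2 + t * (norm (f x))\<^sup>2 + t * (norm (g x))\<^sup>2"
  if t: "0 < t" for t n x
 proof -
  have am: "p * q <= p\<^sup>2 / t + t * q\<^sup>2" if "0 <= p" "0 <= q" for p q :: real
  proof -
   have "0 <= (p - t * q)\<^sup>2" by simp
   then have "2 * (p * q) * t <= p\<^sup>2 + t\<^sup>2 * q\<^sup>2" by (simp add: power2_eq_square algebra_simps)
   moreover have "0 <= p * q * t" using that t by simp
   ultimately have "(p * q) * t <= p\<^sup>2 + t\<^sup>2 * q\<^sup>2" by linarith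
   then have "p * q <= (p\<^sup>2 + t\<^sup>2 * q\<^sup>2) / t" using t by (simp add: pos_le_divide_eq)
   also have "... = p\<^sup>2 / t + t * q\<^sup>2" using t by (simp add: add_divide_distrib power2_eq_square)
   finally show ?thesis .
  qed
  have am1: "p * q <= p\<^sup>2 + q\<^sup>2" if "0 <= p" "0 <= q" for p q :: real
  proof -
   have "0 <= (p - q)\<^sup>2" by simp
   then have "2 * (p * q) <= p\<^sup>2 + q\<^sup>2" by (simp add: power2_eq_square algebra_simps)
   moreover have "0 <= p * q" using that by simp
   ultimately show ?thesis by linarith
  qed
  have "F n x .* G n x - f x .* g x = (F n x - f x) .* (G n x - g x) + (F n x - f x) .* g x + f x .* (G n x - g x)"
   by (simp add: inner_diff_left inner_diff_right)
  also have "\<bar>...\<bar> <= norm (F n x - f x) * norm (G n x - g x) + norm (F n x - f x) * norm (g x) + norm (f x) * norm (G n x - g x)"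
   by (intro abs_add3_le Cauchy_Schwarz_ineq2)
  also have "... <= ((norm (F n x - f x))\<^sup>2 + (norm (G n x - g x))\<^sup>2) + ((norm (F n x - f x))\<^sup>2 / t + t * (norm (g x))\<^sup>2) + ((norm (G n x - g x))\<^sup>2 / t + t * (norm (f x))\<^sup>2)"
   by (intro add_mono am1 am order_trans[OF eq_refl[OF mult.commute[of "norm (f x)"]] am]) auto
  finally show ?thesis by (simp add: algebra_simps)
 qed
 have rhs: "integ (%x. (1 + 1 / t) * (norm (F n x - f x))\<^sup>2 + (1 + 1 / t) * (norm (G n x - g x))\<^sup>2 + t * (norm (f x))\<^sup>2 + t * (norm (g x))\<^sup>2)" for t n
  by (intro B_integrable_add integrable_mult_right F G f g)
 show int: "integ (%x. F n x .* G n x - f x .* g x)" for n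
  by (rule B_integrable_bound[OF rhs[of 1 n]]) (use pt[of 1 n] in \<open>auto intro!: AE_I2 order_trans[OF _ abs_ge_self]\<close>)
 define C where "C = (LI x. (norm (f x))\<^sup>2) + (LI x. (norm (g x))\<^sup>2)"
 have C: "0 <= C" by (simp add: C_def)
 define e where "e n = (LI x. (norm (F n x - f x))\<^sup>2) + (LI x. (norm (G n x - g x))\<^sup>2)" for n
 have e: "e ~~> 0" unfolding e_def[abs_def] using tendsto_add[OF F(2) G(2)] by simp
 have le: "(LI x. \<bar>F n x .* G n x - f x .* g x\<bar>) <= (1 + 1 / t) * e n + t * C" if t: "0 < t" for t n
 proof -
  have "(LI x. \<bar>F n x .* G n x - f x .* g x\<bar>) <= (LI x. (1 + 1 / t) * (norm (F n x - f x))\<^sup>2 + (1 + 1 / t) * (norm (G n x - g x))\<^sup>2 + t * (norm (f x))\<^sup>2 + t * (norm (g x))\<^sup>2)"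
   by (rule integral_mono[OF integrable_abs[OF int] rhs pt[OF t]])
  also have "... = (1 + 1 / t) * e n + t * C"
   using F(1)[of n] G(1)[of n] f g by (simp add: e_def C_def algebra_simps)
  finally show ?thesis .
 qed
 show "(%n. LI x. \<bar>F n x .* G n x - f x .* g x\<bar>) ~~> 0"
 proof (rule LIMSEQ_I)
  fix r :: real assume r: "0 < r"
  define t where "t = r / (2 * (C + 1))"
  have t: "0 < t" using r C by (simp add: t_def)
  have tC: "t * C <= r / 2" using r C by (simp add: t_def field_simps)
  have "(%n. (1 + 1 / t) * e n) ~~> (1 + 1/t) * 0" by (intro tendsto_mult tendsto_const e)
  then have "(%n. (1 + 1 / t) * e n) ~~> 0" by simp
  from LIMSEQ_D[OF this, of "r/2"] r
  obtain N where N: "!!n. n >= N ==> \<bar>(1 + 1 / t) * e n\<bar> < r/2" by auto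
  show "\<exists>N. \<forall>n\<ge>N. norm ((LI x. \<bar>F n x .* G n x - f x .* g x\<bar>) - 0) < r"
  proof (intro exI[of _ N] allI impI)
   fix n assume "n >= N"
   then have "(LI x. \<bar>F n x .* G n x - f x .* g x\<bar>) < r" using le[OF t, of n] N[of n] tC by linarith
   moreover have "0 <= (LI x. \<bar>F n x .* G n x - f x .* g x\<bar>)" by simp
   ultimately show "norm ((LI x. \<bar>F n x .* G n x - f x .* g x\<bar>) - 0) < r" by simp
  qed
 qed
qed

lemma bounded_weight_L1_limit:
 fixes F :: "nat => 'a::euclidean_space => real" and f \<phi> :: "'a => real"
 assumes \<phi>: "\<phi> : borel_fun" "!!x. \<bar>\<phi> x\<bar> <= B"
  and F: "!!n. integ (%x. F n x - f x)" "(%n. LI x. \<bar>F n x - f x\<bar>) ~~> 0" and f: "integ f"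
 shows "(%n. LI x. \<phi> x * F n x) ~~> (LI x. \<phi> x * f x)" "integ (%x. \<phi> x * F n x)" "integ (%x. \<phi> x * f x)"
proof -
 have mu: "integ (%x. \<phi> x * h x)" if h: "integ h" for h
  by (rule B_integrable_bound[OF integrable_mult_right[OF h, of B]])
   (use \<phi> h in \<open>auto intro!: AE_I2 mult_right_mono simp: abs_mult intro: order_trans[OF _ abs_ge_self]\<close>)
 have iF: "integ (F n)" for n using B_integrable_add[OF F(1)[of n] f] by simp
 show "integ (%x. \<phi> x * F n x)" for n by (rule mu[OF iF])
 show i2: "integ (%x. \<phi> x * f x)" by (rule mu[OF f])
 have B: "0 <= B" using \<phi>(2) abs_ge_zero order_trans by blast
 have "\<bar>(LI x. \<phi> x * F n x) - (LI x. \<phi> x * f x)\<bar> <= B * (LI x. \<bar>F n x - f x\<bar>)" for n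
 proof -
  have "(LI x. \<phi> x * F n x) - (LI x. \<phi> x * f x) = (LI x. \<phi> x * (F n x - f x))"
   using mu[OF iF, of n] i2 by (simp add: right_diff_distrib)
  also have "\<bar>...\<bar> <= (LI x. \<bar>\<phi> x * (F n x - f x)\<bar>)" by (rule integral_abs_bound)
  also have "... <= (LI x. B * \<bar>F n x - f x\<bar>)"
   by (rule integral_mono[OF integrable_abs[OF mu[OF F(1)]] integrable_mult_right[OF integrable_abs[OF F(1)]]])
    (use \<phi>(2) in \<open>auto simp: abs_mult intro: mult_right_mono\<close>)
  finally show ?thesis by simp
 qed
 then have "(%n. (LI x. \<phi> x * F n x) - (LI x. \<phi> x * f x)) ~~> 0"
  by (intro Lim_null_comparison[OF _ tendsto_mult_right_zero[OF F(2), of B]] always_eventually) auto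
 then show "(%n. LI x. \<phi> x * F n x) ~~> (LI x. \<phi> x * f x)" by (rule LIM_zero_cancel)
qed

lemma norm_conv_le:
 fixes h :: "'a::euclidean_space => 'b::euclidean_space"
 assumes K: "mollifier d K" and h: "integ h" and b: "AE z in lborel. z : cball x d --> norm (h z) <= B" and B: "0 <= B"
 shows "norm (conv K h x) <= B"
proof -
 note KD = mollifierD[OF K]
 have KR: "integ (%z. K (x - z))" "(LI z. K (x - z)) = 1"
 proof -
  have "integrable (distr lborel borel (%z. x - z)) K" using KD(6) by (simp only: lborel_distr_reflect)
  then show "integ (%z. K (x - z))" using KD(5) by (subst (asm) integrable_distr_eq) auto
  show "(LI z. K (x - z)) = 1" using integral_reflect[OF KD(5)] KD(4) by simp
 qed
 have "norm (conv K h x) <= (LI z. norm (K (x - z) *. h z))" unfolding conv_def by (rule integral_norm_bound)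
 also have "... <= (LI z. K (x - z) * B)"
 proof (rule integral_mono_AE)
  show "integ (%z. norm (K (x - z) *. h z))" by (intro integrable_norm conv_integrable[OF KD(1,3) h])
  show "integ (%z. K (x - z) * B)" using KR by simp
  show "AE z in lborel. norm (K (x - z) *. h z) <= K (x - z) * B"
   using b
  proof eventually_elim
   fix z assume z: "z : cball x d --> norm (h z) <= B"
   show "norm (K (x - z) *. h z) <= K (x - z) * B"
    using z KD(2)[of "x - z"] zero_outsideD[OF KD(3), of "x - z"]
    by (cases "z : cball x d") (auto simp: dist_norm intro: mult_left_mono)
  qed
 qed
 also have "... = B" using KR by simp
 finally show ?thesis .
qed

lemma AE_subseq_of_L1:
 fixes F :: "nat => 'a::euclidean_space => 'b::euclidean_space"
 assumes "!!n. integ (%x. F n x - f x)" "(%n. LI x. norm (F n x - f x)) ~~> 0"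
 obtains r where "strict_mono (r :: nat => nat)" "AE x in lborel. (%n. F (r n) x) ~~> f x"
proof -
 obtain r where r: "strict_mono (r :: nat => nat)" "AE x in lborel. (%n. F (r n) x - f x) ~~> 0"
  using tendsto_L1_AE_subseq[of lborel "%n x. F n x - f x"] assms by blast
 show thesis by (rule that[OF r(1)]) (use r(2) in eventually_elim, simp add: LIM_zero_iff)
qed


section \<open>Integration by parts against kernels, and a regularised norm\<close>

lemma has_grad_cong_open:
 assumes "has_grad F a b x" "open S" "x : S" "!!y. y : S ==> F y = G y"
 shows "has_grad G a b x"
 using assms unfolding has_grad_def by (blast intro: has_derivative_transform_within_open)

lemma has_grad_reflect:
 assumes "has_grad K a b (q - z)"
 shows "has_grad (%z. K (q - z)) (- a) (- b) z"
proof -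
 have "((%z. q - z) has_derivative (%v. - v)) (at z)" by (auto intro!: derivative_eq_intros)
 from has_derivative_compose[OF this assms[unfolded has_grad_def]]
 show ?thesis unfolding has_grad_def by (rule has_derivative_eq_rhs) auto
qed

lemma has_grad_inner:
 fixes F G :: "plane => 'v::real_inner"
 assumes "has_grad F a b z" "has_grad G a' b' z"
 shows "has_grad (%z. F z .* G z) (F z .* a' + a .* G z) (F z .* b' + b .* G z) z"
 unfolding has_grad_def
 by (rule has_derivative_eq_rhs[OF has_derivative_inner[OF assms[unfolded has_grad_def]]])
  (auto simp: inner_add_left inner_add_right algebra_simps)

lemma has_grad_compose:
 fixes F :: "plane => 'v::real_normed_vector"
 assumes "has_grad F a b z" "(H has_derivative H') (at (F z))"
 shows "has_grad (%z. H (F z)) (H' a) (H' b) z"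
proof -
 interpret bounded_linear H' using assms(2) by (rule has_derivative_bounded_linear)
 show ?thesis using has_derivative_compose[OF assms(1)[unfolded has_grad_def] assms(2)]
  unfolding has_grad_def by (rule has_derivative_eq_rhs) (auto simp: add scaleR)
qed

lemma has_grad_lincomb:
 fixes F G :: "plane => 'v::real_normed_vector"
 assumes "has_grad F a b z" "has_grad G a' b' z"
 shows "has_grad (%z. F z + t *. G z) (a + t *. a') (b + t *. b') z"
 unfolding has_grad_def
 by (rule has_derivative_eq_rhs[OF has_derivative_add[OF assms(1)[unfolded has_grad_def] has_derivative_scaleR_right[OF assms(2)[unfolded has_grad_def]]]])
  (auto simp: algebra_simps)

lemma reflected_kernel_integrable:
 fixes A K :: "'a::euclidean_space => real"
 assumes "contU A" "contU K" "zero_outside d K"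
 shows "integ (%z. A z * K (q - z))"
proof (rule continuous_zero_outside_integrable[where R="norm q + d"])
 show "contU (%z. A z * K (q - z))"
  by (intro continuous_intros assms continuous_on_compose2[OF assms(2)]) auto
 show "zero_outside (norm q + d) (%z. A z * K (q - z))"
  unfolding zero_outside_def
 proof (intro allI impI)
  fix z :: 'a assume "norm q + d < norm z"
  then have "d < norm (q - z)" using norm_triangle_ineq2[of z q] by (simp add: norm_minus_commute)
  then show "A z * K (q - z) = 0" using zero_outsideD[OF assms(3)] by simp
 qed
qed

text \<open>The reflection in \<open>K (q - z)\<close> reverses the sign of the derivative of the
  kernel and so cancels the sign of the integration by parts.\<close>

lemma integration_by_parts_kernel:
 fixes A K :: "plane => real"
 assumes A: "!!x. has_grad A (A1 x) (A2 x) x" and cA: "contU A1" "contU A2"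
  and K: "!!x. has_grad K (K1 x) (K2 x) x" and cK: "contU K1" "contU K2"
  and Z: "zero_outside d K" "zero_outside d K1" "zero_outside d K2"
 shows "(LI z. A1 z * K (q - z)) = (LI z. A z * K1 (q - z))"
  and "(LI z. A2 z * K (q - z)) = (LI z. A z * K2 (q - z))"
proof -
 have cA0: "contU A" and cK0: "contU K"
  using A K has_grad_isCont by (blast intro: continuous_at_imp_continuous_on)+
 have g: "has_grad (%z. A z * K (q - z)) (A1 z * K (q - z) - A z * K1 (q - z)) (A2 z * K (q - z) - A z * K2 (q - z)) z" for z
  using has_grad_mult[OF A has_grad_reflect[OF K], of q z] by (simp add: algebra_simps)
 have c: "contU (%z. A1 z * K (q - z) - A z * K1 (q - z))" "contU (%z. A2 z * K (q - z) - A z * K2 (q - z))"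
  by (intro continuous_intros cA cA0 continuous_on_compose2[OF cK0] continuous_on_compose2[OF cK(1)] continuous_on_compose2[OF cK(2)]; auto)+
 have z: "A z * K (q - z) = 0" if "norm q + d < norm z" for z
 proof -
  have "d < norm (q - z)" using norm_triangle_ineq2[of z q] that by (simp add: norm_minus_commute)
  then show ?thesis using zero_outsideD[OF Z(1)] by simp
 qed
 note 0 = integral_has_grad_eq_0[OF g c z]
 note I = reflected_kernel_integrable[OF cA(1) cK0 Z(1), of q] reflected_kernel_integrable[OF cA(2) cK0 Z(1), of q]
  reflected_kernel_integrable[OF cA0 cK(1) Z(2), of q] reflected_kernel_integrable[OF cA0 cK(2) Z(3), of q]
 show "(LI z. A1 z * K (q - z)) = (LI z. A z * K1 (q - z))" using 0(1) I by simp
 show "(LI z. A2 z * K (q - z)) = (LI z. A z * K2 (q - z))" using 0(2) I by simp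
qed

lemma conv_bmp_has_grad:
 fixes h :: "plane => 'b::euclidean_space"
 assumes d: "0 < d" and h: "integ h"
 shows "has_grad (conv (bmp d) h) (conv (bmp1 d) h x) (conv (bmp2 d) h x) x"
  "has_grad (conv (bmp1 d) h) (conv (bmp11 d) h x) (conv (bmp12 d) h x) x"
  "has_grad (conv (bmp2 d) h) (conv (bmp12 d) h x) (conv (bmp22 d) h x) x"
 by (rule conv_has_grad[OF bmp_has_grad(1)[OF d] bmp_continuous(2,3)[OF d] bmp_zero_outside(1,2,3)[OF d] h]
   conv_has_grad[OF bmp_has_grad(2)[OF d] bmp_continuous(4,5)[OF d] bmp_zero_outside(2,4,5)[OF d] h]
   conv_has_grad[OF bmp_has_grad(3)[OF d] bmp_continuous(5,6)[OF d] bmp_zero_outside(3,5,6)[OF d] h])+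

lemma conv_bmp_continuous:
 fixes h :: "plane => 'b::euclidean_space"
 assumes d: "0 < d" and h: "integ h"
 shows "contU (conv (bmp d) h)" "contU (conv (bmp1 d) h)" "contU (conv (bmp2 d) h)"
  "contU (conv (bmp11 d) h)" "contU (conv (bmp12 d) h)" "contU (conv (bmp22 d) h)"
 by (rule conv_continuous[OF bmp_continuous(1)[OF d] bmp_zero_outside(1)[OF d] h]
  conv_continuous[OF bmp_continuous(2)[OF d] bmp_zero_outside(2)[OF d] h]
  conv_continuous[OF bmp_continuous(3)[OF d] bmp_zero_outside(3)[OF d] h]
  conv_continuous[OF bmp_continuous(4)[OF d] bmp_zero_outside(4)[OF d] h]
  conv_continuous[OF bmp_continuous(5)[OF d] bmp_zero_outside(5)[OF d] h]
  conv_continuous[OF bmp_continuous(6)[OF d] bmp_zero_outside(6)[OF d] h])+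

text \<open>A smooth convex substitute for the norm, with gradient \<open>unitn\<close>. Smoothness
  at 0 permits the chain rule, convexity yields the Kato inequality.\<close>

definition rootn :: "'v::real_inner => real" where "rootn y = sqrt (1 + y .* y)"

lemma rootn_ge: "1 <= rootn y" "norm y <= rootn y" "rootn y <= 1 + norm y" "(rootn y)\<^sup>2 = 1 + y .* y"
proof -
 show "1 <= rootn y" by (simp add: rootn_def)
 show "(rootn y)\<^sup>2 = 1 + y .* y" by (simp add: rootn_def add_nonneg_nonneg)
 show "norm y <= rootn y" unfolding rootn_def norm_eq_sqrt_inner by simp
 show "rootn y <= 1 + norm y" unfolding rootn_def
  by (rule real_le_lsqrt) (auto simp: power2_sum dot_square_norm add_nonneg_nonneg)
qed

lemma rootn_neq_0: "rootn y ~= 0"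
 using rootn_ge(1)[of y] by auto

lemma rootn_derivative: "(rootn has_derivative (%h. (y .* h) / rootn y)) (at y)"
proof -
 have p: "0 < 1 + y .* y" by (simp add: add_pos_nonneg)
 have "((%y. 1 + y .* y) has_derivative (%h. 2 * (y .* h))) (at y)"
  by (auto intro!: derivative_eq_intros simp: inner_commute)
 from has_derivative_real_sqrt[OF p this]
 show ?thesis unfolding rootn_def by (rule has_derivative_eq_rhs) (auto simp: field_simps)
qed

lemma rootn_continuous: "continuous_on A rootn"
 unfolding rootn_def by (intro continuous_intros)

lemma rootn_lipschitz: "\<bar>rootn x - rootn y\<bar> <= norm (x - y)" for x y :: "'v::euclidean_space"
proof -
 have "norm (rootn x - rootn y) <= 1 * norm (x - y)"
 proof (rule differentiable_bound[of UNIV rootn "%y h. (y .* h) / rootn y"])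
  fix z :: 'v
  show "(rootn has_derivative (%h. (z .* h) / rootn z)) (at z within UNIV)" by (rule has_derivative_at_withinI[OF rootn_derivative])
  show "onorm (%h. (z .* h) / rootn z) <= 1"
  proof (rule onorm_le)
   fix h :: 'v
   have "\<bar>z .* h\<bar> <= norm z * norm h" by (rule Cauchy_Schwarz_ineq2)
   also have "... <= rootn z * norm h" by (intro mult_right_mono rootn_ge) auto
   finally show "norm ((z .* h) / rootn z) <= 1 * norm h" using rootn_ge(1)[of z] by (simp add: divide_le_eq mult.commute)
  qed
 qed auto
 then show ?thesis by simp
qed

definition unitn :: "'v::real_inner => 'v" where "unitn y = (1 / rootn y) *. y"

lemma unitn_norm: "norm (unitn y) <= 1"
 using rootn_ge[of y] by (simp add: unitn_def divide_le_eq)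

lemma unitn_continuous: "continuous_on A unitn"
 unfolding unitn_def by (intro continuous_intros rootn_continuous ballI rootn_neq_0)

lemma unitn_derivative:
 fixes y :: "'v::real_inner"
 shows "(unitn has_derivative (%h. (1 / rootn y) *. h - ((y .* h) / (rootn y) ^ 3) *. y)) (at y)"
proof -
 have nz: "rootn y ~= 0" using rootn_ge(1)[of y] by simp
 have "((%y. inverse (rootn y)) has_derivative (%h. - (inverse (rootn y) * ((y .* h) / rootn y) * inverse (rootn y)))) (at y)"
  by (rule Deriv.has_derivative_inverse[OF nz rootn_derivative])
 note D = has_derivative_scaleR[OF this has_derivative_ident]
 have e: "unitn = (%x :: 'v. x /\<^sub>R rootn x)" by (auto simp: unitn_def fun_eq_iff inverse_eq_divide)
 show ?thesis
  by (subst e, rule has_derivative_eq_rhs[OF D]) (auto simp: fun_eq_iff inverse_eq_divide power3_eq_cube)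
qed

text \<open>Convexity of \<open>rootn\<close>: the quadratic form of its Hessian is nonnegative by
  Cauchy-Schwarz, because \<open>y \<bullet> y\<close> is at most the square of
  \<open>rootn y\<close>.\<close>

lemma unitn_derivative_nonneg:
 "0 <= ((1 / rootn y) *. h - ((y .* h) / (rootn y) ^ 3) *. y) .* h"
proof -
 define s where "s = rootn y"
 have s: "1 <= s" "s\<^sup>2 = 1 + y .* y" using rootn_ge[of y] by (auto simp: s_def)
 have "(y .* h)\<^sup>2 <= (y .* y) * (h .* h)" by (rule Cauchy_Schwarz_ineq)
 also have "... <= s\<^sup>2 * (h .* h)" unfolding s(2) by (intro mult_right_mono) auto
 finally have "(y .* h)\<^sup>2 / s ^ 3 <= s\<^sup>2 * (h .* h) / s ^ 3" using s by (intro divide_right_mono) auto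
 also have "... = (h .* h) / s" using s(1) by (simp add: power2_eq_square power3_eq_cube)
 finally show ?thesis by (simp add: s_def[symmetric] inner_diff_left power2_eq_square)
qed

section \<open>Local boundedness of weak solutions by Kato's inequality\<close>

text \<open>All functions are cut off to a closed disk and thus globally integrable; the equations
  survive as identities between convolutions whose kernels fit into the disk.
  \<open>coercive\<close> is the only growth information on the potential, so \<open>f\<close> is no
  more than integrable.\<close>

locale weak_solution =
 fixes u g1 g2 :: "plane => 'v::euclidean_space" and V :: "'v => real" and dV :: "'v => 'v"
  and C0 :: real and c :: "plane" and R :: real and f :: "plane => 'v"
 assumes V_deriv: "!!y. (V has_derivative (%h. dV y .* h)) (at y)" and dV_cont: "contU dV"
  and coercive: "!!y. - C0 * rootn y <= y .* dV y" and C0: "0 <= C0" and R: "0 < R"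
  and outside: "!!x. x ~: cball c R ==> u x = 0" "!!x. x ~: cball c R ==> g1 x = 0" "!!x. x ~: cball c R ==> g2 x = 0"
  and int: "integ u" "integ g1" "integ g2" "integ f"
  and int2: "integ (%x. (norm (g1 x))\<^sup>2)" "integ (%x. (norm (g2 x))\<^sup>2)"
  and f_def: "!!x. f x = indicator (cball c R) x *. dV (u x)"
  and weak1: "!!x d. 0 < d ==> cball x d <= cball c R ==> conv (bmp1 d) u x = conv (bmp d) g1 x"
  and weak2: "!!x d. 0 < d ==> cball x d <= cball c R ==> conv (bmp2 d) u x = conv (bmp d) g2 x"
  and weak_eq: "!!x d. 0 < d ==> cball x d <= cball c R ==> conv (bmp1 d) g1 x + conv (bmp2 d) g2 x = conv (bmp d) f x"
begin

lemma borel: "u : borel_fun" "g1 : borel_fun" "g2 : borel_fun" "f : borel_fun"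
 using int by auto

lemma inner_cball: "x : ball c (R - d) ==> cball x d <= cball c R"
 by (auto simp: cball_subset_cball_iff dist_commute)

text \<open>\<open>weak1\<close> and \<open>weak2\<close> hold for an open set of centres and may
  therefore be differentiated once more; \<open>weak_eq\<close> then gives the equation for the
  mollified map.\<close>

lemma laplacian_conv:
 assumes d: "0 < d" and x: "x : ball c (R - d)"
 shows "conv (bmp11 d) u x + conv (bmp22 d) u x = conv (bmp d) f x"
proof -
 have "has_grad (conv (bmp d) g1) (conv (bmp11 d) u x) (conv (bmp12 d) u x) x"
  by (rule has_grad_cong_open[OF conv_bmp_has_grad(2)[OF d int(1)] open_ball x]) (rule weak1[OF d inner_cball])
 from has_grad_unique(1)[OF this conv_bmp_has_grad(1)[OF d int(2)]]
 have 1: "conv (bmp11 d) u x = conv (bmp1 d) g1 x" .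
 have "has_grad (conv (bmp d) g2) (conv (bmp12 d) u x) (conv (bmp22 d) u x) x"
  by (rule has_grad_cong_open[OF conv_bmp_has_grad(3)[OF d int(1)] open_ball x]) (rule weak2[OF d inner_cball])
 from has_grad_unique(2)[OF this conv_bmp_has_grad(1)[OF d int(3)]]
 have 2: "conv (bmp22 d) u x = conv (bmp2 d) g2 x" .
 show ?thesis unfolding 1 2 by (rule weak_eq[OF d inner_cball[OF x]])
qed

text \<open>For the smooth map \<open>U\<close> the Laplacian of \<open>rootn U\<close> is
  \<open>unitn U \<bullet> \<Delta>U\<close> plus two terms that are nonnegative by convexity. This
  is tested against a bump, and both derivatives are moved to the kernel.\<close>

lemma kato_conv:
 assumes d: "0 < d" and r: "0 < r" and q: "cball q r <= ball c (R - d)"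
 shows "(LI z. unitn (conv (bmp d) u z) .* conv (bmp d) f z * bmp r (q - z))
  <= (LI z. (rootn (conv (bmp d) u z) - 1) * (bmp11 r (q - z) + bmp22 r (q - z)))"
proof -
 define U P Q P1 P2 Q2 where "U = conv (bmp d) u" and "P = conv (bmp1 d) u" and "Q = conv (bmp2 d) u"
  and "P1 = conv (bmp11 d) u" and "P2 = conv (bmp12 d) u" and "Q2 = conv (bmp22 d) u"
 note defs = U_def P_def Q_def P1_def P2_def Q2_def
 have g: "has_grad U (P x) (Q x) x" "has_grad P (P1 x) (P2 x) x" "has_grad Q (P2 x) (Q2 x) x" for x
  unfolding defs by (rule conv_bmp_has_grad[OF d int(1)])+
 have cont: "contU U" "contU P" "contU Q" "contU P1" "contU P2" "contU Q2"
  unfolding defs by (rule conv_bmp_continuous[OF d int(1)])+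
 \<comment> \<open>The Hessian of \<open>rootn\<close> at \<open>y\<close>, applied to
   \<open>h\<close>.\<close>
 define T where "T y h = (1 / rootn y) *. h - ((y .* h) / (rootn y) ^ 3) *. y" for y h :: 'v
 have cT: "contU (%x. T (U x) (H x))" if "contU H" for H
  unfolding T_def
  by (intro continuous_intros that cont continuous_on_compose2[OF rootn_continuous[of UNIV] cont(1)] ballI) (auto simp: rootn_neq_0)
 have cN: "contU (%x. unitn (U x))" by (rule continuous_on_compose2[OF unitn_continuous[of UNIV] cont(1)]) auto
 have gPhi: "has_grad (%x. rootn (U x) - 1) (unitn (U x) .* P x) (unitn (U x) .* Q x) x" for x
 proof -
  have "((%y. rootn y - 1) has_derivative (%h. unitn (U x) .* h)) (at (U x))"
   using rootn_derivative[of "U x"] by (auto intro!: derivative_eq_intros simp: unitn_def)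
  from has_grad_compose[OF g(1) this] show ?thesis .
 qed
 have gN: "has_grad (%x. unitn (U x)) (T (U x) (P x)) (T (U x) (Q x)) x" for x
  using has_grad_compose[OF g(1) unitn_derivative[of "U x"]] by (simp add: T_def)
 have gNP: "has_grad (%x. unitn (U x) .* P x) (unitn (U x) .* P1 x + T (U x) (P x) .* P x) (unitn (U x) .* P2 x + T (U x) (Q x) .* P x) x" for x
  by (rule has_grad_inner[OF gN g(2)])
 have gNQ: "has_grad (%x. unitn (U x) .* Q x) (unitn (U x) .* P2 x + T (U x) (P x) .* Q x) (unitn (U x) .* Q2 x + T (U x) (Q x) .* Q x) x" for x
  by (rule has_grad_inner[OF gN g(3)])
 note bc = bmp_continuous[OF r] and bz = bmp_zero_outside[OF r] and bg = bmp_has_grad[OF r]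
 have cNP: "contU (%x. unitn (U x) .* P x)" "contU (%x. unitn (U x) .* Q x)"
  by (intro continuous_intros cN cont)+
 have i11: "(LI z. (unitn (U z) .* P z) * bmp1 r (q - z)) = (LI z. (rootn (U z) - 1) * bmp11 r (q - z))"
  by (rule integration_by_parts_kernel(1)[OF gPhi cNP bg(2) bc(4,5) bz(2,4,5)])
 have i22: "(LI z. (unitn (U z) .* Q z) * bmp2 r (q - z)) = (LI z. (rootn (U z) - 1) * bmp22 r (q - z))"
  by (rule integration_by_parts_kernel(2)[OF gPhi cNP bg(3) bc(5,6) bz(3,5,6)])
 have cD1: "contU (%x. unitn (U x) .* P1 x + T (U x) (P x) .* P x)" "contU (%x. unitn (U x) .* P2 x + T (U x) (Q x) .* P x)"
  by (intro continuous_intros cN cont cT)+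
 have cD2: "contU (%x. unitn (U x) .* P2 x + T (U x) (P x) .* Q x)" "contU (%x. unitn (U x) .* Q2 x + T (U x) (Q x) .* Q x)"
  by (intro continuous_intros cN cont cT)+
 have j11: "(LI z. (unitn (U z) .* P1 z + T (U z) (P z) .* P z) * bmp r (q - z)) = (LI z. (unitn (U z) .* P z) * bmp1 r (q - z))"
  by (rule integration_by_parts_kernel(1)[OF gNP cD1 bg(1) bc(2,3) bz(1,2,3)])
 have j22: "(LI z. (unitn (U z) .* Q2 z + T (U z) (Q z) .* Q z) * bmp r (q - z)) = (LI z. (unitn (U z) .* Q z) * bmp2 r (q - z))"
  by (rule integration_by_parts_kernel(2)[OF gNQ cD2 bg(1) bc(2,3) bz(1,2,3)])
 have cPhi: "contU (%x. rootn (U x) - 1)"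
  by (intro continuous_intros continuous_on_compose2[OF rootn_continuous[of UNIV] cont(1)]) auto
 have cf: "contU (conv (bmp d) f)" by (rule conv_bmp_continuous[OF d int(4)])
 have "(LI z. unitn (U z) .* conv (bmp d) f z * bmp r (q - z))
   <= (LI z. (unitn (U z) .* P1 z + T (U z) (P z) .* P z) * bmp r (q - z) + (unitn (U z) .* Q2 z + T (U z) (Q z) .* Q z) * bmp r (q - z))"
 proof (rule integral_mono)
  show "integ (%z. unitn (U z) .* conv (bmp d) f z * bmp r (q - z))"
   by (rule reflected_kernel_integrable[OF _ bc(1) bz(1)]) (intro continuous_intros cN cf)
  show "integ (%z. (unitn (U z) .* P1 z + T (U z) (P z) .* P z) * bmp r (q - z) + (unitn (U z) .* Q2 z + T (U z) (Q z) .* Q z) * bmp r (q - z))"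
   by (intro B_integrable_add reflected_kernel_integrable[OF _ bc(1) bz(1)] cD1 cD2)
  fix z
  show "unitn (U z) .* conv (bmp d) f z * bmp r (q - z)
   <= (unitn (U z) .* P1 z + T (U z) (P z) .* P z) * bmp r (q - z) + (unitn (U z) .* Q2 z + T (U z) (Q z) .* Q z) * bmp r (q - z)"
  proof (cases "z : cball q r")
   case True
   then have z: "z : ball c (R - d)" using q by blast
   have "conv (bmp d) f z = P1 z + Q2 z" using laplacian_conv[OF d z] by (simp add: defs)
   then have "unitn (U z) .* conv (bmp d) f z <= (unitn (U z) .* P1 z + T (U z) (P z) .* P z) + (unitn (U z) .* Q2 z + T (U z) (Q z) .* Q z)"
    using unitn_derivative_nonneg[of "U z" "P z"] unitn_derivative_nonneg[of "U z" "Q z"]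
    by (simp add: inner_add_right T_def)
   from mult_right_mono[OF this mollifierD(2)[OF bmp_mollifier[OF r], of "q - z"]]
   show ?thesis by (simp add: distrib_right)
  next
   case False
   then have "r < norm (q - z)" by (simp add: dist_norm)
   then show ?thesis using zero_outsideD[OF bz(1)] by simp
  qed
 qed
 also have "... = (LI z. (rootn (U z) - 1) * bmp11 r (q - z)) + (LI z. (rootn (U z) - 1) * bmp22 r (q - z))"
  unfolding i11[symmetric] i22[symmetric] j11[symmetric] j22[symmetric]
  by (intro B_integral_add reflected_kernel_integrable[OF _ bc(1) bz(1)] cD1 cD2)
 also have "... = (LI z. (rootn (U z) - 1) * (bmp11 r (q - z) + bmp22 r (q - z)))"
  unfolding distrib_left
  by (intro B_integral_add[symmetric] reflected_kernel_integrable[OF cPhi bc(4) bz(4)] reflected_kernel_integrable[OF cPhi bc(6) bz(6)])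
 finally show ?thesis unfolding defs .
qed

text \<open>Subtracting 1 makes the function vanish where \<open>u\<close> does, so that it is
  integrable over the plane.\<close>

definition G where "G x = rootn (u x) - 1"

lemma G_integrable: "integ G" and G_nonneg: "0 <= G x"
proof -
 show "0 <= G x" using rootn_ge(1)[of "u x"] by (simp add: G_def)
 have [measurable]: "rootn : borel_fun" using rootn_continuous by (rule borel_measurable_continuous_onI)
 show "integ G"
 proof (rule B_integrable_bound[OF int(1)])
  show "G : borel_measurable lborel" unfolding G_def[abs_def] using borel(1) by measurable
  show "AE x in lborel. norm (G x) <= norm (u x)"
  proof (rule AE_I2)
   fix x show "norm (G x) <= norm (u x)" using rootn_ge(1,3)[of "u x"] by (simp add: G_def)
  qed
 qed
qed

text \<open>The limit of \<open>kato_conv\<close> for vanishing mollification. Since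
  \<open>unitn\<close> is bounded, L^1 convergence of the mollified \<open>f\<close> and domination
  by \<open>2 * norm (f x)\<close> suffice. The coercivity then bounds
  \<open>unitn (u z) \<bullet> f z\<close> below by \<open>- C0\<close>.\<close>

lemma kato:
 assumes r: "0 < r" and q: "cball q r <= ball c R"
 shows "- C0 <= conv (bmp11 r) G q + conv (bmp22 r) G q"
proof -
 have qr: "dist q c + r < R" using q r by (simp add: cball_subset_ball_iff)
 define d0 where "d0 = (R - (dist q c + r)) / 2"
 have d0: "0 < d0" using qr by (simp add: d0_def)
 define D0 where "D0 n = d0 * inverse (real (Suc n))" for n
 have D0: "0 < D0 n" "D0 n <= d0" for n
  using d0 by (auto simp: D0_def intro!: mult_left_le simp: inverse_le_1_iff)
 have D0l: "D0 ~~> 0" unfolding D0_def[abs_def] using tendsto_mult_right_zero[OF LIMSEQ_inverse_real_of_nat, of d0] .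
 have mol: "mollifier (D0 n) (bmp (D0 n))" for n by (rule bmp_mollifier[OF D0(1)])
 note M1 = mollify_L1_seq[OF int(1) mol D0l] and Mf = mollify_L1_seq[OF int(4) mol D0l]
 obtain s where s: "strict_mono (s :: nat => nat)" "AE x in lborel. (%n. conv (bmp (D0 (s n))) u x) ~~> u x"
  by (rule AE_subseq_of_L1[OF M1])
 define D where "D n = D0 (s n)" for n
 have D: "0 < D n" "D n <= d0" for n using D0 by (auto simp: D_def)
 have sub: "cball q r <= ball c (R - D n)" for n
  using qr D(2)[of n] r unfolding d0_def by (simp add: cball_subset_ball_iff)
 define U where "U n = conv (bmp (D n)) u" for n
 define X where "X n = conv (bmp (D n)) f" for n
 have Um[measurable]: "U n : borel_fun" and Xm[measurable]: "X n : borel_fun" for n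
  unfolding U_def X_def by (intro conv_mollifier_measurable[OF bmp_mollifier[OF D(1)]] int)+
 note [measurable] = borel
 have rm[measurable]: "rootn : borel_measurable (borel :: 'v measure)" and nm[measurable]: "unitn : borel_measurable (borel :: 'v measure)"
  using rootn_continuous unitn_continuous by (auto intro: borel_measurable_continuous_onI)
 have U1: "integ (%x. U n x - u x)" "(%n. LI x. norm (U n x - u x)) ~~> 0" for n
  using M1(1)[of "s n"] LIMSEQ_subseq_LIMSEQ[OF M1(2) s(1)] by (auto simp: U_def D_def comp_def)
 have X1: "integ (%x. X n x - f x)" "(%n. LI x. norm (X n x - f x)) ~~> 0" for n
  using Mf(1)[of "s n"] LIMSEQ_subseq_LIMSEQ[OF Mf(2) s(1)] by (auto simp: X_def D_def comp_def)
 note bc = bmp_continuous[OF r] and bz = bmp_zero_outside[OF r]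
 have kern: "contU (%z. bmp r (q - z))" "contU (%z. bmp11 r (q - z) + bmp22 r (q - z))"
  by (intro continuous_intros continuous_on_compose2[OF bc(1)] continuous_on_compose2[OF bc(4)] continuous_on_compose2[OF bc(6)]; auto)+
 obtain B1 where B1: "!!x. \<bar>bmp r x\<bar> <= B1" using bounded_compact_support[OF bc(1) bz(1)] by blast
 obtain B11 where B11: "!!x. \<bar>bmp11 r x\<bar> <= B11" using bounded_compact_support[OF bc(4) bz(4)] by blast
 obtain B22 where B22: "!!x. \<bar>bmp22 r x\<bar> <= B22" using bounded_compact_support[OF bc(6) bz(6)] by blast
 have lim1: "(%n. LI z. (bmp11 r (q - z) + bmp22 r (q - z)) * (rootn (U n z) - 1)) ~~> (LI z. (bmp11 r (q - z) + bmp22 r (q - z)) * G z)"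
 proof (rule bounded_weight_L1_limit(1)[where B="B11 + B22"])
  show "(%z. bmp11 r (q - z) + bmp22 r (q - z)) : borel_fun" using kern(2) by (rule borel_measurable_continuous_onI)
  show "\<bar>bmp11 r (q - x) + bmp22 r (q - x)\<bar> <= B11 + B22" for x
   using B11[of "q - x"] B22[of "q - x"] by linarith
  have le: "\<bar>rootn (U n z) - 1 - G z\<bar> <= norm (U n z - u z)" for n z using rootn_lipschitz[of "U n z" "u z"] by (simp add: G_def)
  show int': "integ (%x. rootn (U n x) - 1 - G x)" for n
   by (rule B_integrable_bound[OF U1(1)[of n]]) (use le in \<open>auto simp: G_def[abs_def]\<close>)
  show "(%n. LI x. \<bar>rootn (U n x) - 1 - G x\<bar>) ~~> 0"
  proof (rule Lim_null_comparison[OF _ U1(2)], intro always_eventually allI)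
   fix n
   have "(LI x. \<bar>rootn (U n x) - 1 - G x\<bar>) <= (LI x. norm (U n x - u x))"
    by (rule integral_mono[OF integrable_abs[OF int'] integrable_norm[OF U1(1)] le])
   then show "norm (LI x. \<bar>rootn (U n x) - 1 - G x\<bar>) <= (LI x. norm (U n x - u x))" by simp
  qed
 qed (rule G_integrable)
 have fN: "integ (%z. unitn (u z) .* f z)"
 proof (rule B_integrable_bound[OF int(4)])
  show "AE x in lborel. norm (unitn (u x) .* f x) <= norm (f x)"
  proof (rule AE_I2)
   fix x
   have "\<bar>unitn (u x) .* f x\<bar> <= norm (unitn (u x)) * norm (f x)" by (rule Cauchy_Schwarz_ineq2)
   also have "... <= 1 * norm (f x)" by (intro mult_right_mono unitn_norm) auto
   finally show "norm (unitn (u x) .* f x) <= norm (f x)" by simp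
  qed
 qed measurable
 define E where "E n x = (unitn (U n x) - unitn (u x)) .* f x" for n x
 have Em[measurable]: "E n : borel_fun" for n unfolding E_def[abs_def] by measurable
 have Eb: "\<bar>E n x\<bar> <= 2 * norm (f x)" for n x
 proof -
  have "\<bar>E n x\<bar> <= norm (unitn (U n x) - unitn (u x)) * norm (f x)" unfolding E_def by (rule Cauchy_Schwarz_ineq2)
  also have "... <= 2 * norm (f x)"
   using norm_triangle_ineq4[of "unitn (U n x)" "unitn (u x)"] unitn_norm[of "U n x"] unitn_norm[of "u x"]
   by (intro mult_right_mono) auto
  finally show ?thesis .
 qed
 have Eint: "integ (E n)" for n
  by (rule B_integrable_bound[OF integrable_mult_right[OF integrable_norm[OF int(4)], of 2]]) (use Eb in auto)
 have Elim: "(%n. LI x. \<bar>E n x\<bar>) ~~> 0"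
 proof -
  have "(%n. LI x. \<bar>E n x\<bar>) ~~> (\<integral>x. 0 \<partial>(lborel :: (plane) measure))"
  proof (rule integral_dominated_convergence[where w="%x. 2 * norm (f x)"])
   show "integ (%x. 2 * norm (f x))" using int(4) by auto
   show "AE x in lborel. (%n. \<bar>E n x\<bar>) ~~> 0"
    using s(2)
   proof eventually_elim
    fix x assume l: "(%n. conv (bmp (D0 (s n))) u x) ~~> u x"
    then have "(%n. U n x) ~~> u x" by (simp add: U_def D_def)
    then have "(%n. unitn (U n x)) ~~> unitn (u x)"
     by (rule continuous_on_tendsto_compose[OF unitn_continuous[of UNIV]]) auto
    then have "(%n. E n x) ~~> (unitn (u x) - unitn (u x)) .* f x" unfolding E_def by (intro tendsto_intros)
    then show "(%n. \<bar>E n x\<bar>) ~~> 0" by (simp add: tendsto_rabs_zero)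
   qed
  qed (use Eb in auto)
  then show ?thesis by simp
 qed
 have lim2: "(%n. LI z. bmp r (q - z) * (unitn (U n z) .* X n z)) ~~> (LI z. bmp r (q - z) * (unitn (u z) .* f z))"
 proof (rule bounded_weight_L1_limit(1)[where B=B1])
  show "(%z. bmp r (q - z)) : borel_fun" using kern(1) by (rule borel_measurable_continuous_onI)
  show "\<bar>bmp r (q - x)\<bar> <= B1" for x by (rule B1)
  have le: "\<bar>unitn (U n x) .* X n x - unitn (u x) .* f x\<bar> <= norm (X n x - f x) + \<bar>E n x\<bar>" for n x
  proof -
   have "unitn (U n x) .* X n x - unitn (u x) .* f x = unitn (U n x) .* (X n x - f x) + E n x"
    by (simp add: E_def inner_diff_left inner_diff_right)
   moreover have "\<bar>unitn (U n x) .* (X n x - f x)\<bar> <= norm (unitn (U n x)) * norm (X n x - f x)" by (rule Cauchy_Schwarz_ineq2)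
   moreover have "norm (unitn (U n x)) * norm (X n x - f x) <= 1 * norm (X n x - f x)" by (intro mult_right_mono unitn_norm) auto
   ultimately show ?thesis by linarith
  qed
  show int': "integ (%x. unitn (U n x) .* X n x - unitn (u x) .* f x)" for n
   by (rule B_integrable_bound[OF B_integrable_add[OF integrable_norm[OF X1(1)[of n]] integrable_abs[OF Eint[of n]]]])
    (use le in \<open>auto intro!: AE_I2 intro: order_trans[OF _ abs_ge_self]\<close>)
  show "(%n. LI x. \<bar>unitn (U n x) .* X n x - unitn (u x) .* f x\<bar>) ~~> 0"
  proof (rule Lim_null_comparison, intro always_eventually allI)
   fix n
   have "(LI x. \<bar>unitn (U n x) .* X n x - unitn (u x) .* f x\<bar>) <= (LI x. norm (X n x - f x) + \<bar>E n x\<bar>)"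
    by (rule integral_mono[OF integrable_abs[OF int'] B_integrable_add[OF integrable_norm[OF X1(1)] integrable_abs[OF Eint]] le])
   also have "... = (LI x. norm (X n x - f x)) + (LI x. \<bar>E n x\<bar>)"
    by (rule B_integral_add[OF integrable_norm[OF X1(1)] integrable_abs[OF Eint]])
   finally show "norm (LI x. \<bar>unitn (U n x) .* X n x - unitn (u x) .* f x\<bar>) <= (LI x. norm (X n x - f x)) + (LI x. \<bar>E n x\<bar>)" by simp
   show "(%n. (LI x. norm (X n x - f x)) + (LI x. \<bar>E n x\<bar>)) ~~> 0"
    using tendsto_add[OF X1(2) Elim] by simp
  qed
 qed (rule fN)
 have ineq: "(LI z. bmp r (q - z) * (unitn (u z) .* f z)) <= (LI z. (bmp11 r (q - z) + bmp22 r (q - z)) * G z)"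
 proof (rule tendsto_le[OF _ lim1 lim2])
  show "\<forall>\<^sub>F n in sequentially. (LI z. bmp r (q - z) * (unitn (U n z) .* X n z)) <= (LI z. (bmp11 r (q - z) + bmp22 r (q - z)) * (rootn (U n z) - 1))"
   using kato_conv[OF D(1) r sub] by (intro always_eventually allI) (simp add: U_def X_def mult.commute)
 qed simp
 have "- C0 = (LI z. - C0 * bmp r (q - z))"
  using integral_reflect[OF mollifierD(5)[OF bmp_mollifier[OF r]], of q] mollifierD(4)[OF bmp_mollifier[OF r]] by simp
 also have "... <= (LI z. bmp r (q - z) * (unitn (u z) .* f z))"
 proof (rule integral_mono)
  show "integ (%z. - C0 * bmp r (q - z))"
   by (rule reflected_kernel_integrable[OF continuous_on_const bc(1) bz(1)])
  show "integ (%z. bmp r (q - z) * (unitn (u z) .* f z))"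
   using conv_integrable[OF bc(1) bz(1) fN, of q] by simp
  fix z
  show "- C0 * bmp r (q - z) <= bmp r (q - z) * (unitn (u z) .* f z)"
  proof (cases "z : cball q r")
   case True
   then have zc: "z : cball c R" using q by auto
   have rp: "0 < rootn (u z)" using rootn_ge(1)[of "u z"] by linarith
   have "unitn (u z) .* f z = (u z .* dV (u z)) / rootn (u z)" using zc by (simp add: unitn_def f_def)
   also have "... >= - C0" using coercive[of "u z"] rp by (simp add: pos_le_divide_eq)
   finally have "- C0 <= unitn (u z) .* f z" .
   from mult_left_mono[OF this mollifierD(2)[OF bmp_mollifier[OF r], of "q - z"]] show ?thesis by (simp add: mult.commute)
  next
   case False
   then have "r < norm (q - z)" by (simp add: dist_norm)
   then show ?thesis using zero_outsideD[OF bz(1)] by simp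
  qed
 qed
 also note ineq
 also have "(LI z. (bmp11 r (q - z) + bmp22 r (q - z)) * G z) = conv (bmp11 r) G q + conv (bmp22 r) G q"
  using conv_integrable[OF bc(4) bz(4) G_integrable, of q] conv_integrable[OF bc(6) bz(6) G_integrable, of q]
  by (simp add: conv_def distrib_right)
 finally show ?thesis .
qed

text \<open>Mollifications of \<open>G\<close> are smooth with Laplacian at least
  \<open>- C0\<close>, so the mean value inequality bounds them pointwise by the L^1 norm of
  \<open>G\<close>, independently of the mollification radius.\<close>

lemma G_conv_bounded:
 assumes R1: "0 < R1" "R1 < R"
 obtains B d0 where "0 < d0" "!!d x. 0 < d ==> d < d0 ==> x : ball c R1 ==> conv (bmp d) G x <= B"
proof -
 \<comment> \<open>A quarter of the margin: the disks of radius \<open>2 * s\<close> together with a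
   mollification radius below \<open>s\<close> use three quarters of it.\<close>
 define s where "s = (R - R1) / 4"
 have s: "0 < s" and s4: "4 * s = R - R1" using R1 by (auto simp: s_def)
 obtain d1 where d1: "d1 > 0" "!!r K. r < d1 ==> mollifier r K ==> (NNI x. ennreal (norm (conv K G x - G x))) <= ennreal 1"
  using mollify_L1[OF G_integrable, of 1] by auto
 define I where "I = (LI x. G x)"
 define d0 where "d0 = min d1 s"
 define B where "B = (4 * ((I + 1) / s\<^sup>2) + C0 * s\<^sup>2 / 2 * rcut_mass 1) / rwt_mass 1"
 show thesis
 proof (rule that[of d0 B])
  show "0 < d0" using d1 s by (simp add: d0_def)
  fix d x assume d: "0 < d" "d < d0" and x: "x : ball c R1"
  define g where "g = conv (bmp d) G"
  have bsub: "cball y d <= ball c R" if "y : ball x (2 * s)" for y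
  proof
   fix z assume z: "z : cball y d"
   have "dist c z <= dist c x + dist x y + dist y z" by (metis add_mono_thms_linordered_semiring(3) dist_triangle order_trans)
   also have "... < R1 + 2 * s + s" using x z d that by (auto simp: d0_def)
   also have "... <= R" using R1(2) s4 by linarith
   finally show "z : ball c R" by simp
  qed
  note cg = conv_bmp_continuous[OF d(1) G_integrable]
  have mv: "g x * rwt_mass 1 <= (LI z. rwt 1 z * g (x + s *. z)) + C0 * s\<^sup>2 / 2 * rcut_mass 1"
   unfolding g_def
  proof (rule weighted_mean_value_inequality[OF conv_bmp_has_grad(1)[OF d(1) G_integrable] conv_bmp_has_grad(2)[OF d(1) G_integrable] conv_bmp_has_grad(3)[OF d(1) G_integrable]])
   show "- C0 <= conv (bmp11 d) G y + conv (bmp22 d) G y" if "y : ball x (2 * s)" for y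
    by (rule kato[OF d(1) bsub[OF that]])
  qed (use cg s in \<open>auto intro: continuous_on_subset\<close>)
  have mol: "mollifier d (bmp d)" by (rule bmp_mollifier[OF d(1)])
  have gint: "integ g"
  proof -
   have "integ (%x. conv (bmp d) G x - G x)"
    using mollify_L1_seq(1)[OF G_integrable, of "%n. d * inverse (real (Suc n))" "%n. bmp (d * inverse (real (Suc n)))" 0]
     bmp_mollifier d(1) tendsto_mult_right_zero[OF LIMSEQ_inverse_real_of_nat, of d] by simp
   from B_integrable_add[OF this G_integrable] show ?thesis by (simp add: g_def)
  qed
  have gn: "0 <= g y" for y
   unfolding g_def conv_def by (rule integral_nonneg_AE) (use mollifierD(2)[OF mol] G_nonneg in auto)
  have gI: "integral\<^sup>L lborel g <= I + 1"
  proof -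
   have i': "integ (%x. g x - G x)" using gint G_integrable by auto
   have "ennreal (LI x. norm (g x - G x)) = (NNI x. ennreal (norm (g x - G x)))"
    using i' by (intro nn_integral_eq_integral[symmetric]) auto
   also have "... <= ennreal 1" unfolding g_def using d by (intro d1(2)[OF _ mol]) (simp add: d0_def)
   finally have "(LI x. norm (g x - G x)) <= 1" by simp
   moreover have "integral\<^sup>L lborel g - I <= (LI x. norm (g x - G x))"
   proof -
    have "integral\<^sup>L lborel g - I = (LI x. g x - G x)" unfolding I_def using gint G_integrable by simp
    also have "... <= (LI x. norm (g x - G x))" using i' by (intro integral_mono) auto
    finally show ?thesis .
   qed
   ultimately show ?thesis by linarith
  qed
  have gm: "g : borel_fun" using gint by auto
  have "(LI z. rwt 1 z * g (x + s *. z)) <= (LI z. 4 * g (x + s *. z))"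
  proof (rule integral_mono)
   have "contU g" using cg(1) by (simp add: g_def)
   then have "continuous_on (ball x (2 * s)) g" by (rule continuous_on_subset) auto
   from cutoff_mult_integrable[OF rwt_continuous rwt_zero_outside this, of s] s
   show "integ (%z. rwt 1 z * g (x + s *. z))" by simp
   have "integrable (density (distr lborel borel (%z. x + s *. z)) (%_. ennreal (\<bar>s\<bar> ^ DIM(plane)))) g"
    using gint lborel_affine[of s x] s by simp
   then have "integrable (distr lborel borel (%z. x + s *. z)) (%z. (\<bar>s\<bar> ^ DIM(plane)) *. g z)"
    by (subst (asm) integrable_density) (use gm in auto)
   then have "integ (%z. (\<bar>s\<bar> ^ DIM(plane)) *. g (x + s *. z))"
    by (subst (asm) integrable_distr_eq) (use gm in auto)
   then show "integ (%z. 4 * g (x + s *. z))" using s by simp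
   show "rwt 1 z * g (x + s *. z) <= 4 * g (x + s *. z)" for z
    by (intro mult_right_mono gn) (simp add: rwt_def)
  qed
  also have "... = 4 * (integral\<^sup>L lborel g / s\<^sup>2)"
   using integral_affine_substitution[OF gm s, of x] s by simp
  also have "... <= 4 * ((I + 1) / s\<^sup>2)" using gI s by (intro mult_left_mono divide_right_mono) auto
  finally have "g x * rwt_mass 1 <= 4 * ((I + 1) / s\<^sup>2) + C0 * s\<^sup>2 / 2 * rcut_mass 1" using mv by linarith
  then show "conv (bmp d) G x <= B" unfolding B_def g_def[symmetric]
   using rwt_mass_pos[of 1] by (simp add: pos_le_divide_eq)
 qed
qed

text \<open>The mollifications share a bound and converge to \<open>G\<close> in L^1, so the part of
  \<open>G\<close> above that bound has an integral below every positive \<open>e\<close>.\<close>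

lemma locally_bounded:
 assumes R1: "0 < R1" "R1 < R"
 obtains B where "0 <= B" "AE x in lborel. x : ball c R1 --> norm (u x) <= B"
proof -
 obtain B d0 where B: "0 < d0" "!!d x. 0 < d ==> d < d0 ==> x : ball c R1 ==> conv (bmp d) G x <= B"
  by (rule G_conv_bounded[OF R1]) blast
 define E where "E = (NNI x. ennreal (G x - B) * indicator (ball c R1) x)"
 have [measurable]: "G : borel_fun" using G_integrable by auto
 have [measurable]: "ball c R1 : sets borel" by auto
 have "E <= ennreal e" if e: "0 < e" for e
 proof -
  obtain d1 where d1: "d1 > 0" "!!r K. r < d1 ==> mollifier r K ==> (NNI x. ennreal (norm (conv K G x - G x))) <= ennreal e"
   using mollify_L1[OF G_integrable e] by auto
  define d where "d = min d0 d1 / 2"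
  have d: "0 < d" "d < d0" "d < d1" using B d1 by (auto simp: d_def)
  have "E <= (NNI x. ennreal (norm (conv (bmp d) G x - G x)))"
   unfolding E_def
  proof (rule nn_integral_mono)
   fix x
   show "ennreal (G x - B) * indicator (ball c R1) x <= ennreal (norm (conv (bmp d) G x - G x))"
   proof (cases "x : ball c R1")
    case True
    have "G x - B <= norm (conv (bmp d) G x - G x)" using B(2)[OF d(1,2) True] by simp
    then show ?thesis using True by (simp add: ennreal_leI)
   qed simp
  qed
  also have "... <= ennreal e" by (rule d1(2)[OF d(3) bmp_mollifier[OF d(1)]])
  finally show ?thesis .
 qed
 then have "E <= 0 + ennreal e" if "0 < e" for e using that by simp
 then have "E <= 0" by (rule ennreal_le_epsilon)
 then have "E = 0" by simp
 then have "AE x in lborel. ennreal (G x - B) * indicator (ball c R1) x = 0"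
  unfolding E_def by (subst (asm) nn_integral_0_iff_AE) auto
 then have "AE x in lborel. x : ball c R1 --> norm (u x) <= max (B + 1) 0"
 proof eventually_elim
  fix x assume "ennreal (G x - B) * indicator (ball c R1) x = 0"
  then have "x : ball c R1 --> G x <= B" by (auto simp: ennreal_eq_0_iff split: split_indicator_asm)
  then show "x : ball c R1 --> norm (u x) <= max (B + 1) 0" using rootn_ge(2)[of "u x"] by (auto simp: G_def)
 qed
 then show thesis by (intro that[of "max (B + 1) 0"]) auto
qed

end


section \<open>The stress tensor of a weak solution is divergence free\<close>

text \<open>\<open>T n\<close> is bounded but need not tend to 0 uniformly. Splitting
  \<open>G n\<close> into the fixed \<open>g\<close>, for which dominated convergence works, and a
  remainder that is small in L^1 avoids this.\<close>

lemma bounded_times_L1_limit: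
 fixes T G :: "nat => 'a::euclidean_space => 'b::euclidean_space"
 assumes [measurable]: "!!n. T n : borel_fun" and M: "!!n x. norm (T n x) <= M"
  and T0: "AE x in lborel. (%n. T n x) ~~> 0"
  and G: "!!n. integ (%x. G n x - g x)" "(%n. LI x. norm (G n x - g x)) ~~> 0" and g: "integ g"
 shows "(%n. LI x. T n x .* G n x) ~~> 0"
proof -
 have [measurable]: "g : borel_fun" using g by auto
 have le: "\<bar>T n x .* v\<bar> <= M * norm v" for n x v
  using Cauchy_Schwarz_ineq2[of "T n x" v] mult_right_mono[OF M[of n x] norm_ge_zero[of v]] by linarith
 have bint: "integ (%x. T n x .* h x)" if h: "integ h" for n h
 proof (rule B_integrable_bound)
  show "integ (%x. M * norm (h x))" using h by auto
  have [measurable]: "h : borel_fun" using h by auto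
  show "(%x. T n x .* h x) : borel_measurable lborel" by measurable
  show "AE x in lborel. norm (T n x .* h x) <= norm (M * norm (h x))"
   using le by (auto intro!: AE_I2 intro: order_trans[OF _ abs_ge_self])
 qed
 have l1: "(%n. LI x. T n x .* (G n x - g x)) ~~> 0"
 proof (rule Lim_null_comparison, intro always_eventually allI)
  fix n
  have "norm (LI x. T n x .* (G n x - g x)) <= (LI x. norm (T n x .* (G n x - g x)))"
   by (rule integral_norm_bound)
  also have "... <= (LI x. M * norm (G n x - g x))"
   by (rule integral_mono) (use bint[OF G(1)] G(1) le in auto)
  also have "... = M * (LI x. norm (G n x - g x))" by simp
  finally show "norm (LI x. T n x .* (G n x - g x)) <= M * (LI x. norm (G n x - g x))" .
  show "(%n. M * (LI x. norm (G n x - g x))) ~~> 0" by (rule tendsto_mult_right_zero[OF G(2)])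
 qed
 have l2: "(%n. LI x. T n x .* g x) ~~> (\<integral>x. 0 \<partial>(lborel :: 'a measure))"
 proof (rule integral_dominated_convergence[where w="%x. M * norm (g x)"])
  show "integ (%x. M * norm (g x))" using g by auto
  show "AE x in lborel. (%n. T n x .* g x) ~~> 0"
   using T0 by eventually_elim (auto intro: tendsto_eq_intros)
  show "AE x in lborel. norm (T n x .* g x) <= M * norm (g x)" for n using le by auto
 qed measurable
 have "(LI x. T n x .* G n x) = (LI x. T n x .* (G n x - g x)) + (LI x. T n x .* g x)" for n
 proof -
  have "(LI x. T n x .* G n x) = (LI x. T n x .* (G n x - g x) + T n x .* g x)"
   by (simp add: inner_diff_right)
  also have "... = (LI x. T n x .* (G n x - g x)) + (LI x. T n x .* g x)"
   by (rule B_integral_add[OF bint[OF G(1)] bint[OF g]])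
  finally show ?thesis .
 qed
 then show ?thesis using tendsto_add[OF l1 l2] by simp
qed

lemma continuous_bounded_cball:
 fixes H :: "'a::euclidean_space => 'b::real_normed_vector"
 assumes "contU H"
 obtains M where "0 <= M" "!!y. norm y <= B ==> norm (H y) <= M"
proof -
 have "compact (H ` cball 0 B)" by (intro compact_continuous_image continuous_on_subset[OF assms]) auto
 then obtain M where M: "\<forall>y\<in>H ` cball 0 B. norm y <= M" using compact_imp_bounded bounded_iff by blast
 show thesis
 proof (rule that[of "max M 0"])
  fix y :: 'a assume "norm y <= B"
  then have "H y : H ` cball 0 B" by (intro imageI) simp
  then show "norm (H y) <= max M 0" using M by (metis max.coboundedI1)
 qed simp
qed

context weak_solution
begin

lemma V_cont: "continuous_on A V"
 using V_deriv by (intro continuous_at_imp_continuous_on ballI) (rule has_derivative_continuous)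

text \<open>The defect is \<open>div T = \<nabla>U \<cdot> (\<Delta>U - \<nabla>V(U))\<close> for the stress tensor \<open>T\<close> of the smooth map \<open>U\<close>, tested against a kernel.\<close>

lemma hopf_conv:
 assumes d: "0 < d" and r: "0 < r" and q: "cball q r <= ball c (R - d)"
 defines "U \<equiv> conv (bmp d) u" and "P \<equiv> conv (bmp1 d) u" and "Q \<equiv> conv (bmp2 d) u" and "X \<equiv> conv (bmp d) f"
 shows "(LI z. (P z .* Q z) * bmp1 r (q - z)) - (LI z. (V (U z) + (1/2) * (P z .* P z - Q z .* Q z)) * bmp2 r (q - z))
   = (LI z. ((X z - dV (U z)) .* Q z) * bmp r (q - z))" (is ?A)
  and "(LI z. (V (U z) + (-1/2) * (P z .* P z - Q z .* Q z)) * bmp1 r (q - z)) - (LI z. (P z .* Q z) * bmp2 r (q - z))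
   = - (LI z. ((X z - dV (U z)) .* P z) * bmp r (q - z))" (is ?B)
proof -
 define P1 P2 Q2 where "P1 = conv (bmp11 d) u" and "P2 = conv (bmp12 d) u" and "Q2 = conv (bmp22 d) u"
 note defs = U_def P_def Q_def P1_def P2_def Q2_def
 have g: "has_grad U (P x) (Q x) x" "has_grad P (P1 x) (P2 x) x" "has_grad Q (P2 x) (Q2 x) x" for x
  unfolding defs by (rule conv_bmp_has_grad[OF d int(1)])+
 have cont: "contU U" "contU P" "contU Q" "contU P1" "contU P2" "contU Q2"
  unfolding defs by (rule conv_bmp_continuous[OF d int(1)])+
 have cdV: "contU (%z. dV (U z))" by (rule continuous_on_compose2[OF dV_cont cont(1)]) auto
 have cV: "contU (%z. V (U z))" by (rule continuous_on_compose2[OF V_cont[of UNIV] cont(1)]) auto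
 have gV: "has_grad (%z. V (U z)) (dV (U z) .* P z) (dV (U z) .* Q z) z" for z
  by (rule has_grad_compose[OF g(1) V_deriv])
 have gb: "has_grad (%z. P z .* Q z) (P z .* P2 z + P1 z .* Q z) (P z .* Q2 z + P2 z .* Q z) z" for z
  by (rule has_grad_inner[OF g(2,3)])
 have gk: "has_grad (%z. P z .* P z + (-1) *. (Q z .* Q z)) ((P z .* P1 z + P1 z .* P z) + (-1) *. (Q z .* P2 z + P2 z .* Q z))
  ((P z .* P2 z + P2 z .* P z) + (-1) *. (Q z .* Q2 z + Q2 z .* Q z)) z" for z
  by (rule has_grad_lincomb[OF has_grad_inner[OF g(2,2)] has_grad_inner[OF g(3,3)]])
 \<comment> \<open>\<open>(e1 t, e2 t)\<close> is the gradient of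
   \<open>V(U) + t * (|P|^2 - |Q|^2)\<close>; the values \<open>1/2\<close> and \<open>-1/2\<close>
   of \<open>t\<close> give the two diagonal entries.\<close>
 define e1 where "e1 t z = dV (U z) .* P z + (2 * t) * (P z .* P1 z - Q z .* P2 z)" for t :: real and z
 define e2 where "e2 t z = dV (U z) .* Q z + (2 * t) * (P z .* P2 z - Q z .* Q2 z)" for t :: real and z
 have ga: "has_grad (%z. V (U z) + t * (P z .* P z - Q z .* Q z)) (e1 t z) (e2 t z) z" for z t
  using has_grad_lincomb[where t=t, OF gV[of z] gk[of z]] by (simp add: e1_def e2_def inner_commute algebra_simps)
 have ce: "contU (e1 t)" "contU (e2 t)" for t
  unfolding e1_def[abs_def] e2_def[abs_def] by (intro continuous_intros cont cdV)+
 have cb: "contU (%z. P z .* P2 z + P1 z .* Q z)" "contU (%z. P z .* Q2 z + P2 z .* Q z)"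
  by (intro continuous_intros cont)+
 note bc = bmp_continuous[OF r] and bz = bmp_zero_outside[OF r] and bg = bmp_has_grad[OF r]
 note ib = integration_by_parts_kernel[where q=q, OF gb cb bg(1) bc(2,3) bz(1,2,3)]
 note ia = integration_by_parts_kernel[where q=q, OF ga ce bg(1) bc(2,3) bz(1,2,3)]
 note ki = reflected_kernel_integrable[where q=q, OF _ bc(1) bz(1)]
 have XL: "z : cball q r ==> X z = P1 z + Q2 z" for z
  using laplacian_conv[OF d, of z] q by (auto simp: X_def defs)
 have Koff: "z ~: cball q r ==> bmp r (q - z) = 0" for z
  using zero_outsideD[OF bz(1), of "q - z"] by (simp add: dist_norm)
 show ?A
 proof -
  have "(LI z. (P z .* Q z) * bmp1 r (q - z)) - (LI z. (V (U z) + (1/2) * (P z .* P z - Q z .* Q z)) * bmp2 r (q - z))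
   = (LI z. (P z .* P2 z + P1 z .* Q z) * bmp r (q - z)) - (LI z. e2 (1/2) z * bmp r (q - z))"
   unfolding ib(1) ia(2) ..
  also have "... = (LI z. (P z .* P2 z + P1 z .* Q z) * bmp r (q - z) - e2 (1/2) z * bmp r (q - z))"
   by (rule B_integral_diff[symmetric, OF ki[OF cb(1)] ki[OF ce(2)]])
  also have "... = (LI z. ((X z - dV (U z)) .* Q z) * bmp r (q - z))"
  proof (rule B_integral_cong[OF refl])
   fix z
   show "(P z .* P2 z + P1 z .* Q z) * bmp r (q - z) - e2 (1/2) z * bmp r (q - z) = ((X z - dV (U z)) .* Q z) * bmp r (q - z)"
    by (cases "z : cball q r") (simp_all add: XL Koff e2_def inner_diff_left inner_add_left inner_commute algebra_simps)
  qed
  finally show ?thesis .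
 qed
 show ?B
 proof -
  have "(LI z. (V (U z) + (-1/2) * (P z .* P z - Q z .* Q z)) * bmp1 r (q - z)) - (LI z. (P z .* Q z) * bmp2 r (q - z))
   = (LI z. e1 (-1/2) z * bmp r (q - z)) - (LI z. (P z .* Q2 z + P2 z .* Q z) * bmp r (q - z))"
   unfolding ib(2) ia(1) ..
  also have "... = (LI z. e1 (-1/2) z * bmp r (q - z) - (P z .* Q2 z + P2 z .* Q z) * bmp r (q - z))"
   by (rule B_integral_diff[symmetric, OF ki[OF ce(1)] ki[OF cb(2)]])
  also have "... = (LI z. - (((X z - dV (U z)) .* P z) * bmp r (q - z)))"
  proof (rule B_integral_cong[OF refl])
   fix z
   show "e1 (-1/2) z * bmp r (q - z) - (P z .* Q2 z + P2 z .* Q z) * bmp r (q - z) = - (((X z - dV (U z)) .* P z) * bmp r (q - z))"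
    by (cases "z : cball q r") (simp_all add: XL Koff e1_def inner_diff_left inner_add_left inner_commute algebra_simps)
  qed
  finally show ?thesis by simp
 qed
qed

definition W where "W x = indicator (cball c R) x * V (u x)"

text \<open>With \<open>stress (1/2)\<close>, \<open>shear\<close> and \<open>stress (-1/2)\<close>
  as entries 11, 12 and 22 one obtains the stress tensor turned by a right angle. Its trace is
  \<open>2 * W\<close>, and vanishing divergence becomes closedness of its rows.\<close>

definition stress where "stress t x = W x + t * (g1 x .* g1 x - g2 x .* g2 x)"

definition shear where "shear x = g1 x .* g2 x"

lemma square_integrable: "integ (%x. g1 x .* g1 x)" "integ (%x. g2 x .* g2 x)"
 using int2 by (simp_all add: power2_norm_eq_inner)

lemma shear_integrable: "integ shear"
proof (rule B_integrable_bound)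
 show "integ (%x. g1 x .* g1 x + g2 x .* g2 x)" using square_integrable by auto
 note [measurable] = borel
 show "shear : borel_measurable lborel" unfolding shear_def[abs_def] by measurable
 show "AE x in lborel. norm (shear x) <= norm (g1 x .* g1 x + g2 x .* g2 x)"
 proof (rule AE_I2)
  fix x
  have "0 <= (g1 x - g2 x) .* (g1 x - g2 x)" "0 <= (g1 x + g2 x) .* (g1 x + g2 x)" by simp_all
  then show "norm (shear x) <= norm (g1 x .* g1 x + g2 x .* g2 x)"
   unfolding shear_def by (simp add: inner_simps inner_commute)
 qed
qed

lemma stress_integrable: "integ W ==> integ (stress t)"
 unfolding stress_def[abs_def] using square_integrable by auto

text \<open>The limit of \<open>hopf_conv\<close>. Products of derivatives converge in L^1 since the
  mollified gradients converge in L^2. For \<open>V (U n z)\<close> and for the defect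
  \<open>X n z - dV (U n z)\<close> the domination comes from the local bound of \<open>u\<close>,
  as the potential may grow arbitrarily fast.\<close>

lemma hopf:
 assumes Wint: "integ W" and r: "0 < r" and q: "cball q r <= ball c R"
 shows "conv (bmp1 r) shear q = conv (bmp2 r) (stress (1/2)) q"
  and "conv (bmp1 r) (stress (-1/2)) q = conv (bmp2 r) shear q"
proof -
 have qr: "dist q c + r < R" using q r by (simp add: cball_subset_ball_iff)
 \<comment> \<open>Halfway between the support of the kernel and the boundary circle:
   \<open>u\<close> is bounded on this disk, and mollification radii up to \<open>d0\<close> do not
   lead out of it.\<close>
 define R1 where "R1 = (R + (dist q c + r)) / 2"
 have "0 <= dist q c" by simp
 moreover have "2 * R1 = R + (dist q c + r)" by (simp add: R1_def)
 ultimately have R1: "0 < R1" "R1 < R" "dist q c + r < R1" using qr r by linarith+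
 obtain B where B: "0 <= B" "AE x in lborel. x : ball c R1 --> norm (u x) <= B" using locally_bounded[OF R1(1,2)] by blast
 define d0 where "d0 = (R1 - (dist q c + r)) / 2"
 have d0: "0 < d0" using R1 by (simp add: d0_def)
 define D0 where "D0 n = d0 * inverse (real (Suc n))" for n
 have D0: "0 < D0 n" "D0 n <= d0" for n
  using d0 by (auto simp: D0_def intro!: mult_left_le simp: inverse_le_1_iff)
 have D0l: "D0 ~~> 0" unfolding D0_def[abs_def] using tendsto_mult_right_zero[OF LIMSEQ_inverse_real_of_nat, of d0] .
 have mol0: "mollifier (D0 n) (bmp (D0 n))" for n by (rule bmp_mollifier[OF D0(1)])
 obtain s1 where s1: "strict_mono (s1 :: nat => nat)" "AE x in lborel. (%n. conv (bmp (D0 (s1 n))) u x) ~~> u x"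
  by (rule AE_subseq_of_L1[OF mollify_L1_seq[OF int(1) mol0 D0l]])
 have D1l: "(%n. D0 (s1 n)) ~~> 0" using LIMSEQ_subseq_LIMSEQ[OF D0l s1(1)] by (simp add: comp_def)
 obtain s2 where s2: "strict_mono (s2 :: nat => nat)" "AE x in lborel. (%n. conv (bmp (D0 (s1 (s2 n)))) f x) ~~> f x"
  by (rule AE_subseq_of_L1[OF mollify_L1_seq[OF int(4) mol0 D1l]])
 define D where "D n = D0 (s1 (s2 n))" for n
 have D: "0 < D n" "D n <= d0" for n using D0 by (auto simp: D_def)
 have Dl: "D ~~> 0" using LIMSEQ_subseq_LIMSEQ[OF D1l s2(1)] by (simp add: comp_def D_def[abs_def])
 have mol: "mollifier (D n) (bmp (D n))" for n by (rule bmp_mollifier[OF D(1)])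
 define U X G1 G2 where "U n = conv (bmp (D n)) u" and "X n = conv (bmp (D n)) f"
  and "G1 n = conv (bmp (D n)) g1" and "G2 n = conv (bmp (D n)) g2" for n
 have Ul: "AE x in lborel. (%n. U n x) ~~> u x"
  using s1(2)
 proof eventually_elim
  fix x assume "(%n. conv (bmp (D0 (s1 n))) u x) ~~> u x"
  from LIMSEQ_subseq_LIMSEQ[OF this s2(1)] show "(%n. U n x) ~~> u x" by (simp add: comp_def U_def D_def)
 qed
 have Xl: "AE x in lborel. (%n. X n x) ~~> f x" using s2(2) by (simp add: X_def D_def)
 have sub: "cball q r <= ball c (R - D n)" for n
  using R1(2,3) D(2)[of n] r unfolding d0_def by (simp add: cball_subset_ball_iff)
 have inb: "cball z (D n) <= ball c R1" if "z : cball q r" for z n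
 proof -
  have "dist z c <= r + dist q c" using that dist_triangle[of z c q] by (simp add: dist_commute)
  moreover have "dist q c + r + D n < R1" using D(2)[of n] d0 unfolding d0_def by (simp add: field_simps)
  ultimately show ?thesis using D(1)[of n] by (simp add: cball_subset_ball_iff)
 qed
 have Um[measurable]: "U n : borel_fun" and Xm[measurable]: "X n : borel_fun"
  and G1m[measurable]: "G1 n : borel_fun" and G2m[measurable]: "G2 n : borel_fun" for n
  unfolding U_def X_def G1_def G2_def by (intro conv_mollifier_measurable[OF mol] int)+
 note [measurable] = borel
 have [measurable]: "V : borel_fun" "dV : borel_fun"
  using V_cont[of UNIV] dV_cont by (auto intro: borel_measurable_continuous_onI)
 obtain M1 where M1: "0 <= M1" "!!y. norm y <= B ==> norm (dV y) <= M1" using continuous_bounded_cball[OF dV_cont] by blast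
 obtain M2 where M2: "0 <= M2" "!!y. norm y <= B ==> norm (V y) <= M2" using continuous_bounded_cball[OF V_cont] by blast
 have Ub: "norm (U n z) <= B" if "z : cball q r" for n z
  unfolding U_def
 proof (rule norm_conv_le[OF mol int(1) _ B(1)])
  show "AE x in lborel. x : cball z (D n) --> norm (u x) <= B"
   using B(2) by eventually_elim (use inb[OF that] in blast)
 qed
 have Xb: "norm (X n z) <= M1" if "z : cball q r" for n z
  unfolding X_def
 proof (rule norm_conv_le[OF mol int(4) _ M1(1)])
  show "AE x in lborel. x : cball z (D n) --> norm (f x) <= M1"
   using B(2)
  proof eventually_elim
   fix x assume x: "x : ball c R1 --> norm (u x) <= B"
   show "x : cball z (D n) --> norm (f x) <= M1"
    using x inb[OF that, of n] M1 by (auto simp: f_def indicator_def)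
  qed
 qed
 have PG: "conv (bmp1 (D n)) u z = G1 n z" "conv (bmp2 (D n)) u z = G2 n z" if "z : cball q r" for n z
  unfolding G1_def G2_def using weak1[OF D(1) inner_cball] weak2[OF D(1) inner_cball] sub that by blast+
 have l: "(%n. LI x. norm (G1 n x - g1 x)) ~~> 0" "(%n. LI x. norm (G2 n x - g2 x)) ~~> 0"
  "integ (%x. G1 n x - g1 x)" "integ (%x. G2 n x - g2 x)" for n
  unfolding G1_def G2_def by (rule mollify_L1_seq[OF int(2) mol Dl] mollify_L1_seq[OF int(3) mol Dl])+
 have k: "(%n. LI x. (norm (G1 n x - g1 x))\<^sup>2) ~~> 0" "(%n. LI x. (norm (G2 n x - g2 x))\<^sup>2) ~~> 0"
  "integ (%x. (norm (G1 n x - g1 x))\<^sup>2)" "integ (%x. (norm (G2 n x - g2 x))\<^sup>2)" for n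
  unfolding G1_def G2_def by (rule mollify_L2_seq[OF int(2) int2(1) mol Dl] mollify_L2_seq[OF int(3) int2(2) mol Dl])+
 note i11 = inner_L2_limit[OF G1m G1m borel(2) borel(2) k(3,1) k(3,1) int2(1) int2(1)]
  and i22 = inner_L2_limit[OF G2m G2m borel(3) borel(3) k(4,2) k(4,2) int2(2) int2(2)]
  and i12 = inner_L2_limit[OF G1m G2m borel(2) borel(3) k(3,1) k(4,2) int2(1) int2(2)]
 have off: "\<phi> (q - z) = 0" if "zero_outside r \<phi>" "z ~: cball q r" for \<phi> :: "plane => real" and z
  using zero_outsideD[OF that(1), of "q - z"] that(2) by (simp add: dist_norm)
 have weight: "(%z. \<phi> (q - z)) : borel_fun" "\<exists>M. \<forall>z. \<bar>\<phi> (q - z)\<bar> <= M"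
  if c\<phi>: "contU \<phi>" and z\<phi>: "zero_outside r \<phi>" for \<phi> :: "plane => real"
 proof -
  show "(%z. \<phi> (q - z)) : borel_fun"
   by (intro borel_measurable_continuous_onI continuous_on_compose2[OF c\<phi>] continuous_intros) auto
  obtain B where B: "!!x. \<bar>\<phi> x\<bar> <= B" using bounded_compact_support[OF c\<phi> z\<phi>] by blast
  show "\<exists>M. \<forall>z. \<bar>\<phi> (q - z)\<bar> <= M" by (rule exI[of _ B], rule allI, rule B)
 qed
 have L1: "(%n. LI z. (conv (bmp1 (D n)) u z .* conv (bmp2 (D n)) u z) * \<phi> (q - z)) ~~> conv \<phi> shear q"
  if c\<phi>: "contU \<phi>" and z\<phi>: "zero_outside r \<phi>" for \<phi> :: "plane => real"
 proof -
  obtain M where M: "!!z. \<bar>\<phi> (q - z)\<bar> <= M" using weight(2)[OF c\<phi> z\<phi>] by blast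
  have "(%n. LI z. \<phi> (q - z) * (G1 n z .* G2 n z)) ~~> (LI z. \<phi> (q - z) * (g1 z .* g2 z))"
   by (rule bounded_weight_L1_limit(1)[OF weight(1)[OF c\<phi> z\<phi>] M i12]) (use shear_integrable in \<open>simp add: shear_def[abs_def]\<close>)
  moreover have "(LI z. (conv (bmp1 (D n)) u z .* conv (bmp2 (D n)) u z) * \<phi> (q - z)) = (LI z. \<phi> (q - z) * (G1 n z .* G2 n z))" for n
  proof (rule B_integral_cong[OF refl])
   fix z show "(conv (bmp1 (D n)) u z .* conv (bmp2 (D n)) u z) * \<phi> (q - z) = \<phi> (q - z) * (G1 n z .* G2 n z)"
    by (cases "z : cball q r") (simp_all add: PG off[OF z\<phi>] del: mem_cball)
  qed
  ultimately show ?thesis by (simp add: conv_def shear_def)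
 qed
 have L2: "(%n. LI z. (V (U n z) + t * (conv (bmp1 (D n)) u z .* conv (bmp1 (D n)) u z - conv (bmp2 (D n)) u z .* conv (bmp2 (D n)) u z)) * \<phi> (q - z))
   ~~> conv \<phi> (stress t) q"
  if c\<phi>: "contU \<phi>" and z\<phi>: "zero_outside r \<phi>" for \<phi> :: "plane => real" and t
 proof -
  obtain M where M: "!!z. \<bar>\<phi> (q - z)\<bar> <= M" using weight(2)[OF c\<phi> z\<phi>] by blast
  note a1 = bounded_weight_L1_limit[OF weight(1)[OF c\<phi> z\<phi>] M i11 square_integrable(1)]
   and a2 = bounded_weight_L1_limit[OF weight(1)[OF c\<phi> z\<phi>] M i22 square_integrable(2)]
  have [measurable]: "(%z. \<phi> (q - z)) : borel_fun" by (rule weight(1)[OF c\<phi> z\<phi>])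
  have Mn: "0 <= M" using M[of 0] by linarith
  have dom: "integ (%z. (M * M2) * indicator (cball q r) z)"
   by (intro integrable_mult_right integrable_real_indicator emeasure_bounded_finite) auto
  have bd: "\<bar>\<phi> (q - z) * V (U n z)\<bar> <= (M * M2) * indicator (cball q r) z" for n z
  proof (cases "z : cball q r")
   case True
   have "\<bar>\<phi> (q - z)\<bar> * \<bar>V (U n z)\<bar> <= M * M2" using M2(2)[OF Ub[OF True, of n]] M Mn by (intro mult_mono) auto
   then show ?thesis using True by (simp add: abs_mult)
  qed (simp add: off[OF z\<phi>])
  have lV: "(%n. LI z. \<phi> (q - z) * V (U n z)) ~~> (LI z. \<phi> (q - z) * W z)"
  proof (rule integral_dominated_convergence[OF _ _ dom])
   show "(%z. \<phi> (q - z) * W z) : borel_measurable lborel" using Wint by simp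
   show "AE z in lborel. (%n. \<phi> (q - z) * V (U n z)) ~~> \<phi> (q - z) * W z"
    using Ul
   proof eventually_elim
    fix z assume lz: "(%n. U n z) ~~> u z"
    show "(%n. \<phi> (q - z) * V (U n z)) ~~> \<phi> (q - z) * W z"
    proof (cases "z : cball q r")
     case True
     then have "z : cball c R" using q by auto
     then have "W z = V (u z)" by (simp add: W_def)
     moreover have "(%n. V (U n z)) ~~> V (u z)" by (rule continuous_on_tendsto_compose[OF V_cont[of UNIV] lz]) auto
     ultimately show ?thesis by (simp add: tendsto_mult_left)
    qed (simp add: off[OF z\<phi>])
   qed
   show "AE z in lborel. norm (\<phi> (q - z) * V (U n z)) <= (M * M2) * indicator (cball q r) z" for n using bd by simp
  qed measurable
  have iV: "integ (%z. \<phi> (q - z) * V (U n z))" for n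
  proof (rule B_integrable_bound[OF dom])
   show "AE z in lborel. norm (\<phi> (q - z) * V (U n z)) <= norm ((M * M2) * indicator (cball q r) z :: real)"
    using bd by (auto intro!: AE_I2 intro: order_trans[OF _ abs_ge_self])
  qed measurable
  have iW: "integ (%z. \<phi> (q - z) * W z)" using conv_integrable[OF c\<phi> z\<phi> Wint, of q] by simp
  have "(%n. (LI z. \<phi> (q - z) * V (U n z)) + t * ((LI z. \<phi> (q - z) * (G1 n z .* G1 n z)) - (LI z. \<phi> (q - z) * (G2 n z .* G2 n z))))
   ~~> (LI z. \<phi> (q - z) * W z) + t * ((LI z. \<phi> (q - z) * (g1 z .* g1 z)) - (LI z. \<phi> (q - z) * (g2 z .* g2 z)))"
   by (intro tendsto_add tendsto_mult tendsto_diff tendsto_const lV a1(1) a2(1))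
  moreover have "(LI z. \<phi> (q - z) * W z) + t * ((LI z. \<phi> (q - z) * (g1 z .* g1 z)) - (LI z. \<phi> (q - z) * (g2 z .* g2 z))) = conv \<phi> (stress t) q"
  proof -
   have "conv \<phi> (stress t) q = (LI z. \<phi> (q - z) * W z + t * (\<phi> (q - z) * (g1 z .* g1 z) - \<phi> (q - z) * (g2 z .* g2 z)))"
    by (simp add: conv_def stress_def algebra_simps)
   then show ?thesis using iW a1(3) a2(3) by simp
  qed
  moreover have "(LI z. \<phi> (q - z) * V (U n z)) + t * ((LI z. \<phi> (q - z) * (G1 n z .* G1 n z)) - (LI z. \<phi> (q - z) * (G2 n z .* G2 n z)))
   = (LI z. (V (U n z) + t * (conv (bmp1 (D n)) u z .* conv (bmp1 (D n)) u z - conv (bmp2 (D n)) u z .* conv (bmp2 (D n)) u z)) * \<phi> (q - z))" for n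
  proof -
   have "(LI z. (V (U n z) + t * (conv (bmp1 (D n)) u z .* conv (bmp1 (D n)) u z - conv (bmp2 (D n)) u z .* conv (bmp2 (D n)) u z)) * \<phi> (q - z))
    = (LI z. \<phi> (q - z) * V (U n z) + t * (\<phi> (q - z) * (G1 n z .* G1 n z) - \<phi> (q - z) * (G2 n z .* G2 n z)))"
   proof (rule B_integral_cong[OF refl])
    fix z
    show "(V (U n z) + t * (conv (bmp1 (D n)) u z .* conv (bmp1 (D n)) u z - conv (bmp2 (D n)) u z .* conv (bmp2 (D n)) u z)) * \<phi> (q - z)
     = \<phi> (q - z) * V (U n z) + t * (\<phi> (q - z) * (G1 n z .* G1 n z) - \<phi> (q - z) * (G2 n z .* G2 n z))"
     by (cases "z : cball q r") (simp_all add: PG off[OF z\<phi>] algebra_simps del: mem_cball)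
   qed
   then show ?thesis using iV[of n] a1(2)[of n] a2(2)[of n] by simp
  qed
  ultimately show ?thesis by simp
 qed
 note bc = bmp_continuous[OF r] and bz = bmp_zero_outside[OF r]
 \<comment> \<open>The defect times the kernel. It is bounded, and it tends to 0 almost everywhere
   because both mollified terms have the same limit \<open>dV (u z)\<close> on the support of the
   kernel.\<close>
 define T where "T n z = bmp r (q - z) *. (X n z - dV (U n z))" for n z
 obtain Bk where Bk: "!!z. \<bar>bmp r (q - z)\<bar> <= Bk" using weight(2)[OF bc(1) bz(1)] by blast
 have [measurable]: "(%z. bmp r (q - z)) : borel_fun" by (rule weight(1)[OF bc(1) bz(1)])
 have Tm: "T n : borel_fun" for n unfolding T_def[abs_def] by measurable
 have Bk0: "0 <= Bk" using Bk[of 0] by linarith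
 have Tb: "norm (T n z) <= Bk * (M1 + M1)" for n z
 proof (cases "z : cball q r")
  case True
  have "norm (X n z - dV (U n z)) <= M1 + M1" using norm_triangle_ineq4[of "X n z" "dV (U n z)"] Xb[OF True, of n] M1(2)[OF Ub[OF True, of n]] by linarith
  then show ?thesis unfolding T_def norm_scaleR by (intro mult_mono Bk) (use Bk0 in auto)
 next
  case False then show ?thesis using off[OF bz(1)] Bk0 M1(1) by (simp add: T_def)
 qed
 have T0: "AE z in lborel. (%n. T n z) ~~> 0"
  using Ul Xl
 proof eventually_elim
  fix z assume lu: "(%n. U n z) ~~> u z" and lx: "(%n. X n z) ~~> f z"
  show "(%n. T n z) ~~> 0"
  proof (cases "z : cball q r")
   case True
   then have "z : cball c R" using q by auto
   then have fz: "f z = dV (u z)" by (simp add: f_def)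
   have "(%n. dV (U n z)) ~~> dV (u z)" by (rule continuous_on_tendsto_compose[OF dV_cont lu]) auto
   then have "(%n. T n z) ~~> bmp r (q - z) *. (f z - dV (u z))"
    unfolding T_def by (intro tendsto_scaleR tendsto_diff tendsto_const lx)
   then show ?thesis using fz by simp
  qed (simp add: off[OF bz(1)] T_def)
 qed
 have R1: "(%n. LI z. ((X n z - dV (U n z)) .* conv (bmp2 (D n)) u z) * bmp r (q - z)) ~~> 0"
 proof -
  have "(LI z. ((X n z - dV (U n z)) .* conv (bmp2 (D n)) u z) * bmp r (q - z)) = (LI z. T n z .* G2 n z)" for n
  proof (rule B_integral_cong[OF refl])
   fix z show "((X n z - dV (U n z)) .* conv (bmp2 (D n)) u z) * bmp r (q - z) = T n z .* G2 n z"
    by (cases "z : cball q r") (simp_all add: T_def PG off[OF bz(1)] del: mem_cball)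
  qed
  then show ?thesis using bounded_times_L1_limit[OF Tm Tb T0 l(4,2) int(3)] by simp
 qed
 have R2: "(%n. - (LI z. ((X n z - dV (U n z)) .* conv (bmp1 (D n)) u z) * bmp r (q - z))) ~~> - 0"
 proof (rule tendsto_minus)
  have "(LI z. ((X n z - dV (U n z)) .* conv (bmp1 (D n)) u z) * bmp r (q - z)) = (LI z. T n z .* G1 n z)" for n
  proof (rule B_integral_cong[OF refl])
   fix z show "((X n z - dV (U n z)) .* conv (bmp1 (D n)) u z) * bmp r (q - z) = T n z .* G1 n z"
    by (cases "z : cball q r") (simp_all add: T_def PG off[OF bz(1)] del: mem_cball)
  qed
  then show "(%n. LI z. ((X n z - dV (U n z)) .* conv (bmp1 (D n)) u z) * bmp r (q - z)) ~~> 0"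
   using bounded_times_L1_limit[OF Tm Tb T0 l(3,1) int(2)] by simp
 qed
 note H = hopf_conv[OF D(1) r sub]
 have "conv (bmp1 r) shear q - conv (bmp2 r) (stress (1/2)) q = 0"
  by (rule LIMSEQ_unique[OF tendsto_diff[OF L1[OF bc(2) bz(2)] L2[OF bc(3) bz(3), of "1/2"]]])
   (use R1 in \<open>simp only: U_def X_def H(1)\<close>)
 then show "conv (bmp1 r) shear q = conv (bmp2 r) (stress (1/2)) q" by simp
 have "conv (bmp1 r) (stress (-1/2)) q - conv (bmp2 r) shear q = - 0"
  by (rule LIMSEQ_unique[OF tendsto_diff[OF L2[OF bc(2) bz(2), of "-1/2"] L1[OF bc(3) bz(3)]]])
   (use R2 in \<open>simp only: U_def X_def H(2)\<close>)
 then show "conv (bmp1 r) (stress (-1/2)) q = conv (bmp2 r) shear q" by simp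
qed

end


section \<open>From divergence-free integrable fields to Airy functions\<close>

text \<open>\<open>\<partial>\<^sub>1\<close> of the integrand of \<open>w\<close> is the \<open>t\<close>-derivative of \<open>t * P (c + t *\<^sub>R (x - c))\<close>, because the field is closed.\<close>

lemma poincare_ball:
 fixes P Q A B C :: "plane => real"
 assumes P: "!!x. x : ball c r ==> has_grad P (A x) (B x) x" and Q: "!!x. x : ball c r ==> has_grad Q (B x) (C x) x"
  and cont: "contU A" "contU B" "contU C"
 obtains w where "!!x. x : ball c r ==> has_grad w (P x) (Q x) x"
proof
 define y where "y x t = c + t *. (x - c)" for x :: "plane" and t :: real
 define f where "f x t = fst (x - c) * P (y x t) + snd (x - c) * Q (y x t)" for x t
 define \<alpha> where "\<alpha> x t = P (y x t) + t * (fst (x - c) * A (y x t) + snd (x - c) * B (y x t))" for x t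
 define \<beta> where "\<beta> x t = Q (y x t) + t * (fst (x - c) * B (y x t) + snd (x - c) * C (y x t))" for x t
 \<comment> \<open>The derivative of the integrand with respect to the point as a bounded linear
   map, which is the form required by the Leibniz rule.\<close>
 define fx :: "plane => real => (plane) \<Rightarrow>\<^sub>L real"
  where "fx x t = \<alpha> x t *. fst_blinfun + \<beta> x t *. snd_blinfun" for x t
 have fxa: "blinfun_apply (fx x t) h = \<alpha> x t * fst h + \<beta> x t * snd h" for x t h
  by (simp add: fx_def blinfun.add_left blinfun.scaleR_left fst_blinfun.rep_eq snd_blinfun.rep_eq)
 have yin: "y x t : ball c r" if "x : ball c r" "t : {0..1}" for x t
 proof -
  have "norm (t *. (x - c)) <= 1 * norm (x - c)" unfolding norm_scaleR using that by (intro mult_right_mono) auto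
  then show ?thesis using that by (simp add: y_def dist_norm norm_minus_commute)
 qed
 have cP: "continuous_on (ball c r) P" and cQ: "continuous_on (ball c r) Q"
  by (intro continuous_at_imp_continuous_on ballI has_grad_isCont[OF P] has_grad_isCont[OF Q]; assumption)+
 fix x assume x: "x : ball c r"
 have yl: "y x t = c + t *. (x - c)" for t by (simp add: y_def)
 have dP: "((%t. P (y x t)) has_real_derivative (fst (x - c) * A (y x t) + snd (x - c) * B (y x t))) (at t within {0..1})"
  and dQ: "((%t. Q (y x t)) has_real_derivative (fst (x - c) * B (y x t) + snd (x - c) * C (y x t))) (at t within {0..1})" if "t : {0..1}" for t
  using has_grad_line[OF P[OF yin[OF x that], unfolded yl], where T="{0..1}"] has_grad_line[OF Q[OF yin[OF x that], unfolded yl], where T="{0..1}"]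
  unfolding yl by (simp_all add: has_real_derivative_iff_has_vector_derivative)
 have i\<alpha>: "(\<alpha> x has_integral P x) (cbox 0 1)"
 proof -
  have "((%t. t * P (y x t)) has_vector_derivative \<alpha> x t) (at t within {0..1})" if "t : {0..1}" for t
   using DERIV_mult[OF DERIV_ident dP[OF that]] by (simp add: has_real_derivative_iff_has_vector_derivative \<alpha>_def mult.commute)
  from fundamental_theorem_of_calculus[OF _ this] show ?thesis by (simp add: y_def)
 qed
 have i\<beta>: "(\<beta> x has_integral Q x) (cbox 0 1)"
 proof -
  have "((%t. t * Q (y x t)) has_vector_derivative \<beta> x t) (at t within {0..1})" if "t : {0..1}" for t
   using DERIV_mult[OF DERIV_ident dQ[OF that]] by (simp add: has_real_derivative_iff_has_vector_derivative \<beta>_def mult.commute)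
  from fundamental_theorem_of_calculus[OF _ this] show ?thesis by (simp add: y_def)
 qed
 have "((%x. integral (cbox 0 1) (f x)) has_derivative blinfun_apply (integral (cbox 0 1) (fx x))) (at x within ball c r)"
 proof (rule leibniz_rule)
  fix z t assume z: "z : ball c r" and t: "t : cbox (0::real) 1"
  have yz: "y z t : ball c r" using yin[OF z] t by simp
  have dy: "((%z. y z t) has_derivative (%h. t *. h)) (at z)"
   unfolding y_def by (auto intro!: derivative_eq_intros)
  note d1 = has_derivative_compose[OF dy P[OF yz, unfolded has_grad_def]] and d2 = has_derivative_compose[OF dy Q[OF yz, unfolded has_grad_def]]
  have f1: "((%z. fst (z - c)) has_derivative fst) (at z)" and f2: "((%z. snd (z - c)) has_derivative snd) (at z)"
   by (auto intro!: derivative_eq_intros)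
  have "((%z. f z t) has_derivative blinfun_apply (fx z t)) (at z)"
   unfolding f_def
   by (rule has_derivative_eq_rhs[OF has_derivative_add[OF has_derivative_mult[OF f1 d1] has_derivative_mult[OF f2 d2]]])
    (auto simp: fun_eq_iff fxa \<alpha>_def \<beta>_def algebra_simps)
  then show "((%z. f z t) has_derivative blinfun_apply (fx z t)) (at z within ball c r)" by (rule has_derivative_at_withinI)
 next
  fix z assume z: "z : ball c r"
  have cyz: "continuous_on {0..1} (y z)" unfolding y_def by (intro continuous_intros)
  have im: "y z ` {0..1} <= ball c r" using yin[OF z] by blast
  have "continuous_on {0..1} (f z)"
   unfolding f_def[abs_def]
   by (intro continuous_intros continuous_on_compose2[OF cP cyz im] continuous_on_compose2[OF cQ cyz im])
  then show "f z integrable_on cbox 0 1" using integrable_continuous[of 0 1 "f z"] by simp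
 next
  have cy: "continuous_on (ball c r \<times> cbox 0 1) (%z. y (fst z) (snd z))" unfolding y_def by (intro continuous_intros)
  have "continuous_on (ball c r \<times> cbox 0 1) (%z. fx (fst z) (snd z))"
   unfolding fx_def \<alpha>_def \<beta>_def
   by (intro continuous_intros cy continuous_on_compose2[OF cP cy] continuous_on_compose2[OF cQ cy] continuous_on_compose2[OF cont(1) cy]
    continuous_on_compose2[OF cont(2) cy] continuous_on_compose2[OF cont(3) cy] subset_UNIV image_subsetI) (auto intro!: yin simp del: mem_ball)
  then show "continuous_on (ball c r \<times> cbox 0 1) (%(z, t). fx z t)" by (simp add: case_prod_unfold)
 qed (use x in auto)
 moreover have "integral (cbox 0 1) (fx x) = P x *. fst_blinfun + Q x *. snd_blinfun"
  unfolding fx_def[abs_def] by (intro integral_unique has_integral_add has_integral_scaleR_left i\<alpha> i\<beta>)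
 ultimately have "((%x. integral (cbox 0 1) (f x)) has_derivative blinfun_apply (P x *. fst_blinfun + Q x *. snd_blinfun)) (at x)"
  using x by (simp add: at_within_open[OF _ open_ball] del: mem_ball)
 then show "has_grad (%x. integral (cbox 0 1) (f x)) (P x) (Q x) x"
  unfolding has_grad_def
  by (rule has_derivative_eq_rhs) (auto simp: fun_eq_iff blinfun.add_left blinfun.scaleR_left fst_blinfun.rep_eq snd_blinfun.rep_eq)
qed

lemma rcut_le_1: "rcut j z <= 1"
proof -
 have "max 0 (1 - (z .* z) ^ j) <= 1" by simp
 then show ?thesis unfolding rcut_def using power_mono[of "max 0 (1 - (z .* z) ^ j)" 1 2] by simp
qed

text \<open>Bundles what remains true when merely integrable fields are replaced by continuous ones;
  \<open>e\<close> bounds the L^1 error of each entry.\<close>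

definition airy_near :: "plane set => real => (plane => real) => (plane => real) => (plane => real) \<Rightarrow>
  (plane => real) => (plane => real) => (plane => real) \<Rightarrow>
  (plane => real) => (plane => real) => (plane => real) => bool" where
 "airy_near D e a b c w p q A B C \<longleftrightarrow> airy D w p q A B C & (\<forall>x. 0 <= A x + C x) &
  (NNI x. ennreal (norm (A x - a x))) <= ennreal e & (NNI x. ennreal (norm (B x - b x))) <= ennreal e &
  (NNI x. ennreal (norm (C x - c x))) <= ennreal e"

text \<open>Mollification makes \<open>(A, B)\<close> and \<open>(B, C)\<close> closed in the
  classical sense. Their potentials \<open>p\<close> and \<open>q\<close> form a closed field once
  more, because both have \<open>B\<close> as mixed derivative. Averaging preserves the sign of the
  trace.\<close>

lemma airy_of_divergence_free:
 fixes a b c :: "plane => real"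
 assumes int: "integ a" "integ b" "integ c" and R2: "R2 < R" and e: "0 < e"
  and hopf: "!!d x. 0 < d ==> cball x d <= ball c0 R ==> conv (bmp1 d) b x = conv (bmp2 d) a x"
   "!!d x. 0 < d ==> cball x d <= ball c0 R ==> conv (bmp1 d) c x = conv (bmp2 d) b x"
  and pos: "!!x. 0 <= a x + c x"
 shows "\<exists>w p q A B C. airy_near (ball c0 R2) e a b c w p q A B C"
proof -
 obtain d1 where d1: "d1 > 0" "!!r K. r < d1 ==> mollifier r K ==> (NNI x. ennreal (norm (conv K a x - a x))) <= ennreal e"
  using mollify_L1[OF int(1) e] by auto
 obtain d2 where d2: "d2 > 0" "!!r K. r < d2 ==> mollifier r K ==> (NNI x. ennreal (norm (conv K b x - b x))) <= ennreal e"
  using mollify_L1[OF int(2) e] by auto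
 obtain d3 where d3: "d3 > 0" "!!r K. r < d3 ==> mollifier r K ==> (NNI x. ennreal (norm (conv K c x - c x))) <= ennreal e"
  using mollify_L1[OF int(3) e] by auto
 define d where "d = min (min d1 d2) (min d3 (R - R2)) / 2"
 have d: "0 < d" "d < d1" "d < d2" "d < d3" "d < R - R2" using d1 d2 d3 R2 by (auto simp: d_def)
 define A B C where "A = conv (bmp d) a" and "B = conv (bmp d) b" and "C = conv (bmp d) c"
 have sub: "cball x d <= ball c0 R" if "x : ball c0 R2" for x
  using that d by (auto simp: cball_subset_ball_iff dist_commute)
 note ga = conv_bmp_has_grad(1)[OF d(1) int(1)] and gb = conv_bmp_has_grad(1)[OF d(1) int(2)] and gc = conv_bmp_has_grad(1)[OF d(1) int(3)]
 note ca = conv_bmp_continuous(1-3)[OF d(1) int(1)] and cb = conv_bmp_continuous(1-3)[OF d(1) int(2)] and cc = conv_bmp_continuous(1-3)[OF d(1) int(3)]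
 have gA: "has_grad A (conv (bmp1 d) a x) (conv (bmp2 d) a x) x"
  and gB: "has_grad B (conv (bmp2 d) a x) (conv (bmp2 d) b x) x"
  and gC: "has_grad C (conv (bmp2 d) b x) (conv (bmp2 d) c x) x" if "x : ball c0 R2" for x
  using ga[of x] gb[of x] gc[of x] hopf[OF d(1) sub[OF that]] by (simp_all add: A_def B_def C_def)
 obtain p where p: "!!x. x : ball c0 R2 ==> has_grad p (A x) (B x) x"
 proof (rule poincare_ball[OF gA gB ca(2,3) cb(3)])
  fix h assume "!!x. x : ball c0 R2 ==> has_grad h (A x) (B x) x"
  then show thesis by (rule that)
 qed
 obtain q where q: "!!x. x : ball c0 R2 ==> has_grad q (B x) (C x) x"
 proof (rule poincare_ball[OF gB gC ca(3) cb(3) cc(3)])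
  fix h assume "!!x. x : ball c0 R2 ==> has_grad h (B x) (C x) x"
  then show thesis by (rule that)
 qed
 have cABC: "contU A" "contU B" "contU C" using ca(1) cb(1) cc(1) by (simp_all add: A_def B_def C_def)
 obtain w where w: "!!x. x : ball c0 R2 ==> has_grad w (p x) (q x) x"
 proof (rule poincare_ball[OF p q cABC])
  fix h assume "!!x. x : ball c0 R2 ==> has_grad h (p x) (q x) x"
  then show thesis by (rule that)
 qed
 have mol: "mollifier d (bmp d)" by (rule bmp_mollifier[OF d(1)])
 have "airy (ball c0 R2) w p q A B C" unfolding airy_def using p q w cABC by blast
 moreover have "0 <= A x + C x" for x
 proof -
  note m = mollifierD[OF mol]
  have "A x + C x = (LI z. bmp d (x - z) * (a z + c z))"
   using conv_integrable[OF m(1,3) int(1), of x] conv_integrable[OF m(1,3) int(3), of x]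
   by (simp add: A_def C_def conv_def distrib_left)
  also have "... >= 0" using m(2) pos by (intro integral_nonneg_AE AE_I2) auto
  finally show ?thesis .
 qed
 moreover note d1(2)[OF d(2) mol] d2(2)[OF d(3) mol] d3(2)[OF d(4) mol]
 ultimately have "airy_near (ball c0 R2) e a b c w p q A B C" unfolding airy_near_def A_def B_def C_def by blast
 then show ?thesis by blast
qed

lemma ennreal_add4:
 "0 <= p ==> 0 <= q ==> 0 <= r ==> 0 <= s ==> ennreal (p + (q + (r + s))) = ennreal p + (ennreal q + (ennreal r + ennreal s))"
 by simp

lemma hmass_perturb:
 assumes [measurable]: "a : borel_fun" "b : borel_fun" "c : borel_fun"
   "A : borel_fun" "B : borel_fun" "C : borel_fun" "D : sets borel"
  and e: "(NNI x. ennreal (norm (A x - a x))) <= ennreal e" "(NNI x. ennreal (norm (B x - b x))) <= ennreal e"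
   "(NNI x. ennreal (norm (C x - c x))) <= ennreal e" "0 <= e"
 shows "hmass D A B C <= hmass D a b c + ennreal (3 * e)"
proof -
 have m: "(%x. ennreal (\<bar>a x\<bar> + \<bar>b x\<bar> + \<bar>c x\<bar>) * indicator D x) : borel_measurable lborel"
   "(%x. ennreal (norm (A x - a x))) : borel_measurable lborel" "(%x. ennreal (norm (B x - b x))) : borel_measurable lborel"
   "(%x. ennreal (norm (C x - c x))) : borel_measurable lborel"
   "(%x. ennreal (norm (A x - a x)) + (ennreal (norm (B x - b x)) + ennreal (norm (C x - c x)))) : borel_measurable lborel"
   "(%x. ennreal (norm (B x - b x)) + ennreal (norm (C x - c x))) : borel_measurable lborel"
  by measurable
 have "hmass D A B C <= (NNI x. ennreal (\<bar>a x\<bar> + \<bar>b x\<bar> + \<bar>c x\<bar>) * indicator D x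
   + (ennreal (norm (A x - a x)) + (ennreal (norm (B x - b x)) + ennreal (norm (C x - c x)))))"
  unfolding hmass_def
 proof (rule nn_integral_mono)
  fix x
  have "\<bar>A x\<bar> + \<bar>B x\<bar> + \<bar>C x\<bar> <= (\<bar>a x\<bar> + \<bar>b x\<bar> + \<bar>c x\<bar>) + (norm (A x - a x) + (norm (B x - b x) + norm (C x - c x)))"
   unfolding real_norm_def by linarith
  then have "ennreal (\<bar>A x\<bar> + \<bar>B x\<bar> + \<bar>C x\<bar>) <= ennreal ((\<bar>a x\<bar> + \<bar>b x\<bar> + \<bar>c x\<bar>) + (norm (A x - a x) + (norm (B x - b x) + norm (C x - c x))))"
   by (rule ennreal_leI)
  also have "... = ennreal (\<bar>a x\<bar> + \<bar>b x\<bar> + \<bar>c x\<bar>) + (ennreal (norm (A x - a x)) + (ennreal (norm (B x - b x)) + ennreal (norm (C x - c x))))"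
   by (rule ennreal_add4) auto
  finally show "ennreal (\<bar>A x\<bar> + \<bar>B x\<bar> + \<bar>C x\<bar>) * indicator D x <= ennreal (\<bar>a x\<bar> + \<bar>b x\<bar> + \<bar>c x\<bar>) * indicator D x
   + (ennreal (norm (A x - a x)) + (ennreal (norm (B x - b x)) + ennreal (norm (C x - c x))))"
   by (cases "x : D") auto
 qed
 also have "... = hmass D a b c + ((NNI x. ennreal (norm (A x - a x))) + ((NNI x. ennreal (norm (B x - b x))) + (NNI x. ennreal (norm (C x - c x)))))"
  unfolding hmass_def by (simp only: nn_integral_add[OF m(1,5)] nn_integral_add[OF m(2,6)] nn_integral_add[OF m(3,4)])
 also have "... <= hmass D a b c + (ennreal e + (ennreal e + ennreal e))" by (intro add_mono e order_refl)
 also have "ennreal e + (ennreal e + ennreal e) = ennreal (3 * e)" using e(4) by (simp add: ennreal_plus[symmetric] del: ennreal_plus)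
 finally show ?thesis .
qed

text \<open>The fields are replaced by Airy data with L^1 error \<open>1 / (n + 1)\<close>. An error
  that tends to 0 affects neither the vanishing of the mass off \<open>S\<close> nor the limits
  \<open>Z s\<close>.\<close>

lemma divergence_free_limit_monotone:
 fixes a b c :: "nat => plane => real"
 assumes int: "!!n. integ (a n)" "!!n. integ (b n)" "!!n. integ (c n)"
  and hopf: "!!n d x. 0 < d ==> cball x d <= ball c0 R ==> conv (bmp1 d) (b n) x = conv (bmp2 d) (a n) x"
   "!!n d x. 0 < d ==> cball x d <= ball c0 R ==> conv (bmp1 d) (c n) x = conv (bmp2 d) (b n) x"
  and pos: "!!n x. 0 <= a n x + c n x"
  and M: "0 <= M" "!!n. hmass (ball c0 R) (a n) (b n) (c n) <= ennreal M"
  and op: "open (ball c0 R - S)"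
  and small: "!!K. compact K ==> K <= ball c0 R - S ==> (%n. hmass K (a n) (b n) (c n)) ~~> 0"
  and fin: "!!m. AE y in lborel. finite {t. pt m y t : ball c0 R \<inter> S}"
  and R': "0 < R'" "R' < R" and j: "0 < j"
  and lim: "!!s. 0 < s ==> s < R' ==> (%n. LI y. rcut j ((1 / s) *. (y - c0)) * (a n y + c n y)) ~~> Z s"
  and s: "0 < s" "s <= t" "t < R'"
 shows "Z s / s <= Z t / t"
proof -
 define R2 where "R2 = (R' + R) / 2"
 have R2: "R' < R2" "R2 < R" using R' by (auto simp: R2_def)
 have bR: "ball c0 R2 <= ball c0 R" using R2 by auto
 define e where "e n = inverse (real (Suc n))" for n
 have e: "0 < e n" "e n <= 1" for n by (auto simp: e_def inverse_le_1_iff)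
 have el: "e ~~> 0" unfolding e_def[abs_def] by (rule LIMSEQ_inverse_real_of_nat)
 have "\<exists>w p q A B C. airy_near (ball c0 R2) (e n) (a n) (b n) (c n) w p q A B C" for n
 proof (rule airy_of_divergence_free[OF int R2(2) e(1)])
  show "conv (bmp1 d) (b n) x = conv (bmp2 d) (a n) x" "conv (bmp1 d) (c n) x = conv (bmp2 d) (b n) x"
   if "0 < d" "cball x d <= ball c0 R" for d x by (rule hopf(1)[OF that], rule hopf(2)[OF that])
  show "0 <= a n x + c n x" for x by (rule pos)
 qed
 then obtain w p q A B C where X: "!!n. airy_near (ball c0 R2) (e n) (a n) (b n) (c n) (w n) (p n) (q n) (A n) (B n) (C n)" by metis
 have X': "airy (ball c0 R2) (w n) (p n) (q n) (A n) (B n) (C n)" "0 <= A n x + C n x"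
  "(NNI x. ennreal (norm (A n x - a n x))) <= ennreal (e n)" "(NNI x. ennreal (norm (B n x - b n x))) <= ennreal (e n)"
  "(NNI x. ennreal (norm (C n x - c n x))) <= ennreal (e n)" for n x
  using X[of n] unfolding airy_near_def by blast+
 note D = airyD[OF X'(1)]
 have m: "a n : borel_fun" "b n : borel_fun" "c n : borel_fun" for n using int by auto
 note pert = hmass_perturb[OF m D(7-9) _ X'(3-5) less_imp_le[OF e(1)]]
 have AI: "integ (%x. A n x - a n x)" "(LI x. norm (A n x - a n x)) <= e n" for n
 proof -
  have "(NNI x. ennreal (norm (A n x - a n x))) < \<infinity>" using X'(3)[of n] by (rule order_le_less_trans) simp
  then show i: "integ (%x. A n x - a n x)" using D(7)[of n] m(1)[of n] by (intro integrableI_bounded) auto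
  have "ennreal (LI x. norm (A n x - a n x)) <= ennreal (e n)"
   using nn_integral_eq_integral[OF integrable_norm[OF i]] X'(3)[of n] by simp
  then show "(LI x. norm (A n x - a n x)) <= e n" using e(1)[of n] by (simp add: ennreal_le_iff)
 qed
 have CI: "integ (%x. C n x - c n x)" "(LI x. norm (C n x - c n x)) <= e n" for n
 proof -
  have "(NNI x. ennreal (norm (C n x - c n x))) < \<infinity>" using X'(5)[of n] by (rule order_le_less_trans) simp
  then show i: "integ (%x. C n x - c n x)" using D(9)[of n] m(3)[of n] by (intro integrableI_bounded) auto
  have "ennreal (LI x. norm (C n x - c n x)) <= ennreal (e n)"
   using nn_integral_eq_integral[OF integrable_norm[OF i]] X'(5)[of n] by simp
  then show "(LI x. norm (C n x - c n x)) <= e n" using e(1)[of n] by (simp add: ennreal_le_iff)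
 qed
 show ?thesis
 proof (rule airy_limit_monotone[of c0 R2 w p q A B C "M + 4" S R' j Z s t])
  show "airy (ball c0 R2) (w n) (p n) (q n) (A n) (B n) (C n)" for n by (rule X'(1))
  show "0 <= A n x + C n x" for n x by (rule X'(2))
  \<comment> \<open>Three entries with error at most 1 each; 4 instead of 3 makes the inequality
    strict.\<close>
  show "hmass (ball c0 R2) (A n) (B n) (C n) < ennreal (M + 4)" for n
  proof -
   have "hmass (ball c0 R2) (A n) (B n) (C n) <= hmass (ball c0 R2) (a n) (b n) (c n) + ennreal (3 * e n)" by (rule pert) simp
   also have "... <= ennreal M + ennreal (3 * e n)" by (intro add_mono order_trans[OF hmass_mono[OF bR] M(2)] order_refl)
   also have "... = ennreal (M + 3 * e n)" using M(1) e(1)[of n] by simp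
   also have "... < ennreal (M + 4)" using M(1) e[of n] by (intro ennreal_lessI) auto
   finally show ?thesis .
  qed
  have "ball c0 R2 - S = ball c0 R2 \<inter> (ball c0 R - S)" using bR by auto
  then show "open (ball c0 R2 - S)" using op by auto
  show "(%n. hmass K (A n) (B n) (C n)) ~~> 0" if K: "compact K" "K <= ball c0 R2 - S" for K
  proof (rule tendsto_sandwich[OF _ _ tendsto_const])
   have "(%n. ennreal (3 * e n)) ~~> ennreal (3 * 0)" by (intro tendsto_ennrealI tendsto_mult tendsto_const el)
   then show "(%n. hmass K (a n) (b n) (c n) + ennreal (3 * e n)) ~~> 0"
    using tendsto_add[OF small[of K]] K bR by fastforce
   have "K : sets borel" using borel_closed[OF compact_imp_closed[OF K(1)]] by simp
   then show "\<forall>\<^sub>F n in sequentially. hmass K (A n) (B n) (C n) <= hmass K (a n) (b n) (c n) + ennreal (3 * e n)"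
    using pert by (intro always_eventually allI)
  qed simp
  show "AE y in lborel. finite {t. pt m y t : ball c0 R2 \<inter> S}" for m
   using fin[of m] by eventually_elim (erule rev_finite_subset, use bR in blast)
  show "(%n. LI y. rcut j ((1 / s) *. (y - c0)) * (A n y + C n y)) ~~> Z s" if s: "0 < s" "s < R'" for s
  proof -
   define \<phi> where "\<phi> y = rcut j ((1 / s) *. (y - c0))" for y
   have cphi: "contU \<phi>" unfolding \<phi>_def by (intro continuous_on_compose2[OF rcut_continuous] continuous_intros) auto
   have phi: "0 <= \<phi> y" "\<phi> y <= 1" for y by (auto simp: \<phi>_def rcut_nonneg rcut_le_1)
   have AC: "integ (%x. (A n x + C n x) - (a n x + c n x))" for n
    using B_integrable_add[OF AI(1) CI(1), of n n] by (simp add: algebra_simps)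
   have "(%n. LI y. \<phi> y * (A n y + C n y) - \<phi> y * (a n y + c n y)) ~~> 0"
   proof (rule Lim_null_comparison, intro always_eventually allI)
    fix n
    have "norm (LI y. \<phi> y * (A n y + C n y) - \<phi> y * (a n y + c n y)) <= (LI y. norm (A n y - a n y) + norm (C n y - c n y))"
    proof (rule order_trans[OF integral_norm_bound integral_mono])
     have le: "norm (\<phi> y * (A n y + C n y) - \<phi> y * (a n y + c n y)) <= norm (A n y - a n y) + norm (C n y - c n y)" for y
     proof -
      have "\<phi> y * \<bar>(A n y + C n y) - (a n y + c n y)\<bar> <= 1 * \<bar>(A n y + C n y) - (a n y + c n y)\<bar>" by (intro mult_right_mono phi) auto
      moreover have "norm (\<phi> y * (A n y + C n y) - \<phi> y * (a n y + c n y)) = \<phi> y * \<bar>(A n y + C n y) - (a n y + c n y)\<bar>"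
       using phi(1)[of y] by (simp add: right_diff_distrib[symmetric] abs_mult)
      moreover have "\<bar>(A n y + C n y) - (a n y + c n y)\<bar> <= norm (A n y - a n y) + norm (C n y - c n y)"
       unfolding real_norm_def by linarith
      ultimately show ?thesis by simp
     qed
     show i: "integ (%y. norm (A n y - a n y) + norm (C n y - c n y))" using AI(1) CI(1) by auto
     have [measurable]: "\<phi> : borel_fun" using cphi by (rule borel_measurable_continuous_onI)
     note [measurable] = m D(7-9)
     have "integ (%y. \<phi> y * (A n y + C n y) - \<phi> y * (a n y + c n y))"
      by (rule B_integrable_bound[OF i]) (use le in \<open>auto intro!: AE_I2 intro: order_trans[OF _ abs_ge_self]\<close>)
     then show "integ (%y. norm (\<phi> y * (A n y + C n y) - \<phi> y * (a n y + c n y)))" by auto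
     show "norm (\<phi> y * (A n y + C n y) - \<phi> y * (a n y + c n y)) <= norm (A n y - a n y) + norm (C n y - c n y)" for y by (rule le)
    qed
    also have "... <= e n + e n" using AI[of n] CI[of n] by simp
    finally show "norm (LI y. \<phi> y * (A n y + C n y) - \<phi> y * (a n y + c n y)) <= e n + e n" .
    show "(%n. e n + e n) ~~> 0" using tendsto_add[OF el el] by simp
   qed
   moreover have "(LI y. \<phi> y * (A n y + C n y) - \<phi> y * (a n y + c n y)) = (LI y. \<phi> y * (A n y + C n y)) - (LI y. \<phi> y * (a n y + c n y))" for n
   proof (rule B_integral_diff)
    have pm: "\<phi> : borel_measurable lborel" using cphi by (simp add: borel_measurable_continuous_onI)
    have bdd: "integ (%y. \<phi> y * h y)" if h: "integ h" for h
     by (rule B_integrable_bound[OF h]) (use pm h phi in \<open>auto simp: abs_mult mult_left_le_one_le\<close>)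
    show "integ (%y. \<phi> y * (a n y + c n y))" by (rule bdd) (use int in auto)
    have "integ (%x. ((A n x + C n x) - (a n x + c n x)) + (a n x + c n x))"
     by (rule B_integrable_add[OF AC]) (use int in auto)
    then show "integ (%y. \<phi> y * (A n y + C n y))" by (intro bdd) simp
   qed
   ultimately have "(%n. (LI y. \<phi> y * (A n y + C n y)) - (LI y. \<phi> y * (a n y + c n y))) ~~> 0" by simp
   from tendsto_add[OF this lim[OF s, folded \<phi>_def]] show ?thesis unfolding \<phi>_def[symmetric] by simp
  qed
 qed (use M R' R2 j s in auto)
qed


section \<open>Transfer between vectors with two components and pairs\<close>

text \<open>The statement lives on \<open>real^2\<close>, whereas slices and Fubini are convenient
  on pairs. \<open>J\<close> and its inverse \<open>Ji\<close> are isometries that preserve Lebesgue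
  measure.\<close>

definition J :: "plane => real^2" where "J z = (\<chi> i. if i = 1 then fst z else snd z)"

definition Ji :: "real^2 => plane" where "Ji x = (x $ 1, x $ 2)"

lemma J_component [simp]: "J z $ 1 = fst z" "J z $ 2 = snd z" "fst (Ji x) = x $ 1" "snd (Ji x) = x $ 2"
 by (simp_all add: J_def Ji_def)

lemma J_Ji [simp]: "J (Ji x) = x" "Ji (J z) = z"
 by (simp_all add: vec_eq_iff forall_2 prod_eq_iff)

lemma J_diff: "J (a - b) = J a - J b"
 by (simp add: vec_eq_iff forall_2)

lemma J_inner: "J a .* J b = a .* b"
 by (simp add: inner_vec_def sum_2 inner_prod_def)

lemma J_norm: "norm (J a) = norm a"
 by (simp add: norm_eq_sqrt_inner J_inner)

lemma J_dist: "dist (J a) (J b) = dist a b" and Ji_dist: "dist (Ji x) (Ji y) = dist x y"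
proof -
 show *: "dist (J a) (J b) = dist a b" for a b by (simp add: dist_norm J_norm flip: J_diff)
 show "dist (Ji x) (Ji y) = dist x y" using *[of "Ji x" "Ji y"] by simp
qed

lemma J_continuous: "continuous_on A J" and Ji_continuous: "continuous_on B Ji"
 by (auto simp: continuous_on_iff J_dist Ji_dist simp del: split_paired_All split_paired_Ex)

lemma J_measurable [measurable]: "J : borel_fun" and Ji_measurable [measurable]: "Ji : borel_fun"
 using J_continuous[of UNIV] Ji_continuous[of UNIV] by (auto intro: borel_measurable_continuous_onI)

lemma J_image: "J ` D = Ji -` D"
proof (intro equalityI subsetI)
 fix x assume "x : Ji -` D"
 then have "x = J (Ji x)" "Ji x : D" by simp_all
 then show "x : J ` D" by blast
qed auto

lemma J_image_borel: "D : sets borel ==> J ` D : sets borel"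
 unfolding J_image using measurable_sets[OF Ji_measurable] by fastforce

lemma Basis_real2: "(Basis :: (real^2) set) = {axis 1 1, axis 2 1}"
 by (auto simp: Basis_vec_def UNIV_2)

lemma distr_J: "distr lborel borel J = lborel"
proof (rule lborel_eqI[symmetric])
 fix l u :: "real^2" assume le: "!!b. b : Basis ==> l .* b <= u .* b"
 have le1: "l $ 1 <= u $ 1" "l $ 2 <= u $ 2" using le[of "axis 1 1"] le[of "axis 2 1"] by (auto simp: Basis_real2 inner_axis)
 have v: "J -` box l u = {l $ 1 <..< u $ 1} \<times> {l $ 2 <..< u $ 2}"
  by (auto simp: mem_box_cart forall_2)
 have "emeasure (distr lborel borel J) (box l u) = emeasure (lborel \<Otimes>\<^sub>M lborel) ({l $ 1 <..< u $ 1} \<times> {l $ 2 <..< u $ 2})"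
  by (subst emeasure_distr) (auto simp: v lborel_prod)
 also have "... = ennreal (u $ 1 - l $ 1) * ennreal (u $ 2 - l $ 2)"
  using le1 by (subst lborel.emeasure_pair_measure_Times) auto
 also have "... = (\<Prod>b\<in>Basis. (u - l) .* b)"
  using le1 by (simp add: Basis_real2 axis_eq_axis inner_axis ennreal_mult)
 finally show "emeasure (distr lborel borel J) (box l u) = (\<Prod>b\<in>Basis. (u - l) .* b)" .
qed simp

lemma nn_integral_J: "F : borel_fun ==> (NNI z. F (J z)) = (NNI x. F x)"
 using nn_integral_distr[of J lborel borel F] by (simp add: distr_J)

lemma integral_J:
 fixes F :: "real^2 => 'b::euclidean_space"
 assumes "F : borel_fun"
 shows "(LI z. F (J z)) = (LI x. F x)" "integ (%z. F (J z)) \<longleftrightarrow> integ F"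
 using integral_distr[of J lborel borel F] integrable_distr_eq[of J lborel borel F] assms by (simp_all add: distr_J)

text \<open>Local integrability refers to Lebesgue measurable functions, the convolutions above to
  Borel functions on the whole space. A change on a null set and a cut-off to \<open>K\<close>
  bridge the gap; the representative is assembled from its coordinates.\<close>

lemma borel_representative:
 fixes h :: "'a::euclidean_space => 'b::euclidean_space"
 assumes K: "compact K" and h: "h absolutely_integrable_on K"
 obtains h' where "h' : borel_fun" "integ h'" "!!x. x ~: K ==> h' x = 0"
  "AE x in lborel. x : K --> h' x = h x"
proof -
 define H where "H x = indicator K x *. h x" for x
 have Hi: "integrable lebesgue H" using h unfolding set_integrable_def H_def .
 have Kb[measurable]: "K : sets borel" using compact_imp_closed[OF K] by simp
 have "\<exists>g\<in>borel_measurable lborel. AE x in lborel. H x .* b = g x" for b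
  using Hi by (intro completion_ex_borel_measurable_real) auto
 then obtain g where g: "!!b. g b : borel_measurable lborel" "!!b. AE x in lborel. H x .* b = g b x" by metis
 define h' where "h' x = indicator K x *. (\<Sum>b\<in>Basis. g b x *. b)" for x
 have [measurable]: "g b : borel_fun" for b using g(1)[of b] by simp
 have hm: "h' : borel_fun" unfolding h'_def by measurable
 have "AE x in lborel. \<forall>b\<in>Basis. H x .* b = g b x" by (rule AE_finite_allI) (auto intro: g(2))
 then have ae: "AE x in lborel. h' x = H x"
 proof eventually_elim
  fix x assume b: "\<forall>b\<in>Basis. H x .* b = g b x"
  have "(\<Sum>b\<in>Basis. g b x *. b) = (\<Sum>b\<in>Basis. (H x .* b) *. b)" using b by (intro sum.cong) auto
  also have "... = H x" by (rule euclidean_representation)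
  finally show "h' x = H x" by (simp add: h'_def H_def indicator_def)
 qed
 have "integrable lebesgue h'"
 proof (rule integrable_cong_AE_imp[OF Hi measurable_completion])
  show "h' : borel_measurable lborel" using hm by simp
  have "AE x in lborel. H x = h' x" using ae by eventually_elim simp
  then show "AE x in lebesgue. H x = h' x" by (rule AE_completion)
 qed
 then have li: "integ h'" using hm integrable_completion[of h' lborel] by simp
 have z: "h' x = 0" if "x ~: K" for x using that by (simp add: h'_def)
 have ae': "AE x in lborel. x : K --> h' x = h x" using ae by eventually_elim (simp add: H_def)
 show thesis by (rule that) (fact hm li z ae')+
qed

lemma integral_representative:
 fixes h h' \<Psi> :: "'a::euclidean_space => 'b::euclidean_space"
 assumes \<Omega>: "open \<Omega>" and K: "compact K" "K <= \<Omega>" and h: "h absolutely_integrable_on K"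
  and h': "h' : borel_fun" "!!x. x ~: K ==> h' x = 0" "AE x in lborel. x : K --> h' x = h x"
  and \<Psi>: "\<Psi> : borel_fun" "!!x. x ~: K ==> \<Psi> x = 0"
 shows "(\<integral>x. h x .* \<Psi> x \<partial>lebesgue_on \<Omega>) = (LI x. h' x .* \<Psi> x)"
proof -
 have Hi: "integrable lebesgue (%x. indicator K x *. h x)" using h unfolding set_integrable_def .
 have "(\<integral>x. h x .* \<Psi> x \<partial>lebesgue_on \<Omega>) = (\<integral>x. indicator \<Omega> x *. (h x .* \<Psi> x) \<partial>lebesgue)"
  using \<Omega> by (intro integral_restrict_space) auto
 also have "... = (\<integral>x. (indicator K x *. h x) .* \<Psi> x \<partial>lebesgue)"
 proof (rule B_integral_cong[OF refl])
  fix x show "indicator \<Omega> x *. (h x .* \<Psi> x) = (indicator K x *. h x) .* \<Psi> x"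
   using K(2) \<Psi>(2)[of x] by (cases "x : K") (auto simp: indicator_def)
 qed
 also have "... = (\<integral>x. h' x .* \<Psi> x \<partial>lebesgue)"
 proof (rule integral_cong_AE)
  have [measurable]: "\<Psi> : borel_measurable lebesgue" "h' : borel_measurable lebesgue" using \<Psi>(1) h'(1) by (auto intro: measurable_completion)
  have [measurable]: "(%x. indicator K x *. h x) : borel_measurable lebesgue" using Hi by auto
  show "(%x. (indicator K x *. h x) .* \<Psi> x) : borel_measurable lebesgue" by measurable
  show "(%x. h' x .* \<Psi> x) : borel_measurable lebesgue" by measurable
  have "AE x in lborel. (indicator K x *. h x) .* \<Psi> x = h' x .* \<Psi> x"
   using h'(3) by eventually_elim (auto simp: indicator_def h'(2))
  then show "AE x in lebesgue. (indicator K x *. h x) .* \<Psi> x = h' x .* \<Psi> x" by (rule AE_completion)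
 qed
 also have "... = (LI x. h' x .* \<Psi> x)"
  using h'(1) \<Psi>(1) by (intro integral_completion) auto
 finally show ?thesis .
qed

lemma nn_integral_le_on_domain:
 assumes \<Omega>: "open \<Omega>" and le: "AE x in lborel. F x <= G x * indicator \<Omega> x"
 shows "(NNI x. F x) <= (\<integral>\<^sup>+x. G x \<partial>lebesgue_on \<Omega>)"
proof -
 have "(NNI x. F x) = (\<integral>\<^sup>+x. F x \<partial>lebesgue)" by (rule nn_integral_completion[symmetric])
 also have "... <= (\<integral>\<^sup>+x. G x * indicator \<Omega> x \<partial>lebesgue)" by (rule nn_integral_mono_AE[OF AE_completion[OF le]])
 also have "... = (\<integral>\<^sup>+x. G x \<partial>lebesgue_on \<Omega>)" using \<Omega> by (subst nn_integral_restrict_space) auto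
 finally show ?thesis .
qed

text \<open>The inner product with \<open>v\<close> extracts components, because the weak
  formulations are stated componentwise.\<close>

lemma conv_J:
 fixes h :: "real^2 => 'b::euclidean_space"
 assumes h: "integ h" and K: "contU K" "zero_outside r K"
 shows "conv K (%z. h (J z)) q .* v = (LI x. (h x .* v) * K (q - Ji x))" (is ?A)
  "integ (%x. (h x .* v) * K (q - Ji x))" (is ?B)
proof -
 have [measurable]: "h : borel_fun" "K : borel_fun"
  using h K(1) by (auto intro: borel_measurable_continuous_onI)
 have hJ: "integ (%z. h (J z))" using integral_J(2)[of h] h by simp
 note ci = conv_integrable[OF K hJ, of q]
 have m: "(%x. (h x .* v) * K (q - Ji x)) : borel_fun" by measurable
 have "integ (%z. (K (q - z) *. h (J z)) .* v)" by (rule integrable_inner_left) (rule ci)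
 then have "integ (%z. (h (J z) .* v) * K (q - Ji (J z)))" by (simp add: mult.commute)
 then show ?B using integral_J(2)[OF m] by simp
 have "conv K (%z. h (J z)) q .* v = (LI z. (K (q - z) *. h (J z)) .* v)"
  unfolding conv_def by (rule integral_inner_left[symmetric]) (rule ci)
 also have "... = (LI z. (h (J z) .* v) * K (q - Ji (J z)))" by (simp add: mult.commute)
 also have "... = (LI x. (h x .* v) * K (q - Ji x))" by (rule integral_J(1)[OF m])
 finally show ?A .
qed

lemma kq_J: "kq k d (q - Ji x) = kq k d (x - J q)"
proof -
 have "(x - J q) .* (x - J q) = (Ji x - q) .* (Ji x - q)" using J_inner[of "Ji x - q" "Ji x - q"] by (simp add: J_diff)
 also have "... = (q - Ji x) .* (q - Ji x)" by (simp add: inner_diff_left inner_diff_right inner_commute)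
 finally show ?thesis by (simp add: kq_def)
qed

text \<open>The minus signs come from the reflection: the kernel has the argument
  \<open>q - Ji x\<close>, the test function the argument \<open>x - J q\<close>.\<close>

lemma bmp_J:
 fixes q :: "plane" and d :: real
 defines "\<phi> \<equiv> %x. kq 0 d (x - J q)"
 shows "bmp d (q - Ji x) = \<phi> x / bmpZ d" "bmp1 d (q - Ji x) = - partial 1 \<phi> x / bmpZ d" "bmp2 d (q - Ji x) = - partial 2 \<phi> x / bmpZ d"
 unfolding \<phi>_def bmp_def bmp1_def bmp2_def partial_kq kq_J by (simp_all add: algebra_simps flip: kq_J)

text \<open>\<open>grad\<close> is defined by partial derivatives; expanding \<open>h\<close> in the
  standard basis recovers the full derivative.\<close>

lemma C_on_1_grad:
 fixes V :: "real^'k => real"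
 assumes "C_on 1 UNIV V"
 shows "(V has_derivative (%h. grad V y .* h)) (at y)" "contU (grad V)"
proof -
 obtain f' where f': "!!x. (V has_derivative f' x) (at x)" "!!b. b : Basis ==> contU (%x. f' x b)"
  using assms by auto
 have g: "grad V x $ i = f' x (axis i 1)" for x i
  unfolding grad_def partial_def using frechet_derivative_at[OF f'(1)[of x]] by simp
 have "f' y h = grad V y .* h" for h
 proof -
  have lin: "linear (f' y)" using f'(1) by (rule has_derivative_linear)
  have "f' y h = f' y (\<Sum>i\<in>UNIV. h $ i *. axis i 1)" using basis_expansion[of h] by (simp add: scalar_mult_eq_scaleR)
  also have "... = (\<Sum>i\<in>UNIV. h $ i * f' y (axis i 1))" by (simp add: linear_sum[OF lin] linear_scale[OF lin])
  also have "... = grad V y .* h" by (simp add: inner_vec_def g mult.commute)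
  finally show ?thesis .
 qed
 then have "f' y = (%h. grad V y .* h)" by blast
 then show "(V has_derivative (%h. grad V y .* h)) (at y)" using f'(1)[of y] by simp
 have "contU (%x. f' x (axis i 1))" for i by (rule f'(2)) (auto simp: axis_in_Basis_iff)
 then show "contU (grad V)"
  by (subst continuous_on_componentwise) (auto simp: Basis_vec_def inner_axis g)
qed

lemma admissible_nonneg: "admissible_potential V ==> 0 <= V y"
 unfolding admissible_potential_def using cINF_lower[of V UNIV y] by auto

lemma admissible_C1: "admissible_potential V ==> C_on 1 UNIV V"
 unfolding admissible_potential_def smooth_on_def by blast

text \<open>Far out the growth condition makes the product nonnegative. On the remaining ball it is
  at least \<open>- R * M\<close> for a bound \<open>M\<close> of the gradient, and
  \<open>rootn\<close> is at least 1.\<close>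

lemma admissible_coercive:
 fixes V :: "real^'k => real"
 assumes V: "admissible_potential V"
 obtains C where "0 <= C" "!!y. - C * rootn y <= y .* grad V y"
proof -
 obtain \<alpha> R where aR: "0 < \<alpha>" "0 < R" "!!y. R < norm y ==> \<alpha> * (norm y)\<^sup>2 <= y .* grad V y"
  using V unfolding admissible_potential_def by blast
 have "compact (grad V ` cball 0 R)"
  by (intro compact_continuous_image continuous_on_subset[OF C_on_1_grad(2)[OF admissible_C1[OF V]]]) auto
 then obtain M where M: "\<forall>y\<in>grad V ` cball 0 R. norm y <= M" using compact_imp_bounded bounded_iff by blast
 have "grad V 0 : grad V ` cball 0 R" using aR by (intro imageI) simp
 then have M0: "0 <= M" using M norm_ge_zero order_trans by blast
 show thesis
 proof (rule that[of "R * M"])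
  show "0 <= R * M" using aR M0 by simp
  fix y :: "real^'k"
  have r: "R * M * 1 <= R * M * rootn y" using rootn_ge(1)[of y] aR M0 by (intro mult_left_mono) auto
  have m: "- (R * M) * rootn y = - (R * M * rootn y)" by simp
  show "- (R * M) * rootn y <= y .* grad V y"
  proof (cases "R < norm y")
   case True
   have "0 <= \<alpha> * (norm y)\<^sup>2" using aR by simp
   moreover have "0 <= R * M" using aR M0 by simp
   ultimately show ?thesis using aR(3)[OF True] r m by linarith
  next
   case False
   then have "grad V y : grad V ` cball 0 R" by (intro imageI) simp
   then have "norm (grad V y) <= M" using M by blast
   then have "norm y * norm (grad V y) <= R * M" using False aR by (intro mult_mono) auto
   then show ?thesis using Cauchy_Schwarz_ineq2[of y "grad V y"] r m by linarith
  qed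
 qed
qed

lemma norm_matrix2: "(norm (G :: real^2^'k))\<^sup>2 = (norm (\<chi> j. G $ j $ 1))\<^sup>2 + (norm (\<chi> j. G $ j $ 2))\<^sup>2"
 by (simp add: power2_norm_eq_inner inner_vec_def sum_2 sum.distrib)


section \<open>The rotated stress tensor of an Allen-Cahn solution\<close>

text \<open>The interface between the equation and the monotonicity argument. The factor 3 counts
  the entries, each of which is bounded by the energy density; the factor 2 is that of the trace
  \<open>2 * V(u) / \<epsilon>\<close>.\<close>

definition stress_field ::
  "(real^'k => real) => (real^2) set => real => (real^2 => real^'k) => real^2 => real \<Rightarrow>
   (plane => real) => (plane => real) => (plane => real) => bool" where
 "stress_field V \<Omega> \<epsilon> u x0 R a b c \<longleftrightarrow>
   integ a & integ b & integ c & (\<forall>x. 0 <= a x + c x) &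
   (\<forall>d x. 0 < d --> cball x d <= ball (Ji x0) R -->
    conv (bmp1 d) b x = conv (bmp2 d) a x & conv (bmp1 d) c x = conv (bmp2 d) b x) &
   (\<forall>D\<in>sets borel. hmass D a b c \<le>
    3 * (\<integral>\<^sup>+x. ennreal (energy_density V \<Omega> \<epsilon> u x) * indicator (J ` D) x \<partial>lebesgue_on \<Omega>)) &
   (\<forall>\<phi>. \<phi> : borel_fun --> (\<forall>x. x ~: cball x0 R --> \<phi> x = 0) -->
    (LI y. \<phi> (J y) * (a y + c y)) = 2 * (\<integral>x. \<phi> x * (V (u x) / \<epsilon>) \<partial>lebesgue_on \<Omega>))"

lemma J_mem_cball: "J z : cball x0 R \<longleftrightarrow> z : cball (Ji x0) R"
 using J_dist[of "Ji x0" z] by simp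

text \<open>Borel representatives of \<open>u\<close> and its weak gradient on the disk are moved to
  pairs, where they form a \<open>weak_solution\<close>; bumps as test functions supply the
  convolution identities. That locale is used with the potential \<open>V / \<epsilon>^2\<close>, so
  its stresses are multiplied by \<open>\<epsilon>\<close> at the end.\<close>

lemma stress_field_exists:
 fixes V :: "real^'k => real"
 assumes V: "admissible_potential V" and \<Omega>: "open \<Omega>" and \<epsilon>: "0 < \<epsilon>" and sol: "AC_solution V \<Omega> \<epsilon> u"
  and en: "energy V \<Omega> \<epsilon> u <= ennreal M" and R: "0 < R" "cball x0 R <= \<Omega>"
 shows "\<exists>a b c. stress_field V \<Omega> \<epsilon> u x0 R a b c"
proof -
 define K where "K = cball x0 R"
 have K: "compact K" "K <= \<Omega>" using R by (auto simp: K_def)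
 have Kb[measurable]: "K : sets borel" by (simp add: K_def)
 define G where "G = weak_gradient \<Omega> u"
 have "\<exists>G. is_weak_gradient \<Omega> u G" using sol unfolding AC_solution_def sobolev_H1_def by blast
 then have wg: "is_weak_gradient \<Omega> u G" unfolding G_def weak_gradient_def by (rule someI_ex)
 have ul: "locally_integrable_on u \<Omega>" "locally_integrable_on G \<Omega>" using wg unfolding is_weak_gradient_def by (rule conjunct1, rule conjunct1[OF conjunct2])
 have Fl: "locally_integrable_on (%x. grad V (u x)) \<Omega>" using sol unfolding AC_solution_def by (rule conjunct1[OF conjunct2])
 have loc: "h absolutely_integrable_on K" if "locally_integrable_on h \<Omega>" for h :: "real^2 => 'b::euclidean_space"
  using that[unfolded locally_integrable_on_def, rule_format, OF conjI[OF K]] .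
 note uK = loc[OF ul(1)] and GK = loc[OF ul(2)] and FK = loc[OF Fl]
 obtain u' where u': "u' : borel_fun" "integ u'" "!!x. x ~: K ==> u' x = 0" "AE x in lborel. x : K --> u' x = u x"
  by (rule borel_representative[OF K(1) uK], rule that)
 obtain G' where G': "G' : borel_fun" "integ G'" "!!x. x ~: K ==> G' x = 0" "AE x in lborel. x : K --> G' x = G x"
  by (rule borel_representative[OF K(1) GK], rule that)
 obtain F' where F': "F' : borel_fun" "integ F'" "!!x. x ~: K ==> F' x = 0" "AE x in lborel. x : K --> F' x = grad V (u x)"
  by (rule borel_representative[OF K(1) FK], rule that)
 note [measurable] = u'(1) G'(1) F'(1)
 have V1: "C_on 1 UNIV V" by (rule admissible_C1[OF V])
 note gV = C_on_1_grad[OF V1]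
 have Vc: "contU V" using gV(1) by (intro continuous_at_imp_continuous_on ballI) (rule has_derivative_continuous)
 have [measurable]: "V : borel_fun" "grad V : borel_fun"
  using Vc gV(2) by (auto intro: borel_measurable_continuous_onI)
 have V0: "0 <= V y" for y by (rule admissible_nonneg[OF V])
 \<comment> \<open>\<open>F'\<close> represents \<open>grad V (u x)\<close>, but the locale asks for
   the exact value \<open>dV (u x)\<close> of the chosen representative; \<open>w\<close> has this
   form and agrees with \<open>F'\<close> almost everywhere.\<close>
 define w where "w x = indicator K x *. grad V (u' x)" for x
 have wm[measurable]: "w : borel_fun" unfolding w_def by measurable
 have w0: "w x = 0" if "x ~: K" for x using that by (simp add: w_def)
 have wae: "AE x in lborel. x : K --> w x = grad V (u x)" using u'(4) by eventually_elim (simp add: w_def)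
 have wint: "integ w"
 proof (rule integrable_cong_AE_imp[OF F'(2)])
  show "AE x in lborel. F' x = w x"
   using wae F'(4) by eventually_elim (metis F'(3) w0)
 qed measurable
 define gi where "gi i x = (\<chi> j. G' x $ j $ i)" for i x
 have gi_int: "integ (gi i)" for i
 proof -
  have "linear (%G :: real^2^'k. \<chi> j. G $ j $ i)" by (rule linearI) (simp_all add: vec_eq_iff)
  then have "bounded_linear (%G :: real^2^'k. \<chi> j. G $ j $ i)" by (simp add: linear_conv_bounded_linear)
  from integrable_bounded_linear[OF this G'(2)] show ?thesis by (simp add: gi_def[abs_def])
 qed
 have gim[measurable]: "gi i : borel_fun" for i using gi_int[of i] by auto
 have gi_inner: "gi i x .* axis j 1 = G' x $ j $ i" for i j x by (simp add: gi_def inner_axis)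
 define c0 where "c0 = Ji x0"
 define uu where "uu z = u' (J z)" for z
 define g where "g i z = gi i (J z)" for i z
 define f where "f z = (1 / \<epsilon>\<^sup>2) *. w (J z)" for z
 have memK: "J z : K \<longleftrightarrow> z : cball c0 R" for z unfolding K_def c0_def by (rule J_mem_cball)
 have fint: "integ (%x. (1 / \<epsilon>\<^sup>2) *. w x)" using wint by simp
 \<comment> \<open>The test function that becomes the kernel \<open>bmp d (q - Ji x)\<close> after
   division by \<open>bmpZ d\<close>.\<close>
 define ph where "ph q d x = kq 0 d (x - J q)" for q d and x :: "real^2"
 have tf: "test_function \<Omega> (ph q d)" "!!x. x ~: K ==> ph q d x = 0" "!!x i. x ~: K ==> partial i (ph q d) x = 0"
  if d: "0 < d" and q: "cball q d <= cball c0 R" for q d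
 proof -
  have sub: "cball (J q) d <= K"
  proof
   fix x assume "x : cball (J q) d"
   then have "Ji x : cball q d" using J_dist[of q "Ji x"] by simp
   then have "J (Ji x) : K" unfolding memK using q by blast
   then show "x : K" by simp
  qed
  show "test_function \<Omega> (ph q d)" unfolding ph_def by (rule test_function_kq[OF d order_trans[OF sub K(2)]])
  have off: "kq k d (x - J q) = 0" if "x ~: K" for k x
  proof (rule kq_zero_outside[OF d])
   have "x ~: cball (J q) d" using sub that by blast
   then show "d <= norm (x - J q)" by (simp add: dist_norm norm_minus_commute)
  qed
  show "ph q d x = 0" if "x ~: K" for x using off[OF that] by (simp add: ph_def)
  show "partial i (ph q d) x = 0" if "x ~: K" for x i unfolding ph_def partial_kq using off[OF that] by simp
 qed
 have kc: "contU (%x. kq k d (x - J q))" for k d q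
  by (intro continuous_on_compose2[OF kq_continuous] continuous_intros) auto
 have phm[measurable]: "ph q d : borel_fun" for q d
  unfolding ph_def using kc by (rule borel_measurable_continuous_onI)
 have ppm[measurable]: "partial i (ph q d) : borel_fun" for q d i
 proof -
  have "contU (%x. -2 * (x - J q) $ i * kq 2 d (x - J q))" by (intro continuous_intros kc)
  then show ?thesis unfolding ph_def partial_kq by (rule borel_measurable_continuous_onI)
 qed
 note bJ = bmp_J[folded ph_def]
 have rep_u: "(\<integral>x. u x $ j * \<psi> x \<partial>lebesgue_on \<Omega>) = (LI x. (u' x .* axis j 1) * \<psi> x)"
  and rep_G: "(\<integral>x. G x $ j $ i * \<psi> x \<partial>lebesgue_on \<Omega>) = (LI x. (gi i x .* axis j 1) * \<psi> x)"
  and rep_F: "(\<integral>x. grad V (u x) $ j * \<psi> x \<partial>lebesgue_on \<Omega>) = (LI x. (w x .* axis j 1) * \<psi> x)"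
  if p: "\<psi> : borel_fun" "!!x. x ~: K ==> \<psi> x = 0" for \<psi> :: "real^2 => real" and i j
 proof -
  note [measurable] = p(1)
  have "(\<integral>x. u x .* (\<psi> x *. axis j 1) \<partial>lebesgue_on \<Omega>) = (LI x. u' x .* (\<psi> x *. axis j 1))"
   by (rule integral_representative[OF \<Omega> K uK u'(1,3,4)]) (use p(2) in auto)
  then show "(\<integral>x. u x $ j * \<psi> x \<partial>lebesgue_on \<Omega>) = (LI x. (u' x .* axis j 1) * \<psi> x)" by (simp add: inner_axis mult.commute)
  have "(\<integral>x. G x .* (\<psi> x *. axis j (axis i 1)) \<partial>lebesgue_on \<Omega>) = (LI x. G' x .* (\<psi> x *. axis j (axis i 1)))"
   by (rule integral_representative[OF \<Omega> K GK G'(1,3,4)]) (use p(2) in auto)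
  then show "(\<integral>x. G x $ j $ i * \<psi> x \<partial>lebesgue_on \<Omega>) = (LI x. (gi i x .* axis j 1) * \<psi> x)" by (simp add: inner_axis gi_def mult.commute)
  have "(\<integral>x. grad V (u x) .* (\<psi> x *. axis j 1) \<partial>lebesgue_on \<Omega>) = (LI x. w x .* (\<psi> x *. axis j 1))"
   by (rule integral_representative[OF \<Omega> K FK wm w0 wae]) (use p(2) in auto)
  then show "(\<integral>x. grad V (u x) $ j * \<psi> x \<partial>lebesgue_on \<Omega>) = (LI x. (w x .* axis j 1) * \<psi> x)" by (simp add: inner_axis mult.commute)
 qed
 have weak: "conv k uu q = conv (bmp d) (g i) q"
  if k: "contU k" "zero_outside d k" and d: "0 < d" and q: "cball q d <= cball c0 R"
   and ke: "!!x. k (q - Ji x) = - partial i (ph q d) x / bmpZ d" for k i q d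
 proof -
  have "conv k uu q $ j = conv (bmp d) (g i) q $ j" for j
  proof -
   have "conv k uu q $ j = (LI x. (u' x .* axis j 1) * k (q - Ji x))"
    unfolding cart_eq_inner_axis uu_def[abs_def] by (rule conv_J(1)[OF u'(2) k])
   also have "... = (LI x. (- 1 / bmpZ d) * ((u' x .* axis j 1) * partial i (ph q d) x))" unfolding ke by simp
   also have "... = (- 1 / bmpZ d) * (\<integral>x. u x $ j * partial i (ph q d) x \<partial>lebesgue_on \<Omega>)"
    by (subst rep_u[OF ppm tf(3)[OF d q]]) simp_all
   also have "... = (1 / bmpZ d) * (\<integral>x. G x $ j $ i * ph q d x \<partial>lebesgue_on \<Omega>)"
    using wg tf(1)[OF d q] unfolding is_weak_gradient_def by simp
   also have "... = (LI x. (gi i x .* axis j 1) * bmp d (q - Ji x))"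
    by (subst rep_G[OF phm tf(2)[OF d q]]) (simp_all add: bJ)
   also have "... = conv (bmp d) (g i) q $ j"
    unfolding cart_eq_inner_axis g_def[abs_def]
    by (rule conv_J(1)[symmetric, OF gi_int bmp_continuous(1)[OF d] bmp_zero_outside(1)[OF d]])
   finally show ?thesis .
  qed
  then show ?thesis by (simp add: vec_eq_iff)
 qed
 have weak_eq: "conv (bmp1 d) (g 1) q + conv (bmp2 d) (g 2) q = conv (bmp d) f q"
  if d: "0 < d" and q: "cball q d <= cball c0 R" for d q
 proof -
  have "(conv (bmp1 d) (g 1) q + conv (bmp2 d) (g 2) q) $ j = conv (bmp d) f q $ j" for j
  proof -
   note c1 = conv_J[where q=q and v="axis j 1", OF gi_int[of 1] bmp_continuous(2)[OF d] bmp_zero_outside(2)[OF d]]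
    and c2 = conv_J[where q=q and v="axis j 1", OF gi_int[of 2] bmp_continuous(3)[OF d] bmp_zero_outside(3)[OF d]]
   \<comment> \<open>Only row \<open>j\<close> is nonzero, and it is the gradient of the test
     function; one inner product of matrices thus covers both directions.\<close>
   define \<Psi> where "\<Psi> x = partial 1 (ph q d) x *. axis j (axis 1 1) + partial 2 (ph q d) x *. (axis j (axis 2 1) :: real^2^'k)" for x
   have \<Psi>m: "\<Psi> : borel_fun" unfolding \<Psi>_def by measurable
   have GP: "H .* \<Psi> x = H $ j .* grad (ph q d) x" for H x
    by (simp add: \<Psi>_def inner_add_right inner_axis inner_vec_def[of "H $ j"] sum_2 grad_def mult.commute)
   have "(conv (bmp1 d) (g 1) q + conv (bmp2 d) (g 2) q) $ j
     = (LI x. (gi 1 x .* axis j 1) * bmp1 d (q - Ji x)) + (LI x. (gi 2 x .* axis j 1) * bmp2 d (q - Ji x))"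
    unfolding cart_eq_inner_axis inner_add_left g_def[abs_def] c1(1) c2(1) by (rule refl)
   also have "... = (LI x. (gi 1 x .* axis j 1) * bmp1 d (q - Ji x) + (gi 2 x .* axis j 1) * bmp2 d (q - Ji x))"
    by (rule B_integral_add[symmetric, OF c1(2) c2(2)])
   also have "... = (LI x. (- 1 / bmpZ d) * (G' x .* \<Psi> x))"
   proof (rule B_integral_cong[OF refl])
    fix x
    show "(gi 1 x .* axis j 1) * bmp1 d (q - Ji x) + (gi 2 x .* axis j 1) * bmp2 d (q - Ji x) = (- 1 / bmpZ d) * (G' x .* \<Psi> x)"
     unfolding GP gi_inner bJ by (simp add: inner_vec_def sum_2 grad_def add_divide_distrib)
   qed
   also have "... = (- 1 / bmpZ d) * (\<integral>x. G x .* \<Psi> x \<partial>lebesgue_on \<Omega>)"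
    by (subst integral_representative[OF \<Omega> K GK G'(1,3,4) \<Psi>m]) (auto simp: \<Psi>_def tf(3)[OF d q])
   also have "... = (- 1 / bmpZ d) * (- (1 / \<epsilon>\<^sup>2) * (\<integral>x. grad V (u x) $ j * ph q d x \<partial>lebesgue_on \<Omega>))"
   proof -
    have "(\<integral>x. G x $ j .* grad (ph q d) x \<partial>lebesgue_on \<Omega>) = - (1 / \<epsilon>\<^sup>2) * (\<integral>x. grad V (u x) $ j * ph q d x \<partial>lebesgue_on \<Omega>)"
     using sol tf(1)[OF d q] unfolding AC_solution_def G_def by blast
    then show ?thesis unfolding GP by simp
   qed
   also have "... = (LI x. (((1 / \<epsilon>\<^sup>2) *. w x) .* axis j 1) * bmp d (q - Ji x))"
    by (subst rep_F[OF phm tf(2)[OF d q]]) (simp_all add: bJ)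
   also have "... = conv (bmp d) f q $ j"
    unfolding cart_eq_inner_axis f_def[abs_def]
    by (rule conv_J(1)[symmetric, OF fint bmp_continuous(1)[OF d] bmp_zero_outside(1)[OF d]])
   finally show ?thesis .
  qed
  then show ?thesis by (simp add: vec_eq_iff)
 qed
 \<comment> \<open>A Borel version of the energy density on \<open>K\<close>, equal to 0
   elsewhere.\<close>
 define e where "e x = indicator K x * (V (u' x) / \<epsilon>) + \<epsilon> / 2 * (norm (G' x))\<^sup>2" for x
 have em[measurable]: "e : borel_fun" unfolding e_def by measurable
 have e0: "0 <= e x" for x using V0 \<epsilon> by (simp add: e_def)
 have EN: "(NNI x. ennreal (e x) * indicator D x) <= (\<integral>\<^sup>+x. ennreal (energy_density V \<Omega> \<epsilon> u x) * indicator D x \<partial>lebesgue_on \<Omega>)" for D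
 proof (rule nn_integral_le_on_domain[OF \<Omega>])
  show "AE x in lborel. ennreal (e x) * indicator D x <= ennreal (energy_density V \<Omega> \<epsilon> u x) * indicator D x * indicator \<Omega> x"
   using u'(4) G'(4)
  proof eventually_elim
   fix x assume x: "x : K --> u' x = u x" "x : K --> G' x = G x"
   show "ennreal (e x) * indicator D x <= ennreal (energy_density V \<Omega> \<epsilon> u x) * indicator D x * indicator \<Omega> x"
   proof (cases "x : K")
    case True
    then have "x : \<Omega>" "e x = energy_density V \<Omega> \<epsilon> u x" using K x by (auto simp: e_def energy_density_def G_def)
    then show ?thesis by simp
   next
    case False then show ?thesis by (simp add: e_def G'(3))
   qed
  qed
 qed
 have "(NNI x. ennreal (e x)) <= energy V \<Omega> \<epsilon> u" using EN[of UNIV] by (simp add: energy_def)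
 also have "... < \<infinity>" using en by (rule order_le_less_trans) simp
 finally have eint: "integ e" using e0 by (intro integrableI_bounded) auto
 have eJ: "integ (%z. e (J z))" using integral_J(2)[OF em] eint by simp
 have gn: "(norm (G' x))\<^sup>2 = gi 1 x .* gi 1 x + gi 2 x .* gi 2 x" for x
  using norm_matrix2[of "G' x"] by (simp add: gi_def power2_norm_eq_inner)
 have e2: "e x = indicator K x * (V (u' x) / \<epsilon>) + \<epsilon> / 2 * (gi 1 x .* gi 1 x + gi 2 x .* gi 2 x)" for x
  unfolding e_def gn ..
 have eJe: "e (J z) = \<epsilon> * (indicator (cball c0 R) z * (V (uu z) / \<epsilon>\<^sup>2)) + \<epsilon> / 2 * (g 1 z .* g 1 z + g 2 z .* g 2 z)" for z
  using \<epsilon> by (auto simp: e2 uu_def g_def memK indicator_def power2_eq_square)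
 have [measurable]: "uu : borel_fun" "g i : borel_fun" for i unfolding uu_def g_def by measurable
 have Wm: "(%z. indicator (cball c0 R) z * (V (uu z) / \<epsilon>\<^sup>2)) : borel_fun"
  by (intro borel_measurable_times borel_measurable_indicator borel_measurable_divide measurable_compose[OF \<open>uu : borel_fun\<close>]) auto
 have gg: "0 <= g i z .* g i z" for i z by simp
 have WP: "0 <= indicator (cball c0 R) z * (V (uu z) / \<epsilon>\<^sup>2)" for z using V0 by simp
 have g2int: "integ (%z. (norm (g i z))\<^sup>2)" if i: "i = 1 \<or> i = 2" for i
 proof (rule B_integrable_bound)
  show "integ (%z. (2 / \<epsilon>) * e (J z))" using eJ by simp
  show "AE z in lborel. norm ((norm (g i z))\<^sup>2) <= norm ((2 / \<epsilon>) * e (J z))"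
  proof (rule AE_I2)
   fix z
   have "\<epsilon> / 2 * (g i z .* g i z) <= \<epsilon> / 2 * (g 1 z .* g 1 z + g 2 z .* g 2 z)" using i \<epsilon> gg by (intro mult_left_mono) auto
   also have "... <= e (J z)" unfolding eJe using mult_nonneg_nonneg[OF less_imp_le[OF \<epsilon>] WP[of z]] by linarith
   finally have "(2 / \<epsilon>) * (\<epsilon> / 2 * (g i z .* g i z)) <= (2 / \<epsilon>) * e (J z)" using \<epsilon> by (intro mult_left_mono) auto
   then have "g i z .* g i z <= (2 / \<epsilon>) * e (J z)" using \<epsilon> by simp
   moreover have "0 <= (2 / \<epsilon>) * e (J z)" using e0 \<epsilon> by simp
   ultimately show "norm ((norm (g i z))\<^sup>2) <= norm ((2 / \<epsilon>) * e (J z))"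
    unfolding power2_norm_eq_inner real_norm_def using gg[of i z] by linarith
  qed
 qed measurable
 obtain C where C: "0 <= C" "!!y. - C * rootn y <= y .* grad V y" using admissible_coercive[OF V] by blast
 interpret ws: weak_solution uu "g 1" "g 2" "%y. V y / \<epsilon>\<^sup>2" "%y. (1 / \<epsilon>\<^sup>2) *. grad V y" "C / \<epsilon>\<^sup>2" c0 R f
 proof
  show "((%y. V y / \<epsilon>\<^sup>2) has_derivative (%h. ((1 / \<epsilon>\<^sup>2) *. grad V y) .* h)) (at y)" for y
   using has_derivative_mult_right[OF gV(1)[of y], of "1 / \<epsilon>\<^sup>2"] by simp
  show "contU (%y. (1 / \<epsilon>\<^sup>2) *. grad V y)" by (intro continuous_intros gV(2))
  show "- (C / \<epsilon>\<^sup>2) * rootn y <= y .* ((1 / \<epsilon>\<^sup>2) *. grad V y)" for y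
   using mult_left_mono[OF C(2)[of y], of "1 / \<epsilon>\<^sup>2"] by simp
  show "0 <= C / \<epsilon>\<^sup>2" using C(1) by simp
  show "0 < R" by (rule R(1))
  show "uu x = 0" "g 1 x = 0" "g 2 x = 0" if "x ~: cball c0 R" for x
   using that memK[of x] u'(3)[of "J x"] G'(3)[of "J x"] by (auto simp: uu_def g_def gi_def vec_eq_iff)
  show "integ uu" "integ (g 1)" "integ (g 2)" "integ f"
   unfolding uu_def[abs_def] g_def[abs_def] f_def[abs_def]
   using integral_J(2)[OF u'(1)] u'(2) integral_J(2)[OF gim] gi_int integral_J(2)[of "%x. (1 / \<epsilon>\<^sup>2) *. w x"] fint by simp_all
  show "integ (%x. (norm (g 1 x))\<^sup>2)" "integ (%x. (norm (g 2 x))\<^sup>2)" by (rule g2int; simp)+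
  show "f x = indicator (cball c0 R) x *. ((1 / \<epsilon>\<^sup>2) *. grad V (uu x))" for x
   by (simp add: f_def w_def uu_def memK indicator_def)
  show "conv (bmp1 d) uu x = conv (bmp d) (g 1) x" if "0 < d" "cball x d <= cball c0 R" for x d
   by (rule weak[OF bmp_continuous(2) bmp_zero_outside(2) that bJ(2)]) (use that in auto)
  show "conv (bmp2 d) uu x = conv (bmp d) (g 2) x" if "0 < d" "cball x d <= cball c0 R" for x d
   by (rule weak[OF bmp_continuous(3) bmp_zero_outside(3) that bJ(3)]) (use that in auto)
  show "conv (bmp1 d) (g 1) x + conv (bmp2 d) (g 2) x = conv (bmp d) f x" if "0 < d" "cball x d <= cball c0 R" for x d
   by (rule weak_eq[OF that])
 qed
 have Wd: "ws.W z = indicator (cball c0 R) z * (V (uu z) / \<epsilon>\<^sup>2)" for z by (simp add: ws.W_def)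
 have W0: "0 <= ws.W z" for z unfolding Wd by (rule WP)
 have Wint: "integ ws.W"
 proof (rule B_integrable_bound)
  show "integ (%z. (1 / \<epsilon>) * e (J z))" using eJ by simp
  show "ws.W : borel_measurable lborel" unfolding Wd[abs_def] using Wm by simp
  show "AE z in lborel. norm (ws.W z) <= norm ((1 / \<epsilon>) * e (J z))"
  proof (rule AE_I2)
   fix z
   have "0 <= \<epsilon> / 2 * (g 1 z .* g 1 z + g 2 z .* g 2 z)" using \<epsilon> gg by (intro mult_nonneg_nonneg add_nonneg_nonneg) auto
   then have "\<epsilon> * ws.W z <= e (J z)" unfolding eJe Wd by linarith
   then have "(1 / \<epsilon>) * (\<epsilon> * ws.W z) <= (1 / \<epsilon>) * e (J z)" using \<epsilon> by (intro mult_left_mono) auto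
   then have "ws.W z <= (1 / \<epsilon>) * e (J z)" using \<epsilon> by simp
   then show "norm (ws.W z) <= norm ((1 / \<epsilon>) * e (J z))" using W0[of z] unfolding real_norm_def by linarith
  qed
 qed
 define a b c where "a z = \<epsilon> * ws.stress (1/2) z" and "b z = \<epsilon> * ws.shear z" and "c z = \<epsilon> * ws.stress (-1/2) z" for z
 have ac: "a z + c z = 2 * (\<epsilon> * ws.W z)" for z by (simp add: a_def c_def ws.stress_def algebra_simps)
 have conv_scale: "conv k (%z. \<epsilon> * h z) x = \<epsilon> * conv k h x" for k h x
  by (simp add: conv_def mult.left_commute)
 have "stress_field V \<Omega> \<epsilon> u x0 R a b c"
  unfolding stress_field_def
 proof (intro conjI allI impI ballI)
  show "integ a" "integ b" "integ c"
   unfolding a_def[abs_def] b_def[abs_def] c_def[abs_def] using ws.stress_integrable[OF Wint] ws.shear_integrable by auto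
  show "0 <= a x + c x" for x unfolding ac using W0 \<epsilon> by simp
  show "conv (bmp1 d) b x = conv (bmp2 d) a x" "conv (bmp1 d) c x = conv (bmp2 d) b x" if "0 < d" "cball x d <= ball (Ji x0) R" for d x
   unfolding a_def[abs_def] b_def[abs_def] c_def[abs_def] conv_scale
   using ws.hopf[OF Wint that(1)] that(2) unfolding c0_def by simp_all
  show "hmass D a b c <= 3 * (\<integral>\<^sup>+x. ennreal (energy_density V \<Omega> \<epsilon> u x) * indicator (J ` D) x \<partial>lebesgue_on \<Omega>)" if D: "D : sets borel" for D
  proof -
   have [measurable]: "J ` D : sets borel" by (rule J_image_borel[OF D])
   have "hmass D a b c <= (NNI z. 3 * (ennreal (e (J z)) * indicator (J ` D) (J z)))"
    unfolding hmass_def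
   proof (rule nn_integral_mono)
    fix z
    show "ennreal (\<bar>a z\<bar> + \<bar>b z\<bar> + \<bar>c z\<bar>) * indicator D z <= 3 * (ennreal (e (J z)) * indicator (J ` D) (J z))"
    proof (cases "z : D")
     case True
     define s1 s2 where "s1 = \<epsilon> / 2 * (g 1 z .* g 1 z)" and "s2 = \<epsilon> / 2 * (g 2 z .* g 2 z)"
     have s: "0 <= s1" "0 <= s2" using \<epsilon> gg by (simp_all add: s1_def s2_def)
     have w: "0 <= \<epsilon> * ws.W z" using \<epsilon> W0 by simp
     have ez: "e (J z) = \<epsilon> * ws.W z + s1 + s2" by (simp add: eJe Wd s1_def s2_def algebra_simps)
     define X where "X = \<epsilon> * ws.W z"
     have X0: "0 <= X" using w by (simp add: X_def)
     have "a z = X + s1 - s2" "c z = X - s1 + s2"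
      by (simp_all add: a_def c_def ws.stress_def s1_def s2_def X_def algebra_simps)
     then have "\<bar>a z\<bar> <= X + s1 + s2" "\<bar>c z\<bar> <= X + s1 + s2" using s X0 by (auto simp: abs_le_iff)
     moreover have "\<bar>b z\<bar> <= s1 + s2"
     proof -
      have "0 <= (g 1 z - g 2 z) .* (g 1 z - g 2 z)" "0 <= (g 1 z + g 2 z) .* (g 1 z + g 2 z)" by simp_all
      then have "\<bar>g 1 z .* g 2 z\<bar> <= (1/2) * (g 1 z .* g 1 z + g 2 z .* g 2 z)" by (simp add: inner_simps inner_commute)
      from mult_left_mono[OF this less_imp_le[OF \<epsilon>]] show ?thesis
       using \<epsilon> by (simp add: b_def ws.shear_def s1_def s2_def abs_mult algebra_simps)
     qed
     ultimately have "\<bar>a z\<bar> + \<bar>b z\<bar> + \<bar>c z\<bar> <= 3 * e (J z)" unfolding ez X_def[symmetric] distrib_left using s X0 by linarith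
     then have "ennreal (\<bar>a z\<bar> + \<bar>b z\<bar> + \<bar>c z\<bar>) <= ennreal (3 * e (J z))" by (rule ennreal_leI)
     also have "... = 3 * ennreal (e (J z))" using e0 by (simp add: ennreal_mult)
     finally show ?thesis using True by simp
    qed simp
   qed
   also have "... = 3 * (NNI z. ennreal (e (J z)) * indicator (J ` D) (J z))" by (rule nn_integral_cmult) measurable
   also have "(NNI z. ennreal (e (J z)) * indicator (J ` D) (J z)) = (NNI x. ennreal (e x) * indicator (J ` D) x)"
    by (rule nn_integral_J[where F="%x. ennreal (e x) * indicator (J ` D) x"]) measurable
   also have "3 * ... <= 3 * (\<integral>\<^sup>+x. ennreal (energy_density V \<Omega> \<epsilon> u x) * indicator (J ` D) x \<partial>lebesgue_on \<Omega>)"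
    by (intro mult_left_mono EN) simp
   finally show ?thesis .
  qed
  fix \<phi> :: "real^2 => real" assume [measurable]: "\<phi> : borel_fun" and off: "\<forall>x. x ~: cball x0 R --> \<phi> x = 0"
  have off': "\<phi> x = 0" if "x ~: K" for x using off that by (simp add: K_def)
  define F where "F x = \<phi> x * (indicator K x * (V (u' x) / \<epsilon>))" for x
  have Fm[measurable]: "F : borel_fun" unfolding F_def by measurable
  have "(LI y. \<phi> (J y) * (a y + c y)) = (LI y. 2 * F (J y))"
  proof (rule B_integral_cong[OF refl])
   fix y
   have "a y + c y = 2 * (indicator K (J y) * (V (u' (J y)) / \<epsilon>))"
    unfolding ac Wd using \<epsilon> by (auto simp: memK uu_def indicator_def power2_eq_square)
   then show "\<phi> (J y) * (a y + c y) = 2 * F (J y)" by (simp add: F_def)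
  qed
  also have "... = 2 * (LI x. F x)" using integral_J(1)[OF Fm] by simp
  also have "(LI x. F x) = (\<integral>x. F x \<partial>lebesgue)" by (rule integral_completion[symmetric]) simp
  \<comment> \<open>The cut-off inside \<open>V\<close> gives a function that is measurable on the
    whole space; \<open>u\<close> alone is controlled on \<open>K\<close> only.\<close>
  also have "... = (\<integral>x. \<phi> x * (indicator K x * (V (indicator K x *. u x) / \<epsilon>)) \<partial>lebesgue)"
  proof (rule integral_cong_AE)
   have [measurable]: "(%x. indicator K x *. u x) : borel_measurable lebesgue"
    using uK unfolding set_integrable_def by auto
   have [measurable]: "\<phi> : borel_measurable lebesgue" "(indicator K :: real^2 => real) : borel_measurable lebesgue"
    by (auto intro!: measurable_completion)
   show "F : borel_measurable lebesgue" using Fm by (auto intro!: measurable_completion)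
   show "(%x. \<phi> x * (indicator K x * (V (indicator K x *. u x) / \<epsilon>))) : borel_measurable lebesgue" by measurable
   have "AE x in lborel. F x = \<phi> x * (indicator K x * (V (indicator K x *. u x) / \<epsilon>))"
    using u'(4) by eventually_elim (auto simp: F_def indicator_def)
   then show "AE x in lebesgue. F x = \<phi> x * (indicator K x * (V (indicator K x *. u x) / \<epsilon>))" by (rule AE_completion)
  qed
  also have "... = (\<integral>x. indicator \<Omega> x *. (\<phi> x * (V (u x) / \<epsilon>)) \<partial>lebesgue)"
  proof (rule B_integral_cong[OF refl])
   fix x show "\<phi> x * (indicator K x * (V (indicator K x *. u x) / \<epsilon>)) = indicator \<Omega> x *. (\<phi> x * (V (u x) / \<epsilon>))"
    using off'[of x] K(2) by (auto simp: indicator_def)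
  qed
  also have "... = (\<integral>x. \<phi> x * (V (u x) / \<epsilon>) \<partial>lebesgue_on \<Omega>)"
   using \<Omega> by (intro integral_restrict_space[symmetric]) auto
  finally show "(LI y. \<phi> (J y) * (a y + c y)) = 2 * (\<integral>x. \<phi> x * (V (u x) / \<epsilon>) \<partial>lebesgue_on \<Omega>)" .
 qed
 then show ?thesis by blast
qed


section \<open>Radon measures on the domain, cut-offs and coverings\<close>

text \<open>Truncations to an exhaustion by compact sets are measurable, and at each point they are
  eventually constant.\<close>

lemma locally_integrable_on_measurable:
 fixes G :: "'a::euclidean_space => 'b::euclidean_space"
 assumes \<Omega>: "open \<Omega>" and G: "locally_integrable_on G \<Omega>"
 shows "G : borel_measurable (lebesgue_on \<Omega>)"
proof -
 obtain C where C: "!!n. compact (C n)" "!!n. C n <= \<Omega>" "!!K. compact K ==> K <= \<Omega> ==> \<exists>N. \<forall>n\<ge>N. K <= C (n :: nat)"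
  using open_Union_compact_subsets[OF \<Omega>] by metis
 show ?thesis
 proof (rule borel_measurable_LIMSEQ_metric)
  fix n
  have "G absolutely_integrable_on C n" using G C unfolding locally_integrable_on_def by blast
  then have "(%x. indicator (C n) x *. G x) : borel_measurable lebesgue" unfolding set_integrable_def by auto
  then show "(%x. indicator (C n) x *. G x) : borel_measurable (lebesgue_on \<Omega>)" by (rule measurable_restrict_space1)
 next
  fix x assume "x : space (lebesgue_on \<Omega>)"
  then have "{x} <= \<Omega>" by simp
  then obtain N where N: "\<forall>n\<ge>N. {x} <= C n" using C(3)[of "{x}"] by auto
  show "(%n. indicator (C n) x *. G x) ~~> G x"
   by (rule tendsto_eventually) (use N in \<open>auto simp: eventually_sequentially intro!: exI[of _ N]\<close>)
 qed
qed

lemma radon_sets: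
 assumes "radon_measure_on \<Omega> \<mu>"
 shows "A : sets borel ==> A <= \<Omega> ==> A : sets \<mu>" "space \<mu> = \<Omega>"
  "\<phi> : borel_fun ==> (\<phi> :: _ => real) : borel_measurable \<mu>"
proof -
 have s: "sets \<mu> = sets (restrict_space borel \<Omega>)" using assms unfolding radon_measure_on_def by blast
 show "A : sets \<mu>" if "A : sets borel" "A <= \<Omega>" using that unfolding s sets_restrict_space by blast
 show "space \<mu> = \<Omega>" using sets_eq_imp_space_eq[OF s] by (simp add: space_restrict_space)
 show "\<phi> : borel_measurable \<mu>" if "\<phi> : borel_fun"
  unfolding measurable_cong_sets[OF s refl] by (rule measurable_restrict_space1[OF that])
qed

lemma radon_test_integrable:
 fixes \<phi> :: "'a::euclidean_space => real"
 assumes \<mu>: "radon_measure_on \<Omega> \<mu>" and K: "compact K" "K <= \<Omega>"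
  and \<phi>: "\<phi> : borel_fun" "!!x. 0 <= \<phi> x & \<phi> x <= 1" "!!x. x ~: K ==> \<phi> x = 0"
 shows "integrable \<mu> (indicat_real K)" "integrable \<mu> \<phi>"
proof -
 have "K : sets \<mu>" by (rule radon_sets(1)[OF \<mu> _ K(2)]) (simp add: borel_compact K)
 moreover have "emeasure \<mu> K < \<infinity>" using \<mu> K unfolding radon_measure_on_def by blast
 ultimately show i: "integrable \<mu> (indicat_real K)" by (rule integrable_real_indicator)
 show "integrable \<mu> \<phi>"
 proof (rule B_integrable_bound[OF i radon_sets(3)[OF \<mu> \<phi>(1)]], rule AE_I2)
  fix x show "norm (\<phi> x) <= norm (indicat_real K x)" using \<phi>(2)[of x] \<phi>(3)[of x] by (cases "x : K") auto
 qed
qed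

lemma densities_converge_testD:
 fixes \<phi> :: "'a::euclidean_space => real"
 assumes c: "densities_converge_weakly \<Omega> f \<mu>" and \<Omega>: "open \<Omega>"
  and f: "!!n. f n : borel_measurable (lebesgue_on \<Omega>)" "!!n x. 0 <= f n x"
  and \<phi>: "contU \<phi>" and K: "compact K" "K <= \<Omega>" "!!x. x ~: K ==> \<phi> x = 0"
 shows "(%n. \<integral>x. \<phi> x * f n x \<partial>lebesgue_on \<Omega>) ~~> (\<integral>x. \<phi> x \<partial>\<mu>)"
proof -
 have sub: "closure {x. \<phi> x ~= 0} <= K" by (rule closure_minimal) (use K compact_imp_closed in auto)
 have "compact (closure {x. \<phi> x ~= 0})" using sub K(1) by (meson bounded_subset closed_closure compact_eq_bounded_closed)
 then have "(%n. \<integral>x. \<phi> x \<partial>density (lebesgue_on \<Omega>) (%x. ennreal (f n x))) ~~> (\<integral>x. \<phi> x \<partial>\<mu>)"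
  using c \<phi> sub K(2) unfolding densities_converge_weakly_def by blast
 moreover have "(\<integral>x. \<phi> x \<partial>density (lebesgue_on \<Omega>) (%x. ennreal (f n x))) = (\<integral>x. \<phi> x * f n x \<partial>lebesgue_on \<Omega>)" for n
 proof -
  have "\<phi> : borel_measurable (lebesgue_on \<Omega>)"
   using \<phi> by (intro measurable_restrict_space1 measurable_completion) (simp add: borel_measurable_continuous_onI)
  from integral_density[OF this f(1)[of n]] f(2) show ?thesis by (simp add: mult.commute)
 qed
 ultimately show ?thesis by simp
qed

lemma compact_cutoff:
 fixes L :: "'a::euclidean_space set"
 assumes L: "compact L" and T: "open T" "L <= T"
 obtains \<phi> :: "'a => real" and K where "contU \<phi>" "!!x. 0 <= \<phi> x & \<phi> x <= 1" "!!x. x : L ==> \<phi> x = 1"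
  "compact K" "K <= T" "!!x. x ~: K ==> \<phi> x = 0"
proof (cases "L = {}")
 case True
 then show thesis by (intro that[of "%_. 0" "{}"]) auto
next
 case False
 obtain e where e: "0 < e" "{x. infdist x L <= e} <= T" by (rule compact_in_open_separated[OF False L T])
 show thesis
 proof (rule that)
  show "contU (%x. max 0 (1 - infdist x L / e))" by (intro continuous_intros) (use e in auto)
  show "0 <= max 0 (1 - infdist x L / e) & max 0 (1 - infdist x L / e) <= 1" for x using infdist_nonneg[of x L] e by simp
  show "max 0 (1 - infdist x L / e) = 1" if "x : L" for x using that by simp
  show "compact {x. infdist x L <= e}" by (rule compact_infdist_le[OF False L e(1)])
  show "{x. infdist x L <= e} <= T" by (rule e(2))
  show "max 0 (1 - infdist x L / e) = 0" if "x ~: {x. infdist x L <= e}" for x using that e(1) by (simp add: pos_le_divide_eq)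
 qed
qed

lemma hausdorff1_null_cover:
 assumes "hausdorff1 B = 0" "0 < \<delta>" "0 < (\<tau> :: ennreal)"
 obtains C :: "nat => 'a::metric_space set" where "B <= (\<Union>i. C i)" "!!i. bounded (C i)" "!!i. diameter (C i) <= \<delta>"
  "(\<Sum>i. ennreal (diameter (C i))) < \<tau>"
proof -
 have "hausdorff1_delta \<delta> B <= hausdorff1 B" unfolding hausdorff1_def using assms(2) by (intro SUP_upper) simp
 then have "hausdorff1_delta \<delta> B < \<tau>" using assms by simp
 then obtain C where "C : {C. B <= (\<Union>i. C i) & (\<forall>i. bounded (C i) & diameter (C i) <= \<delta>)}" "(\<Sum>i. ennreal (diameter (C i))) < \<tau>"
  unfolding hausdorff1_delta_def INF_less_iff by blast
 then show thesis using that by blast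
qed

text \<open>On the unit circle all \<open>rcut (Suc j)\<close> vanish; this is why the limit
  measures open disks.\<close>

lemma rcut_limit: "(%j. rcut (Suc j) z) ~~> indicator (ball 0 1) z"
proof (cases "norm z < 1")
 case True
 then have "z .* z < 1" by (simp add: dot_square_norm power_less_one_iff abs_square_less_1)
 then have "(%j. (z .* z) ^ Suc j) ~~> 0" by (intro LIMSEQ_Suc LIMSEQ_realpow_zero) auto
 then have "(%j. (max 0 (1 - (z .* z) ^ Suc j))\<^sup>2) ~~> (max 0 (1 - 0))\<^sup>2" by (intro tendsto_intros)
 then show ?thesis using True by (simp add: rcut_def)
next
 case False
 then have "rcut (Suc j) z = 0" for j by (simp add: rcut_outside)
 then show ?thesis using False by simp
qed

section \<open>Limit measures of Allen-Cahn solutions\<close>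

locale allen_cahn_limit =
 fixes V :: "real^'k => real" and \<Omega> :: "(real^2) set" and M \<eta> :: real and \<epsilon> :: "nat => real"
  and u :: "nat => real^2 => real^'k" and \<nu> \<zeta> :: "(real^2) measure" and S :: "(real^2) set"
 assumes \<Omega>: "open \<Omega>" "bounded \<Omega>" and V: "admissible_potential V" and M: "0 < M"
  and eps: "!!n. 0 < \<epsilon> n & \<epsilon> n <= 1" and eps_lim: "\<epsilon> ~~> 0"
  and sol: "!!n. AC_solution V \<Omega> (\<epsilon> n) (u n)" and energy_le: "!!n. energy V \<Omega> (\<epsilon> n) (u n) <= ennreal M"
  and conv_\<nu>: "densities_converge_weakly \<Omega> (%n. energy_density V \<Omega> (\<epsilon> n) (u n)) \<nu>"
  and conv_\<zeta>: "densities_converge_weakly \<Omega> (%n x. V (u n x) / \<epsilon> n) \<zeta>"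
  and \<eta>: "0 < \<eta>" and clearing: "clearing_out V \<Omega> \<eta>"
  and S: "S = concentration_set \<Omega> \<nu> \<eta>" and S_closed: "closedin (top_of_set \<Omega>) S" and S_finite: "hausdorff1 S < \<infinity>"
begin

lemma radon: "radon_measure_on \<Omega> \<nu>" "radon_measure_on \<Omega> \<zeta>"
 using conv_\<nu> conv_\<zeta> unfolding densities_converge_weakly_def by blast+

definition e where "e n x = energy_density V \<Omega> (\<epsilon> n) (u n) x"

definition p where "p n x = V (u n x) / \<epsilon> n"

lemma p_e_bounds: "0 <= p n x" "p n x <= e n x" "0 <= e n x"
proof -
 show "0 <= p n x" using admissible_nonneg[OF V] eps[of n] by (simp add: p_def)
 moreover show "p n x <= e n x" using eps[of n] by (simp add: p_def e_def energy_density_def)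
 ultimately show "0 <= e n x" by linarith
qed

lemma e_measurable: "e n : borel_measurable (lebesgue_on \<Omega>)" and p_measurable: "p n : borel_measurable (lebesgue_on \<Omega>)"
proof -
 have H: "sobolev_H1 \<Omega> (u n)" using sol[of n] unfolding AC_solution_def by blast
 have [measurable]: "u n : borel_measurable (lebesgue_on \<Omega>)"
  using H unfolding sobolev_H1_def square_integrable_on_def by blast
 have "\<exists>G. is_weak_gradient \<Omega> (u n) G" using H unfolding sobolev_H1_def by blast
 then have "is_weak_gradient \<Omega> (u n) (weak_gradient \<Omega> (u n))" unfolding weak_gradient_def by (rule someI_ex)
 then have [measurable]: "weak_gradient \<Omega> (u n) : borel_measurable (lebesgue_on \<Omega>)"
  using locally_integrable_on_measurable[OF \<Omega>(1)] unfolding is_weak_gradient_def by blast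
 have "contU V"
  using C_on_1_grad(1)[OF admissible_C1[OF V]] by (intro continuous_at_imp_continuous_on ballI) (rule has_derivative_continuous)
 then have [measurable]: "V : borel_fun" by (rule borel_measurable_continuous_onI)
 show "p n : borel_measurable (lebesgue_on \<Omega>)" unfolding p_def by measurable
 show "e n : borel_measurable (lebesgue_on \<Omega>)" unfolding e_def energy_density_def by measurable
qed

lemma energy_e: "(\<integral>\<^sup>+x. ennreal (e n x) \<partial>lebesgue_on \<Omega>) <= ennreal M"
 using energy_le[of n] unfolding energy_def e_def .

lemma e_integrable: "integrable (lebesgue_on \<Omega>) (e n)" and p_integrable: "integrable (lebesgue_on \<Omega>) (p n)"
proof -
 have "(\<integral>\<^sup>+x. ennreal (e n x) \<partial>lebesgue_on \<Omega>) < \<infinity>" using energy_e[of n] by (rule order_le_less_trans) simp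
 then show i: "integrable (lebesgue_on \<Omega>) (e n)" using p_e_bounds(3) e_measurable by (intro integrableI_bounded) auto
 show "integrable (lebesgue_on \<Omega>) (p n)"
  by (rule B_integrable_bound[OF i p_measurable]) (use p_e_bounds in auto)
qed

lemma cutoff_integrable:
 assumes "\<phi> : borel_fun" "!!x. 0 <= \<phi> x & \<phi> x <= (1::real)"
 shows "integrable (lebesgue_on \<Omega>) (%x. \<phi> x * e n x)" "integrable (lebesgue_on \<Omega>) (%x. \<phi> x * p n x)"
  "(\<integral>x. \<phi> x * p n x \<partial>lebesgue_on \<Omega>) <= (\<integral>x. \<phi> x * e n x \<partial>lebesgue_on \<Omega>)" "(\<integral>x. \<phi> x * e n x \<partial>lebesgue_on \<Omega>) <= M"
proof -
 have [measurable]: "\<phi> : borel_measurable (lebesgue_on \<Omega>)"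
  using assms(1) by (intro measurable_restrict_space1 measurable_completion) simp
 note [measurable] = e_measurable p_measurable
 have le: "\<phi> x * h <= h" if "0 <= h" for x h using assms(2)[of x] that mult_right_mono[of "\<phi> x" 1 h] by simp
 show ie: "integrable (lebesgue_on \<Omega>) (%x. \<phi> x * e n x)"
  by (rule B_integrable_bound[OF e_integrable[of n]]) (use le p_e_bounds assms(2) in \<open>auto simp: abs_mult\<close>)
 show ip: "integrable (lebesgue_on \<Omega>) (%x. \<phi> x * p n x)"
  by (rule B_integrable_bound[OF p_integrable[of n]]) (use le p_e_bounds assms(2) in \<open>auto simp: abs_mult\<close>)
 show "(\<integral>x. \<phi> x * p n x \<partial>lebesgue_on \<Omega>) <= (\<integral>x. \<phi> x * e n x \<partial>lebesgue_on \<Omega>)"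
  by (rule integral_mono[OF ip ie]) (use p_e_bounds assms(2) in \<open>auto intro: mult_left_mono\<close>)
 have "(\<integral>x. \<phi> x * e n x \<partial>lebesgue_on \<Omega>) <= (\<integral>x. e n x \<partial>lebesgue_on \<Omega>)"
  by (rule integral_mono[OF ie e_integrable]) (use le p_e_bounds in auto)
 also have "... <= M"
 proof -
  have "ennreal (\<integral>x. e n x \<partial>lebesgue_on \<Omega>) <= ennreal M"
   using energy_e[of n] nn_integral_eq_integral[OF e_integrable[of n]] p_e_bounds(3) by simp
  then show ?thesis using M by (simp add: ennreal_le_iff)
 qed
 finally show "(\<integral>x. \<phi> x * e n x \<partial>lebesgue_on \<Omega>) <= M" .
qed

lemma test_limits:
 assumes \<phi>: "contU \<phi>" and K: "compact K" "K <= \<Omega>" "!!x. x ~: K ==> \<phi> x = (0::real)"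
 shows "(%n. \<integral>x. \<phi> x * e n x \<partial>lebesgue_on \<Omega>) ~~> (\<integral>x. \<phi> x \<partial>\<nu>)"
  "(%n. \<integral>x. \<phi> x * p n x \<partial>lebesgue_on \<Omega>) ~~> (\<integral>x. \<phi> x \<partial>\<zeta>)"
proof -
 show "(%n. \<integral>x. \<phi> x * e n x \<partial>lebesgue_on \<Omega>) ~~> (\<integral>x. \<phi> x \<partial>\<nu>)"
  by (rule densities_converge_testD[where f=e, OF _ \<Omega>(1) e_measurable p_e_bounds(3) \<phi> K]) (use conv_\<nu> in \<open>simp add: e_def[abs_def]\<close>)
 show "(%n. \<integral>x. \<phi> x * p n x \<partial>lebesgue_on \<Omega>) ~~> (\<integral>x. \<phi> x \<partial>\<zeta>)"
  by (rule densities_converge_testD[where f=p, OF _ \<Omega>(1) p_measurable p_e_bounds(1) \<phi> K]) (use conv_\<zeta> in \<open>simp add: p_def[abs_def]\<close>)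
qed

lemma S_compl_open: "open (\<Omega> - S)"
 using S_closed \<Omega>(1) by (metis openin_diff openin_open_eq openin_subtopology_self)

text \<open>At a point off \<open>S\<close> the lower density is below \<open>\<eta>\<close>, so
  some small radius satisfies the hypothesis of clearing out, and the disk of half that radius has
  no mass. Finitely many such disks cover \<open>L\<close>.\<close>

lemma \<nu>_null_off_S:
 assumes L: "compact L" "L <= \<Omega> - S"
 shows "emeasure \<nu> L = 0"
proof -
 have "\<exists>r>0. ball x r <= \<Omega> & emeasure \<nu> (cball x (r / 2) \<inter> \<Omega>) = 0" if x: "x : L" for x
 proof -
  have x\<Omega>: "x : \<Omega>" "x ~: S" using x L by auto
  obtain r0 where r0: "0 < r0" "ball x r0 <= \<Omega>" using \<Omega>(1) x\<Omega> openE by blast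
  have "\<exists>r. 0 < r & r < r0 & \<not> ennreal \<eta> <= emeasure \<nu> (cball x r \<inter> \<Omega>) / ennreal r"
  proof (rule ccontr)
   assume "\<not> ?thesis"
   then have "\<forall>\<^sub>F r in at_right 0. ennreal \<eta> <= emeasure \<nu> (cball x r \<inter> \<Omega>) / ennreal r"
    using eventually_at_right_real[OF r0(1)] by (auto elim!: eventually_mono)
   then have "ennreal \<eta> <= Liminf (at_right 0) (%r. emeasure \<nu> (cball x r \<inter> \<Omega>) / ennreal r)" by (rule Liminf_bounded)
   then show False using x\<Omega> unfolding S concentration_set_def by blast
  qed
  then obtain r where r: "0 < r" "r < r0" "\<not> ennreal \<eta> <= emeasure \<nu> (cball x r \<inter> \<Omega>) / ennreal r" by blast
  have bx: "ball x r <= \<Omega>" using r(2) r0(2) by (meson less_imp_le order_trans subset_ball)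
  have lt: "emeasure \<nu> (cball x r \<inter> \<Omega>) < ennreal (\<eta> * r)"
  proof (rule ccontr)
   assume "\<not> ?thesis"
   then have "ennreal (\<eta> * r) / ennreal r <= emeasure \<nu> (cball x r \<inter> \<Omega>) / ennreal r" by (intro divide_right_mono_ennreal) simp
   moreover have "ennreal (\<eta> * r) / ennreal r = ennreal \<eta>" using r(1) \<eta> by (simp add: divide_ennreal)
   ultimately show False using r(3) by simp
  qed
  have "(SUP n. energy V \<Omega> (\<epsilon> n) (u n)) <= ennreal M" by (rule SUP_least) (rule energy_le)
  then have "(SUP n. energy V \<Omega> (\<epsilon> n) (u n)) < \<infinity>" by (rule order_le_less_trans) simp
  then have "emeasure \<nu> (cball x (r / 2) \<inter> \<Omega>) = 0"
   using clearing eps eps_lim sol conv_\<nu> r(1) bx lt unfolding clearing_out_def by blast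
  then show ?thesis using r(1) bx by blast
 qed
 then obtain r where r: "!!x. x : L ==> 0 < r x & ball x (r x) <= \<Omega> & emeasure \<nu> (cball x (r x / 2) \<inter> \<Omega>) = 0" by metis
 have "L <= (\<Union>x\<in>L. ball x (r x / 2))" using r by fastforce
 then obtain F where F: "F <= L" "finite F" "L <= (\<Union>x\<in>F. ball x (r x / 2))"
  by (rule compactE_image[OF L(1), rotated]) auto
 have N: "(\<Union>x\<in>F. cball x (r x / 2) \<inter> \<Omega>) : null_sets \<nu>"
 proof (rule null_sets_UN')
  show "countable F" using F(2) by (rule countable_finite)
  fix x assume "x : F"
  then have "emeasure \<nu> (cball x (r x / 2) \<inter> \<Omega>) = 0" using r F(1) by blast
  moreover have "cball x (r x / 2) \<inter> \<Omega> : sets \<nu>" by (rule radon_sets(1)[OF radon(1)]) (use \<Omega> in auto)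
  ultimately show "cball x (r x / 2) \<inter> \<Omega> : null_sets \<nu>" by auto
 qed
 have "L <= (\<Union>x\<in>F. cball x (r x / 2) \<inter> \<Omega>)"
 proof
  fix y assume y: "y : L"
  then obtain x where "x : F" "y : ball x (r x / 2)" using F(3) by blast
  then show "y : (\<Union>x\<in>F. cball x (r x / 2) \<inter> \<Omega>)" using y L(2) ball_subset_cball[of x "r x / 2"] by blast
 qed
 moreover have "L : sets \<nu>" by (rule radon_sets(1)[OF radon(1)]) (use L borel_compact in auto)
 ultimately show ?thesis using null_sets_subset[OF N] by blast
qed

text \<open>Weak convergence does not see indicators, so \<open>L\<close> is first enlarged to a
  continuous cut-off with compact support off \<open>S\<close>, where \<open>\<nu>\<close> vanishes
  as well. The potential part is dominated by the energy.\<close>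

lemma cutoff_off_S:
 assumes L: "compact L" "L <= \<Omega> - S"
 shows "(%n. \<integral>\<^sup>+x. ennreal (e n x) * indicator L x \<partial>lebesgue_on \<Omega>) ~~> 0" "emeasure \<zeta> L = 0"
proof -
 obtain \<phi> :: "real^2 => real" and K where \<phi>: "contU \<phi>" "!!x. 0 <= \<phi> x & \<phi> x <= 1" "!!x. x : L ==> \<phi> x = 1"
  and K: "compact K" "K <= \<Omega> - S" "!!x. x ~: K ==> \<phi> x = 0"
  by (rule compact_cutoff[OF L(1) S_compl_open L(2)]) blast
 have K\<Omega>: "K <= \<Omega>" using K(2) by blast
 have \<phi>m: "\<phi> : borel_fun" using \<phi>(1) by (rule borel_measurable_continuous_onI)
 have "K : null_sets \<nu>" using \<nu>_null_off_S[OF K(1,2)] radon_sets(1)[OF radon(1) borel_compact[OF K(1)] K\<Omega>] by blast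
 then have "AE x in \<nu>. \<phi> x = 0" by (rule AE_not_in[THEN eventually_mono]) (rule K(3))
 then have "(\<integral>x. \<phi> x \<partial>\<nu>) = 0" by (rule integral_eq_zero_AE)
 then have l0: "(%n. \<integral>x. \<phi> x * e n x \<partial>lebesgue_on \<Omega>) ~~> 0" using test_limits(1)[OF \<phi>(1) K(1) K\<Omega> K(3)] by simp
 note ci = cutoff_integrable[OF \<phi>m \<phi>(2)]
 show "(%n. \<integral>\<^sup>+x. ennreal (e n x) * indicator L x \<partial>lebesgue_on \<Omega>) ~~> 0"
 proof (rule tendsto_sandwich[OF _ _ tendsto_const])
  show "(%n. ennreal (\<integral>x. \<phi> x * e n x \<partial>lebesgue_on \<Omega>)) ~~> 0" using tendsto_ennrealI[OF l0] by simp
  show "\<forall>\<^sub>F n in sequentially. (\<integral>\<^sup>+x. ennreal (e n x) * indicator L x \<partial>lebesgue_on \<Omega>) <= ennreal (\<integral>x. \<phi> x * e n x \<partial>lebesgue_on \<Omega>)"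
  proof (intro always_eventually allI)
   fix n
   have "(\<integral>\<^sup>+x. ennreal (e n x) * indicator L x \<partial>lebesgue_on \<Omega>) <= (\<integral>\<^sup>+x. ennreal (\<phi> x * e n x) \<partial>lebesgue_on \<Omega>)"
   proof (rule nn_integral_mono)
    fix x show "ennreal (e n x) * indicator L x <= ennreal (\<phi> x * e n x)" by (cases "x : L") (auto simp: \<phi>(3))
   qed
   also have "... = ennreal (\<integral>x. \<phi> x * e n x \<partial>lebesgue_on \<Omega>)"
    by (rule nn_integral_eq_integral[OF ci(1)]) (use \<phi>(2) p_e_bounds in auto)
   finally show "(\<integral>\<^sup>+x. ennreal (e n x) * indicator L x \<partial>lebesgue_on \<Omega>) <= ennreal (\<integral>x. \<phi> x * e n x \<partial>lebesgue_on \<Omega>)" .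
  qed
 qed simp
 have "(\<integral>x. \<phi> x \<partial>\<zeta>) <= 0"
  by (rule tendsto_le[OF _ l0 test_limits(2)[OF \<phi>(1) K(1) K\<Omega> K(3)]]) (use ci(3) in auto)
 moreover have "emeasure \<zeta> L <= ennreal (\<integral>x. \<phi> x \<partial>\<zeta>)"
 proof -
  have "emeasure \<zeta> L = (\<integral>\<^sup>+x. indicator L x \<partial>\<zeta>)"
   by (rule nn_integral_indicator[symmetric], rule radon_sets(1)[OF radon(2)]) (use L borel_compact in auto)
  also have "... <= (\<integral>\<^sup>+x. ennreal (\<phi> x) \<partial>\<zeta>)"
   by (rule nn_integral_mono) (auto simp: \<phi>(3) indicator_def)
  also have "... = ennreal (\<integral>x. \<phi> x \<partial>\<zeta>)"
   by (rule nn_integral_eq_integral[OF radon_test_integrable(2)[OF radon(2) K(1) K\<Omega> \<phi>m \<phi>(2) K(3)]]) (use \<phi>(2) in auto)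
  finally show ?thesis .
 qed
 ultimately show "emeasure \<zeta> L = 0" by (simp add: ennreal_neg)
qed

definition \<phi> where "\<phi> x0 j s x = rcut j ((1 / s) *. (Ji x - Ji x0))"

lemma \<phi>_props:
 assumes s: "0 < s"
 shows "contU (\<phi> x0 j s)" "\<phi> x0 j s : borel_fun" "0 <= \<phi> x0 j s x & \<phi> x0 j s x <= 1"
  "x ~: ball x0 s ==> \<phi> x0 j s x = 0" "(%j. \<phi> x0 (Suc j) s x) ~~> indicator (ball x0 s) x"
proof -
 show c: "contU (\<phi> x0 j s)"
  unfolding \<phi>_def by (intro continuous_on_compose2[OF rcut_continuous[of UNIV]] continuous_intros Ji_continuous) auto
 then show "\<phi> x0 j s : borel_fun" by (rule borel_measurable_continuous_onI)
 show "0 <= \<phi> x0 j s x & \<phi> x0 j s x <= 1" by (simp add: \<phi>_def rcut_nonneg rcut_le_1)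
 have n: "norm (Ji x - Ji x0) = dist x0 x" using Ji_dist[of x x0] by (simp add: dist_norm norm_minus_commute)
 show "\<phi> x0 j s x = 0" if "x ~: ball x0 s"
  unfolding \<phi>_def using that s n by (intro rcut_outside one_le_norm_scaled) auto
 have "norm ((1 / s) *. (Ji x - Ji x0)) < 1 \<longleftrightarrow> x : ball x0 s" using s n by (simp add: pos_divide_less_eq)
 then have "indicat_real (ball 0 1) ((1 / s) *. (Ji x - Ji x0)) = indicator (ball x0 s) x" by (simp add: indicator_def)
 then show "(%j. \<phi> x0 (Suc j) s x) ~~> indicator (ball x0 s) x"
  using rcut_limit[of "(1 / s) *. (Ji x - Ji x0)"] unfolding \<phi>_def by simp
qed

text \<open>Two limits in a fixed order: weak convergence in \<open>n\<close> is applied to the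
  continuous cut-off for each \<open>j\<close>, and only then does \<open>j\<close> tend to
  infinity. The bound \<open>M\<close> is the energy bound, passed on by the cut-offs.\<close>

lemma \<phi>_limit:
 assumes s: "0 < s" "cball x0 s <= \<Omega>"
 shows "(%j. \<integral>x. \<phi> x0 (Suc j) s x \<partial>\<zeta>) ~~> measure \<zeta> (ball x0 s)"
  "emeasure \<zeta> (ball x0 s) = ennreal (measure \<zeta> (ball x0 s))" "measure \<zeta> (ball x0 s) <= M"
proof -
 have off: "x ~: cball x0 s ==> \<phi> x0 j s x = 0" for j x using \<phi>_props(4)[OF s(1), of x x0 j] ball_subset_cball by blast
 note P = \<phi>_props[OF s(1), of x0]
 have bs: "ball x0 s : sets \<zeta>" by (rule radon_sets(1)[OF radon(2)]) (use s ball_subset_cball in auto)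
 have "emeasure \<zeta> (ball x0 s) <= emeasure \<zeta> (cball x0 s)"
  by (rule emeasure_mono[OF ball_subset_cball], rule radon_sets(1)[OF radon(2)]) (use s in auto)
 also have "... < \<infinity>" using radon(2) s unfolding radon_measure_on_def by simp
 finally show "emeasure \<zeta> (ball x0 s) = ennreal (measure \<zeta> (ball x0 s))" by (simp add: emeasure_eq_ennreal_measure)
 note ti = radon_test_integrable[OF radon(2) compact_cball s(2) P(2,3) off]
 have "(%j. \<integral>x. \<phi> x0 (Suc j) s x \<partial>\<zeta>) ~~> (\<integral>x. indicator (ball x0 s) x \<partial>\<zeta>)"
 proof (rule integral_dominated_convergence[OF _ _ ti(1)])
  show "indicat_real (ball x0 s) : borel_measurable \<zeta>" using bs by simp
  show "\<phi> x0 (Suc j) s : borel_measurable \<zeta>" for j by (rule radon_sets(3)[OF radon(2) P(2)])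
  show "AE x in \<zeta>. (%j. \<phi> x0 (Suc j) s x) ~~> indicator (ball x0 s) x" by (rule AE_I2) (rule P(5))
  show "AE x in \<zeta>. norm (\<phi> x0 (Suc j) s x) <= indicator (cball x0 s) x" for j
  proof (rule AE_I2)
   fix x show "norm (\<phi> x0 (Suc j) s x) <= indicator (cball x0 s) x"
    using P(3)[of "Suc j" x] off[of x "Suc j"] by (cases "x : cball x0 s") (auto simp del: mem_cball)
  qed
 qed
 moreover have "ball x0 s \<inter> \<Omega> = ball x0 s" using s(2) ball_subset_cball by blast
 ultimately show l: "(%j. \<integral>x. \<phi> x0 (Suc j) s x \<partial>\<zeta>) ~~> measure \<zeta> (ball x0 s)"
  using bs by (simp add: radon_sets(2)[OF radon(2)])
 have "(\<integral>x. \<phi> x0 (Suc j) s x \<partial>\<zeta>) <= M" for j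
 proof (rule tendsto_upperbound[OF test_limits(2)[OF P(1) compact_cball s(2) off]])
  show "\<forall>\<^sub>F n in sequentially. (\<integral>x. \<phi> x0 (Suc j) s x * p n x \<partial>lebesgue_on \<Omega>) <= M"
   using order_trans[OF cutoff_integrable(3,4)[OF P(2,3)]] by (intro always_eventually allI)
 qed auto
 then show "measure \<zeta> (ball x0 s) <= M" by (intro LIMSEQ_le_const2[OF l]) auto
qed

text \<open>The stress fields on a slightly larger disk are inserted into
  \<open>divergence_free_limit_monotone\<close>. Their traces converge to \<open>2 * \<zeta>\<close>
  against the cut-offs, whence the factor 2.\<close>

lemma cutoff_ratio_mono:
 assumes s: "0 < s" "s <= t" "t < \<rho>" and \<rho>: "ball x0 \<rho> <= \<Omega>" and j: "0 < j"
 shows "(2 * (\<integral>x. \<phi> x0 j s x \<partial>\<zeta>)) / s <= (2 * (\<integral>x. \<phi> x0 j t x \<partial>\<zeta>)) / t"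
proof -
 \<comment> \<open>Thirds of the gap between \<open>t\<close> and \<open>\<rho>\<close>: the closed
   disk of radius \<open>R\<close> stays in the domain, and \<open>R' < R\<close> leaves room for
   mollification and for the affine approximation.\<close>
 define R' R where "R' = t + (\<rho> - t) / 3" and "R = t + 2 * (\<rho> - t) / 3"
 have "3 * R' = 2 * t + \<rho>" "3 * R = t + 2 * \<rho>" by (auto simp: R'_def R_def field_simps)
 then have R: "0 < R'" "t < R'" "R' < R" "0 < R" "R < \<rho>" using s by linarith+
 have cR: "cball x0 R <= \<Omega>" using R(5) \<rho> by (force simp: subset_eq)
 have "\<exists>a b c. stress_field V \<Omega> (\<epsilon> n) (u n) x0 R a b c" for n
  using stress_field_exists[OF V \<Omega>(1) _ sol[of n] energy_le[of n] R(4) cR] eps[of n] by blast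
 then obtain a b c where F: "!!n. stress_field V \<Omega> (\<epsilon> n) (u n) x0 R (a n) (b n) (c n)" by metis
 note F' = F[unfolded stress_field_def]
 define T where "T = J -` S"
 have hm: "hmass D (a n) (b n) (c n) <= 3 * (\<integral>\<^sup>+x. ennreal (e n x) * indicator (J ` D) x \<partial>lebesgue_on \<Omega>)" if "D : sets borel" for D n
  using F'[of n] that unfolding e_def by blast
 show ?thesis
 proof (rule divergence_free_limit_monotone[where a=a and b=b and c=c and ?c0.0="Ji x0" and R=R and M="3 * M" and S=T and R'=R' and j=j])
  show "integ (a n)" "integ (b n)" "integ (c n)" for n using F'[of n] by blast+
  show "conv (bmp1 d) (b n) x = conv (bmp2 d) (a n) x" "conv (bmp1 d) (c n) x = conv (bmp2 d) (b n) x"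
   if "0 < d" "cball x d <= ball (Ji x0) R" for n d x using F'[of n] that by blast+
  show "0 <= a n x + c n x" for n x using F'[of n] by blast
  show "0 <= 3 * M" using M by simp
  show "hmass (ball (Ji x0) R) (a n) (b n) (c n) <= ennreal (3 * M)" for n
  proof -
   have "hmass (ball (Ji x0) R) (a n) (b n) (c n) <= 3 * (\<integral>\<^sup>+x. ennreal (e n x) * indicator (J ` ball (Ji x0) R) x \<partial>lebesgue_on \<Omega>)"
    by (rule hm) simp
   also have "... <= 3 * (\<integral>\<^sup>+x. ennreal (e n x) \<partial>lebesgue_on \<Omega>)"
    by (intro mult_left_mono nn_integral_mono) (auto simp: indicator_def)
   also have "... <= 3 * ennreal M" by (intro mult_left_mono energy_e) simp
   also have "... = ennreal (3 * M)" using M by (simp add: ennreal_mult)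
   finally show ?thesis .
  qed
  have JT: "J z : \<Omega> - S \<longleftrightarrow> z ~: T" if "z : ball (Ji x0) R" for z
  proof -
   have "J z : cball x0 R" unfolding J_mem_cball using that by simp
   then show ?thesis using cR by (auto simp: T_def)
  qed
  have "ball (Ji x0) R - T = ball (Ji x0) R \<inter> J -` (\<Omega> - S)" using JT by blast
  moreover have "open (J -` (\<Omega> - S))" by (rule open_vimage[OF S_compl_open J_continuous])
  ultimately show "open (ball (Ji x0) R - T)" by (simp add: open_Int)
  show "(%n. hmass K (a n) (b n) (c n)) ~~> 0" if K: "compact K" "K <= ball (Ji x0) R - T" for K
  proof (rule tendsto_sandwich[OF _ _ tendsto_const])
   have "J z : \<Omega> - S" if "z : K" for z using that K(2) JT[of z] by blast
   then have JK: "compact (J ` K)" "J ` K <= \<Omega> - S" using compact_continuous_image[OF J_continuous K(1)] by blast+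
   have "(%n. 3 * (\<integral>\<^sup>+x. ennreal (e n x) * indicator (J ` K) x \<partial>lebesgue_on \<Omega>)) ~~> 3 * 0"
    by (rule ennreal_tendsto_cmult[OF _ cutoff_off_S(1)[OF JK]]) simp
   then show "(%n. 3 * (\<integral>\<^sup>+x. ennreal (e n x) * indicator (J ` K) x \<partial>lebesgue_on \<Omega>)) ~~> 0" by simp
   show "\<forall>\<^sub>F n in sequentially. hmass K (a n) (b n) (c n) <= 3 * (\<integral>\<^sup>+x. ennreal (e n x) * indicator (J ` K) x \<partial>lebesgue_on \<Omega>)"
    by (intro always_eventually allI hm borel_compact K(1))
  qed simp
  show "AE y in lborel. finite {t. pt m y t : ball (Ji x0) R \<inter> T}" for m
  proof -
   \<comment> \<open>The intercept of the line of slope \<open>m\<close> through \<open>x\<close>.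
     It is Lipschitz, so almost every such line meets \<open>S\<close> in finitely many
     points.\<close>
   define f where "f x = x $ 2 - m * x $ 1" for x :: "real^2"
   have "\<bar>f x - f y\<bar> <= (1 + \<bar>m\<bar>) * dist x y" for x y
   proof -
    have "\<bar>x $ 2 - y $ 2\<bar> <= dist x y" "\<bar>x $ 1 - y $ 1\<bar> <= dist x y"
     using component_le_norm_cart[of "x - y" 2] component_le_norm_cart[of "x - y" 1] by (auto simp: dist_norm)
    moreover from this(2) have "\<bar>m\<bar> * \<bar>x $ 1 - y $ 1\<bar> <= \<bar>m\<bar> * dist x y" by (rule mult_left_mono) simp
    moreover have "f x - f y = (x $ 2 - y $ 2) - m * (x $ 1 - y $ 1)" by (simp add: f_def algebra_simps)
    then have "\<bar>f x - f y\<bar> <= \<bar>x $ 2 - y $ 2\<bar> + \<bar>m\<bar> * \<bar>x $ 1 - y $ 1\<bar>"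
     using abs_triangle_ineq4[of "x $ 2 - y $ 2" "m * (x $ 1 - y $ 1)"] by (simp only: abs_mult)
    ultimately show ?thesis by (simp add: algebra_simps)
   qed
   then have "AE y in lborel. finite (S \<inter> f -` {y})" by (intro finite_fibres_of_lipschitz[OF S_finite, where L="1 + \<bar>m\<bar>"]) auto
   then show ?thesis
   proof eventually_elim
    fix y assume fin: "finite (S \<inter> f -` {y})"
    have "finite ((%t. J (pt m y t)) -` (S \<inter> f -` {y}))"
    proof (rule finite_vimageI[OF fin])
     show "inj (%t. J (pt m y t))"
     proof (rule injI)
      fix t t' assume "J (pt m y t) = J (pt m y t')"
      then have "J (pt m y t) $ 1 = J (pt m y t') $ 1" by simp
      then show "t = t'" by (simp add: pt_def)
     qed
    qed
    moreover have "{t. pt m y t : ball (Ji x0) R \<inter> T} <= (%t. J (pt m y t)) -` (S \<inter> f -` {y})"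
     by (auto simp: T_def f_def pt_def)
    ultimately show "finite {t. pt m y t : ball (Ji x0) R \<inter> T}" by (rule rev_finite_subset)
   qed
  qed
  show "(%n. LI y. rcut j ((1 / s) *. (y - Ji x0)) * (a n y + c n y)) ~~> 2 * (\<integral>x. \<phi> x0 j s x \<partial>\<zeta>)"
   if s: "0 < s" "s < R'" for s
  proof -
   note P = \<phi>_props[OF s(1), of x0]
   have sub: "cball x0 R <= \<Omega>" by (rule cR)
   have off: "\<phi> x0 j s x = 0" if "x ~: cball x0 R" for x
    by (rule \<phi>_props(4)[OF s(1)]) (use that s R in auto)
   have "(LI y. \<phi> x0 j s (J y) * (a n y + c n y)) = 2 * (\<integral>x. \<phi> x0 j s x * p n x \<partial>lebesgue_on \<Omega>)" for n
    using F'[of n] P(2) off unfolding p_def by blast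
   moreover have "(%n. 2 * (\<integral>x. \<phi> x0 j s x * p n x \<partial>lebesgue_on \<Omega>)) ~~> 2 * (\<integral>x. \<phi> x0 j s x \<partial>\<zeta>)"
    by (intro tendsto_mult tendsto_const test_limits(2)[OF P(1) compact_cball sub off])
   ultimately show ?thesis by (simp add: \<phi>_def)
  qed
 qed (use s R j in auto)
qed

lemma ratio_mono_interior:
 assumes s: "0 < s" "s <= t" "t < \<rho>" and \<rho>: "ball x0 \<rho> <= \<Omega>"
 shows "measure \<zeta> (ball x0 s) / s <= measure \<zeta> (ball x0 t) / t"
proof -
 have sub: "cball x0 s <= \<Omega>" "cball x0 t <= \<Omega>" using s \<rho> by (force simp: subset_eq)+
 have "(%j. (2 * (\<integral>x. \<phi> x0 (Suc j) s x \<partial>\<zeta>)) / s) ~~> (2 * measure \<zeta> (ball x0 s)) / s"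
  using s by (intro tendsto_intros \<phi>_limit(1) sub) auto
 moreover have "(%j. (2 * (\<integral>x. \<phi> x0 (Suc j) t x \<partial>\<zeta>)) / t) ~~> (2 * measure \<zeta> (ball x0 t)) / t"
  using s by (intro tendsto_intros \<phi>_limit(1) sub) auto
 ultimately have "(2 * measure \<zeta> (ball x0 s)) / s <= (2 * measure \<zeta> (ball x0 t)) / t"
  by (rule LIMSEQ_le) (use cutoff_ratio_mono[OF s \<rho>] in auto)
 then show ?thesis by (simp add: field_simps)
qed

text \<open>The closed disk may touch the boundary of the domain, where local finiteness gives
  nothing; the open disk is therefore exhausted by smaller ones, all of mass at most
  \<open>M\<close>.\<close>

lemma ball_mass:
 assumes \<rho>: "0 < \<rho>" "ball x0 \<rho> <= \<Omega>"
 shows "emeasure \<zeta> (ball x0 \<rho>) = ennreal (measure \<zeta> (ball x0 \<rho>))" "measure \<zeta> (ball x0 \<rho>) <= M"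
proof -
 define r where "r n = \<rho> * (1 - inverse (real (Suc (Suc n))))" for n
 have r: "0 < r n" "r n < \<rho>" for n using \<rho>(1) by (auto simp: r_def field_simps intro!: add_pos_nonneg)
 have rm: "incseq r" unfolding r_def incseq_def using \<rho>(1) by (auto intro!: mult_left_mono simp: le_imp_inverse_le)
 have rl: "r ~~> \<rho>"
 proof -
  have "(%n. \<rho> * (1 - inverse (real (Suc (Suc n))))) ~~> \<rho> * (1 - 0)"
   by (intro tendsto_intros LIMSEQ_Suc[OF LIMSEQ_inverse_real_of_nat])
  then show ?thesis by (simp add: r_def[abs_def])
 qed
 have U: "(\<Union>n. ball x0 (r n)) = ball x0 \<rho>"
 proof (intro equalityI subsetI)
  fix x assume "x : ball x0 \<rho>"
  then have "\<forall>\<^sub>F n in sequentially. dist x0 x < r n" by (intro order_tendstoD(1)[OF rl]) simp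
  then show "x : (\<Union>n. ball x0 (r n))" using eventually_happens'[OF sequentially_bot] by fastforce
 next
  fix x assume "x : (\<Union>n. ball x0 (r n))"
  then obtain n where "dist x0 x < r n" by auto
  then show "x : ball x0 \<rho>" using r(2)[of n] by simp
 qed
 have sub: "cball x0 (r n) <= \<Omega>" for n using r(2)[of n] \<rho>(2) by (force simp: subset_eq)
 have "(SUP n. emeasure \<zeta> (ball x0 (r n))) = emeasure \<zeta> (\<Union>n. ball x0 (r n))"
 proof (rule SUP_emeasure_incseq)
  show "range (%n. ball x0 (r n)) <= sets \<zeta>"
   using radon_sets(1)[OF radon(2)] sub ball_subset_cball by (blast intro: borel_open open_ball)
  show "incseq (%n. ball x0 (r n))" using rm unfolding incseq_def by (simp add: subset_ball)
 qed
 moreover have "emeasure \<zeta> (ball x0 (r n)) <= ennreal M" for n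
  unfolding \<phi>_limit(2)[OF r(1) sub] by (intro ennreal_leI \<phi>_limit(3)[OF r(1) sub])
 ultimately have le: "emeasure \<zeta> (ball x0 \<rho>) <= ennreal M" unfolding U by (metis SUP_least)
 then have "emeasure \<zeta> (ball x0 \<rho>) < \<infinity>" by (rule order_le_less_trans) simp
 then show e: "emeasure \<zeta> (ball x0 \<rho>) = ennreal (measure \<zeta> (ball x0 \<rho>))" by (simp add: emeasure_eq_ennreal_measure)
 show "measure \<zeta> (ball x0 \<rho>) <= M" using le M unfolding e by (simp add: ennreal_le_iff)
qed

text \<open>The outer radius is reached from the left. The mass of the disk of radius
  \<open>r < t\<close> is at most that of radius \<open>t\<close>, so only the denominator has to
  converge.\<close>

lemma ratio_mono:
 assumes s: "0 < s" "s <= t" "t <= \<rho>" and \<rho>: "ball x0 \<rho> <= \<Omega>"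
 shows "measure \<zeta> (ball x0 s) / s <= measure \<zeta> (ball x0 t) / t"
proof (cases "s = t")
 case False
 then have st: "s < t" using s by simp
 have bt: "ball x0 t <= \<Omega>" using s(3) \<rho> by (meson order_trans subset_ball)
 have ts: "ball x0 t : sets \<zeta>" by (rule radon_sets(1)[OF radon(2) _ bt]) simp
 have fin: "emeasure \<zeta> (ball x0 t) ~= \<infinity>" using ball_mass(1)[OF _ bt] s by simp
 show ?thesis
 proof (rule tendsto_lowerbound)
  show "((%r. measure \<zeta> (ball x0 t) / r) \<longlongrightarrow> measure \<zeta> (ball x0 t) / t) (at_left t)" using s by (intro tendsto_intros) auto
  show "\<forall>\<^sub>F r in at_left t. measure \<zeta> (ball x0 s) / s <= measure \<zeta> (ball x0 t) / r"
   using eventually_at_left_real[OF st]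
  proof eventually_elim
   fix r assume r: "r : {s<..<t}"
   have "measure \<zeta> (ball x0 s) / s <= measure \<zeta> (ball x0 r) / r" using r s by (intro ratio_mono_interior[OF _ _ _ bt]) auto
   also have "... <= measure \<zeta> (ball x0 t) / r"
   proof (intro divide_right_mono)
    have "ball x0 r <= ball x0 t" using r by (intro subset_ball) auto
    moreover have "ball x0 r : sets \<zeta>" by (rule radon_sets(1)[OF radon(2) _ order_trans[OF calculation bt]]) simp
    ultimately show "measure \<zeta> (ball x0 r) <= measure \<zeta> (ball x0 t)"
     by (rule measure_mono_fmeasurable) (use ts fin in \<open>simp add: fmeasurable_def top.not_eq_extremum\<close>)
   qed (use r s in auto)
   finally show "measure \<zeta> (ball x0 s) / s <= measure \<zeta> (ball x0 t) / r" .
  qed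
 qed simp
qed simp

lemma emeasure_ratio: "0 < r ==> ball x0 r <= \<Omega> ==> emeasure \<zeta> (ball x0 r) / ennreal r = ennreal (measure \<zeta> (ball x0 r) / r)"
 using ball_mass(1)[of r x0] by (simp add: divide_ennreal)

text \<open>Monotonicity compares small disks with those of radius \<open>d\<close> and gives mass
  at most \<open>M / d\<close> times the radius, for all centres in \<open>L\<close>. A set of
  length 0 has covers of arbitrarily small total diameter, whose members are replaced by such
  disks.\<close>

lemma \<zeta>_null_on_S:
 assumes A: "A : sets \<zeta>" "hausdorff1 (A \<inter> S) = 0" and L: "compact L" "L <= \<Omega>" and m: "A \<inter> S \<inter> L : sets \<zeta>"
 shows "emeasure \<zeta> (A \<inter> S \<inter> L) = 0"
proof (cases "L = {}")
 case False
 obtain d where d: "0 < d" "{x. infdist x L <= d} <= \<Omega>" by (rule compact_in_open_separated[OF False L(1) \<Omega>(1) L(2)])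
 have bd: "ball x d <= \<Omega>" if "x : L" for x
 proof
  fix y assume "y : ball x d"
  then have "infdist y L <= d" using infdist_le[OF that, of y] by (simp add: dist_commute)
  then show "y : \<Omega>" using d(2) by blast
 qed
 have dens: "emeasure \<zeta> (ball x r) <= ennreal (M / d * r)" if "x : L" "0 < r" "r <= d" for x r
 proof -
  have "measure \<zeta> (ball x r) / r <= measure \<zeta> (ball x d) / d" by (rule ratio_mono[OF that(2,3) order_refl bd[OF that(1)]])
  also have "... <= M / d" using ball_mass(2)[OF d(1) bd[OF that(1)]] d(1) by (intro divide_right_mono) auto
  finally have "measure \<zeta> (ball x r) <= M / d * r" using that(2) by (simp add: pos_divide_le_eq)
  moreover have "ball x r <= \<Omega>" using bd[OF that(1)] that(3) by (meson order_trans subset_ball)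
  ultimately show ?thesis using ball_mass(1)[OF that(2)] by (simp add: ennreal_leI)
 qed
 have bound: "emeasure \<zeta> (A \<inter> S \<inter> L) <= ennreal (M / d * (2 * \<tau>))" if \<tau>: "0 < \<tau>" "\<tau> < d / 2" for \<tau>
 proof -
  obtain C where C: "A \<inter> S <= (\<Union>i. C i)" "!!i. bounded (C i)" "!!i. diameter (C i) <= d / 2" "(\<Sum>i. ennreal (diameter (C i))) < ennreal \<tau>"
   by (rule hausdorff1_null_cover[OF A(2), of "d / 2" "ennreal \<tau>"]) (use d \<tau> in auto)
  \<comment> \<open>Covering sets may have diameter 0, and a point at distance exactly the diameter
    must lie in an open disk; so each radius is enlarged by a positive amount, with total
    \<open>\<tau>\<close>.\<close>
  define h where "h i = \<tau> * (1 / 2) ^ Suc i" for i :: nat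
  have h: "0 < h i" "h i <= \<tau>" for i
   using \<tau> mult_left_mono[of "(1 / 2) ^ Suc i" 1 \<tau>] power_le_one[of "1 / 2 :: real" "Suc i"] by (auto simp: h_def)
  define r where "r i = diameter (C i) + h i" for i
  have r: "0 < r i" "r i <= d" for i
   using diameter_ge_0[OF C(2)[of i]] C(3)[of i] h[of i] \<tau> by (auto simp: r_def)
  \<comment> \<open>The density bound holds for centres in \<open>L\<close>; covering sets that miss
    \<open>L\<close> are discarded in \<open>T\<close>.\<close>
  define x where "x i = (SOME x. x : C i \<inter> L)" for i
  have x: "x i : C i \<inter> L" if "C i \<inter> L ~= {}" for i using someI_ex[of "%x. x : C i \<inter> L"] that unfolding x_def by blast
  define T where "T i = (if C i \<inter> L = {} then {} else ball (x i) (r i))" for i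
  have Tsub: "T i : sets \<zeta>" for i
  proof (cases "C i \<inter> L = {}")
   case False
   have "ball (x i) (r i) <= \<Omega>" using bd[of "x i"] x[OF False] r(2)[of i] subset_ball[of "r i" d "x i"] by blast
   then show ?thesis using radon_sets(1)[OF radon(2)] False by (simp add: T_def)
  qed (simp add: T_def)
  have "A \<inter> S \<inter> L <= (\<Union>i. T i)"
  proof
   fix y assume y: "y : A \<inter> S \<inter> L"
   then obtain i where i: "y : C i" using C(1) by blast
   then have ne: "C i \<inter> L ~= {}" using y by blast
   have "dist (x i) y <= diameter (C i)" using x[OF ne] i by (intro diameter_bounded_bound[OF C(2)]) auto
   then have "y : T i" using ne h(1)[of i] by (simp add: T_def r_def)
   then show "y : (\<Union>i. T i)" by blast
  qed
  then have "emeasure \<zeta> (A \<inter> S \<inter> L) <= emeasure \<zeta> (\<Union>i. T i)" by (rule emeasure_mono) (use Tsub in auto)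
  also have "... <= (\<Sum>i. emeasure \<zeta> (T i))" by (rule emeasure_subadditive_countably) (use Tsub in auto)
  also have "... <= (\<Sum>i. ennreal (M / d) * (ennreal (diameter (C i)) + ennreal (h i)))"
  proof (rule suminf_le[OF _ summableI summableI])
   fix i
   have "emeasure \<zeta> (T i) <= ennreal (M / d * r i)"
    using dens[of "x i" "r i"] x[of i] r[of i] by (auto simp: T_def)
   also have "... = ennreal (M / d) * ennreal (diameter (C i) + h i)"
    unfolding r_def by (rule ennreal_mult) (use M d diameter_ge_0[OF C(2)[of i]] h(1)[of i] in auto)
   also have "ennreal (diameter (C i) + h i) = ennreal (diameter (C i)) + ennreal (h i)"
    by (rule ennreal_plus) (use diameter_ge_0[OF C(2)[of i]] h(1)[of i] in auto)
   finally show "emeasure \<zeta> (T i) <= ennreal (M / d) * (ennreal (diameter (C i)) + ennreal (h i))" .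
  qed
  also have "... = ennreal (M / d) * ((\<Sum>i. ennreal (diameter (C i))) + (\<Sum>i. ennreal (h i)))"
   by (simp add: ennreal_suminf_cmult suminf_add[OF summableI summableI])
  also have "... <= ennreal (M / d) * (ennreal \<tau> + ennreal \<tau>)"
  proof (intro mult_left_mono add_mono)
   show "(\<Sum>i. ennreal (diameter (C i))) <= ennreal \<tau>" using C(4) by simp
   have hs: "h sums (\<tau> * 1)" unfolding h_def by (rule sums_mult[OF power_half_series])
   have "(\<Sum>i. ennreal (h i)) = ennreal (\<Sum>i. h i)" using h(1) hs by (intro suminf_ennreal2) (auto simp: less_imp_le sums_iff)
   then show "(\<Sum>i. ennreal (h i)) <= ennreal \<tau>" using hs by (simp add: sums_iff)
  qed auto
  also have "ennreal \<tau> + ennreal \<tau> = ennreal (2 * \<tau>)" using \<tau> by (simp flip: ennreal_plus)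
  also have "ennreal (M / d) * ennreal (2 * \<tau>) = ennreal (M / d * (2 * \<tau>))" by (rule ennreal_mult[symmetric]) (use M d \<tau> in auto)
  finally show ?thesis .
 qed
 have "emeasure \<zeta> (A \<inter> S \<inter> L) <= ennreal (M / d * (2 * 0))"
 proof (rule tendsto_lowerbound)
  show "((%\<tau>. ennreal (M / d * (2 * \<tau>))) \<longlongrightarrow> ennreal (M / d * (2 * 0))) (at_right 0)" by (intro tendsto_intros)
  show "\<forall>\<^sub>F \<tau> in at_right 0. emeasure \<zeta> (A \<inter> S \<inter> L) <= ennreal (M / d * (2 * \<tau>))"
   by (rule eventually_mono[OF eventually_at_right_real[of 0 "d / 2"]], use d(1) in simp, rule bound) auto
 qed simp
 then show ?thesis by simp
qed simp

text \<open>Both parts of the domain are exhausted by compact sets: on \<open>S\<close> the covering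
  argument applies, and off \<open>S\<close> the measure vanishes by clearing out.\<close>

lemma \<zeta>_absolutely_continuous:
 assumes A: "A : sets \<zeta>" "hausdorff1 (A \<inter> S) = 0"
 shows "emeasure \<zeta> A = 0"
proof -
 have A\<Omega>: "A <= \<Omega>" using sets.sets_into_space[OF A(1)] radon_sets(2)[OF radon(2)] by simp
 obtain T where T: "closed T" "S = \<Omega> \<inter> T" using S_closed unfolding closedin_closed by blast
 have Ss: "S : sets \<zeta>" by (rule radon_sets(1)[OF radon(2)]) (use T \<Omega> in auto)
 obtain C where C: "!!n. compact (C n)" "!!n. C n <= \<Omega>" "(\<Union>n. C (n :: nat)) = \<Omega>"
  using open_Union_compact_subsets[OF \<Omega>(1)] by metis
 obtain D where D: "!!n. compact (D n)" "!!n. D n <= \<Omega> - S" "(\<Union>n. D (n :: nat)) = \<Omega> - S"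
  using open_Union_compact_subsets[OF S_compl_open] by metis
 have Cs: "A \<inter> S \<inter> C n : sets \<zeta>" for n using A(1) Ss radon_sets(1)[OF radon(2) borel_compact[OF C(1)] C(2)] by blast
 have Ds: "D n : sets \<zeta>" for n using radon_sets(1)[OF radon(2) borel_compact[OF D(1)]] D(2) by blast
 have 1: "(\<Union>n. A \<inter> S \<inter> C n) : null_sets \<zeta>"
  using \<zeta>_null_on_S[OF A C(1,2) Cs] Cs by (intro null_sets_UN) auto
 have 2: "(\<Union>n. D n) : null_sets \<zeta>" using cutoff_off_S(2)[OF D(1,2)] Ds by (intro null_sets_UN) auto
 have "A <= (\<Union>n. A \<inter> S \<inter> C n) \<union> (\<Union>n. D n)" using A\<Omega> C(3) D(3) by blast
 then have "A : null_sets \<zeta>" by (rule null_sets_subset[OF null_sets.Un[OF 1 2] A(1)])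
 then show ?thesis by blast
qed

end

theorem proposition6:
  fixes V :: "real^'k \<Rightarrow> real"
    and \<Omega> :: "(real^2) set"
    and M\<^sub>0 \<eta>\<^sub>1 :: real
    and \<epsilon> :: "nat \<Rightarrow> real"
    and u :: "nat \<Rightarrow> real^2 \<Rightarrow> real^'k"
    and \<nu> \<zeta> :: "(real^2) measure"
    and S :: "(real^2) set"
  assumes "smooth_bounded_domain \<Omega>"
    and "admissible_potential V"
    and "0 < M\<^sub>0"
    and "\<And>n. 0 < \<epsilon> n \<and> \<epsilon> n \<le> 1"
    and "\<epsilon> \<longlonglongrightarrow> 0"
    and "\<And>n. AC_solution V \<Omega> (\<epsilon> n) (u n)"
    and "\<And>n. energy V \<Omega> (\<epsilon> n) (u n) \<le> ennreal M\<^sub>0"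
    and "densities_converge_weakly \<Omega> (\<lambda>n. energy_density V \<Omega> (\<epsilon> n) (u n)) \<nu>"
    and "densities_converge_weakly \<Omega> (\<lambda>n x. V (u n x) / \<epsilon> n) \<zeta>"
    and "0 < \<eta>\<^sub>1"
    and "clearing_out V \<Omega> \<eta>\<^sub>1"
    and "S = concentration_set \<Omega> \<nu> \<eta>\<^sub>1"
    and "closedin (top_of_set \<Omega>) S"
    and "rectifiable1 S"
    and "hausdorff1 S < \<infinity>"
  shows "(\<forall>x\<^sub>0\<in>\<Omega>. \<forall>\<rho> r\<^sub>0 r\<^sub>1. 0 < \<rho> \<and> ball x\<^sub>0 \<rho> \<subseteq> \<Omega> \<and> 0 < r\<^sub>0 \<and> r\<^sub>0 \<le> r\<^sub>1 \<and> r\<^sub>1 \<le> \<rho> \<longrightarrow>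
            emeasure \<zeta> (ball x\<^sub>0 r\<^sub>1) / ennreal r\<^sub>1 \<ge> emeasure \<zeta> (ball x\<^sub>0 r\<^sub>0) / ennreal r\<^sub>0) \<and>
         (\<forall>x\<^sub>0\<in>\<Omega>. \<exists>l. ((\<lambda>r. emeasure \<zeta> (ball x\<^sub>0 r) / ennreal r) \<longlongrightarrow> l) (at_right 0) \<and>
            (\<forall>\<rho>. 0 < \<rho> \<and> ball x\<^sub>0 \<rho> \<subseteq> \<Omega> \<longrightarrow>
               l \<le> emeasure \<zeta> (ball x\<^sub>0 \<rho>) / ennreal \<rho> \<and>
               emeasure \<zeta> (ball x\<^sub>0 \<rho>) / ennreal \<rho> \<le> ennreal (M\<^sub>0 / infdist x\<^sub>0 (frontier \<Omega>)))) \<and>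
         (\<forall>A\<in>sets \<zeta>. hausdorff1 (A \<inter> S) = 0 \<longrightarrow> emeasure \<zeta> A = 0)"
proof -
 note sb = assms(1)[unfolded smooth_bounded_domain_def]
 interpret allen_cahn_limit V \<Omega> M\<^sub>0 \<eta>\<^sub>1 \<epsilon> u \<nu> \<zeta> S
 proof
  show "open \<Omega>" "bounded \<Omega>" using sb by blast+
 qed (fact assms)+
 \<comment> \<open>A nonempty bounded set is not the whole plane, so its frontier is nonempty; the
   distance to an empty set would be the default value 0.\<close>
 have fr: "frontier \<Omega> ~= {}" using sb not_bounded_UNIV frontier_eq_empty[of \<Omega>] by metis
 have frO: "x ~: frontier \<Omega>" if "x : \<Omega>" for x using that \<Omega>(1) by (simp add: frontier_def interior_open)
 define d where "d x = infdist x (frontier \<Omega>)" for x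
 have dpos: "0 < d x" if "x : \<Omega>" for x
  unfolding d_def by (rule infdist_pos_not_in_closed[OF frontier_closed fr frO[OF that]])
 \<comment> \<open>A disk is connected: if it met both the domain and its complement, it would
   contain a frontier point closer than the distance \<open>d x\<close>.\<close>
 have dball: "ball x (d x) <= \<Omega>" if x: "x : \<Omega>" for x
 proof (rule ccontr)
  assume "\<not> ?thesis"
  then have "ball x (d x) - \<Omega> ~= {}" by blast
  moreover have "ball x (d x) \<inter> \<Omega> ~= {}" using x dpos[OF x] centre_in_ball by blast
  ultimately obtain y where "y : ball x (d x)" "y : frontier \<Omega>" using connected_Int_frontier[OF connected_ball] by blast
  then show False using infdist_le[of y "frontier \<Omega>" x] by (simp add: d_def)
 qed
 \<comment> \<open>The nearest frontier point lies outside the open domain, so no admissible disk is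
   larger. Every admissible \<open>\<rho>\<close> can thus be compared with \<open>d x\<close>,
   which explains the denominator of the bound.\<close>
 have dle: "\<rho> <= d x" if "ball x \<rho> <= \<Omega>" for x \<rho>
 proof (rule ccontr)
  assume lt: "\<not> ?thesis"
  obtain y where y: "y : frontier \<Omega>" "d x = dist x y" unfolding d_def by (rule infdist_attains_inf[OF frontier_closed fr]) blast
  then have "y : ball x \<rho>" using lt by simp
  then show False using that frO y(1) by blast
 qed
 have mono: "emeasure \<zeta> (ball x s) / ennreal s <= emeasure \<zeta> (ball x t) / ennreal t"
  if "0 < s" "s <= t" "t <= \<rho>" "ball x \<rho> <= \<Omega>" for x s t \<rho>
 proof -
  have "ball x s <= \<Omega>" "ball x t <= \<Omega>" using that subset_ball[of s \<rho> x] subset_ball[of t \<rho> x] by auto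
  then show ?thesis using that ratio_mono[OF that] by (simp add: emeasure_ratio ennreal_leI)
 qed
 have limit: "\<exists>l. ((%r. emeasure \<zeta> (ball x r) / ennreal r) \<longlongrightarrow> l) (at_right 0) &
   (\<forall>\<rho>. 0 < \<rho> & ball x \<rho> <= \<Omega> --> l <= emeasure \<zeta> (ball x \<rho>) / ennreal \<rho> &
     emeasure \<zeta> (ball x \<rho>) / ennreal \<rho> <= ennreal (M\<^sub>0 / infdist x (frontier \<Omega>)))" if x: "x : \<Omega>" for x
 proof -
  define F where "F r = emeasure \<zeta> (ball x r) / ennreal r" for r
  \<comment> \<open>A nondecreasing quotient converges at 0 to its infimum, so the limit lies below
    every value.\<close>
  define l where "l = (INF r\<in>{0<..<d x}. F r)"
  have lF: "l <= F r" if "0 < r" "r < d x" for r unfolding l_def using that by (intro INF_lower) simp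
  have ev: "\<forall>\<^sub>F r in at_right 0. r : {0<..<d x}" by (rule eventually_at_right_real[OF dpos[OF x]])
  have "(F \<longlongrightarrow> l) (at_right 0)"
  proof (rule order_tendstoI)
   fix a assume "a < l"
   then show "\<forall>\<^sub>F r in at_right 0. a < F r"
    using ev by (auto elim!: eventually_mono intro: order_less_le_trans lF)
  next
   fix a assume "l < a"
   then obtain r where r: "0 < r" "r < d x" "F r < a" unfolding l_def INF_less_iff by auto
   show "\<forall>\<^sub>F r in at_right 0. F r < a"
    using eventually_at_right_real[OF r(1)]
   proof eventually_elim
    fix s assume "s : {0<..<r}"
    then have "F s <= F r" unfolding F_def using r by (intro mono[OF _ _ _ dball[OF x]]) auto
    then show "F s < a" using r(3) by (rule order_le_less_trans)
   qed
  qed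
  moreover have "l <= F \<rho>" "F \<rho> <= ennreal (M\<^sub>0 / d x)" if \<rho>: "0 < \<rho>" "ball x \<rho> <= \<Omega>" for \<rho>
  proof -
   have \<rho>d: "\<rho> <= d x" by (rule dle[OF \<rho>(2)])
   have "l <= F (\<rho> / 2)" using \<rho>(1) \<rho>d by (intro lF) auto
   also have "... <= F \<rho>" unfolding F_def using \<rho>(1) by (intro mono[OF _ _ order_refl \<rho>(2)]) auto
   finally show "l <= F \<rho>" .
   have "F \<rho> <= F (d x)" unfolding F_def by (rule mono[OF \<rho>(1) \<rho>d order_refl dball[OF x]])
   also have "... = ennreal (measure \<zeta> (ball x (d x)) / d x)" unfolding F_def by (rule emeasure_ratio[OF dpos[OF x] dball[OF x]])
   also have "... <= ennreal (M\<^sub>0 / d x)"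
    using ball_mass(2)[OF dpos[OF x] dball[OF x]] dpos[OF x] by (intro ennreal_leI divide_right_mono) auto
   finally show "F \<rho> <= ennreal (M\<^sub>0 / d x)" .
  qed
  ultimately show ?thesis unfolding F_def d_def by blast
 qed
 show ?thesis using mono limit \<zeta>_absolutely_continuous by blast
qed

end
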